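(* Let $G$ be a Lie group acting properly on a manifold $M$, with resulting orbit space $M/G$. Let $x\in M$, let $[x]\in M/G$ be its orbit, let $G_x$ be the stabilizer of $x$, and let $S$ be a slice through $x$. Then $$T_{[x]}(M/G)\cong (T_xS)^{G_x}$$ as real vector spaces, where $(T_xS)^{G_x}$ is the space of fixed points of the tangent action of $G_x$ on $T_xS$. That is, the internal tangent space to $[x]$ in $M/G$, viewed as a diffeological space with the quotient diffeology, is isomorphic to the stratified tangent space to $[x]$ in $M/G$, viewed as a stratified space with the induced orbit-type stratification.
   Context: Manifolds are smooth, Hausdorff, second-countable and without boundary; vector spaces and linear maps are over $\mathbb{R}$. Diffeological spaces. A parametrization of a set $X$ is a map $p:U\to X$ with $U\subseteq\mathbb{R}^n$ open, $n\ge 0$. A diffeological space is a nonempty set $X$ with a collection $\mathcal{D}_X$ of parametrizations, called plots (the collection is called a diffeology), such that: (1) all constant parametrizations $\mathbb{R}^n\to X$ are plots; (2) if $p:U\to X$ is a plot, $V\subseteq\mathbb{R}^m$ is open and $F:V\to U$ is smooth, then $p\circ F$ is a plot; (3) a parametrization $p:U\to X$ such that every $u\in U$ has an open neighborhood $V\subseteq U$ with $p|_V$ a plot is itself a plot. A manifold carries the standard diffeology, whose plots are all smooth parametrizations. If $\sim$ is an equivalence relation on $X$ with projection $\pi:X\to X/\sim$, the quotient diffeology on $X/\sim$ consists of the parametrizations which locally have the form $\pi\circ p$ with $p\in\mathcal{D}_X$. Internal tangent space. A plot pointing to $x\in X$, written $p:(U_p,0)\to(X,x)$, is a plot with connected domain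 $U_p$ containing $0$ and $p(0)=x$. The internal tangent space is $T_x(X)=F/R$, where $F=\bigoplus_p T_0(U_p)$ is indexed by all plots pointing to $x$ (with $(p,v)$ denoting $v\in T_0(U_p)$ in the summand indexed by $p$), and $R$ is the span of all vectors $(p,v)-(q,g_*(v))$, where $p,q$ are plots pointing to $x$, $v\in T_0(U_p)$, and $g:(U_p,0)\to(U_q,0)$ is a germ at $0$ of smooth maps with $p=q\circ g$ as germs at $0$. Actions and slices. An action $A:G\times M\to M$, $A(g,x)=g\cdot x$, is a smooth left action of a Lie group. It is proper if $(g,x)\mapsto(g\cdot x,x)$ is a proper map $G\times M\to M\times M$. The stabilizer of $x$ is $G_x=\{g\in G: g\cdot x=x\}$, which is compact when the action is proper. $M/G$ is the set of orbits with the quotient topology and quotient diffeology. Let $A_x:G\to M$, $A_x(g)=g\cdot x$, and let $\mathfrak{g}=T_1G$. A slice at (through) $x_0$ is a submanifold $S\subseteq M$ through $x_0$ such that: (1) $T_{x_0}M=(A_{x_0})_*|_1(\mathfrak{g})\oplus T_{x_0}S$ and $T_xM=(A_x)_*|_1(\mathfrak{g})+T_xS$ for all $x\in S$; (2) $S$ is $G_{x_0}$-invariant; (3) if $g\in G$, $x\in S$ and $g\cdot x\in S$, then $g\in G_{x_0}$. Slices exist through every point for proper actions. The tangent action of $G_x$ on $T_xM$ is $k\mapsto$ the differential at $x$ of $y\mapsto k\cdot y$; it leaves $T_xS$ invariant. For a group $H$ acting on a set $V$, $V^H=\{v\in V: h\cdot v=v\ \forall h\in H\}$. Stratification. A stratification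 of a topological space is a locally finite partition into locally closed smooth manifolds (strata) such that if $S_1\cap\overline{S_2}\ne\emptyset$ for strata $S_1,S_2$, then $S_1$ is in the topological boundary of $S_2$. Points $x,y\in M$ have the same orbit type if there is a $G$-equivariant bijection $G\cdot x\to G\cdot y$ (equivalently, $G_x$ and $G_y$ are conjugate). The orbit-type stratification of $M$ consists of the connected components of the orbit types, and it descends to a stratification of $M/G$, also called the orbit-type stratification. Points $x,y\in M$ have the same local type, $x\approx y$, if for any $G$-invariant open neighborhoods $U$ of $x$ and $V$ of $y$, after shrinking $U$ and $V$ if necessary, there is a $G$-equivariant diffeomorphism $U\to V$ sending $G\cdot x$ onto $G\cdot y$. The stratum of $M/G$ containing $[x]$ is described by $M^{\approx}_{G\cdot x}/G=\{G\cdot y: y\approx x\}$, which is a smooth manifold of dimension $\dim (T_xS)^{G_x}$ (a known fact). The stratified tangent space to $[x]$ is the ordinary tangent space at $[x]$ of the manifold stratum containing $[x]$. *)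

theory Defs
  imports "HOL-Analysis.Analysis" "HOL-Algebra.Group_Action" "HOL-Library.Function_Algebras"
begin

section \<open>Real vector spaces, their quotients and isomorphisms\<close>

text \<open>The pointwise vector space structure on functions; addition and zero come from
  \<open>Function_Algebras\<close>. It is used for coordinate vectors (type \<open>nat \<Rightarrow> real\<close>) and, iterated, for
  families of coordinate vectors.\<close>

instantiation "fun" :: (type, scaleR) scaleR
begin
definition scaleR_fun :: "real \<Rightarrow> ('a \<Rightarrow> 'b) \<Rightarrow> 'a \<Rightarrow> 'b"
  where "scaleR_fun r f = (\<lambda>x. r *\<^sub>R f x)"
instance ..
end

instance "fun" :: (type, real_vector) real_vector
  by standard (simp_all add: scaleR_fun_def plus_fun_def zero_fun_def fun_Compl_def fun_diff_def
      fun_eq_iff algebra_simps)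

text \<open>The vector spaces compared below do not all consist of elements of a \<open>real_vector\<close> type (a
  quotient consists of cosets), so a vector space is given by a carrier and its operations.\<close>

record 'v vspace =
  vcarrier :: "'v set"
  vadd :: "'v \<Rightarrow> 'v \<Rightarrow> 'v"
  vscale :: "real \<Rightarrow> 'v \<Rightarrow> 'v"

definition vs_isomorphic :: "'v vspace \<Rightarrow> 'w vspace \<Rightarrow> bool"
  where "vs_isomorphic V W \<longleftrightarrow>
    (\<exists>f. bij_betw f (vcarrier V) (vcarrier W) \<and>
         (\<forall>a\<in>vcarrier V. \<forall>b\<in>vcarrier V. f (vadd V a b) = vadd W (f a) (f b)) \<and>
         (\<forall>r. \<forall>a\<in>vcarrier V. f (vscale V r a) = vscale W r (f a)))"

definition sub_vspace :: "'v::real_vector set \<Rightarrow> 'v vspace"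
  where "sub_vspace W = \<lparr>vcarrier = W, vadd = (+), vscale = (*\<^sub>R)\<rparr>"

text \<open>The quotient of a subspace \<open>F\<close> by a subspace \<open>R \<subseteq> F\<close>. Adding \<open>R\<close> to \<open>r A\<close> matters only for
  \<open>r = 0\<close>.\<close>

definition quot_vspace :: "'v::real_vector set \<Rightarrow> 'v set \<Rightarrow> 'v set vspace"
  where "quot_vspace F R =
    \<lparr>vcarrier = (\<lambda>f. {f + h |h. h \<in> R}) ` F,
     vadd = (\<lambda>A B. {a + b |a b. a \<in> A \<and> b \<in> B}),
     vscale = (\<lambda>r A. {r *\<^sub>R a + h |a h. a \<in> A \<and> h \<in> R})\<rparr>"

section \<open>Smooth maps between open subsets of Cartesian spaces\<close>

text \<open>The space \<open>\<real>\<^sup>n\<close>, \<open>n \<ge> 0\<close>, is \<^term>\<open>Euclidean_space n\<close>: sequences vanishing from index \<open>n\<close>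
  on. In particular \<open>\<real>\<^sup>k \<subseteq> \<real>\<^sup>n\<close> for \<open>k \<le> n\<close>.\<close>

abbreviation Rn :: "nat \<Rightarrow> (nat \<Rightarrow> real) set"
  where "Rn n \<equiv> topspace (Euclidean_space n)"

definition part_deriv :: "nat \<Rightarrow> ((nat \<Rightarrow> real) \<Rightarrow> real) \<Rightarrow> (nat \<Rightarrow> real) \<Rightarrow> real"
  where "part_deriv i f x = deriv (\<lambda>t. f (x(i := t))) (x i)"

fun Ck_on :: "nat \<Rightarrow> nat \<Rightarrow> (nat \<Rightarrow> real) set \<Rightarrow> ((nat \<Rightarrow> real) \<Rightarrow> real) \<Rightarrow> bool"
  where
    "Ck_on 0 n U f \<longleftrightarrow> continuous_map (subtopology (Euclidean_space n) U) euclideanreal f"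
  | "Ck_on (Suc k) n U f \<longleftrightarrow>
       continuous_map (subtopology (Euclidean_space n) U) euclideanreal f \<and>
       (\<forall>i<n. (\<forall>x\<in>U. (\<lambda>t. f (x(i := t))) field_differentiable at (x i)) \<and>
               Ck_on k n U (part_deriv i f))"

text \<open>Used only for \<open>U\<close> open in \<open>\<real>\<^sup>n\<close>; values of \<open>F\<close> outside \<open>U\<close> are irrelevant.\<close>

definition smooth_map :: "nat \<Rightarrow> (nat \<Rightarrow> real) set \<Rightarrow> nat \<Rightarrow> ((nat \<Rightarrow> real) \<Rightarrow> nat \<Rightarrow> real) \<Rightarrow> bool"
  where "smooth_map n U m F \<longleftrightarrow> F ` U \<subseteq> Rn m \<and> (\<forall>j<m. \<forall>k. Ck_on k n U (\<lambda>x. F x j))"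

definition jacobian ::
    "nat \<Rightarrow> nat \<Rightarrow> ((nat \<Rightarrow> real) \<Rightarrow> nat \<Rightarrow> real) \<Rightarrow> (nat \<Rightarrow> real) \<Rightarrow> (nat \<Rightarrow> real) \<Rightarrow> nat \<Rightarrow> real"
  where "jacobian n m F x v =
    (\<lambda>j. if j < m then \<Sum>i<n. part_deriv i (\<lambda>y. F y j) x * v i else 0)"

section \<open>Manifolds\<close>

type_synonym 'a chart = "'a set \<times> ('a \<Rightarrow> nat \<Rightarrow> real)"

record 'a mfd =
  mdim :: nat
  mtop :: "'a topology"
  atlas :: "'a chart set"

abbreviation points :: "'a mfd \<Rightarrow> 'a set"
  where "points M \<equiv> topspace (mtop M)"

definition chart_inv :: "'a chart \<Rightarrow> (nat \<Rightarrow> real) \<Rightarrow> 'a"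
  where "chart_inv c = inv_into (fst c) (snd c)"

definition is_chart :: "nat \<Rightarrow> 'a topology \<Rightarrow> 'a chart \<Rightarrow> bool"
  where "is_chart n X c \<longleftrightarrow>
    openin X (fst c) \<and> openin (Euclidean_space n) (snd c ` fst c) \<and>
    homeomorphic_map (subtopology X (fst c)) (subtopology (Euclidean_space n) (snd c ` fst c)) (snd c)"

definition charts_compatible :: "nat \<Rightarrow> 'a chart \<Rightarrow> 'a chart \<Rightarrow> bool"
  where "charts_compatible n c d \<longleftrightarrow>
    smooth_map n (snd c ` (fst c \<inter> fst d)) n (snd d \<circ> chart_inv c) \<and>
    smooth_map n (snd d ` (fst c \<inter> fst d)) n (snd c \<circ> chart_inv d)"

text \<open>The given atlas need not be maximal.\<close>

definition smooth_manifold :: "'a mfd \<Rightarrow> bool"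
  where "smooth_manifold M \<longleftrightarrow>
    Hausdorff_space (mtop M) \<and> second_countable (mtop M) \<and>
    (\<forall>c\<in>atlas M. is_chart (mdim M) (mtop M) c) \<and>
    (\<Union>c\<in>atlas M. fst c) = points M \<and>
    (\<forall>c\<in>atlas M. \<forall>d\<in>atlas M. charts_compatible (mdim M) c d)"

definition Rn_mfd :: "nat \<Rightarrow> (nat \<Rightarrow> real) mfd"
  where "Rn_mfd n = \<lparr>mdim = n, mtop = Euclidean_space n, atlas = {(Rn n, id)}\<rparr>"

definition prod_chart :: "nat \<Rightarrow> 'a chart \<Rightarrow> 'b chart \<Rightarrow> ('a \<times> 'b) chart"
  where "prod_chart m c d =
    (fst c \<times> fst d, \<lambda>(a, b) i. if i < m then snd c a i else snd d b (i - m))"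

definition prod_mfd :: "'a mfd \<Rightarrow> 'b mfd \<Rightarrow> ('a \<times> 'b) mfd"
  where "prod_mfd M N =
    \<lparr>mdim = mdim M + mdim N, mtop = prod_topology (mtop M) (mtop N),
     atlas = {prod_chart (mdim M) c d |c d. c \<in> atlas M \<and> d \<in> atlas N}\<rparr>"

definition msmooth_on :: "'a mfd \<Rightarrow> 'a set \<Rightarrow> 'b mfd \<Rightarrow> ('a \<Rightarrow> 'b) \<Rightarrow> bool"
  where "msmooth_on M W N f \<longleftrightarrow>
    openin (mtop M) W \<and> continuous_map (subtopology (mtop M) W) (mtop N) f \<and>
    (\<forall>c\<in>atlas M. \<forall>d\<in>atlas N.
       smooth_map (mdim M) (snd c ` {y \<in> fst c \<inter> W. f y \<in> fst d}) (mdim N)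
         (snd d \<circ> f \<circ> chart_inv c))"

abbreviation msmooth :: "'a mfd \<Rightarrow> 'b mfd \<Rightarrow> ('a \<Rightarrow> 'b) \<Rightarrow> bool"
  where "msmooth M N f \<equiv> msmooth_on M (points M) N f"

subsection \<open>Tangent spaces and differentials\<close>

text \<open>A tangent vector at \<open>x\<close> assigns to each chart of the atlas around \<open>x\<close> a coordinate vector,
  such that the coordinate vectors transform by the Jacobians of the coordinate changes.\<close>

definition charts_at :: "'a mfd \<Rightarrow> 'a \<Rightarrow> 'a chart set"
  where "charts_at M x = {c \<in> atlas M. x \<in> fst c}"

definition tangent_space :: "'a mfd \<Rightarrow> 'a \<Rightarrow> ('a chart \<Rightarrow> nat \<Rightarrow> real) set"
  where "tangent_space M x =
    {t. (\<forall>c\<in>charts_at M x. t c \<in> Rn (mdim M)) \<and>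
        (\<forall>c. c \<notin> charts_at M x \<longrightarrow> t c = 0) \<and>
        (\<forall>c\<in>charts_at M x. \<forall>d\<in>charts_at M x.
           t d = jacobian (mdim M) (mdim M) (snd d \<circ> chart_inv c) (snd c x) (t c))}"

text \<open>The differential of \<open>f\<close> at \<open>x\<close>; for smooth \<open>f\<close> it does not depend on the chart chosen
  around \<open>x\<close>.\<close>

definition differential ::
    "'a mfd \<Rightarrow> 'b mfd \<Rightarrow> ('a \<Rightarrow> 'b) \<Rightarrow> 'a \<Rightarrow> ('a chart \<Rightarrow> nat \<Rightarrow> real) \<Rightarrow> 'b chart \<Rightarrow> nat \<Rightarrow> real"
  where "differential M N f x t =
    (\<lambda>d. if d \<in> charts_at N (f x) then
           let c = (SOME c. c \<in> charts_at M x)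
           in jacobian (mdim M) (mdim N) (snd d \<circ> f \<circ> chart_inv c) (snd c x) (t c)
         else 0)"

subsection \<open>Embedded submanifolds\<close>

definition adapted_charts :: "'a mfd \<Rightarrow> nat \<Rightarrow> 'a set \<Rightarrow> 'a chart set"
  where "adapted_charts M k S =
    {c. is_chart (mdim M) (mtop M) c \<and> (\<forall>d\<in>atlas M. charts_compatible (mdim M) c d) \<and>
        S \<inter> fst c = {y \<in> fst c. snd c y \<in> Rn k}}"

definition submanifold :: "'a mfd \<Rightarrow> nat \<Rightarrow> 'a set \<Rightarrow> bool"
  where "submanifold M k S \<longleftrightarrow>
    k \<le> mdim M \<and> S \<subseteq> points M \<and> (\<forall>s\<in>S. \<exists>c\<in>adapted_charts M k S. s \<in> fst c)"

definition sub_mfd :: "'a mfd \<Rightarrow> nat \<Rightarrow> 'a set \<Rightarrow> 'a mfd"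
  where "sub_mfd M k S =
    \<lparr>mdim = k, mtop = subtopology (mtop M) S,
     atlas = {(fst c \<inter> S, snd c) |c. c \<in> adapted_charts M k S}\<rparr>"

text \<open>\<open>T\<^sub>xS\<close> regarded as a subspace of \<open>T\<^sub>xM\<close>.\<close>

definition sub_tangent_space :: "'a mfd \<Rightarrow> nat \<Rightarrow> 'a set \<Rightarrow> 'a \<Rightarrow> ('a chart \<Rightarrow> nat \<Rightarrow> real) set"
  where "sub_tangent_space M k S x =
    differential (sub_mfd M k S) M (\<lambda>y. y) x ` tangent_space (sub_mfd M k S) x"

section \<open>Diffeologies and internal tangent spaces\<close>

text \<open>A parametrization \<open>(n, U, p)\<close> has open domain \<open>U \<subseteq> \<real>\<^sup>n\<close>; extensionality of \<open>p\<close> makes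
  parametrizations with equal domains and equal values there equal.\<close>

type_synonym 'x param = "nat \<times> (nat \<Rightarrow> real) set \<times> ((nat \<Rightarrow> real) \<Rightarrow> 'x)"

definition params :: "'x set \<Rightarrow> 'x param set"
  where "params X = {(n, U, p). openin (Euclidean_space n) U \<and> p \<in> U \<rightarrow>\<^sub>E X}"

definition standard_diffeology :: "'a mfd \<Rightarrow> 'a param set"
  where "standard_diffeology M =
    {(n, U, p). (n, U, p) \<in> params (points M) \<and> msmooth_on (Rn_mfd n) U M p}"

text \<open>The quotient diffeology on \<open>\<pi> ` X\<close>, for \<open>D\<close> a diffeology on \<open>X\<close>.\<close>

definition quotient_diffeology :: "'x set \<Rightarrow> 'x param set \<Rightarrow> ('x \<Rightarrow> 'y) \<Rightarrow> 'y param set"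
  where "quotient_diffeology X D \<pi> =
    {(n, U, p). (n, U, p) \<in> params (\<pi> ` X) \<and>
       (\<forall>u\<in>U. \<exists>V q. openin (Euclidean_space n) V \<and> u \<in> V \<and> V \<subseteq> U \<and>
                     (n, V, q) \<in> D \<and> (\<forall>v\<in>V. p v = \<pi> (q v)))}"

definition pointed_plots :: "'x param set \<Rightarrow> 'x \<Rightarrow> 'x param set"
  where "pointed_plots D x =
    {(n, U, p). (n, U, p) \<in> D \<and> connectedin (Euclidean_space n) U \<and> 0 \<in> U \<and> p 0 = x}"

text \<open>Elements of \<open>\<Oplus>\<^sub>p T\<^sub>0(U\<^sub>p)\<close> are finitely supported families indexed by plots, where
  \<open>T\<^sub>0(U\<^sub>p) = \<real>\<^sup>n\<close> for a plot \<open>p\<close> with domain \<open>U\<^sub>p \<subseteq> \<real>\<^sup>n\<close>.\<close>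

definition plot_sum :: "'x param set \<Rightarrow> 'x \<Rightarrow> ('x param \<Rightarrow> nat \<Rightarrow> real) set"
  where "plot_sum D x =
    {f. finite {P. f P \<noteq> 0} \<and>
        (\<forall>P. f P \<noteq> 0 \<longrightarrow> P \<in> pointed_plots D x \<and> f P \<in> Rn (fst P))}"

definition summand :: "'x param \<Rightarrow> (nat \<Rightarrow> real) \<Rightarrow> 'x param \<Rightarrow> nat \<Rightarrow> real"
  where "summand P v = (\<lambda>Q. if Q = P then v else 0)"

text \<open>A germ at \<open>0\<close> is given by a representative \<open>g\<close> on an open neighbourhood \<open>W\<close> of \<open>0\<close>.\<close>

definition plot_relations :: "'x param set \<Rightarrow> 'x \<Rightarrow> ('x param \<Rightarrow> nat \<Rightarrow> real) set"
  where "plot_relations D x = span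
    {summand (n, U, p) v - summand (m, V, q) (jacobian n m g 0 v) | n U p m V q g W v.
       (n, U, p) \<in> pointed_plots D x \<and> (m, V, q) \<in> pointed_plots D x \<and> v \<in> Rn n \<and>
       openin (Euclidean_space n) W \<and> 0 \<in> W \<and> W \<subseteq> U \<and>
       smooth_map n W m g \<and> g ` W \<subseteq> V \<and> g 0 = 0 \<and> (\<forall>u\<in>W. p u = q (g u))}"

definition internal_tangent_space :: "'x param set \<Rightarrow> 'x \<Rightarrow> ('x param \<Rightarrow> nat \<Rightarrow> real) set vspace"
  where "internal_tangent_space D x = quot_vspace (plot_sum D x) (plot_relations D x)"

section \<open>Proper actions of Lie groups\<close>

definition lie_group :: "('g, 'r) monoid_scheme \<Rightarrow> 'g mfd \<Rightarrow> bool"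
  where "lie_group G GM \<longleftrightarrow>
    group G \<and> smooth_manifold GM \<and> points GM = carrier G \<and>
    msmooth (prod_mfd GM GM) GM (\<lambda>(g, h). g \<otimes>\<^bsub>G\<^esub> h) \<and>
    msmooth GM GM (\<lambda>g. inv\<^bsub>G\<^esub> g)"

definition smooth_action ::
    "('g, 'r) monoid_scheme \<Rightarrow> 'g mfd \<Rightarrow> 'm mfd \<Rightarrow> ('g \<Rightarrow> 'm \<Rightarrow> 'm) \<Rightarrow> bool"
  where "smooth_action G GM M \<phi> \<longleftrightarrow>
    group_action G (points M) \<phi> \<and> msmooth (prod_mfd GM M) M (\<lambda>(g, y). \<phi> g y)"

definition proper_action :: "'g mfd \<Rightarrow> 'm mfd \<Rightarrow> ('g \<Rightarrow> 'm \<Rightarrow> 'm) \<Rightarrow> bool"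
  where "proper_action GM M \<phi> \<longleftrightarrow>
    proper_map (prod_topology (mtop GM) (mtop M)) (prod_topology (mtop M) (mtop M))
      (\<lambda>(g, y). (\<phi> g y, y))"

text \<open>\<open>(A\<^sub>x)\<^sub>*|\<^sub>1(\<gg>)\<close>\<close>

definition orbit_directions ::
    "('g, 'r) monoid_scheme \<Rightarrow> 'g mfd \<Rightarrow> 'm mfd \<Rightarrow> ('g \<Rightarrow> 'm \<Rightarrow> 'm) \<Rightarrow> 'm
      \<Rightarrow> ('m chart \<Rightarrow> nat \<Rightarrow> real) set"
  where "orbit_directions G GM M \<phi> x =
    differential GM M (\<lambda>g. \<phi> g x) \<one>\<^bsub>G\<^esub> ` tangent_space GM \<one>\<^bsub>G\<^esub>"

definition slice ::
    "('g, 'r) monoid_scheme \<Rightarrow> 'g mfd \<Rightarrow> 'm mfd \<Rightarrow> ('g \<Rightarrow> 'm \<Rightarrow> 'm) \<Rightarrow> 'm \<Rightarrow> nat \<Rightarrow> 'm set \<Rightarrow> bool"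
  where "slice G GM M \<phi> x\<^sub>0 k S \<longleftrightarrow>
    submanifold M k S \<and> x\<^sub>0 \<in> S \<and>
    orbit_directions G GM M \<phi> x\<^sub>0 \<inter> sub_tangent_space M k S x\<^sub>0 = {0} \<and>
    (\<forall>y\<in>S. tangent_space M y =
       {a + b |a b. a \<in> orbit_directions G GM M \<phi> y \<and> b \<in> sub_tangent_space M k S y}) \<and>
    (\<forall>g\<in>stabilizer G \<phi> x\<^sub>0. \<forall>y\<in>S. \<phi> g y \<in> S) \<and>
    (\<forall>g\<in>carrier G. \<forall>y\<in>S. \<phi> g y \<in> S \<longrightarrow> g \<in> stabilizer G \<phi> x\<^sub>0)"

definition fixed_tangents ::
    "('g, 'r) monoid_scheme \<Rightarrow> 'm mfd \<Rightarrow> ('g \<Rightarrow> 'm \<Rightarrow> 'm) \<Rightarrow> 'm \<Rightarrow> nat \<Rightarrow> 'm set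
      \<Rightarrow> ('m chart \<Rightarrow> nat \<Rightarrow> real) set"
  where "fixed_tangents G M \<phi> x k S =
    {t \<in> sub_tangent_space M k S x. \<forall>h\<in>stabilizer G \<phi> x. differential M M (\<phi> h) x t = t}"

text \<open>The diffeology of \<open>M/G\<close>, whose points are the elements of \<open>orbits G (points M) \<phi>\<close>.\<close>

definition orbit_diffeology ::
    "('g, 'r) monoid_scheme \<Rightarrow> 'm mfd \<Rightarrow> ('g \<Rightarrow> 'm \<Rightarrow> 'm) \<Rightarrow> 'm set param set"
  where "orbit_diffeology G M \<phi> =
    quotient_diffeology (points M) (standard_diffeology M) (orbit G \<phi>)"

section \<open>The orbit-type stratification\<close>

definition orbit_topology ::
    "('g, 'r) monoid_scheme \<Rightarrow> 'm mfd \<Rightarrow> ('g \<Rightarrow> 'm \<Rightarrow> 'm) \<Rightarrow> 'm set topology"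
  where "orbit_topology G M \<phi> = topology (\<lambda>W. W \<subseteq> orbits G (points M) \<phi> \<and>
    openin (mtop M) {y \<in> points M. orbit G \<phi> y \<in> W})"

definition invariant_nbhd ::
    "('g, 'r) monoid_scheme \<Rightarrow> 'm mfd \<Rightarrow> ('g \<Rightarrow> 'm \<Rightarrow> 'm) \<Rightarrow> 'm \<Rightarrow> 'm set \<Rightarrow> bool"
  where "invariant_nbhd G M \<phi> x U \<longleftrightarrow>
    openin (mtop M) U \<and> x \<in> U \<and> (\<forall>g\<in>carrier G. \<forall>y\<in>U. \<phi> g y \<in> U)"

definition equivariant_diffeo ::
    "('g, 'r) monoid_scheme \<Rightarrow> 'm mfd \<Rightarrow> ('g \<Rightarrow> 'm \<Rightarrow> 'm) \<Rightarrow> 'm set \<Rightarrow> 'm set \<Rightarrow> ('m \<Rightarrow> 'm) \<Rightarrow> bool"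
  where "equivariant_diffeo G M \<phi> U V f \<longleftrightarrow>
    bij_betw f U V \<and> msmooth_on M U M f \<and> msmooth_on M V M (inv_into U f) \<and>
    (\<forall>g\<in>carrier G. \<forall>y\<in>U. f (\<phi> g y) = \<phi> g (f y))"

definition same_local_type ::
    "('g, 'r) monoid_scheme \<Rightarrow> 'm mfd \<Rightarrow> ('g \<Rightarrow> 'm \<Rightarrow> 'm) \<Rightarrow> 'm \<Rightarrow> 'm \<Rightarrow> bool"
  where "same_local_type G M \<phi> x y \<longleftrightarrow>
    (\<forall>U V. invariant_nbhd G M \<phi> x U \<and> invariant_nbhd G M \<phi> y V \<longrightarrow>
       (\<exists>U' V' f. invariant_nbhd G M \<phi> x U' \<and> U' \<subseteq> U \<and>
                  invariant_nbhd G M \<phi> y V' \<and> V' \<subseteq> V \<and>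
                  equivariant_diffeo G M \<phi> U' V' f \<and> f ` orbit G \<phi> x = orbit G \<phi> y))"

definition local_type ::
    "('g, 'r) monoid_scheme \<Rightarrow> 'm mfd \<Rightarrow> ('g \<Rightarrow> 'm \<Rightarrow> 'm) \<Rightarrow> 'm \<Rightarrow> 'm set"
  where "local_type G M \<phi> x = {y \<in> points M. same_local_type G M \<phi> y x}"

definition submersion :: "'a mfd \<Rightarrow> 'b mfd \<Rightarrow> ('a \<Rightarrow> 'b) \<Rightarrow> bool"
  where "submersion M N f \<longleftrightarrow>
    msmooth M N f \<and>
    (\<forall>y\<in>points M. differential M N f y ` tangent_space M y = tangent_space N (f y))"

text \<open>\<open>N\<close> is the stratum through the orbit of \<open>x\<close>: the subspace \<open>{G \<cdot> y | y \<approx> x}\<close> of \<open>M/G\<close> with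
  its manifold structure. That structure is the unique one making the projection from the
  submanifold \<open>{y | y \<approx> x}\<close> of \<open>M\<close> a submersion; the atlas itself is determined only up to
  compatibility, so \<open>N\<close> is characterised rather than defined.\<close>

definition orbit_stratum ::
    "('g, 'r) monoid_scheme \<Rightarrow> 'm mfd \<Rightarrow> ('g \<Rightarrow> 'm \<Rightarrow> 'm) \<Rightarrow> 'm \<Rightarrow> 'm set mfd \<Rightarrow> bool"
  where "orbit_stratum G M \<phi> x N \<longleftrightarrow>
    smooth_manifold N \<and>
    mtop N = subtopology (orbit_topology G M \<phi>) (orbit G \<phi> ` local_type G M \<phi> x) \<and>
    (\<exists>l. submanifold M l (local_type G M \<phi> x) \<and>
         submersion (sub_mfd M l (local_type G M \<phi> x)) N (orbit G \<phi>))"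

end

theory Submission
  imports Defs "HOL-Homology.Homology"
begin

text \<open>The stabilizer of \<open>x\<close> is compact, so slice coordinates can be averaged over it; the averaged
  coordinates \<open>\<psi>\<close> turn its action on the slice into the tangent representation \<open>rho\<close>. To first order
  every plot pointing to \<open>[x]\<close> factors through a chart of \<open>M\<close> at \<open>x\<close>. There orbit directions and the
  vectors \<open>v - rho h v\<close> represent zero, hence averaging reduces every vector to a fixed one. Conversely,
  retracting a tube onto the slice, applying \<open>\<psi>\<close> and averaging is a smooth invariant map near \<open>x\<close>; it
  descends to \<open>M/G\<close> and separates the fixed vectors.

  For the stratum \<open>N\<close> only a dimension count is left. In the linearized coordinates translation by a
  small fixed vector is equivariant, so the corresponding slice point has the local type of \<open>x\<close>. This
  gives an injective continuous map from a neighbourhood of zero in the fixed space to \<open>N\<close>, and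
  invariance of domain bounds the dimension of the fixed space. For the other bound, the projection
  to \<open>N\<close> is a submersion that kills orbit directions and is invariant under the stabilizer, so by
  averaging it is already onto on the fixed vectors.\<close>

section \<open>Calculus on open subsets of Cartesian spaces\<close>

text \<open>The stabilizer acts on the slice nonlinearly, and this is the obstacle in both
  directions of the isomorphism. The averages that remove it are taken with an invariant mean: a
  positive linear functional on continuous functions that is invariant under right translation.
  Since this invariance is one-sided, two averaged operators occur. The mean \<open>e\<close> of
  \<open>rho h v\<close> satisfies \<open>e (rho h v) = e v\<close>, which makes the map separating
  the fixed vectors invariant. The mean \<open>e'\<close> of \<open>rho (inv h) v\<close> takes
  values in the fixed vectors, which is what the reduction needs. Both are the identity on
  \<open>fixed\<close>.

  The relations between plots see only germs and first derivatives at 0, so local lifts of plots to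
  M are enough, and two lifts of one plot already produce a relation.

  The two bounds for the stratum draw on different parts of the description of \<open>N\<close>: one
  on its topology as a subspace of the orbit space, the other on the submersion.\<close>

lemma Euclidean_space_top_of_set: "Euclidean_space n = top_of_set {x. \<forall>i\<ge>n. x i = 0}"
  by (simp add: Euclidean_space_def euclidean_product_topology)

lemma mem_Rn: "x \<in> Rn n \<longleftrightarrow> (\<forall>i\<ge>n. x i = 0)"
  by (simp add: topspace_Euclidean_space)

lemma Rn_nth: "x \<in> Rn n \<Longrightarrow> n \<le> i \<Longrightarrow> x i = 0"
  by (simp add: mem_Rn)

lemma subtopology_Rn: "U \<subseteq> Rn n \<Longrightarrow> subtopology (Euclidean_space n) U = top_of_set U"
  by (simp add: Euclidean_space_top_of_set topspace_Euclidean_space subtopology_subtopology inf.absorb2)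

lemma openin_Rn_subset: "openin (Euclidean_space n) U \<Longrightarrow> U \<subseteq> Rn n"
  by (rule openin_subset)

lemma openin_Rn_mem: "openin (Euclidean_space n) U \<Longrightarrow> x \<in> U \<Longrightarrow> x \<in> Rn n"
  using openin_Rn_subset by auto

text \<open>A neighbourhood given coordinatewise still contains what arises from two of its points
  by exchanging single coordinates. Moving from point to point one coordinate at a time, as partial
  derivatives require, therefore never leaves it.\<close>

definition cube :: "nat \<Rightarrow> (nat \<Rightarrow> real) \<Rightarrow> real \<Rightarrow> (nat \<Rightarrow> real) set"
  where "cube n x d = {y \<in> Rn n. \<forall>i<n. \<bar>y i - x i\<bar> < d}"

text \<open>The l1 norm: error estimates for single coordinates add up to it directly.\<close>

definition nrm :: "nat \<Rightarrow> (nat \<Rightarrow> real) \<Rightarrow> real"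
  where "nrm n v = (\<Sum>i<n. \<bar>v i\<bar>)"

lemma open_coord_box: "open {y::nat \<Rightarrow> real. \<forall>i<n. \<bar>y i - x i\<bar> < d}"
proof -
  have "open {y::nat \<Rightarrow> real. \<bar>y i - x i\<bar> < d}" for i
    by (intro open_Collect_less continuous_intros continuous_on_product_coordinates)
  then have "open (\<Inter>i\<in>{..<n}. {y::nat \<Rightarrow> real. \<bar>y i - x i\<bar> < d})"
    by (intro open_INT) auto
  also have "(\<Inter>i\<in>{..<n}. {y::nat \<Rightarrow> real. \<bar>y i - x i\<bar> < d}) = {y. \<forall>i<n. \<bar>y i - x i\<bar> < d}"
    by auto
  finally show ?thesis .
qed

lemma openin_cube: "openin (Euclidean_space n) (cube n x d)"
proof -
  have "cube n x d = {x. \<forall>i\<ge>n. x i = 0} \<inter> {y. \<forall>i<n. \<bar>y i - x i\<bar> < d}"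
    by (auto simp: cube_def mem_Rn)
  then show ?thesis
    unfolding Euclidean_space_top_of_set by (simp add: openin_open_Int open_coord_box)
qed

lemma cube_center: "x \<in> Rn n \<Longrightarrow> d > 0 \<Longrightarrow> x \<in> cube n x d"
  by (simp add: cube_def)

lemma cube_subset_Rn: "cube n x d \<subseteq> Rn n"
  by (auto simp: cube_def)

lemma cube_mono: "d \<le> e \<Longrightarrow> cube n x d \<subseteq> cube n x e"
  by (force simp: cube_def)

text \<open>A basic open set of the product topology gives a radius for each coordinate. All
  coordinates from n on are 0 for points of \<open>Rn n\<close>, so only the finitely many radii
  below n matter and they have a positive minimum.\<close>

lemma open_contains_cube:
  assumes "openin (Euclidean_space n) U" "x \<in> U"
  obtains d where "d > 0" "cube n x d \<subseteq> U"
proof -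
  obtain T where T: "open T" "U = Rn n \<inter> T"
    using assms(1) unfolding Euclidean_space_top_of_set openin_open topspace_Euclidean_space by auto
  have "openin (product_topology (\<lambda>i. euclidean) UNIV) T"
    using T(1) by (simp add: open_fun_def)
  then obtain X where X: "x \<in> (\<Pi>\<^sub>E i\<in>UNIV. X i)" "\<And>i::nat. openin euclidean (X i)"
      "(\<Pi>\<^sub>E i\<in>UNIV. X i) \<subseteq> T"
    using product_topology_open_contains_basis[of "\<lambda>i. euclidean" UNIV T x] assms(2) T(2) by auto
  have "\<exists>e>0. \<forall>t. \<bar>t - x i\<bar> < e \<longrightarrow> t \<in> X i" for i
    using X(1,2)[of ] open_dist[of "X i"] by (auto simp: PiE_def dist_real_def)
  then obtain e where e: "\<And>i. e i > 0" "\<And>i t. \<bar>t - x i\<bar> < e i \<Longrightarrow> t \<in> X i"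
    by metis
  \<comment> \<open>The inserted 1 keeps the set nonempty when n is 0.\<close>
  define d where "d = Min (insert 1 (e ` {..<n}))"
  have d: "d > 0" "\<And>i. i < n \<Longrightarrow> d \<le> e i"
    using e(1) by (auto simp: d_def)
  have "x \<in> Rn n" using assms openin_Rn_subset by blast
  have "cube n x d \<subseteq> U"
  proof
    fix y assume y: "y \<in> cube n x d"
    have "y i \<in> X i" for i
    proof (cases "i < n")
      case True
      then have "\<bar>y i - x i\<bar> < d" using y by (auto simp: cube_def)
      with d(2)[OF True] show ?thesis by (intro e(2)) linarith
    next
      case False
      then have "y i = 0" "x i = 0"
        using y \<open>x \<in> Rn n\<close> by (auto simp: cube_def mem_Rn)
      then show ?thesis using e by (metis X(1) PiE_mem UNIV_I)
    qed
    then have "y \<in> T" using X(3) by auto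
    then show "y \<in> U" using y T(2) by (auto simp: cube_def)
  qed
  then show ?thesis using that d(1) by blast
qed

lemma continuous_on_cube:
  fixes f :: "(nat \<Rightarrow> real) \<Rightarrow> real"
  assumes "openin (Euclidean_space n) U" "continuous_on U f" "x \<in> U" "e > 0"
  obtains d where "d > 0" "cube n x d \<subseteq> U" "\<And>y. y \<in> cube n x d \<Longrightarrow> \<bar>f y - f x\<bar> < e"
proof -
  have "openin (top_of_set U) (U \<inter> f -` ball (f x) e)"
    using assms(2) by (simp add: continuous_openin_preimage_gen)
  then have "openin (Euclidean_space n) (U \<inter> f -` ball (f x) e)"
    using assms(1) openin_trans_full subtopology_Rn openin_Rn_subset by metis
  then obtain d where "d > 0" "cube n x d \<subseteq> U \<inter> f -` ball (f x) e"
    using open_contains_cube assms(3,4) by (metis IntI centre_in_ball vimageI)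
  then show ?thesis using that[of d] by (force simp: dist_real_def abs_minus_commute)
qed

lemma continuous_onI_cube:
  fixes f :: "(nat \<Rightarrow> real) \<Rightarrow> real"
  assumes "U \<subseteq> Rn n"
    and "\<And>x e. x \<in> U \<Longrightarrow> e > 0 \<Longrightarrow> \<exists>d>0. \<forall>y\<in>U \<inter> cube n x d. \<bar>f y - f x\<bar> < e"
  shows "continuous_on U f"
  unfolding continuous_on_def
proof (intro ballI tendstoI)
  fix x and e :: real assume "x \<in> U" "e > 0"
  then obtain d where d: "d > 0" "\<And>y. y \<in> U \<inter> cube n x d \<Longrightarrow> \<bar>f y - f x\<bar> < e"
    using assms(2) by blast
  show "\<forall>\<^sub>F y in at x within U. dist (f y) (f x) < e"
    unfolding eventually_at_topological
  proof (intro exI conjI ballI impI)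
    show "open {y::nat \<Rightarrow> real. \<forall>i<n. \<bar>y i - x i\<bar> < d}" by (rule open_coord_box)
  qed (use d assms(1) in \<open>auto simp: cube_def dist_real_def\<close>)
qed

lemma continuous_on_coords:
  fixes g :: "'a::topological_space \<Rightarrow> nat \<Rightarrow> real"
  assumes "g ` U \<subseteq> Rn m" "\<And>j. j < m \<Longrightarrow> continuous_on U (\<lambda>x. g x j)"
  shows "continuous_on U g"
proof (rule continuous_on_coordinatewise_then_product)
  fix i show "continuous_on U (\<lambda>x. g x i)"
  proof (cases "i < m")
    case False
    then have "\<And>x. x \<in> U \<Longrightarrow> g x i = 0" using assms(1) by (auto simp: mem_Rn image_subset_iff)
    then show ?thesis by (simp cong: continuous_on_cong)
  qed (use assms in auto)
qed

lemma continuous_on_coord: "continuous_on U g \<Longrightarrow> continuous_on U (\<lambda>x. g x (j::nat) :: real)"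
  by (rule continuous_on_product_then_coordinatewise)

lemma line_in_cube:
  assumes "x \<in> cube n z d" "i < n" "\<bar>t - z i\<bar> < d" shows "x(i := t) \<in> cube n z d"
  using assms by (auto simp: cube_def mem_Rn)

lemma eventually_line:
  assumes "openin (Euclidean_space n) U" "x \<in> U" "i < n"
  shows "\<forall>\<^sub>F t in nhds (x i). x(i := t) \<in> U"
proof -
  obtain d where d: "d > 0" "cube n x d \<subseteq> U" using open_contains_cube assms(1,2) .
  have "x \<in> cube n x d" using assms openin_Rn_subset d(1) by (blast intro: cube_center)
  then have "x(i := t) \<in> U" if "\<bar>t - x i\<bar> < d" for t
    using line_in_cube[of x n x d i t] assms(3) that d(2) by auto
  then show ?thesis using d(1) by (auto simp: eventually_nhds_metric dist_real_def)
qed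

lemma MVT_segment:
  fixes g :: "real \<Rightarrow> real"
  assumes "\<And>t. t \<in> closed_segment a b \<Longrightarrow> (g has_field_derivative g' t) (at t)"
  shows "\<exists>s\<in>closed_segment a b. g b - g a = g' s * (b - a)"
proof (cases a b rule: linorder_cases)
  case less
  then obtain z where "a < z" "z < b" "g b - g a = (b - a) * g' z"
    using MVT2[of a b g g'] assms by (auto simp: closed_segment_eq_real_ivl)
  then show ?thesis by (intro bexI[of _ z]) (auto simp: closed_segment_eq_real_ivl)
next
  case greater
  then obtain z where "b < z" "z < a" "g a - g b = (a - b) * g' z"
    using MVT2[of b a g g'] assms by (auto simp: closed_segment_eq_real_ivl)
  then show ?thesis
    by (intro bexI[of _ z]) (auto simp: closed_segment_eq_real_ivl algebra_simps)
qed auto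

section \<open>Strict differentiability and the chain rule from continuous partial
  derivatives\<close>

definition partially_diff :: "nat \<Rightarrow> (nat \<Rightarrow> real) set \<Rightarrow> ((nat \<Rightarrow> real) \<Rightarrow> real) \<Rightarrow> bool"
  where "partially_diff n U f \<longleftrightarrow>
    (\<forall>i<n. \<forall>x\<in>U. (\<lambda>t. f (x(i := t))) field_differentiable at (x i))"

lemma partially_diffD:
  assumes "partially_diff n U f" "i < n" "x \<in> U"
  shows "((\<lambda>t. f (x(i := t))) has_field_derivative part_deriv i f x) (at (x i))"
  using assms unfolding partially_diff_def part_deriv_def
  by (simp add: DERIV_deriv_iff_field_differentiable)

text \<open>Going from z to y one coordinate at a time splits the increment into n one-variable
  increments, each controlled by the mean value theorem and the continuity of a partial derivative.
  The estimate compares two arbitrary points near x, not only a point with x; this two-point form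
  later yields local injectivity and Lipschitz bounds.\<close>

theorem strict_differentiability:
  assumes U: "openin (Euclidean_space n) U" "x \<in> U" and f: "partially_diff n U f"
    and cont: "\<And>i. i < n \<Longrightarrow> continuous_on U (part_deriv i f)" and e: "e > 0"
  obtains d where "d > 0" "cube n x d \<subseteq> U"
    "\<And>y z. y \<in> cube n x d \<Longrightarrow> z \<in> cube n x d \<Longrightarrow>
       \<bar>f y - f z - (\<Sum>i<n. part_deriv i f x * (y i - z i))\<bar> \<le> e * nrm n (\<lambda>i. y i - z i)"
proof -
  have "\<exists>d>0. cube n x d \<subseteq> U \<and> (\<forall>y\<in>cube n x d. \<bar>part_deriv i f y - part_deriv i f x\<bar> < e)"
    if "i < n" for i
    using continuous_on_cube[OF U(1) cont[OF that] U(2) e] by metis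
  then obtain D where D: "\<And>i. i < n \<Longrightarrow> D i > 0" "\<And>i. i < n \<Longrightarrow> cube n x (D i) \<subseteq> U"
    "\<And>i y. i < n \<Longrightarrow> y \<in> cube n x (D i) \<Longrightarrow> \<bar>part_deriv i f y - part_deriv i f x\<bar> < e"
    by metis
  obtain d0 where d0: "d0 > 0" "cube n x d0 \<subseteq> U" using open_contains_cube U .
  define d where "d = Min (insert d0 (D ` {..<n}))"
  have d: "d > 0" "d \<le> d0" "\<And>i. i < n \<Longrightarrow> d \<le> D i"
    using d0 D(1) by (auto simp: d_def)
  have dU: "cube n x d \<subseteq> U" using cube_mono[OF d(2)] d0(2) by blast
  have dD: "\<bar>part_deriv i f y - part_deriv i f x\<bar> < e" if "i < n" "y \<in> cube n x d" for i y
    using D(3)[OF that(1)] cube_mono[OF d(3)[OF that(1)]] that(2) by blast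
  have main: "\<bar>f y - f z - (\<Sum>i<n. part_deriv i f x * (y i - z i))\<bar> \<le> e * nrm n (\<lambda>i. y i - z i)"
    if y: "y \<in> cube n x d" and z: "z \<in> cube n x d" for y z
  proof -
    define w where "w k = (\<lambda>i. if i < k then y i else z i)" for k :: nat
    have wc: "w k \<in> cube n x d" for k
      using y z by (auto simp: w_def cube_def mem_Rn)
    have w0: "w 0 = z" by (simp add: w_def)
    have wn: "w n = y" using y z by (auto simp: w_def cube_def mem_Rn fun_eq_iff not_less)
    have wS: "w (Suc k) = (w k)(k := y k)" and wk: "(w k)(k := z k) = w k" for k
      by (auto simp: w_def fun_eq_iff)
    have step: "\<bar>f (w (Suc k)) - f (w k) - part_deriv k f x * (y k - z k)\<bar> \<le> e * \<bar>y k - z k\<bar>"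
      if k: "k < n" for k
    proof -
      have seg: "(w k)(k := t) \<in> cube n x d" if "t \<in> closed_segment (z k) (y k)" for t
      proof -
        have "\<bar>z k - x k\<bar> < d" "\<bar>y k - x k\<bar> < d" using y z k by (auto simp: cube_def)
        then have "\<bar>t - x k\<bar> < d"
          using that by (auto simp: closed_segment_eq_real_ivl split: if_splits)
        then show ?thesis using line_in_cube[OF wc k] by simp
      qed
      have "((\<lambda>t. f ((w k)(k := t))) has_field_derivative part_deriv k f ((w k)(k := t))) (at t)"
        if "t \<in> closed_segment (z k) (y k)" for t
        using partially_diffD[OF f k, of "(w k)(k := t)"] seg[OF that] dU by auto
      then obtain s where s: "s \<in> closed_segment (z k) (y k)"
        "f ((w k)(k := y k)) - f ((w k)(k := z k)) = part_deriv k f ((w k)(k := s)) * (y k - z k)"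
        using MVT_segment[of "z k" "y k" "\<lambda>t. f ((w k)(k := t))"
            "\<lambda>t. part_deriv k f ((w k)(k := t))"] by blast
      have "f (w (Suc k)) - f (w k) - part_deriv k f x * (y k - z k)
         = (part_deriv k f ((w k)(k := s)) - part_deriv k f x) * (y k - z k)"
        using s(2) unfolding wS wk by (simp add: algebra_simps)
      moreover have "\<bar>part_deriv k f ((w k)(k := s)) - part_deriv k f x\<bar> \<le> e"
        using dD[OF k seg[OF s(1)]] by simp
      ultimately show ?thesis by (simp add: abs_mult mult_right_mono)
    qed
    have "f y - f z = (\<Sum>k<n. f (w (Suc k)) - f (w k))"
      using sum_lessThan_telescope[of "\<lambda>k. f (w k)" n] by (simp add: w0 wn)
    then have "f y - f z - (\<Sum>i<n. part_deriv i f x * (y i - z i))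
        = (\<Sum>k<n. f (w (Suc k)) - f (w k) - part_deriv k f x * (y k - z k))"
      by (simp add: sum_subtractf)
    also have "\<bar>\<dots>\<bar> \<le> (\<Sum>k<n. e * \<bar>y k - z k\<bar>)"
      by (rule order_trans[OF sum_abs sum_mono]) (use step in auto)
    finally show ?thesis by (simp add: nrm_def sum_distrib_left)
  qed
  show ?thesis using that[OF d(1) dU main] .
qed

text \<open>The remainder of f is measured against the l1 norm of \<open>h t - h t0\<close>. Divided
  by the size of \<open>t - t0\<close> this norm is \<open>Q t\<close>, which converges, so the
  remainder quotient tends to 0.\<close>

lemma DERIV_comp_strict:
  fixes h :: "real \<Rightarrow> nat \<Rightarrow> real"
  assumes f: "\<And>e. e > 0 \<Longrightarrow> \<exists>d>0. \<forall>y\<in>cube m (h t0) d.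
       \<bar>f y - f (h t0) - (\<Sum>i<m. D i * (y i - h t0 i))\<bar> \<le> e * nrm m (\<lambda>i. y i - h t0 i)"
    and h: "\<And>i. i < m \<Longrightarrow> ((\<lambda>t. h t i) has_field_derivative a i) (at t0)"
    and hR: "\<forall>\<^sub>F t in nhds t0. h t \<in> Rn m"
  shows "((\<lambda>t. f (h t)) has_field_derivative (\<Sum>i<m. D i * a i)) (at t0)"
proof -
  define q where "q i t = (h t i - h t0 i) / (t - t0)" for i t
  have q: "(q i \<longlongrightarrow> a i) (at t0)" if "i < m" for i
    using h[OF that] by (simp add: q_def[abs_def] has_field_derivative_iff)
  define Q where "Q t = (\<Sum>i<m. \<bar>q i t\<bar>)" for t
  define Q0 where "Q0 = (\<Sum>i<m. \<bar>a i\<bar>)"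
  have Q: "(Q \<longlongrightarrow> Q0) (at t0)"
    unfolding Q_def Q0_def by (intro tendsto_intros q) auto
  have Q0: "Q0 \<ge> 0" by (simp add: Q0_def sum_nonneg)
  define r where "r t = (f (h t) - f (h t0)) / (t - t0) - (\<Sum>i<m. D i * q i t)" for t
  have "(r \<longlongrightarrow> 0) (at t0)"
  proof (rule tendstoI)
    fix e :: real assume "e > 0"
    \<comment> \<open>Near \<open>t0\<close> the quotient \<open>Q\<close> stays below
      \<open>Q0 + 1\<close>, so with this choice the remainder quotient is at most
      \<open>e / 2\<close>.\<close>
    define e' where "e' = e / (Q0 + 1) / 2"
    have "e' > 0" using \<open>e > 0\<close> Q0 by (simp add: e'_def)
    then obtain d where d: "d > 0" and fd: "\<And>y. y \<in> cube m (h t0) d \<Longrightarrow>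
       \<bar>f y - f (h t0) - (\<Sum>i<m. D i * (y i - h t0 i))\<bar> \<le> e' * nrm m (\<lambda>i. y i - h t0 i)"
      using f by blast
    have "\<forall>\<^sub>F t in at t0. \<forall>i\<in>{..<m}. \<bar>h t i - h t0 i\<bar> < d"
    proof (subst eventually_ball_finite_distrib)
      show "\<forall>i\<in>{..<m}. \<forall>\<^sub>F t in at t0. \<bar>h t i - h t0 i\<bar> < d"
      proof
        fix i assume "i \<in> {..<m}"
        then have "((\<lambda>t. h t i) \<longlongrightarrow> h t0 i) (at t0)"
          using h DERIV_isCont isCont_def by blast
        then show "\<forall>\<^sub>F t in at t0. \<bar>h t i - h t0 i\<bar> < d"
          using d tendstoD by (fastforce simp: dist_real_def)
      qed
    qed simp
    moreover have "\<forall>\<^sub>F t in at t0. h t \<in> Rn m"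
      using hR by (simp add: eventually_nhds_conv_at)
    moreover have "\<forall>\<^sub>F t in at t0. Q t < Q0 + 1"
      using Q by (rule order_tendstoD) simp
    moreover have "\<forall>\<^sub>F t in at t0. t \<noteq> t0" by (simp add: eventually_at_filter)
    ultimately show "\<forall>\<^sub>F t in at t0. dist (r t) 0 < e"
    proof eventually_elim
      case (elim t)
      then have "h t \<in> cube m (h t0) d" by (auto simp: cube_def)
      note b = fd[OF this]
      have "r t = (f (h t) - f (h t0) - (\<Sum>i<m. D i * (h t i - h t0 i))) / (t - t0)"
      proof -
        have "(\<Sum>i<m. D i * q i t) = (\<Sum>i<m. D i * (h t i - h t0 i)) / (t - t0)"
          by (simp add: q_def sum_divide_distrib)
        then show ?thesis by (simp only: r_def diff_divide_distrib)
      qed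
      then have "\<bar>r t\<bar> \<le> e' * nrm m (\<lambda>i. h t i - h t0 i) / \<bar>t - t0\<bar>"
        using b by (simp add: divide_right_mono)
      also have "\<dots> = e' * Q t"
        by (simp add: nrm_def Q_def q_def flip: sum_divide_distrib)
      also have "\<dots> \<le> e' * (Q0 + 1)" using elim \<open>e' > 0\<close> by simp
      also have "\<dots> = e / 2" using Q0 by (simp add: e'_def field_simps)
      also have "\<dots> < e" using \<open>e > 0\<close> by simp
      finally show ?case by (simp add: dist_real_def)
    qed
  qed
  moreover have "((\<lambda>t. \<Sum>i<m. D i * q i t) \<longlongrightarrow> (\<Sum>i<m. D i * a i)) (at t0)"
    by (intro tendsto_intros q) auto
  ultimately have "((\<lambda>t. r t + (\<Sum>i<m. D i * q i t)) \<longlongrightarrow> 0 + (\<Sum>i<m. D i * a i)) (at t0)"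
    by (rule tendsto_add)
  then show ?thesis by (simp add: r_def has_field_derivative_iff)
qed

subsection \<open>The classes \<open>C\<^sup>k\<close>\<close>

lemma Ck_on_0: "openin (Euclidean_space n) U \<Longrightarrow> Ck_on 0 n U f \<longleftrightarrow> continuous_on U f"
  using subtopology_Rn[OF openin_Rn_subset] by simp

lemma Ck_on_Suc: "openin (Euclidean_space n) U \<Longrightarrow> Ck_on (Suc k) n U f \<longleftrightarrow>
    continuous_on U f \<and> partially_diff n U f \<and> (\<forall>i<n. Ck_on k n U (part_deriv i f))"
  using subtopology_Rn[OF openin_Rn_subset] by (auto simp: partially_diff_def)

lemma Ck_on_continuous: "openin (Euclidean_space n) U \<Longrightarrow> Ck_on k n U f \<Longrightarrow> continuous_on U f"
  by (cases k) (auto simp only: Ck_on_0 Ck_on_Suc)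

lemma part_deriv_eqI:
  "((\<lambda>t. f (x(i := t))) has_field_derivative D) (at (x i)) \<Longrightarrow> part_deriv i f x = D"
  unfolding part_deriv_def by (rule DERIV_imp_deriv)

lemma DERIV_line_cong:
  assumes "openin (Euclidean_space n) U" "\<And>x. x \<in> U \<Longrightarrow> f x = g x" "x \<in> U" "i < n"
  shows "((\<lambda>t. f (x(i := t))) has_field_derivative D) (at (x i)) \<longleftrightarrow>
         ((\<lambda>t. g (x(i := t))) has_field_derivative D) (at (x i))"
proof (rule DERIV_cong_ev)
  show "\<forall>\<^sub>F t in nhds (x i). f (x(i := t)) = g (x(i := t))"
    using eventually_line[OF assms(1,3,4)] by eventually_elim (use assms(2) in auto)
qed auto

lemma part_deriv_cong:
  assumes "openin (Euclidean_space n) U" "\<And>x. x \<in> U \<Longrightarrow> f x = g x" "x \<in> U" "i < n"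
  shows "part_deriv i f x = part_deriv i g x"
  unfolding part_deriv_def deriv_def using DERIV_line_cong[of n U f g x i, OF assms] by simp

lemma partially_diff_cong:
  assumes "openin (Euclidean_space n) U" "\<And>x. x \<in> U \<Longrightarrow> f x = g x" "partially_diff n U f"
  shows "partially_diff n U g"
  using assms(3) DERIV_line_cong[of n U f g, OF assms(1,2)] unfolding partially_diff_def field_differentiable_def
  by meson

text \<open>Short coordinate lines through a point of an open set stay inside it, so agreement on U
  passes to the partial derivatives.\<close>

lemma Ck_on_cong_imp:
  assumes "openin (Euclidean_space n) U" "\<And>x. x \<in> U \<Longrightarrow> f x = g x" "Ck_on k n U f"
  shows "Ck_on k n U g"
  using assms(2,3)
proof (induction k arbitrary: f g)
  case 0
  then show ?case using assms(1) by (simp add: Ck_on_0 cong: continuous_on_cong del: Ck_on.simps)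
next
  case (Suc k)
  have "continuous_on U g"
    using Suc.prems Ck_on_continuous[OF assms(1)] continuous_on_cong by metis
  moreover have "partially_diff n U g"
    using Suc.prems partially_diff_cong[OF assms(1)] by (metis Ck_on_Suc[OF assms(1)])
  moreover have "Ck_on k n U (part_deriv i g)" if "i < n" for i
  proof (rule Suc.IH)
    show "part_deriv i f x = part_deriv i g x" if "x \<in> U" for x
      using part_deriv_cong[OF assms(1) Suc.prems(1) that \<open>i < n\<close>] by simp
    show "Ck_on k n U (part_deriv i f)"
      using Suc.prems(2) that by (simp only: Ck_on_Suc[OF assms(1)])
  qed
  ultimately show ?case unfolding Ck_on_Suc[OF assms(1)] by blast
qed

text \<open>The inductions below exhibit a derivative by a closed formula \<open>f'\<close>; this
  transfers the class of the formula to \<open>part_deriv\<close>, with which it agrees on U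
  only.\<close>

lemma Ck_on_SucI:
  assumes "openin (Euclidean_space n) U" "continuous_on U f"
    "\<And>i x. i < n \<Longrightarrow> x \<in> U \<Longrightarrow> ((\<lambda>t. f (x(i := t))) has_field_derivative f' i x) (at (x i))"
    "\<And>i. i < n \<Longrightarrow> Ck_on k n U (f' i)"
  shows "Ck_on (Suc k) n U f"
proof -
  have "partially_diff n U f"
    using assms(3) by (auto simp: partially_diff_def field_differentiable_def)
  moreover have "Ck_on k n U (part_deriv i f)" if "i < n" for i
    by (rule Ck_on_cong_imp[OF assms(1) _ assms(4)[OF that]]) (metis part_deriv_eqI assms(3) that)
  ultimately show ?thesis using assms(2) unfolding Ck_on_Suc[OF assms(1)] by blast
qed

lemma Ck_on_SucD:
  assumes "openin (Euclidean_space n) U" "Ck_on (Suc k) n U f"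
  shows "continuous_on U f" "partially_diff n U f" "\<And>i. i < n \<Longrightarrow> Ck_on k n U (part_deriv i f)"
  using assms(2) by (simp_all only: Ck_on_Suc[OF assms(1)])

lemma Ck_on_antimono_Suc:
  "openin (Euclidean_space n) U \<Longrightarrow> Ck_on (Suc k) n U f \<Longrightarrow> Ck_on k n U f"
proof (induction k arbitrary: f)
  case 0 then show ?case by (simp only: Ck_on_0 Ck_on_Suc)
next
  case (Suc k) then show ?case by (simp only: Ck_on_Suc) blast
qed

lemma Ck_on_local:
  assumes U: "openin (Euclidean_space n) U"
    and "\<And>x. x \<in> U \<Longrightarrow> \<exists>V. openin (Euclidean_space n) V \<and> x \<in> V \<and> Ck_on k n V f"
  shows "Ck_on k n U f"
  using assms(2)
proof (induction k arbitrary: f)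
  case cont: 0
  have "continuous_on U f"
  proof (rule continuous_onI_cube[OF openin_Rn_subset[OF U]])
    fix x and e :: real assume "x \<in> U" "e > 0"
    then obtain V where V: "openin (Euclidean_space n) V" "x \<in> V" "continuous_on V f"
      using cont Ck_on_0 by blast
    then show "\<exists>d>0. \<forall>y\<in>U \<inter> cube n x d. \<bar>f y - f x\<bar> < e"
      using continuous_on_cube[OF V(1,3,2) \<open>e > 0\<close>] by (metis IntD2)
  qed
  then show ?case by (simp only: Ck_on_0[OF U])
next
  case (Suc k)
  have "\<exists>V. openin (Euclidean_space n) V \<and> x \<in> V \<and> Ck_on k n V f" if "x \<in> U" for x
    using Suc.prems[OF that] Ck_on_antimono_Suc by blast
  then have "Ck_on k n U f" by (rule Suc.IH)
  then have "continuous_on U f" using Ck_on_continuous U by blast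
  moreover have "partially_diff n U f"
    using Suc.prems unfolding partially_diff_def
    by (metis Ck_on_Suc partially_diff_def)
  moreover have "Ck_on k n U (part_deriv i f)" if "i < n" for i
    using Suc.prems that by (intro Suc.IH) (metis Ck_on_Suc)
  ultimately show ?case unfolding Ck_on_Suc[OF U] by blast
qed

lemma Ck_on_subset:
  assumes "openin (Euclidean_space n) U" "openin (Euclidean_space n) V" "V \<subseteq> U" "Ck_on k n U f"
  shows "Ck_on k n V f"
  by (rule Ck_on_local[OF assms(2)]) (use assms in blast)

lemma Ck_on_const: "openin (Euclidean_space n) U \<Longrightarrow> Ck_on k n U (\<lambda>x. c)"
proof (induction k arbitrary: c)
  case 0 then show ?case by (simp only: Ck_on_0 continuous_on_const)
next
  case (Suc k)
  show ?case by (rule Ck_on_SucI[where f'="\<lambda>_ _. 0"]) (use Suc in \<open>auto intro!: continuous_intros derivative_eq_intros\<close>)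
qed

lemma Ck_on_coord: "openin (Euclidean_space n) U \<Longrightarrow> Ck_on k n U (\<lambda>x. x j)"
proof (cases k)
  case 0
  assume U: "openin (Euclidean_space n) U"
  have "continuous_on U (\<lambda>x::nat \<Rightarrow> real. x j)"
    by (rule continuous_on_coord) (rule continuous_on_id)
  then show ?thesis unfolding 0 Ck_on_0[OF U] .
next
  case (Suc l)
  assume U: "openin (Euclidean_space n) U"
  show ?thesis unfolding Suc
  proof (rule Ck_on_SucI[OF U, where f'="\<lambda>i x. if i = j then 1 else 0"])
    show "((\<lambda>t. (x(i := t)) j) has_field_derivative (if i = j then 1 else 0)) (at (x i))" for i x
      by (cases "i = j") auto
    show "continuous_on U (\<lambda>x::nat \<Rightarrow> real. x j)"
      by (rule continuous_on_coord) (rule continuous_on_id)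
  qed (rule Ck_on_const[OF U])
qed

lemma Ck_on_add:
  assumes U: "openin (Euclidean_space n) U" and "Ck_on k n U f" "Ck_on k n U g"
  shows "Ck_on k n U (\<lambda>x. f x + g x)"
  using assms(2,3)
proof (induction k arbitrary: f g)
  case 0 then show ?case by (simp only: Ck_on_0[OF U] continuous_on_add)
next
  case (Suc k)
  note f = Ck_on_SucD[OF U Suc.prems(1)] and g = Ck_on_SucD[OF U Suc.prems(2)]
  show ?case
    by (rule Ck_on_SucI[OF U, where f'="\<lambda>i x. part_deriv i f x + part_deriv i g x"])
       (intro continuous_on_add f g DERIV_add partially_diffD[OF f(2)] partially_diffD[OF g(2)]
         Suc.IH; assumption)+
qed

lemma Ck_on_mult:
  assumes U: "openin (Euclidean_space n) U" and "Ck_on k n U f" "Ck_on k n U g"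
  shows "Ck_on k n U (\<lambda>x. f x * g x)"
  using assms(2,3)
proof (induction k arbitrary: f g)
  case 0 then show ?case by (simp only: Ck_on_0[OF U] continuous_on_mult)
next
  case (Suc k)
  note f = Ck_on_SucD[OF U Suc.prems(1)] and g = Ck_on_SucD[OF U Suc.prems(2)]
  show ?case
  proof (rule Ck_on_SucI[OF U, where f'="\<lambda>i x. part_deriv i f x * g x + part_deriv i g x * f x"])
    show "((\<lambda>t. f (x(i := t)) * g (x(i := t))) has_field_derivative
      part_deriv i f x * g x + part_deriv i g x * f x) (at (x i))" if "i < n" "x \<in> U" for i x
      using DERIV_mult[OF partially_diffD[OF f(2) that] partially_diffD[OF g(2) that]]
      by (simp only: fun_upd_triv)
    show "Ck_on k n U (\<lambda>x. part_deriv i f x * g x + part_deriv i g x * f x)" if "i < n" for i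
      using Suc.prems[THEN Ck_on_antimono_Suc[OF U]] that
      by (intro Ck_on_add[OF U] Suc.IH f(3) g(3))
  qed (use f g in \<open>auto intro: continuous_on_mult\<close>)
qed

lemma Ck_on_sum:
  assumes U: "openin (Euclidean_space n) U" and "\<And>a. a \<in> A \<Longrightarrow> Ck_on k n U (f a)"
  shows "Ck_on k n U (\<lambda>x. \<Sum>a\<in>A. f a x)"
  using assms(2)
proof (induction A rule: infinite_finite_induct)
  case (insert a A)
  then show ?case using Ck_on_add[OF U, of k "f a" "\<lambda>x. \<Sum>a\<in>A. f a x"] by simp
qed (simp_all only: sum.infinite sum.empty not_False_eq_True Ck_on_const[OF U])

lemma Ck_on_minus:
  assumes U: "openin (Euclidean_space n) U" and "Ck_on k n U f"
  shows "Ck_on k n U (\<lambda>x. - f x)"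
  using Ck_on_mult[OF U Ck_on_const[OF U, of k "-1"] assms(2)] by simp

lemma Ck_on_strict:
  assumes "openin (Euclidean_space n) U" "Ck_on (Suc k) n U f" "x \<in> U" "e > 0"
  shows "\<exists>d>0. cube n x d \<subseteq> U \<and> (\<forall>y\<in>cube n x d. \<forall>z\<in>cube n x d.
       \<bar>f y - f z - (\<Sum>i<n. part_deriv i f x * (y i - z i))\<bar> \<le> e * nrm n (\<lambda>i. y i - z i))"
proof (rule strict_differentiability[OF assms(1,3) _ _ assms(4), of f])
  show "partially_diff n U f" by (rule Ck_on_SucD[OF assms(1,2)])
  show "continuous_on U (part_deriv i f)" if "i < n" for i
    using Ck_on_SucD(3)[OF assms(1,2) that] by (rule Ck_on_continuous[OF assms(1)])
qed blast

lemma DERIV_comp_Ck: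
  fixes h :: "real \<Rightarrow> nat \<Rightarrow> real"
  assumes V: "openin (Euclidean_space m) V" "Ck_on (Suc k) m V f" "h t0 \<in> V"
    and h: "\<And>i. i < m \<Longrightarrow> ((\<lambda>t. h t i) has_field_derivative a i) (at t0)"
    and hR: "\<forall>\<^sub>F t in nhds t0. h t \<in> Rn m"
  shows "((\<lambda>t. f (h t)) has_field_derivative (\<Sum>i<m. part_deriv i f (h t0) * a i)) (at t0)"
proof (rule DERIV_comp_strict[OF _ h hR])
  fix e :: real assume "e > 0"
  obtain d where d: "d > 0" "\<forall>y\<in>cube m (h t0) d. \<forall>z\<in>cube m (h t0) d.
       \<bar>f y - f z - (\<Sum>i<m. part_deriv i f (h t0) * (y i - z i))\<bar> \<le> e * nrm m (\<lambda>i. y i - z i)"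
    using Ck_on_strict[OF V \<open>e > 0\<close>] by (elim exE conjE) (rule that)
  have c: "h t0 \<in> cube m (h t0) d"
    by (rule cube_center[OF openin_Rn_mem[OF V(1,3)] d(1)])
  show "\<exists>d>0. \<forall>y\<in>cube m (h t0) d. \<bar>f y - f (h t0) -
      (\<Sum>i<m. part_deriv i f (h t0) * (y i - h t0 i))\<bar> \<le> e * nrm m (\<lambda>i. y i - h t0 i)"
  proof (intro exI[of _ d] conjI ballI d(1))
    fix y assume "y \<in> cube m (h t0) d"
    from d(2)[rule_format, OF this c] show "\<bar>f y - f (h t0) -
      (\<Sum>i<m. part_deriv i f (h t0) * (y i - h t0 i))\<bar> \<le> e * nrm m (\<lambda>i. y i - h t0 i)" .
  qed
qed assumption

lemma DERIV_comp_map: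
  assumes U: "openin (Euclidean_space n) U" and V: "openin (Euclidean_space m) V"
    and f: "Ck_on (Suc k) m V f" and g: "\<And>j. j < m \<Longrightarrow> partially_diff n U (\<lambda>x. g x j)"
    and gUV: "g ` U \<subseteq> V" and i: "i < n" "x \<in> U"
  shows "((\<lambda>t. f (g (x(i := t)))) has_field_derivative
    (\<Sum>j<m. part_deriv j f (g x) * part_deriv i (\<lambda>x. g x j) x)) (at (x i))"
proof -
  have *: "g (x(i := x i)) = g x" by simp
  have "((\<lambda>t. f (g (x(i := t)))) has_field_derivative
    (\<Sum>j<m. part_deriv j f (g (x(i := x i))) * part_deriv i (\<lambda>x. g x j) x)) (at (x i))"
  proof (rule DERIV_comp_Ck[OF V f])
    show "g (x(i := x i)) \<in> V" using i gUV by auto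
    show "((\<lambda>t. g (x(i := t)) j) has_field_derivative part_deriv i (\<lambda>x. g x j) x) (at (x i))"
      if "j < m" for j using partially_diffD[OF g[OF that] i] .
    show "\<forall>\<^sub>F t in nhds (x i). g (x(i := t)) \<in> Rn m"
      using eventually_line[OF U i(2,1)]
      by eventually_elim (use gUV openin_Rn_subset[OF V] in auto)
  qed
  then show ?thesis unfolding * .
qed

text \<open>In the derivative formula the factor \<open>part_deriv j f (g x)\<close> is again a
  composition with the same g, one order lower. Hence the induction on k with f arbitrary.\<close>

lemma Ck_on_compose:
  assumes U: "openin (Euclidean_space n) U" and V: "openin (Euclidean_space m) V"
    and f: "Ck_on k m V f" and g: "\<And>j. j < m \<Longrightarrow> Ck_on k n U (\<lambda>x. g x j)" and gUV: "g ` U \<subseteq> V"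
  shows "Ck_on k n U (\<lambda>x. f (g x))"
  using f g
proof (induction k arbitrary: f)
  case 0
  have "continuous_on U g"
    using 0 gUV openin_Rn_subset[OF V] Ck_on_continuous[OF U] by (intro continuous_on_coords) blast+
  then show ?case using 0 gUV Ck_on_0[OF U] Ck_on_0[OF V] continuous_on_compose2 by blast
next
  case (Suc k)
  have cg: "continuous_on U g"
    using Suc gUV openin_Rn_subset[OF V] Ck_on_continuous[OF U] by (intro continuous_on_coords) blast+
  note g = Ck_on_SucD[OF U Suc.prems(2)]
  note f = Ck_on_SucD[OF V Suc.prems(1)]
  show ?case
  proof (rule Ck_on_SucI[OF U])
    show "continuous_on U (\<lambda>x. f (g x))" using f(1) cg gUV continuous_on_compose2 by blast
    show "((\<lambda>t. f (g (x(i := t)))) has_field_derivative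
      (\<Sum>j<m. part_deriv j f (g x) * part_deriv i (\<lambda>x. g x j) x)) (at (x i))"
      if "i < n" "x \<in> U" for i x
      using DERIV_comp_map[OF U V Suc.prems(1) g(2) gUV that] by blast
    show "Ck_on k n U (\<lambda>x. \<Sum>j<m. part_deriv j f (g x) * part_deriv i (\<lambda>x. g x j) x)"
      if "i < n" for i
    proof (intro Ck_on_sum[OF U] Ck_on_mult[OF U])
      fix j assume "j \<in> {..<m}"
      then have j: "j < m" by simp
      show "Ck_on k n U (\<lambda>x. part_deriv j f (g x))"
        by (rule Suc.IH[OF f(3)[OF j] Ck_on_antimono_Suc[OF U Suc.prems(2)]])
      show "Ck_on k n U (part_deriv i (\<lambda>x. g x j))" by (rule g(3)[OF j that])
    qed
  qed
qed

subsection \<open>Linear algebra in \<open>\<real>\<^sup>n\<close>\<close>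

lemma scaleR_fun_apply [simp]: "(r *\<^sub>R f) i = r *\<^sub>R f i"
  by (simp add: scaleR_fun_def)

definition uvec :: "nat \<Rightarrow> nat \<Rightarrow> real"
  where "uvec i = (\<lambda>j. if j = i then 1 else 0)"

lemma uvec_Rn: "i < n \<Longrightarrow> uvec i \<in> Rn n"
  by (auto simp: uvec_def mem_Rn)

lemma sum_fun_apply: "(\<Sum>a\<in>A. f a) i = (\<Sum>a\<in>A. f a i)"
  for f :: "'a \<Rightarrow> 'b \<Rightarrow> 'c::comm_monoid_add"
  by (induction A rule: infinite_finite_induct) auto

lemma Rn_expansion: "v \<in> Rn n \<Longrightarrow> v = (\<Sum>i<n. v i *\<^sub>R uvec i)"
  by (rule ext) (auto simp: sum_fun_apply uvec_def mem_Rn if_distrib cong: if_cong)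

lemma subspace_Rn: "subspace (Rn n)"
  by (auto simp: subspace_def mem_Rn)

lemma Rn_0 [simp]: "0 \<in> Rn n"
  by (simp add: mem_Rn)

lemma Rn_add: "u \<in> Rn n \<Longrightarrow> v \<in> Rn n \<Longrightarrow> u + v \<in> Rn n"
  and Rn_diff: "u \<in> Rn n \<Longrightarrow> v \<in> Rn n \<Longrightarrow> u - v \<in> Rn n"
  and Rn_scale: "u \<in> Rn n \<Longrightarrow> r *\<^sub>R u \<in> Rn n"
  by (auto simp: mem_Rn)

lemma linear_sum_apply: "linear L \<Longrightarrow> L (\<Sum>i\<in>A. r i *\<^sub>R f i) = (\<Sum>i\<in>A. r i *\<^sub>R L (f i))"
  by (simp add: real_vector.linear_sum real_vector.linear_scale)

lemma linear_Rn_expansion: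
  assumes "linear L" "v \<in> Rn n" shows "L v = (\<Sum>i<n. v i *\<^sub>R L (uvec i))"
  using linear_sum_apply[OF assms(1), of v uvec "{..<n}"] Rn_expansion[OF assms(2)] by simp

lemma span_uvec: "span (uvec ` {..<n}) = Rn n"
proof
  show "span (uvec ` {..<n}) \<subseteq> Rn n"
    by (rule span_minimal[OF _ subspace_Rn]) (auto intro: uvec_Rn)
  show "Rn n \<subseteq> span (uvec ` {..<n})"
  proof
    fix v assume "v \<in> Rn n"
    have "(\<Sum>i<n. v i *\<^sub>R uvec i) \<in> span (uvec ` {..<n})"
      by (intro span_sum span_scale span_base) auto
    then show "v \<in> span (uvec ` {..<n})" using Rn_expansion[OF \<open>v \<in> Rn n\<close>] by simp
  qed
qed

lemma inj_uvec: "inj uvec"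
  by (rule injI) (metis uvec_def zero_neq_one)

lemma independent_uvec: "independent (uvec ` {..<n})"
proof
  assume "dependent (uvec ` {..<n})"
  then obtain u v where u: "v \<in> uvec ` {..<n}" "u v \<noteq> 0" "(\<Sum>v\<in>uvec ` {..<n}. u v *\<^sub>R v) = 0"
    using real_vector.dependent_finite[of "uvec ` {..<n}"] by auto
  then obtain i where i: "i < n" "u (uvec i) \<noteq> 0" by auto
  have "(\<Sum>j<n. u (uvec j) *\<^sub>R uvec j) = 0"
    using u(3) by (subst (asm) sum.reindex) (auto intro: inj_on_subset[OF inj_uvec])
  then have "(\<Sum>j<n. u (uvec j) *\<^sub>R uvec j) i = 0" by simp
  then show False using i by (simp add: sum_fun_apply uvec_def if_distrib cong: if_cong)
qed

lemma card_uvec: "card (uvec ` {..<n}) = n"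
  by (simp add: card_image inj_on_subset[OF inj_uvec])

lemma dim_Rn: "dim (Rn n) = n"
  by (rule dim_unique[OF _ _ independent_uvec card_uvec]) (auto simp: span_uvec intro: uvec_Rn)

lemma subspace_Rn_basis:
  assumes "subspace V" "V \<subseteq> Rn n"
  obtains B where "B \<subseteq> V" "independent B" "span B = V" "finite B" "card B = dim V" "card B \<le> n"
proof -
  obtain B where B: "B \<subseteq> V" "independent B" "V \<subseteq> span B" "card B = dim V"
    using real_vector.basis_exists[of V] .
  moreover have "finite B \<and> card B \<le> card (uvec ` {..<n})"
    using B assms by (intro real_vector.independent_span_bound) (auto simp: span_uvec)
  moreover have "span B = V" using B assms(1) by (metis span_minimal subset_antisym)
  ultimately show ?thesis using that[of B] by (simp add: card_uvec)
qed

text \<open>The ambient type is infinite-dimensional, so finiteness of the bases comes from the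
  inclusions into \<open>Rn\<close>. If a vector of W were missing from the image, adjoining it to
  the image of a basis of V would give too many independent vectors.\<close>

lemma linear_inj_dim_le:
  assumes "linear L" "subspace V" "V \<subseteq> Rn n" "inj_on L V" "L ` V \<subseteq> W" "subspace W" "W \<subseteq> Rn m"
  shows "dim V \<le> dim W" "dim V = dim W \<Longrightarrow> L ` V = W"
proof -
  obtain B where B: "B \<subseteq> V" "independent B" "span B = V" "finite B" "card B = dim V"
    using subspace_Rn_basis[OF assms(2,3)] .
  obtain C where C: "C \<subseteq> W" "independent C" "span C = W" "finite C" "card C = dim W"
    using subspace_Rn_basis[OF assms(6,7)] .
  have indep: "independent (L ` B)"
    using real_vector.linear_independent_injective_image[OF assms(1) B(2)] B(3) assms(4) by simp
  have cardLB: "card (L ` B) = dim V"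
    using B(5) card_image inj_on_subset[OF assms(4) B(1)] by metis
  have LBW: "L ` B \<subseteq> W" using B(1) assms(5) by auto
  have "card (L ` B) \<le> card C"
    using real_vector.independent_span_bound[OF C(4) indep] LBW C(3) by simp
  then show le: "dim V \<le> dim W" using cardLB C by simp
  have LV: "L ` V = span (L ` B)" using real_vector.linear_span_image[OF assms(1)] B(3) by metis
  assume eq: "dim V = dim W"
  show "L ` V = W"
  proof (rule ccontr)
    assume "L ` V \<noteq> W"
    then obtain w where w: "w \<in> W" "w \<notin> span (L ` B)" using assms(5) LV by blast
    have "independent (insert w (L ` B))" using indep w(2) by (simp add: independent_insert)
    moreover have "insert w (L ` B) \<subseteq> span C" using w(1) LBW C(3) by auto
    ultimately have "card (insert w (L ` B)) \<le> card C"
      using real_vector.independent_span_bound[OF C(4)] by blast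
    moreover have "w \<notin> L ` B" using w(2) real_vector.span_base[of w "L ` B"] by (rule contrapos_nn)
    ultimately show False using cardLB eq C(5) B(4) by simp
  qed
qed

text \<open>An injective endomorphism of \<open>Rn n\<close> is onto by a dimension count, so a
  linear left inverse on \<open>Rn n\<close> is two-sided there.\<close>

lemma linear_Rn_inverse:
  assumes "linear L" "L ` Rn n \<subseteq> Rn n" "\<And>v. v \<in> Rn n \<Longrightarrow> L v = 0 \<Longrightarrow> v = 0"
  obtains K where "linear K" "range K \<subseteq> Rn n" "\<And>v. v \<in> Rn n \<Longrightarrow> K (L v) = v"
    "\<And>v. v \<in> Rn n \<Longrightarrow> L (K v) = v"
proof -
  have inj: "inj_on L (Rn n)"
  proof (rule inj_onI)
    fix u v assume "u \<in> Rn n" "v \<in> Rn n" "L u = L v"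
    then have "L (u - v) = 0" using assms(1) real_vector.linear_diff by fastforce
    then show "u = v" using assms(3)[of "u - v"] \<open>u \<in> Rn n\<close> \<open>v \<in> Rn n\<close> Rn_diff by auto
  qed
  obtain K where K: "range K \<subseteq> Rn n" "linear K" "\<And>v. v \<in> Rn n \<Longrightarrow> K (L v) = v"
    using real_vector.linear_exists_left_inverse_on[OF assms(1) subspace_Rn inj] by auto
  have surj: "L ` Rn n = Rn n"
    by (rule linear_inj_dim_le(2)[OF assms(1) subspace_Rn order_refl inj assms(2) subspace_Rn order_refl])
       simp
  have "L (K v) = v" if "v \<in> Rn n" for v
  proof -
    obtain u where "u \<in> Rn n" "v = L u" using surj \<open>v \<in> Rn n\<close> by auto
    then show ?thesis using K(3) by simp
  qed
  then show ?thesis using that K by blast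
qed

lemma nrm_nonneg: "0 \<le> nrm n v"
  by (simp add: nrm_def sum_nonneg)

lemma nrm_add: "nrm n (u + v) \<le> nrm n u + nrm n v"
  unfolding nrm_def sum.distrib[symmetric] by (rule sum_mono) auto

lemma nrm_scale: "nrm n (r *\<^sub>R v) = \<bar>r\<bar> * nrm n v"
  by (simp add: nrm_def abs_mult sum_distrib_left)

lemma nrm_minus_commute: "nrm n (u - v) = nrm n (v - u)"
  by (simp add: nrm_def abs_minus_commute)

lemma nrm_coord: "i < n \<Longrightarrow> \<bar>v i\<bar> \<le> nrm n v"
  unfolding nrm_def by (rule member_le_sum) auto

lemma nrm_uvec: "i < n \<Longrightarrow> nrm n (uvec i) = 1"
  by (simp add: nrm_def uvec_def if_distrib cong: if_cong)

lemma nrm_eq_0: "v \<in> Rn n \<Longrightarrow> nrm n v = 0 \<Longrightarrow> v = 0"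
  by (rule ext) (metis Rn_nth nrm_coord abs_le_zero_iff not_le zero_fun_apply)

lemma nrm_sum: "nrm n (\<Sum>a\<in>A. f a) \<le> (\<Sum>a\<in>A. nrm n (f a))"
proof (induction A rule: infinite_finite_induct)
  case (insert a A)
  show ?case unfolding sum.insert[OF insert.hyps]
    by (rule order_trans[OF nrm_add add_left_mono[OF insert.IH]])
qed (auto simp: nrm_def)

lemma linear_Rn_bound:
  assumes "linear L" obtains C where "C > 0" "\<And>v. v \<in> Rn n \<Longrightarrow> nrm m (L v) \<le> C * nrm n v"
proof -
  \<comment> \<open>The summand 1 keeps the bound positive when L vanishes on
    \<open>Rn n\<close>.\<close>
  define C where "C = 1 + (\<Sum>i<n. nrm m (L (uvec i)))"
  have C: "nrm m (L (uvec i)) \<le> C" if "i < n" for i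
  proof -
    have "nrm m (L (uvec i)) \<le> (\<Sum>i<n. nrm m (L (uvec i)))"
      using that by (intro member_le_sum) (auto simp: nrm_nonneg)
    then show ?thesis by (simp add: C_def)
  qed
  have "C > 0" using sum_nonneg[of "{..<n}" "\<lambda>i. nrm m (L (uvec i))"] nrm_nonneg
    by (simp add: C_def add_pos_nonneg)
  moreover have "nrm m (L v) \<le> C * nrm n v" if "v \<in> Rn n" for v
  proof -
    have "nrm m (L v) = nrm m (\<Sum>i<n. v i *\<^sub>R L (uvec i))"
      using linear_Rn_expansion[OF assms that] by simp
    also have "\<dots> \<le> (\<Sum>i<n. nrm m (v i *\<^sub>R L (uvec i)))" by (rule nrm_sum)
    also have "\<dots> \<le> (\<Sum>i<n. \<bar>v i\<bar> * C)"
      by (intro sum_mono) (auto simp: nrm_scale C mult_left_mono)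
    also have "\<dots> = C * nrm n v" by (simp add: nrm_def sum_distrib_left mult.commute)
    finally show ?thesis .
  qed
  ultimately show ?thesis using that by blast
qed

subsection \<open>Smooth maps and their Jacobians\<close>

lemma jacobian_Rn: "jacobian n m F x v \<in> Rn m"
  by (simp add: jacobian_def mem_Rn)

lemma linear_jacobian: "linear (jacobian n m F x)"
  by (rule linearI) (auto simp: jacobian_def fun_eq_iff algebra_simps sum.distrib sum_distrib_left)

lemma jacobian_uvec: "i < n \<Longrightarrow> j < m \<Longrightarrow> jacobian n m F x (uvec i) j = part_deriv i (\<lambda>y. F y j) x"
  by (simp add: jacobian_def uvec_def if_distrib cong: if_cong)

lemma jacobian_cong:
  assumes "openin (Euclidean_space n) U" "x \<in> U" "\<And>y. y \<in> U \<Longrightarrow> F y = G y"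
  shows "jacobian n m F x v = jacobian n m G x v"
proof -
  have "part_deriv i (\<lambda>y. F y j) x = part_deriv i (\<lambda>y. G y j) x" if "i < n" for i j
    by (rule part_deriv_cong[OF assms(1) _ assms(2) that]) (simp add: assms(3))
  then show ?thesis by (simp add: jacobian_def fun_eq_iff)
qed

lemma smooth_map_Ck: "smooth_map n U m F \<Longrightarrow> j < m \<Longrightarrow> Ck_on k n U (\<lambda>x. F x j)"
  by (simp add: smooth_map_def)

lemma smooth_map_image: "smooth_map n U m F \<Longrightarrow> F ` U \<subseteq> Rn m"
  by (simp add: smooth_map_def)

lemma smooth_map_mem: "smooth_map n U m F \<Longrightarrow> x \<in> U \<Longrightarrow> F x \<in> Rn m"
  by (auto simp: smooth_map_def)

lemma smooth_mapI:
  "\<lbrakk>\<And>x. x \<in> U \<Longrightarrow> F x \<in> Rn m; \<And>j k. j < m \<Longrightarrow> Ck_on k n U (\<lambda>x. F x j)\<rbrakk> \<Longrightarrow> smooth_map n U m F"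
  by (auto simp: smooth_map_def)

lemma smooth_map_cong:
  assumes "openin (Euclidean_space n) U" "\<And>x. x \<in> U \<Longrightarrow> F x = G x" "smooth_map n U m F"
  shows "smooth_map n U m G"
proof (rule smooth_mapI)
  show "Ck_on k n U (\<lambda>x. G x j)" if "j < m" for j k
    by (rule Ck_on_cong_imp[OF assms(1) _ smooth_map_Ck[OF assms(3) that]]) (simp add: assms(2))
qed (metis assms(2,3) smooth_map_mem)

lemma smooth_map_subset:
  assumes "openin (Euclidean_space n) U" "openin (Euclidean_space n) V" "V \<subseteq> U" "smooth_map n U m F"
  shows "smooth_map n V m F"
proof (rule smooth_mapI)
  show "Ck_on k n V (\<lambda>x. F x j)" if "j < m" for j k
    by (rule Ck_on_subset[OF assms(1-3) smooth_map_Ck[OF assms(4) that]])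
qed (metis assms(3,4) smooth_map_mem subsetD)

lemma smooth_map_local:
  assumes "openin (Euclidean_space n) U"
    "\<And>x. x \<in> U \<Longrightarrow> \<exists>V. openin (Euclidean_space n) V \<and> x \<in> V \<and> smooth_map n V m F"
  shows "smooth_map n U m F"
proof (rule smooth_mapI)
  show "Ck_on k n U (\<lambda>x. F x j)" if "j < m" for j k
    by (rule Ck_on_local[OF assms(1)]) (metis assms(2) smooth_map_Ck that)
qed (metis assms(2) smooth_map_mem)

lemma smooth_map_compose:
  assumes "openin (Euclidean_space n) U" "openin (Euclidean_space m) V"
    "smooth_map n U m G" "smooth_map m V l F" "G ` U \<subseteq> V"
  shows "smooth_map n U l (\<lambda>x. F (G x))"
proof (rule smooth_mapI)
  show "F (G x) \<in> Rn l" if "x \<in> U" for x using that assms(4,5) smooth_map_mem by (metis image_subset_iff)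
  show "Ck_on k n U (\<lambda>x. F (G x) j)" if "j < l" for j k
    using Ck_on_compose[OF assms(1,2) smooth_map_Ck[OF assms(4) that] smooth_map_Ck[OF assms(3)] assms(5)] .
qed

lemma smooth_map_continuous:
  assumes "openin (Euclidean_space n) U" "smooth_map n U m F"
  shows "continuous_on U F"
proof (rule continuous_on_coords[OF smooth_map_image[OF assms(2)]])
  show "continuous_on U (\<lambda>x. F x j)" if "j < m" for j
    using Ck_on_continuous[OF assms(1) smooth_map_Ck[OF assms(2) that, of 0]] .
qed

lemma smooth_map_continuous_map:
  assumes "openin (Euclidean_space n) U" "smooth_map n U m F"
  shows "continuous_map (subtopology (Euclidean_space n) U) (Euclidean_space m) F"
  unfolding cm_Euclidean_space_iff_continuous_on
  using smooth_map_continuous[OF assms] smooth_map_mem[OF assms(2)] openin_Rn_subset[OF assms(1)]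
  by (auto simp: Int_absorb1)

lemma smooth_map_partially_diff:
  assumes "openin (Euclidean_space n) U" "smooth_map n U m F" "j < m"
  shows "partially_diff n U (\<lambda>x. F x j)"
  using Ck_on_SucD(2)[OF assms(1) smooth_map_Ck[OF assms(2,3), of "Suc 0"]] .

lemma part_deriv_Ck:
  assumes "openin (Euclidean_space n) U" "smooth_map n U m F" "j < m" "i < n"
  shows "Ck_on k n U (part_deriv i (\<lambda>x. F x j))"
  using Ck_on_SucD(3)[OF assms(1) smooth_map_Ck[OF assms(2,3), of "Suc k"] assms(4)] .

lemma jacobian_compose:
  assumes "openin (Euclidean_space n) U" "openin (Euclidean_space m) V"
    "smooth_map n U m G" "smooth_map m V l F" "G ` U \<subseteq> V" "x \<in> U"
  shows "jacobian n l (\<lambda>x. F (G x)) x v = jacobian m l F (G x) (jacobian n m G x v)"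
proof -
  have "part_deriv i (\<lambda>y. F (G y) j) x
      = (\<Sum>r<m. part_deriv r (\<lambda>y. F y j) (G x) * part_deriv i (\<lambda>x. G x r) x)"
    if "j < l" "i < n" for i j
    by (rule part_deriv_eqI, rule DERIV_comp_map[OF assms(1,2) smooth_map_Ck[OF assms(4) that(1)]
      smooth_map_partially_diff[OF assms(1,3)] assms(5) that(2) assms(6)])
  moreover have "(\<Sum>i<n. (\<Sum>r<m. a r * b i r) * v i) = (\<Sum>r<m. a r * (\<Sum>i<n. b i r * v i))"
    for a :: "nat \<Rightarrow> real" and b :: "nat \<Rightarrow> nat \<Rightarrow> real"
    by (simp add: sum_distrib_left sum_distrib_right mult.assoc) (rule sum.swap)
  ultimately show ?thesis by (auto simp: jacobian_def fun_eq_iff)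
qed

lemma affine_line: "(\<lambda>j. if j = i then t else x j) = x + (t - x i) *\<^sub>R uvec i"
  by (auto simp: uvec_def fun_eq_iff)

lemma DERIV_affine:
  assumes "linear L"
  shows "((\<lambda>t. (c + L (x(i := t))) j) has_field_derivative L (uvec i) j) (at (x i))"
proof -
  have "L (x(i := t)) = L x + (t - x i) *\<^sub>R L (uvec i)" for t
    using affine_line[of i t x] by (simp add: fun_upd_def real_vector.linear_add[OF assms] real_vector.linear_scale[OF assms])
  then show ?thesis by (auto intro!: derivative_eq_intros)
qed

lemma jacobian_affine:
  assumes "linear L" "\<And>v. v \<in> Rn n \<Longrightarrow> L v \<in> Rn m" "v \<in> Rn n"
  shows "jacobian n m (\<lambda>y. c + L y) x v = L v"
proof
  fix j
  have "part_deriv i (\<lambda>y. (c + L y) j) x = L (uvec i) j" for i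
    by (rule part_deriv_eqI) (rule DERIV_affine[OF assms(1)])
  moreover have "L v j = (\<Sum>i<n. v i * L (uvec i) j)"
    using linear_Rn_expansion[OF assms(1,3)] by (simp add: sum_fun_apply)
  ultimately show "jacobian n m (\<lambda>y. c + L y) x v j = L v j"
    using Rn_nth[OF assms(2)[OF assms(3)], of j] by (auto simp: jacobian_def mult.commute)
qed

lemma smooth_map_affine:
  assumes U: "openin (Euclidean_space n) U" and "linear L" "\<And>v. v \<in> Rn n \<Longrightarrow> L v \<in> Rn m" "c \<in> Rn m"
  shows "smooth_map n U m (\<lambda>y. c + L y)"
proof (rule smooth_mapI)
  show "c + L y \<in> Rn m" if "y \<in> U" for y
    using openin_Rn_mem[OF U that] assms(3,4) Rn_add by blast
  show "Ck_on k n U (\<lambda>y. (c + L y) j)" for j k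
  proof (rule Ck_on_cong_imp[OF U])
    show "c j + (\<Sum>i<n. y i * L (uvec i) j) = (c + L y) j" if "y \<in> U" for y
      using linear_Rn_expansion[OF assms(2) openin_Rn_mem[OF U that]] by (simp add: sum_fun_apply)
    show "Ck_on k n U (\<lambda>y. c j + (\<Sum>i<n. y i * L (uvec i) j))"
      by (intro Ck_on_add[OF U] Ck_on_const[OF U] Ck_on_sum[OF U] Ck_on_mult[OF U] Ck_on_coord[OF U])
  qed
qed

lemma linear_ident_fun: "linear (\<lambda>x::nat \<Rightarrow> real. x)"
  by (rule linearI) auto

lemma smooth_map_id: "openin (Euclidean_space n) U \<Longrightarrow> smooth_map n U n (\<lambda>x. x)"
  using smooth_map_affine[of n U "\<lambda>x. x" n 0] linear_ident_fun by simp

lemma smooth_map_translate: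
  "openin (Euclidean_space n) U \<Longrightarrow> c \<in> Rn n \<Longrightarrow> smooth_map n U n (\<lambda>x. c + x)"
  using smooth_map_affine[of n U "\<lambda>x. x" n c] linear_ident_fun by simp

lemma jacobian_id: "v \<in> Rn n \<Longrightarrow> jacobian n n (\<lambda>x. x) x v = v"
  using jacobian_affine[of "\<lambda>x. x" n n v 0 x] linear_ident_fun by simp

lemma jacobian_translate: "v \<in> Rn n \<Longrightarrow> jacobian n n (\<lambda>x. c + x) x v = v"
  using jacobian_affine[of "\<lambda>x. x" n n v c x] linear_ident_fun by simp

lemma smooth_map_const: "openin (Euclidean_space n) U \<Longrightarrow> c \<in> Rn m \<Longrightarrow> smooth_map n U m (\<lambda>x. c)"
  by (rule smooth_mapI) (auto intro: Ck_on_const simp del: Ck_on.simps)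

lemma jacobian_const: "jacobian n m (\<lambda>x. c) x v = 0"
proof -
  have "part_deriv i (\<lambda>y. c j) x = 0" for i and j by (rule part_deriv_eqI) simp
  then show ?thesis by (simp add: jacobian_def fun_eq_iff)
qed

lemma smooth_map_strict:
  assumes U: "openin (Euclidean_space n) U" and F: "smooth_map n U m F" and x: "x \<in> U" and e: "e > 0"
  shows "\<exists>d>0. cube n x d \<subseteq> U \<and> (\<forall>y\<in>cube n x d. \<forall>z\<in>cube n x d.
       nrm m (F y - F z - jacobian n m F x (y - z)) \<le> e * nrm n (y - z))"
proof -
  \<comment> \<open>One such error for each of the m components adds up to at most e; the
    \<open>+ 1\<close> covers the case that m is 0.\<close>
  define e' where "e' = e / (real m + 1)"
  have e': "e' > 0" "real m * e' \<le> e" using e by (auto simp: e'_def field_simps)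
  have "\<exists>d>0. cube n x d \<subseteq> U \<and> (\<forall>y\<in>cube n x d. \<forall>z\<in>cube n x d.
       \<bar>F y j - F z j - (\<Sum>i<n. part_deriv i (\<lambda>x. F x j) x * (y i - z i))\<bar> \<le> e' * nrm n (\<lambda>i. y i - z i))"
    if "j < m" for j
    using Ck_on_strict[OF U smooth_map_Ck[OF F that, of "Suc 0"] x e'(1)] .
  then have "\<forall>j. \<exists>d. j < m \<longrightarrow> d>0 \<and> cube n x d \<subseteq> U \<and> (\<forall>y\<in>cube n x d. \<forall>z\<in>cube n x d.
       \<bar>F y j - F z j - (\<Sum>i<n. part_deriv i (\<lambda>x. F x j) x * (y i - z i))\<bar> \<le> e' * nrm n (\<lambda>i. y i - z i))"
    by simp
  then obtain D where "\<forall>j<m. D j>0 \<and> cube n x (D j) \<subseteq> U \<and> (\<forall>y\<in>cube n x (D j). \<forall>z\<in>cube n x (D j).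
       \<bar>F y j - F z j - (\<Sum>i<n. part_deriv i (\<lambda>x. F x j) x * (y i - z i))\<bar> \<le> e' * nrm n (\<lambda>i. y i - z i))"
    by (rule choice[THEN exE])
  then have D: "\<And>j. j < m \<Longrightarrow> D j > 0"
    "\<And>j y z. j < m \<Longrightarrow> y \<in> cube n x (D j) \<Longrightarrow> z \<in> cube n x (D j) \<Longrightarrow>
       \<bar>F y j - F z j - (\<Sum>i<n. part_deriv i (\<lambda>x. F x j) x * (y i - z i))\<bar> \<le> e' * nrm n (\<lambda>i. y i - z i)"
    by simp_all
  obtain d0 where d0: "d0 > 0" "cube n x d0 \<subseteq> U" using open_contains_cube[OF U x] .
  define d where "d = Min (insert d0 (D ` {..<m}))"
  have d: "d > 0" "d \<le> d0" "\<And>j. j < m \<Longrightarrow> d \<le> D j" using d0 D(1) by (auto simp: d_def)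
  have "nrm m (F y - F z - jacobian n m F x (y - z)) \<le> e * nrm n (y - z)"
    if y: "y \<in> cube n x d" and z: "z \<in> cube n x d" for y z
  proof -
    have diff: "(\<lambda>i. y i - z i) = y - z" by auto
    have "nrm m (F y - F z - jacobian n m F x (y - z)) \<le> (\<Sum>j<m. e' * nrm n (y - z))"
      unfolding nrm_def[of m]
    proof (rule sum_mono)
      fix j assume "j \<in> {..<m}"
      then have j: "j < m" by simp
      have "y \<in> cube n x (D j)" "z \<in> cube n x (D j)" using y z cube_mono[OF d(3)[OF j]] by auto
      from D(2)[OF j this] show "\<bar>(F y - F z - jacobian n m F x (y - z)) j\<bar> \<le> e' * nrm n (y - z)"
        using j by (simp add: jacobian_def diff)
    qed
    also have "\<dots> = (real m * e') * nrm n (y - z)" by simp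
    also have "\<dots> \<le> e * nrm n (y - z)" using e'(2) nrm_nonneg by (rule mult_right_mono)
    finally show ?thesis .
  qed
  moreover have "cube n x d \<subseteq> U" using cube_mono[OF d(2)] d0(2) by auto
  ultimately show ?thesis using d(1) by (intro exI[of _ d]) auto
qed

subsection \<open>The inverse function theorem\<close>

lemma nrm_triangle_diff: "nrm n u \<le> nrm n v + nrm n (v - u)"
proof -
  have "nrm n (v + (u - v)) \<le> nrm n v + nrm n (u - v)" by (rule nrm_add)
  also have "v + (u - v) = u" by simp
  finally show ?thesis by (simp only: nrm_minus_commute[of n v u])
qed

text \<open>The linear part expands by at least \<open>1 / C\<close> and the strict remainder
  consumes at most half of that, which leaves the factor \<open>2 * C\<close>.\<close>

lemma smooth_map_expanding:
  assumes U: "openin (Euclidean_space n) U" and F: "smooth_map n U m F" and x: "x \<in> U"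
    and C: "C > 0" "\<And>v. v \<in> Rn n \<Longrightarrow> nrm n v \<le> C * nrm m (jacobian n m F x v)"
  shows "\<exists>d>0. cube n x d \<subseteq> U \<and>
    (\<forall>y\<in>cube n x d. \<forall>z\<in>cube n x d. nrm n (y - z) \<le> 2 * C * nrm m (F y - F z))"
proof -
  obtain d where d: "d > 0" "cube n x d \<subseteq> U" "\<forall>y\<in>cube n x d. \<forall>z\<in>cube n x d.
       nrm m (F y - F z - jacobian n m F x (y - z)) \<le> 1 / (2 * C) * nrm n (y - z)"
    using smooth_map_strict[OF U F x, of "1 / (2 * C)"] C(1) by auto
  have "nrm n (y - z) \<le> 2 * C * nrm m (F y - F z)"
    if y: "y \<in> cube n x d" and z: "z \<in> cube n x d" for y z
  proof -
    have yz: "y - z \<in> Rn n" by (rule Rn_diff) (use y z cube_subset_Rn in auto)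
    have "nrm m (jacobian n m F x (y - z))
        \<le> nrm m (F y - F z) + nrm m (F y - F z - jacobian n m F x (y - z))"
      by (rule nrm_triangle_diff)
    also have "\<dots> \<le> nrm m (F y - F z) + 1 / (2 * C) * nrm n (y - z)"
      using d(3)[rule_format, OF y z] by simp
    finally have "C * nrm m (jacobian n m F x (y - z)) \<le> C * (nrm m (F y - F z) + 1 / (2 * C) * nrm n (y - z))"
      using C(1) by simp
    moreover have "nrm n (y - z) \<le> C * nrm m (jacobian n m F x (y - z))" by (rule C(2)[OF yz])
    moreover have "C * (nrm m (F y - F z) + 1 / (2 * C) * nrm n (y - z))
        = C * nrm m (F y - F z) + nrm n (y - z) / 2"
      using C(1) by (simp add: field_simps)
    ultimately show ?thesis by simp
  qed
  then show ?thesis using d(1,2) by (intro exI[of _ d]) auto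
qed

text \<open>The way back from an expanding map to its Jacobian: test on
  \<open>y + t *\<^sub>R v\<close> for small t, where the strict remainder again costs a factor 2.
  Applied at each point of a neighbourhood it bounds all inverse Jacobians by one constant.\<close>

lemma jacobian_expanding:
  assumes U: "openin (Euclidean_space n) U" and F: "smooth_map n U m F" and y: "y \<in> U"
    and C: "C > 0" "\<And>z. z \<in> U \<Longrightarrow> nrm n (z - y) \<le> C * nrm m (F z - F y)" and v: "v \<in> Rn n"
  shows "nrm n v \<le> 2 * C * nrm m (jacobian n m F y v)"
proof -
  obtain d where d: "d > 0" "cube n y d \<subseteq> U" "\<forall>z\<in>cube n y d. \<forall>w\<in>cube n y d.
       nrm m (F z - F w - jacobian n m F y (z - w)) \<le> 1 / (2 * C) * nrm n (z - w)"
    using smooth_map_strict[OF U F y, of "1 / (2 * C)"] C(1) by auto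
  \<comment> \<open>Every coordinate of \<open>t *\<^sub>R v\<close> then stays below d; the
    \<open>+ 1\<close> avoids division by zero for v = 0.\<close>
  define t where "t = d / (nrm n v + 1) / 2"
  have t: "t > 0" using d(1) nrm_nonneg[of n v] by (simp add: t_def)
  define z where "z = y + t *\<^sub>R v"
  have yR: "y \<in> Rn n" by (rule openin_Rn_mem[OF U y])
  have "t * \<bar>v i\<bar> < d" if "i < n" for i
  proof -
    have "t * \<bar>v i\<bar> \<le> t * (nrm n v + 1)" using nrm_coord[OF that, of v] t by (simp add: add_increasing2)
    also have "\<dots> = d / 2" using nrm_nonneg[of n v] by (simp add: t_def field_simps)
    also have "\<dots> < d" using d(1) by simp
    finally show ?thesis .
  qed
  moreover have "z \<in> Rn n" unfolding z_def by (intro Rn_add yR Rn_scale v)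
  ultimately have z: "z \<in> cube n y d" using t by (auto simp: cube_def z_def abs_mult)
  have zy: "z - y = t *\<^sub>R v" by (simp add: z_def)
  have "nrm m (F z - F y) \<le> nrm m (jacobian n m F y (z - y))
      + nrm m (jacobian n m F y (z - y) - (F z - F y))"
    by (rule nrm_triangle_diff)
  also have "\<dots> \<le> nrm m (jacobian n m F y (z - y)) + 1 / (2 * C) * nrm n (z - y)"
    using d(3)[rule_format, OF z cube_center[OF yR d(1)]]
    by (simp add: nrm_minus_commute[of m "jacobian n m F y (z - y)"])
  finally have "C * nrm m (F z - F y) \<le> C * (nrm m (jacobian n m F y (z - y)) + 1 / (2 * C) * nrm n (z - y))"
    using C(1) by simp
  also have "\<dots> = C * nrm m (jacobian n m F y (z - y)) + nrm n (z - y) / 2"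
    using C(1) by (simp add: field_simps)
  finally have "nrm n (z - y) \<le> C * nrm m (jacobian n m F y (z - y)) + nrm n (z - y) / 2"
    using C(2)[of z] z d(2) by force
  then have "nrm n (z - y) \<le> 2 * C * nrm m (jacobian n m F y (z - y))" by simp
  then have "t * nrm n v \<le> t * (2 * C * nrm m (jacobian n m F y v))"
    using t by (simp add: zy nrm_scale real_vector.linear_scale[OF linear_jacobian])
  then show ?thesis using t by simp
qed

lemma tendsto_line:
  assumes "openin (Euclidean_space n) U" "continuous_on U f" "x \<in> U" "i < n"
  shows "((\<lambda>t. f (x(i := t)) :: real) \<longlongrightarrow> f x) (at (x i))"
proof (rule tendstoI)
  fix e :: real assume "e > 0"
  obtain d where d: "d > 0" "cube n x d \<subseteq> U" "\<And>y. y \<in> cube n x d \<Longrightarrow> \<bar>f y - f x\<bar> < e"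
    using continuous_on_cube[OF assms(1-3) \<open>e > 0\<close>] by blast
  have "\<forall>\<^sub>F t in nhds (x i). x(i := t) \<in> cube n x d"
    by (rule eventually_line[OF openin_cube cube_center[OF openin_Rn_mem[OF assms(1,3)] d(1)] assms(4)])
  then have "\<forall>\<^sub>F t in at (x i). x(i := t) \<in> cube n x d"
    by (simp add: eventually_nhds_conv_at)
  then show "\<forall>\<^sub>F t in at (x i). dist (f (x(i := t))) (f x) < e"
    by eventually_elim (use d(3) in \<open>simp add: dist_real_def\<close>)
qed

text \<open>Smoothness of the inverse matrix is read off from the resolvent identity
  \<open>B(y') - B(y) = - B(y') (A(y') - A(y)) B(y)\<close>, so no determinants are needed.\<close>

lemma Ck_on_inverse_matrix:
  assumes U: "openin (Euclidean_space n) U"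
    and A: "\<And>s t k. s < d \<Longrightarrow> t < d \<Longrightarrow> Ck_on k n U (A s t)"
    and res: "\<And>y y' r i. \<lbrakk>y \<in> U; y' \<in> U; r < d; i < d\<rbrakk> \<Longrightarrow>
      B r i y' - B r i y = - (\<Sum>s<d. \<Sum>t<d. B r s y' * (A s t y' - A s t y) * B t i y)"
    and bd: "\<And>y r i. \<lbrakk>y \<in> U; r < d; i < d\<rbrakk> \<Longrightarrow> \<bar>B r i y\<bar> \<le> C"
    and ri: "r < d" "i < d"
  shows "Ck_on k n U (B r i)"
  using ri
proof (induction k arbitrary: r i)
  have cont: "continuous_on U (B r i)" if "r < d" "i < d" for r i
    unfolding continuous_on_def
  proof
    fix y assume y: "y \<in> U"
    have "((\<lambda>y'. B r i y' - B r i y) \<longlongrightarrow> 0) (at y within U)"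
    proof (rule Lim_null_comparison)
      show "\<forall>\<^sub>F y' in at y within U. norm (B r i y' - B r i y) \<le> (\<Sum>s<d. \<Sum>t<d. C * \<bar>A s t y' - A s t y\<bar> * C)"
      proof (rule eventually_at_filter[THEN iffD2, OF always_eventually], intro allI impI)
        fix y' assume y': "y' \<in> U"
        have "norm (B r i y' - B r i y) = \<bar>\<Sum>s<d. \<Sum>t<d. B r s y' * (A s t y' - A s t y) * B t i y\<bar>"
          using res[OF y y' that] by simp
        also have "\<dots> \<le> (\<Sum>s<d. \<bar>\<Sum>t<d. B r s y' * (A s t y' - A s t y) * B t i y\<bar>)" by (rule sum_abs)
        also have "\<dots> \<le> (\<Sum>s<d. \<Sum>t<d. \<bar>B r s y' * (A s t y' - A s t y) * B t i y\<bar>)"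
          by (intro sum_mono sum_abs)
        also have "\<dots> \<le> (\<Sum>s<d. \<Sum>t<d. C * \<bar>A s t y' - A s t y\<bar> * C)"
          unfolding abs_mult using bd[OF y'] bd[OF y] that order_trans[OF abs_ge_zero bd[OF y that]]
          by (intro sum_mono mult_mono) auto
        finally show "norm (B r i y' - B r i y) \<le> (\<Sum>s<d. \<Sum>t<d. C * \<bar>A s t y' - A s t y\<bar> * C)" .
      qed
      have "((\<lambda>y'. A s t y') \<longlongrightarrow> A s t y) (at y within U)" if "s < d" "t < d" for s t
        using Ck_on_continuous[OF U A[OF that, of 0]] y by (simp add: continuous_on_def)
      then have "((\<lambda>y'. \<Sum>s<d. \<Sum>t<d. C * \<bar>A s t y' - A s t y\<bar> * C) \<longlongrightarrow>
        (\<Sum>s<d. \<Sum>t<d. C * \<bar>A s t y - A s t y\<bar> * C)) (at y within U)"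
        by (intro tendsto_intros) auto
      then show "((\<lambda>y'. \<Sum>s<d. \<Sum>t<d. C * \<bar>A s t y' - A s t y\<bar> * C) \<longlongrightarrow> 0) (at y within U)"
        by simp
    qed
    then show "(B r i \<longlongrightarrow> B r i y) (at y within U)" by (rule Lim_null[THEN iffD2])
  qed
  case 0
  then show ?case unfolding Ck_on_0[OF U] by (rule cont)
next
  case (Suc k)
  have cont: "continuous_on U (B r i)" if "r < d" "i < d" for r i
    using Suc.IH[OF that] by (rule Ck_on_continuous[OF U])
  define B' where "B' l y = - (\<Sum>s<d. \<Sum>t<d. B r s y * part_deriv l (A s t) y * B t i y)" for l y
  show ?case
  proof (rule Ck_on_SucI[OF U cont[OF Suc.prems], where f'=B'])
    fix l y assume l: "l < n" and y: "y \<in> U"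
    define q where "q s t \<tau> = (A s t (y(l := \<tau>)) - A s t y) / (\<tau> - y l)" for s t \<tau>
    have q: "(q s t \<longlongrightarrow> part_deriv l (A s t) y) (at (y l))" if "s < d" "t < d" for s t
      using partially_diffD[OF Ck_on_SucD(2)[OF U A[OF that, of "Suc 0"]] l y]
      by (simp add: q_def[abs_def] has_field_derivative_iff)
    have "((\<lambda>\<tau>. - (\<Sum>s<d. \<Sum>t<d. B r s (y(l := \<tau>)) * q s t \<tau> * B t i y)) \<longlongrightarrow> B' l y) (at (y l))"
      unfolding B'_def using Suc.prems
      by (intro tendsto_intros q tendsto_line[OF U cont y l]) auto
    moreover have "\<forall>\<^sub>F \<tau> in at (y l). - (\<Sum>s<d. \<Sum>t<d. B r s (y(l := \<tau>)) * q s t \<tau> * B t i y)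
       = (B r i (y(l := \<tau>)) - B r i (y(l := y l))) / (\<tau> - y l)"
      using eventually_line[OF U y l, THEN eventually_nhds_conv_at[THEN iffD1, THEN conjunct1]]
    proof eventually_elim
      case (elim \<tau>)
      have "(B r i (y(l := \<tau>)) - B r i y) / (\<tau> - y l) =
        - (\<Sum>s<d. \<Sum>t<d. B r s (y(l := \<tau>)) * (A s t (y(l := \<tau>)) - A s t y) * B t i y) / (\<tau> - y l)"
        using res[OF y elim Suc.prems] by simp
      also have "\<dots> = - (\<Sum>s<d. \<Sum>t<d. B r s (y(l := \<tau>)) * q s t \<tau> * B t i y)"
        by (simp add: q_def sum_divide_distrib)
      finally show ?case by simp
    qed
    ultimately show "((\<lambda>\<tau>. B r i (y(l := \<tau>))) has_field_derivative B' l y) (at (y l))"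
      unfolding has_field_derivative_iff by (rule Lim_transform_eventually)
  next
    fix l assume l: "l < n"
    show "Ck_on k n U (B' l)" unfolding B'_def
      using Suc.prems l by (intro Ck_on_minus[OF U] Ck_on_sum[OF U] Ck_on_mult[OF U] Suc.IH
          Ck_on_SucD(3)[OF U A]) auto
  qed
qed

text \<open>Injectivity near x comes from expansion, and openness of the image from invariance of
  domain. By the same expansion the inverse G is Lipschitz. Its partial derivatives are the entries
  of the inverse Jacobian at \<open>G b\<close>, so smoothness follows by bootstrapping: if G is of
  class k, so are these entries along G, and G is of class \<open>Suc k\<close>.\<close>

theorem smooth_inverse_function:
  assumes U: "openin (Euclidean_space n) U" and x: "x \<in> U" and F: "smooth_map n U n F"
    and inj: "\<And>v. v \<in> Rn n \<Longrightarrow> jacobian n n F x v = 0 \<Longrightarrow> v = 0"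
  obtains W G where "openin (Euclidean_space n) W" "x \<in> W" "W \<subseteq> U" "openin (Euclidean_space n) (F ` W)"
    "smooth_map n (F ` W) n G" "\<And>y. y \<in> W \<Longrightarrow> G (F y) = y"
proof -
  define J where "J y = jacobian n n F y" for y
  have J: "linear (J y)" "J y v \<in> Rn n" for y v
    by (simp_all only: J_def linear_jacobian jacobian_Rn)
  obtain X0 where X0: "linear X0" "\<And>v. v \<in> Rn n \<Longrightarrow> X0 (J x v) = v"
    using linear_Rn_inverse[OF J(1), of x n] J(2) inj unfolding J_def by (metis image_subsetI)
  obtain C where C: "C > 0" "\<And>v. v \<in> Rn n \<Longrightarrow> nrm n (X0 v) \<le> C * nrm n v"
    using linear_Rn_bound[OF X0(1)] by blast
  have "nrm n v \<le> C * nrm n (jacobian n n F x v)" if "v \<in> Rn n" for v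
    using C(2)[OF J(2)[of x v]] X0(2)[OF that] by (simp add: J_def)
  then obtain d where d: "d > 0" "cube n x d \<subseteq> U"
    and exp: "\<And>y z. y \<in> cube n x d \<Longrightarrow> z \<in> cube n x d \<Longrightarrow> nrm n (y - z) \<le> 2 * C * nrm n (F y - F z)"
    using smooth_map_expanding[OF U F x C(1)] by auto
  define W where "W = cube n x d"
  have W: "openin (Euclidean_space n) W" "W \<subseteq> U" by (simp_all add: W_def openin_cube d(2))
  have FW: "smooth_map n W n F" by (rule smooth_map_subset[OF U W F])
  have injW: "inj_on F W"
  proof (rule inj_onI)
    fix y z assume yz: "y \<in> W" "z \<in> W" "F y = F z"
    then have "nrm n (y - z) \<le> 0" using exp[of y z] by (simp add: W_def nrm_def)
    then have "y - z = 0"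
      using nrm_eq_0[of "y - z" n] Rn_diff[of y n z] openin_Rn_mem[OF W(1)] yz nrm_nonneg[of n "y - z"]
      by (metis order_antisym)
    then show "y = z" by simp
  qed
  have open_image: "openin (Euclidean_space n) (F ` W)"
    by (rule invariance_of_domain_Euclidean_space[OF W(1) smooth_map_continuous_map[OF W(1) FW] injW])
  define G where "G = inv_into W F"
  have GF: "G (F y) = y" if "y \<in> W" for y using injW that by (simp add: G_def)
  have GW: "G b \<in> W" "F (G b) = b" if "b \<in> F ` W" for b using that GF by auto
  \<comment> \<open>The expansion constant \<open>2 * C\<close> is doubled by
    \<open>jacobian_expanding\<close>, uniformly over W.\<close>
  have C4: "nrm n v \<le> 2 * (2 * C) * nrm n (J y v)" if "y \<in> W" "v \<in> Rn n" for y v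
    unfolding J_def using C(1) that exp
    by (intro jacobian_expanding[OF W(1) FW]) (auto simp: W_def)
  define P where "P y X \<longleftrightarrow> linear X \<and> range X \<subseteq> Rn n \<and> (\<forall>v\<in>Rn n. X (J y v) = v) \<and> (\<forall>v\<in>Rn n. J y (X v) = v)"
    for y and X :: "(nat \<Rightarrow> real) \<Rightarrow> nat \<Rightarrow> real"
  define X where "X y = (SOME X. P y X)" for y
  have "P y (X y)" if y: "y \<in> W" for y
  proof -
    have "v = 0" if "v \<in> Rn n" "J y v = 0" for v
    proof -
      have "nrm n (0 :: nat \<Rightarrow> real) = 0" by (simp add: nrm_def)
      then have "nrm n v \<le> 0" using C4[OF y that(1)] that(2) by simp
      then show ?thesis using nrm_eq_0[OF that(1)] nrm_nonneg[of n v] by simp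
    qed
    then have "\<exists>X. P y X"
      using linear_Rn_inverse[OF J(1)[of y], of n] J(2) unfolding P_def by (metis image_subsetI)
    then show ?thesis unfolding X_def by (rule someI_ex)
  qed
  then have X: "\<And>y. y \<in> W \<Longrightarrow> linear (X y)" "\<And>y v. y \<in> W \<Longrightarrow> X y v \<in> Rn n"
    "\<And>y v. \<lbrakk>y \<in> W; v \<in> Rn n\<rbrakk> \<Longrightarrow> X y (J y v) = v" "\<And>y v. \<lbrakk>y \<in> W; v \<in> Rn n\<rbrakk> \<Longrightarrow> J y (X y v) = v"
    unfolding P_def by (simp_all add: image_subset_iff)
  have Xb: "nrm n (X y v) \<le> 2 * (2 * C) * nrm n v" if "y \<in> W" "v \<in> Rn n" for y v
    using C4[OF that(1) X(2)[OF that(1), of v]] X(4)[OF that] by simp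
  define A where "A s t y = part_deriv t (\<lambda>y. F y s) y" for s t y
  define B where "B r i y = X y (uvec i) r" for r i y
  have Xe: "X y v r = (\<Sum>s<n. v s * B r s y)" if "y \<in> W" "v \<in> Rn n" for y v r
    using linear_Rn_expansion[OF X(1)[OF that(1)] that(2)] by (simp add: B_def sum_fun_apply)
  have Je: "J y v s = (\<Sum>t<n. A s t y * v t)" if "s < n" for y v s
    using that by (simp add: J_def jacobian_def A_def)
  have BCk: "Ck_on k n W (B r i)" if "r < n" "i < n" for k r i
  proof (rule Ck_on_inverse_matrix[OF W(1) _ _ _ that, where A=A and C="2 * (2 * C)"])
    show "Ck_on k n W (A s t)" if "s < n" "t < n" for s t k
      unfolding A_def[abs_def] using that by (intro part_deriv_Ck[OF W(1) FW])
    show "\<bar>B r i y\<bar> \<le> 2 * (2 * C)" if "y \<in> W" "r < n" "i < n" for y r i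
      using order_trans[OF nrm_coord[OF that(2)] Xb[OF that(1) uvec_Rn[OF that(3)]]]
      by (simp add: B_def nrm_uvec[OF that(3)])
    fix y y' r i assume y: "y \<in> W" and y': "y' \<in> W" and r: "r < n" and i: "i < n"
    let ?u = "X y (uvec i)"
    have u: "?u \<in> Rn n" "J y ?u = uvec i" using X y uvec_Rn[OF i] by auto
    have "B r i y' - B r i y = X y' (J y ?u) r - X y' (J y' ?u) r"
      using u X(3)[OF y' u(1)] by (simp add: B_def)
    also have "\<dots> = (\<Sum>s<n. (J y ?u s - J y' ?u s) * B r s y')"
      by (simp add: Xe[OF y' J(2)] left_diff_distrib sum_subtractf)
    also have "\<dots> = (\<Sum>s<n. - (\<Sum>t<n. B r s y' * (A s t y' - A s t y) * B t i y))"
    proof (rule sum.cong[OF refl])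
      fix s assume "s \<in> {..<n}"
      then have "J y ?u s - J y' ?u s = (\<Sum>t<n. (A s t y - A s t y') * B t i y)"
        by (simp add: Je B_def left_diff_distrib sum_subtractf)
      then have "(J y ?u s - J y' ?u s) * B r s y' = (\<Sum>t<n. (A s t y - A s t y') * B t i y * B r s y')"
        by (simp add: sum_distrib_right)
      also have "\<dots> = - (\<Sum>t<n. B r s y' * (A s t y' - A s t y) * B t i y)"
        unfolding sum_negf[symmetric] by (rule sum.cong) (auto simp: algebra_simps)
      finally show "(J y ?u s - J y' ?u s) * B r s y' = - (\<Sum>t<n. B r s y' * (A s t y' - A s t y) * B t i y)" .
    qed
    finally show "B r i y' - B r i y = - (\<Sum>s<n. \<Sum>t<n. B r s y' * (A s t y' - A s t y) * B t i y)"
      by (simp add: sum_negf)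
  qed
  have GR: "G ` F ` W \<subseteq> Rn n" using GF openin_Rn_subset[OF W(1)] by auto
  have lip: "nrm n (G a - G b) \<le> 2 * C * nrm n (a - b)" if "a \<in> F ` W" "b \<in> F ` W" for a b
    using exp[of "G a" "G b"] GW[OF that(1)] GW[OF that(2)] by (simp add: W_def)
  \<comment> \<open>An exact expansion of G along the i-th axis: the column of the inverse Jacobian,
    plus the negated linearization error \<open>R\<close> of F pulled back by
    \<open>X\<close>.\<close>
  have line: "G (b(i := t)) j - G b j = (t - b i) * B j i (G b) + X (G b) R j \<and>
      nrm n (G (b(i := t)) - G b) \<le> 2 * C * \<bar>t - b i\<bar>"
    if b: "b \<in> F ` W" and bt: "b(i := t) \<in> F ` W" and i: "i < n" and j: "j < n"
      and R: "R = - (F (G (b(i := t))) - F (G b) - J (G b) (G (b(i := t)) - G b))" for b i j t R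
  proof -
    let ?y = "G b" and ?y' = "G (b(i := t))"
    have yW: "?y \<in> W" "?y' \<in> W" using GW b bt by auto
    have d: "?y' - ?y \<in> Rn n" using yW openin_Rn_mem[OF W(1)] Rn_diff by auto
    have eq: "b(i := t) - b = (t - b i) *\<^sub>R uvec i" by (auto simp: uvec_def fun_eq_iff)
    have "J ?y (?y' - ?y) = (t - b i) *\<^sub>R uvec i + R"
      unfolding R GW(2)[OF b] GW(2)[OF bt] eq by simp
    then have "R = J ?y (?y' - ?y) - (t - b i) *\<^sub>R uvec i" by simp
    then have "X ?y R = X ?y (J ?y (?y' - ?y)) - X ?y ((t - b i) *\<^sub>R uvec i)"
      using real_vector.linear_diff[OF X(1)[OF yW(1)]] by simp
    also have "\<dots> = (?y' - ?y) - (t - b i) *\<^sub>R X ?y (uvec i)"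
      using X(3)[OF yW(1) d] real_vector.linear_scale[OF X(1)[OF yW(1)]] by simp
    finally have "X ?y R j = (?y' j - ?y j) - (t - b i) * B j i ?y" by (simp add: B_def)
    moreover have "nrm n (?y' - ?y) \<le> 2 * C * \<bar>t - b i\<bar>"
      using lip[OF bt b] unfolding eq nrm_scale nrm_uvec[OF i] by simp
    ultimately show ?thesis by simp
  qed
  have GCk: "Ck_on k n (F ` W) (\<lambda>b. G b j)" if "j < n" for k j
    using that
  proof (induction k arbitrary: j)
    case 0
    have "continuous_on (F ` W) (\<lambda>b. G b j)"
    proof (rule continuous_onI_cube[OF openin_Rn_subset[OF open_image]])
      fix b and e :: real assume b: "b \<in> F ` W" and e: "e > 0"
      \<comment> \<open>In this cube the l1 distance is below \<open>e / (2 * C)\<close>, and G has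
        Lipschitz constant \<open>2 * C\<close>.\<close>
      define \<delta> where "\<delta> = e / (2 * C * real (Suc n))"
      have \<delta>: "\<delta> > 0" using e C(1) by (simp add: \<delta>_def)
      have "\<bar>G a j - G b j\<bar> < e" if a: "a \<in> F ` W \<inter> cube n b \<delta>" for a
      proof -
        have "nrm n (a - b) \<le> (\<Sum>i<n. \<delta>)" unfolding nrm_def using a
          by (intro sum_mono) (auto simp: cube_def less_imp_le)
        also have "\<dots> < real (Suc n) * \<delta>" using \<delta> by simp
        also have "\<dots> = e / (2 * C)" by (simp add: \<delta>_def del: of_nat_Suc)
        finally have "2 * C * nrm n (a - b) < e" using C(1) by (simp add: field_simps)
        moreover have "\<bar>(G a - G b) j\<bar> \<le> nrm n (G a - G b)" by (rule nrm_coord[OF 0])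
        ultimately show ?thesis using lip[of a b] a b by simp
      qed
      then show "\<exists>d>0. \<forall>a\<in>F ` W \<inter> cube n b d. \<bar>G a j - G b j\<bar> < e" using \<delta> by blast
    qed
    then show ?case unfolding Ck_on_0[OF open_image] .
  next
    case (Suc k)
    show ?case
    proof (rule Ck_on_SucI[OF open_image, where f'="\<lambda>i b. B j i (G b)"])
      show "continuous_on (F ` W) (\<lambda>b. G b j)"
        using Suc.IH[OF Suc.prems] by (rule Ck_on_continuous[OF open_image])
      show "Ck_on k n (F ` W) (\<lambda>b. B j i (G b))" if "i < n" for i
        by (rule Ck_on_compose[OF open_image W(1) BCk[OF Suc.prems that] Suc.IH]) (use GW(1) in auto)
      fix i b assume i: "i < n" and b: "b \<in> F ` W"
      let ?y = "G b"
      have yW: "?y \<in> W" by (rule GW(1)[OF b])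
      have "((\<lambda>t. (G (b(i := t)) j - G b j) / (t - b i)) \<longlongrightarrow> B j i ?y) (at (b i))"
      proof (rule tendstoI)
        fix e :: real assume e: "e > 0"
        \<comment> \<open>The error collects the factor \<open>e'\<close> from F, the Lipschitz
          constant \<open>2 * C\<close> of G and the bound \<open>2 * (2 * C)\<close> of the inverse
          Jacobian; this choice makes the product \<open>e / 2\<close>.\<close>
        define e' where "e' = e / (2 * (2 * (2 * C) * (2 * C)))"
        have e': "e' > 0" using e C(1) by (simp add: e'_def)
        obtain \<delta> where \<delta>: "\<delta> > 0" "\<forall>y\<in>cube n ?y \<delta>. \<forall>z\<in>cube n ?y \<delta>.
          nrm n (F y - F z - J ?y (y - z)) \<le> e' * nrm n (y - z)"
          using smooth_map_strict[OF W(1) FW yW e'] unfolding J_def by auto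
        have "\<forall>\<^sub>F t in at (b i). b(i := t) \<in> F ` W"
          using eventually_line[OF open_image b i] by (simp add: eventually_nhds_conv_at)
        moreover have "\<forall>\<^sub>F t in at (b i). \<bar>t - b i\<bar> < \<delta> / (2 * C)"
          using \<delta>(1) C(1) by (auto simp: eventually_at dist_real_def intro!: exI[of _ "\<delta> / (2 * C)"])
        moreover have "\<forall>\<^sub>F t in at (b i). t \<noteq> b i" by (simp add: eventually_at_filter)
        ultimately show "\<forall>\<^sub>F t in at (b i). dist ((G (b(i := t)) j - G b j) / (t - b i)) (B j i ?y) < e"
        proof eventually_elim
          case (elim t)
          let ?y' = "G (b(i := t))"
          define R where "R = - (F ?y' - F ?y - J ?y (?y' - ?y))"
          note l = line[OF b elim(1) i Suc.prems R_def]
          have y'W: "?y' \<in> W" by (rule GW(1)[OF elim(1)])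
          have "\<bar>?y' r - ?y r\<bar> < \<delta>" if "r < n" for r
          proof -
            have "\<bar>?y' r - ?y r\<bar> \<le> nrm n (?y' - ?y)" using nrm_coord[OF that, of "?y' - ?y"] by simp
            also have "\<dots> \<le> 2 * C * \<bar>t - b i\<bar>" using l by simp
            also have "\<dots> < \<delta>" using elim(2) C(1) by (simp add: field_simps)
            finally show ?thesis .
          qed
          then have y'c: "?y' \<in> cube n ?y \<delta>"
            using openin_Rn_mem[OF W(1) y'W] by (simp add: cube_def)
          have "nrm n R \<le> e' * nrm n (?y' - ?y)"
            using \<delta>(2)[rule_format, OF y'c cube_center[OF openin_Rn_mem[OF W(1) yW] \<delta>(1)]]
            by (simp add: R_def nrm_def abs_minus_commute)
          also have "\<dots> \<le> e' * (2 * C * \<bar>t - b i\<bar>)" using l e' by simp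
          finally have "2 * (2 * C) * nrm n R \<le> 2 * (2 * C) * (e' * (2 * C * \<bar>t - b i\<bar>))"
            using C(1) by (intro mult_left_mono) auto
          moreover have "R \<in> Rn n"
          proof -
            have "F ?y' - F ?y - J ?y (?y' - ?y) \<in> Rn n"
              using smooth_map_mem[OF FW] yW y'W J(2) by (intro Rn_diff) auto
            from Rn_scale[OF this, of "-1"] show ?thesis by (simp add: R_def)
          qed
          ultimately have "\<bar>X ?y R j\<bar> \<le> 2 * (2 * C) * (e' * (2 * C * \<bar>t - b i\<bar>))"
            using Xb[OF yW] nrm_coord[OF Suc.prems, of "X ?y R"] by (meson order_trans)
          also have "\<dots> = e / 2 * \<bar>t - b i\<bar>" using C(1) by (simp add: e'_def)
          finally have "\<bar>X ?y R j\<bar> / \<bar>t - b i\<bar> \<le> e / 2" using elim(3) by (simp add: field_simps)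
          then have "\<bar>X ?y R j\<bar> / \<bar>t - b i\<bar> < e" by (rule le_less_trans) (use e in simp)
          moreover have "(?y' j - ?y j) / (t - b i) - B j i ?y = X ?y R j / (t - b i)"
            using l elim(3) by (simp add: field_simps)
          ultimately show ?case by (simp add: dist_real_def)
        qed
      qed
      then show "((\<lambda>t. G (b(i := t)) j) has_field_derivative B j i (G b)) (at (b i))"
        by (simp add: has_field_derivative_iff)
    qed
  qed
  have "smooth_map n (F ` W) n G"
    by (rule smooth_mapI) (use GR GCk in auto)
  then show ?thesis
    using that[OF W(1) _ W(2) open_image _ GF] cube_center[OF openin_Rn_mem[OF U x] d(1)]
    by (simp add: W_def)
qed

section \<open>The invariant mean of a compact group\<close>

text \<open>The induction of Halmos and Vaughan on the size of A. If every nonempty proper subset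
  has a surplus of neighbours, any edge at a may be fixed and removed. Otherwise some proper X has
  no more neighbours than elements; then X is matched by itself and the rest of A into the
  neighbours outside those of X.\<close>

lemma Hall_matching:
  assumes "finite A" "\<And>a. a \<in> A \<Longrightarrow> finite (N a)"
    and "\<And>X. X \<subseteq> A \<Longrightarrow> card X \<le> card (\<Union>(N ` X))"
  shows "\<exists>\<sigma>. inj_on \<sigma> A \<and> (\<forall>a\<in>A. \<sigma> a \<in> N a)"
  using assms
proof (induction "card A" arbitrary: A N rule: less_induct)
  case less
  note fin = less.prems(1,2) and hall = less.prems(3)
  have finU: "finite (\<Union>(N ` X))" if "X \<subseteq> A" for X
    using that fin finite_subset by blast
  show ?case
  proof (cases "A = {}")
    case False
    then obtain a where a: "a \<in> A" by auto
    show ?thesis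
    proof (cases "\<forall>X. X \<noteq> {} \<and> X \<subset> A \<longrightarrow> card X < card (\<Union>(N ` X))")
      case True
      have "card (\<Union>(N ` {a})) \<noteq> 0" using hall[of "{a}"] a by auto
      then obtain b where b: "b \<in> N a" by (auto simp: card_eq_0_iff)
      define N' where "N' x = N x - {b}" for x
      have "\<exists>\<sigma>. inj_on \<sigma> (A - {a}) \<and> (\<forall>x\<in>A - {a}. \<sigma> x \<in> N' x)"
      proof (rule less.hyps)
        show "card (A - {a}) < card A" by (rule card_Diff1_less[OF fin(1) a])
        fix X assume X: "X \<subseteq> A - {a}"
        have eq: "\<Union>(N' ` X) = \<Union>(N ` X) - {b}" by (auto simp: N'_def)
        show "card X \<le> card (\<Union>(N' ` X))"
        proof (cases "X = {}")
          case False
          then have "card X < card (\<Union>(N ` X))" using True X a by blast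
          then show ?thesis unfolding eq
            using card_Diff1_le[of "\<Union>(N ` X)" b] card_Diff_singleton_if[of "\<Union>(N ` X)" b] by (auto split: if_splits)
        qed simp
      qed (use fin in \<open>auto simp: N'_def\<close>)
      then obtain \<sigma> where \<sigma>: "inj_on \<sigma> (A - {a})" "\<And>x. x \<in> A - {a} \<Longrightarrow> \<sigma> x \<in> N x - {b}"
        by (auto simp: N'_def)
      have "inj_on (\<sigma>(a := b)) A"
        using \<sigma> unfolding inj_on_def by (auto split: if_splits)
      moreover have "\<forall>x\<in>A. (\<sigma>(a := b)) x \<in> N x" using \<sigma>(2) b by auto
      ultimately show ?thesis by blast
    next
      case nt: False
      then obtain X where X: "X \<noteq> {}" "X \<subset> A" "card (\<Union>(N ` X)) \<le> card X" by (auto simp: not_less)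
      have finX: "finite X" using X(2) fin(1) finite_subset by blast
      have "\<exists>\<sigma>. inj_on \<sigma> X \<and> (\<forall>a\<in>X. \<sigma> a \<in> N a)"
        by (rule less.hyps) (use X fin hall finX psubset_card_mono in auto)
      then obtain \<sigma> where \<sigma>: "inj_on \<sigma> X" "\<And>a. a \<in> X \<Longrightarrow> \<sigma> a \<in> N a" by blast
      define N' where "N' y = N y - \<Union>(N ` X)" for y
      have "\<exists>\<tau>. inj_on \<tau> (A - X) \<and> (\<forall>y\<in>A - X. \<tau> y \<in> N' y)"
      proof (rule less.hyps)
        show "card (A - X) < card A"
          using X fin(1) by (intro psubset_card_mono) auto
        fix Y assume Y: "Y \<subseteq> A - X"
        have finY: "finite Y" using Y fin(1) finite_subset by blast
        have sub: "X \<union> Y \<subseteq> A" using X Y by auto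
        have "card X + card Y = card (X \<union> Y)" using Y finX finY by (subst card_Un_disjoint) auto
        also have "\<dots> \<le> card (\<Union>(N ` (X \<union> Y)))" using hall[OF sub] .
        also have "\<Union>(N ` (X \<union> Y)) = \<Union>(N ` X) \<union> \<Union>(N' ` Y)" by (auto simp: N'_def)
        also have "card \<dots> \<le> card (\<Union>(N ` X)) + card (\<Union>(N' ` Y))" by (rule card_Un_le)
        finally show "card Y \<le> card (\<Union>(N' ` Y))" using X(3) by simp
      qed (use fin in \<open>auto simp: N'_def\<close>)
      then obtain \<tau> where \<tau>: "inj_on \<tau> (A - X)" "\<And>y. y \<in> A - X \<Longrightarrow> \<tau> y \<in> N y - \<Union>(N ` X)"
        by (auto simp: N'_def)
      define \<rho> where "\<rho> a = (if a \<in> X then \<sigma> a else \<tau> a)" for a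
      have "inj_on \<rho> A"
      proof (rule inj_onI)
        fix u v assume uv: "u \<in> A" "v \<in> A" "\<rho> u = \<rho> v"
        show "u = v"
        proof (cases "u \<in> X"; cases "v \<in> X")
          assume "u \<in> X" "v \<in> X" then show ?thesis using uv \<sigma>(1) by (auto simp: \<rho>_def inj_on_def)
        next
          assume "u \<notin> X" "v \<notin> X" then show ?thesis using uv \<tau>(1) by (auto simp: \<rho>_def inj_on_def)
        next
          assume "u \<in> X" "v \<notin> X"
          then show ?thesis using uv \<sigma>(2)[of u] \<tau>(2)[of v] by (auto simp: \<rho>_def)
        next
          assume "u \<notin> X" "v \<in> X"
          then show ?thesis using uv \<sigma>(2)[of v] \<tau>(2)[of u] by (auto simp: \<rho>_def)
        qed
      qed
      moreover have "\<forall>a\<in>A. \<rho> a \<in> N a" using \<sigma>(2) \<tau>(2) by (auto simp: \<rho>_def)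
      ultimately show ?thesis by blast
    qed
  qed auto
qed

section \<open>Almost invariant averages on a compact group\<close>

locale compact_group = group K for K (structure) +
  fixes T :: "'a topology"
  assumes topspace: "topspace T = carrier K"
    and compact: "compact_space T"
    and cont_mult: "continuous_map (prod_topology T T) T (\<lambda>(a, b). a \<otimes> b)"
    and cont_inv: "continuous_map T T (\<lambda>a. inv a)"
begin

text \<open>Averages over coverings of minimal cardinality are almost invariant: a translate of such a
  covering is again minimal, and Hall's theorem matches the points of two minimal coverings so that
  matched points are close. The invariant mean is a cluster point of these averages.\<close>

definition covering :: "'a set \<Rightarrow> 'a set \<Rightarrow> bool"
  where "covering U A \<longleftrightarrow> finite A \<and> A \<subseteq> carrier K \<and> (\<forall>k\<in>carrier K. \<exists>a\<in>A. k \<otimes> inv a \<in> U)"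

definition minimal_covering :: "'a set \<Rightarrow> 'a set \<Rightarrow> bool"
  where "minimal_covering U A \<longleftrightarrow> covering U A \<and> (\<forall>B. covering U B \<longrightarrow> card A \<le> card B)"

definition average :: "'a set \<Rightarrow> ('a \<Rightarrow> real) \<Rightarrow> real"
  where "average A f = (\<Sum>a\<in>A. f a) / card A"

lemma cont_mult_right: "h \<in> carrier K \<Longrightarrow> continuous_map T T (\<lambda>k. k \<otimes> h)"
  using continuous_map_compose[OF continuous_map_pairedI[OF continuous_map_id continuous_map_const[THEN iffD2]] cont_mult, of h]
  by (simp add: topspace o_def)

text \<open>Translates of the open set U cover the group, compactness leaves finitely many of them,
  and among the finite coverings one has least cardinality.\<close>

lemma ex_minimal_covering:
  assumes "openin T U" "\<one> \<in> U"
  obtains A where "minimal_covering U A"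
proof -
  define \<U> where "\<U> = (\<lambda>a. {k \<in> topspace T. k \<otimes> inv a \<in> U}) ` carrier K"
  have "\<forall>V\<in>\<U>. openin T V"
    unfolding \<U>_def using openin_continuous_map_preimage[OF cont_mult_right assms(1)] by auto
  moreover have "topspace T \<subseteq> \<Union>\<U>"
    using assms(2) by (auto simp: \<U>_def topspace)
  ultimately obtain \<F> where \<F>: "finite \<F>" "\<F> \<subseteq> \<U>" "topspace T \<subseteq> \<Union>\<F>"
    using compact unfolding compact_space_alt by metis
  then obtain A where A: "A \<subseteq> carrier K" "finite A" "\<F> = (\<lambda>a. {k \<in> topspace T. k \<otimes> inv a \<in> U}) ` A"
    using finite_subset_image[OF \<F>(1) \<F>(2)[unfolded \<U>_def]] by auto
  have "\<exists>a\<in>A. k \<otimes> inv a \<in> U" if "k \<in> carrier K" for k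
  proof -
    have "k \<in> \<Union>\<F>" using \<F>(3) that topspace by auto
    then show ?thesis using A(3) by auto
  qed
  then have "covering U A" unfolding covering_def using A(1,2) by simp
  then obtain B where "covering U B" "\<And>B'. covering U B' \<Longrightarrow> card B \<le> card B'"
    using ex_has_least_nat[of "covering U" A card] by blast
  then show ?thesis using that by (auto simp: minimal_covering_def)
qed

lemma minimal_covering_translate:
  assumes A: "minimal_covering U A" and h: "h \<in> carrier K"
  shows "minimal_covering U ((\<lambda>a. a \<otimes> h) ` A)" "inj_on (\<lambda>a. a \<otimes> h) A"
proof -
  have cA: "finite A" "A \<subseteq> carrier K" "\<And>k. k \<in> carrier K \<Longrightarrow> \<exists>a\<in>A. k \<otimes> inv a \<in> U"
    using A by (auto simp: minimal_covering_def covering_def)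
  show inj: "inj_on (\<lambda>a. a \<otimes> h) A" using cA(2) h right_cancel by (auto intro!: inj_onI simp: subset_iff)
  have "covering U ((\<lambda>a. a \<otimes> h) ` A)"
    unfolding covering_def
  proof (intro conjI ballI)
    fix k assume k: "k \<in> carrier K"
    then obtain a where a: "a \<in> A" "(k \<otimes> inv h) \<otimes> inv a \<in> U" using cA(3)[of "k \<otimes> inv h"] h by auto
    have "k \<otimes> inv (a \<otimes> h) = (k \<otimes> inv h) \<otimes> inv a"
      using a(1) cA(2) h k by (auto simp: inv_mult_group m_assoc)
    then show "\<exists>a\<in>(\<lambda>a. a \<otimes> h) ` A. k \<otimes> inv a \<in> U"
      using a by (intro bexI[of _ "a \<otimes> h"]) simp_all
  qed (use cA h in auto)
  then show "minimal_covering U ((\<lambda>a. a \<otimes> h) ` A)"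
    using A by (auto simp: minimal_covering_def card_image[OF inj])
qed

text \<open>Call a and b neighbours if some k is U-close to both. For X in A, exchanging X for its
  neighbours in B again gives a covering: a k served by a point of X is also served by some b in B,
  which is then a neighbour of that point. Minimality of A turns this into Hall's
  inequality.\<close>

lemma minimal_covering_matching:
  assumes A: "minimal_covering U A" and B: "minimal_covering U B"
  obtains \<sigma> where "bij_betw \<sigma> A B"
    "\<And>a. a \<in> A \<Longrightarrow> \<exists>k\<in>carrier K. k \<otimes> inv a \<in> U \<and> k \<otimes> inv (\<sigma> a) \<in> U"
proof -
  have cA: "finite A" "A \<subseteq> carrier K" "\<And>k. k \<in> carrier K \<Longrightarrow> \<exists>a\<in>A. k \<otimes> inv a \<in> U"
    and cB: "finite B" "B \<subseteq> carrier K" "\<And>k. k \<in> carrier K \<Longrightarrow> \<exists>a\<in>B. k \<otimes> inv a \<in> U"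
    using A B by (auto simp: minimal_covering_def covering_def)
  have cAB: "card A = card B"
    using A B by (auto simp: minimal_covering_def intro: antisym)
  define N where "N a = {b \<in> B. \<exists>k\<in>carrier K. k \<otimes> inv a \<in> U \<and> k \<otimes> inv b \<in> U}" for a
  have "\<exists>\<sigma>. inj_on \<sigma> A \<and> (\<forall>a\<in>A. \<sigma> a \<in> N a)"
  proof (rule Hall_matching[OF cA(1)])
    show "finite (N a)" for a using cB(1) by (simp add: N_def)
    fix X assume X: "X \<subseteq> A"
    have finX: "finite X" using X cA(1) finite_subset by blast
    have finN: "finite (\<Union>(N ` X))" using finX cB(1) by (auto simp: N_def)
    have "covering U ((A - X) \<union> \<Union>(N ` X))"
      unfolding covering_def
    proof (intro conjI ballI)
      fix k assume k: "k \<in> carrier K"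
      then obtain a where a: "a \<in> A" "k \<otimes> inv a \<in> U" using cA(3) by blast
      obtain b where b: "b \<in> B" "k \<otimes> inv b \<in> U" using cB(3) k by blast
      show "\<exists>a\<in>A - X \<union> \<Union> (N ` X). k \<otimes> inv a \<in> U"
        using a b k by (cases "a \<in> X") (auto simp: N_def)
    qed (use cA cB finN in \<open>auto simp: N_def\<close>)
    then have "card A \<le> card ((A - X) \<union> \<Union>(N ` X))" using A by (auto simp: minimal_covering_def)
    also have "\<dots> \<le> card (A - X) + card (\<Union>(N ` X))" by (rule card_Un_le)
    also have "card (A - X) = card A - card X" using X finX by (simp add: card_Diff_subset)
    finally show "card X \<le> card (\<Union>(N ` X))" using card_mono[OF cA(1) X] by linarith
  qed
  then obtain \<sigma> where \<sigma>: "inj_on \<sigma> A" "\<And>a. a \<in> A \<Longrightarrow> \<sigma> a \<in> N a" by blast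
  have "\<sigma> ` A \<subseteq> B" using \<sigma>(2) by (auto simp: N_def)
  then have "\<sigma> ` A = B" using card_image[OF \<sigma>(1)] cAB cB(1) card_subset_eq by metis
  then show ?thesis using that[of \<sigma>] \<sigma> by (auto simp: bij_betw_def N_def)
qed

text \<open>The tube lemma at the unit pair against the compact group gives a neighbourhood that
  works for all a at once. The factor \<open>inv v \<otimes> u\<close> is the shape in which matched
  points differ.\<close>

lemma uniform_nbhd:
  assumes f: "continuous_map T euclideanreal f" and e: "e > 0"
  obtains U where "openin T U" "\<one> \<in> U"
    "\<And>u v a. \<lbrakk>u \<in> U; v \<in> U; a \<in> carrier K\<rbrakk> \<Longrightarrow> \<bar>f ((inv v \<otimes> u) \<otimes> a) - f a\<bar> \<le> e"
proof -
  let ?P = "prod_topology (prod_topology T T) T"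
  have "continuous_map ?P T (\<lambda>p. snd (fst p))"
    using continuous_map_compose[OF continuous_map_fst continuous_map_snd] by (simp add: o_def)
  from continuous_map_compose[OF this cont_inv]
  have "continuous_map ?P T (\<lambda>p. inv (snd (fst p)))" by (simp add: o_def)
  moreover have "continuous_map ?P T (\<lambda>p. fst (fst p))" "continuous_map ?P T snd"
    using continuous_map_compose[OF continuous_map_fst continuous_map_fst]
    by (simp_all add: o_def continuous_map_snd)
  ultimately have "continuous_map ?P T (\<lambda>p. (inv (snd (fst p)) \<otimes> fst (fst p)) \<otimes> snd p)"
    using continuous_map_compose[OF continuous_map_pairedI cont_mult, unfolded o_def case_prod_conv] by blast
  then have "continuous_map ?P euclideanreal (\<lambda>p. f ((inv (snd (fst p)) \<otimes> fst (fst p)) \<otimes> snd p))"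
    using continuous_map_compose[OF _ f] by (auto simp: o_def)
  moreover have "continuous_map ?P euclideanreal (\<lambda>p. f (snd p))"
    using continuous_map_compose[OF continuous_map_snd f] by (auto simp: o_def)
  ultimately have c: "continuous_map ?P euclideanreal (\<lambda>p. \<bar>f ((inv (snd (fst p)) \<otimes> fst (fst p)) \<otimes> snd p) - f (snd p)\<bar>)"
    by (intro continuous_map_real_abs continuous_map_diff)
  have "openin ?P {p \<in> topspace ?P. \<bar>f ((inv (snd (fst p)) \<otimes> fst (fst p)) \<otimes> snd p) - f (snd p)\<bar> \<in> {..<e}}"
    by (rule openin_continuous_map_preimage[OF c]) auto
  moreover have "{(\<one>, \<one>)} \<times> carrier K \<subseteq> {p \<in> topspace ?P. \<bar>f ((inv (snd (fst p)) \<otimes> fst (fst p)) \<otimes> snd p) - f (snd p)\<bar> \<in> {..<e}}"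
    using e by (auto simp: topspace)
  moreover have "compactin T (carrier K)" using compact by (simp add: compact_space_def topspace)
  ultimately have "\<exists>W V. openin (prod_topology T T) W \<and> openin T V \<and> (\<one>, \<one>) \<in> W \<and> carrier K \<subseteq> V \<and>
    W \<times> V \<subseteq> {p \<in> topspace ?P. \<bar>f ((inv (snd (fst p)) \<otimes> fst (fst p)) \<otimes> snd p) - f (snd p)\<bar> \<in> {..<e}}"
    by (intro tube_lemma_right) (simp_all add: topspace)
  then obtain W V where W: "openin (prod_topology T T) W" "(\<one>, \<one>) \<in> W" "carrier K \<subseteq> V"
    "W \<times> V \<subseteq> {p \<in> topspace ?P. \<bar>f ((inv (snd (fst p)) \<otimes> fst (fst p)) \<otimes> snd p) - f (snd p)\<bar> \<in> {..<e}}"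
    by (elim exE conjE) (rule that)
  then obtain U1 U2 where U: "openin T U1" "openin T U2" "\<one> \<in> U1" "\<one> \<in> U2" "U1 \<times> U2 \<subseteq> W"
    unfolding openin_prod_topology_alt by meson
  have "\<bar>f ((inv v \<otimes> u) \<otimes> a) - f a\<bar> \<le> e" if "u \<in> U1 \<inter> U2" "v \<in> U1 \<inter> U2" "a \<in> carrier K" for u v a
  proof -
    have "((u, v), a) \<in> W \<times> V" using that U(5) W(3) by auto
    with W(4) show ?thesis by auto
  qed
  then show ?thesis using that[of "U1 \<inter> U2"] U by blast
qed

text \<open>Matched points satisfy \<open>\<sigma> a = (inv v \<otimes> u) \<otimes> a\<close> with
  \<open>u = k \<otimes> inv a\<close> and \<open>v = k \<otimes> inv (\<sigma> a)\<close> both in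
  U. Replacing the translated covering by A therefore changes each summand by at most e.\<close>

lemma average_almost_invariant:
  assumes A: "minimal_covering U A" and U: "U \<subseteq> carrier K"
    and f: "\<And>u v a. \<lbrakk>u \<in> U; v \<in> U; a \<in> carrier K\<rbrakk> \<Longrightarrow> \<bar>f ((inv v \<otimes> u) \<otimes> a) - f a\<bar> \<le> e"
    and h: "h \<in> carrier K"
  shows "\<bar>average A (\<lambda>k. f (k \<otimes> h)) - average A f\<bar> \<le> e"
proof -
  let ?B = "(\<lambda>a. a \<otimes> h) ` A"
  note B = minimal_covering_translate[OF A h]
  have AK: "A \<subseteq> carrier K" "finite A" "A \<noteq> {}"
    using A by (auto simp: minimal_covering_def covering_def)
  obtain \<sigma> where \<sigma>: "bij_betw \<sigma> A ?B"
    "\<And>a. a \<in> A \<Longrightarrow> \<exists>k\<in>carrier K. k \<otimes> inv a \<in> U \<and> k \<otimes> inv (\<sigma> a) \<in> U"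
    using minimal_covering_matching[OF A B(1)] by blast
  have "(\<Sum>a\<in>A. f (a \<otimes> h)) = sum f ?B" by (simp add: sum.reindex[OF B(2)])
  also have "\<dots> = (\<Sum>a\<in>A. f (\<sigma> a))" by (rule sum.reindex_bij_betw[OF \<sigma>(1), symmetric])
  finally have "(\<Sum>a\<in>A. f (a \<otimes> h)) - (\<Sum>a\<in>A. f a) = (\<Sum>a\<in>A. f (\<sigma> a) - f a)"
    by (simp add: sum_subtractf)
  also have "\<bar>\<dots>\<bar> \<le> (\<Sum>a\<in>A. e)"
  proof (rule order_trans[OF sum_abs sum_mono])
    fix a assume a: "a \<in> A"
    then obtain k where k: "k \<in> carrier K" "k \<otimes> inv a \<in> U" "k \<otimes> inv (\<sigma> a) \<in> U" using \<sigma>(2) by blast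
    have "\<sigma> a \<in> ?B" using a \<sigma>(1) by (auto simp: bij_betw_def)
    then have aK: "a \<in> carrier K" "\<sigma> a \<in> carrier K" using a AK(1) h by auto
    have "inv (k \<otimes> inv (\<sigma> a)) \<otimes> (k \<otimes> inv a) \<otimes> a = \<sigma> a"
      using aK k(1) by (simp add: inv_mult_group m_assoc)
    then show "\<bar>f (\<sigma> a) - f a\<bar> \<le> e" using f[OF k(2,3) aK(1)] by simp
  qed
  finally have "\<bar>(\<Sum>a\<in>A. f (a \<otimes> h)) - (\<Sum>a\<in>A. f a)\<bar> \<le> card A * e" by simp
  then have "\<bar>(\<Sum>a\<in>A. f (a \<otimes> h)) - (\<Sum>a\<in>A. f a)\<bar> / card A \<le> e"
    using AK by (simp add: divide_le_eq mult.commute card_gt_0_iff)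
  moreover have "average A (\<lambda>k. f (k \<otimes> h)) - average A f = ((\<Sum>a\<in>A. f (a \<otimes> h)) - (\<Sum>a\<in>A. f a)) / card A"
    by (simp add: average_def diff_divide_distrib)
  ultimately show ?thesis by simp
qed

end

section \<open>Positive means and the existence of an invariant one\<close>

definition positive_mean :: "'a topology \<Rightarrow> (('a \<Rightarrow> real) \<Rightarrow> real) \<Rightarrow> bool"
  where "positive_mean T M \<longleftrightarrow>
    (\<forall>f g. continuous_map T euclideanreal f \<longrightarrow> continuous_map T euclideanreal g \<longrightarrow>
       M (\<lambda>k. f k + g k) = M f + M g) \<and>
    (\<forall>c f. continuous_map T euclideanreal f \<longrightarrow> M (\<lambda>k. c * f k) = c * M f) \<and>
    (\<forall>f. continuous_map T euclideanreal f \<longrightarrow> (\<forall>k\<in>topspace T. 0 \<le> f k) \<longrightarrow> 0 \<le> M f) \<and>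
    M (\<lambda>k. 1) = 1"

text \<open>The functionals bounded by \<open>b f\<close> at each continuous f form a compact
  product. Linearity, positivity and normalization are closed conditions (\<open>E\<close>), and so
  is almost invariance for one function, one translation and one tolerance (\<open>V\<close>).
  Averages over minimal coverings meet any finitely many of these conditions, so by compactness one
  functional meets all.\<close>

lemma (in compact_group) invariant_mean:
  obtains M where "positive_mean T M"
    "\<And>f h. continuous_map T euclideanreal f \<Longrightarrow> h \<in> carrier K \<Longrightarrow> M (\<lambda>k. f (k \<otimes> h)) = M f"
proof -
  define C where "C = {f. continuous_map T euclideanreal f}"
  have "\<exists>b. \<forall>f\<in>C. \<forall>k\<in>carrier K. \<bar>f k\<bar> \<le> b f"
  proof (rule bchoice, rule ballI)
    fix f assume "f \<in> C"
    then have "compactin euclideanreal (f ` topspace T)"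
      using compact by (intro image_compactin[of T]) (auto simp: C_def compact_space_def)
    then have "bounded (f ` topspace T)" by (simp add: compact_imp_bounded)
    then show "\<exists>b. \<forall>k\<in>carrier K. \<bar>f k\<bar> \<le> b" by (auto simp: bounded_iff topspace)
  qed
  then obtain b where b: "\<And>f k. f \<in> C \<Longrightarrow> k \<in> carrier K \<Longrightarrow> \<bar>f k\<bar> \<le> b f" by blast
  have C_add: "(\<lambda>k. f k + g k) \<in> C" if "f \<in> C" "g \<in> C" for f g
    using that by (simp add: C_def continuous_map_add)
  have C_scale: "(\<lambda>k. c * f k) \<in> C" if "f \<in> C" for f c
    using that by (simp add: C_def continuous_map_real_mult_left)
  have C_one: "(\<lambda>k. 1) \<in> C" by (simp add: C_def)
  have C_trans: "(\<lambda>k. f (k \<otimes> h)) \<in> C" if "f \<in> C" "h \<in> carrier K" for f h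
    using continuous_map_compose[OF cont_mult_right[OF that(2)], of euclideanreal f] that(1)
    by (simp add: C_def o_def)
  \<comment> \<open>Discontinuous functions receive a one-point interval, which keeps the product
    over all functions compact.\<close>
  define I where "I f = (if f \<in> C then {- b f..b f} else {0})" for f
  define \<Omega> where "\<Omega> = {m::('a \<Rightarrow> real) \<Rightarrow> real. \<forall>f. m f \<in> I f}"
  have "compactin (product_topology (\<lambda>f. euclideanreal) UNIV) (\<Pi>\<^sub>E f\<in>UNIV. I f)"
    unfolding compactin_PiE by (auto simp: I_def)
  moreover have "(\<Pi>\<^sub>E f\<in>UNIV. I f) = \<Omega>" by (auto simp: \<Omega>_def)
  ultimately have "compact \<Omega>" by (simp add: euclidean_product_topology)
  define E where "E = {m. (\<forall>f\<in>C. \<forall>g\<in>C. m (\<lambda>k. f k + g k) = m f + m g) \<and>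
    (\<forall>c. \<forall>f\<in>C. m (\<lambda>k. c * f k) = c * m f) \<and>
    (\<forall>f\<in>C. (\<forall>k\<in>topspace T. 0 \<le> f k) \<longrightarrow> 0 \<le> m f) \<and> m (\<lambda>k. 1) = 1}"
  have cc: "continuous_on UNIV (\<lambda>m::('a \<Rightarrow> real) \<Rightarrow> real. m f)" for f
    by (rule continuous_on_product_coordinates)
  have "closed E"
    unfolding E_def Ball_def by (intro closed_Collect_conj closed_Collect_all closed_Collect_imp
      open_Collect_const closed_Collect_eq closed_Collect_le continuous_intros cc)
  then have comp: "compact (\<Omega> \<inter> E)" using \<open>compact \<Omega>\<close> by (simp add: compact_Int_closed)
  define Z where "Z = {(f, h, e). f \<in> C \<and> h \<in> carrier K \<and> e > (0::real)}"
  define V where "V = (\<lambda>(f, h, e). {m::('a \<Rightarrow> real) \<Rightarrow> real. \<bar>m (\<lambda>k. f (k \<otimes> h)) - m f\<bar> \<le> e})"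
  have "(\<Omega> \<inter> E) \<inter> (\<Inter>z\<in>Z. V z) \<noteq> {}"
  proof (rule compact_imp_fip_image[OF comp])
    show "closed (V z)" for z
      unfolding V_def by (cases z) (auto intro!: closed_Collect_le continuous_intros cc)
    fix Z' assume Z': "finite Z'" "Z' \<subseteq> Z"
    have "\<exists>U. \<forall>z\<in>Z'. openin T (U z) \<and> \<one> \<in> U z \<and>
        (\<forall>u\<in>U z. \<forall>v\<in>U z. \<forall>a\<in>carrier K. \<bar>fst z ((inv v \<otimes> u) \<otimes> a) - fst z a\<bar> \<le> snd (snd z))"
    proof (rule bchoice, rule ballI)
      fix z assume "z \<in> Z'"
      then have "continuous_map T euclideanreal (fst z)" "snd (snd z) > 0"
        using Z'(2) by (auto simp: Z_def C_def)
      from uniform_nbhd[OF this]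
      show "\<exists>U. openin T U \<and> \<one> \<in> U \<and>
        (\<forall>u\<in>U. \<forall>v\<in>U. \<forall>a\<in>carrier K. \<bar>fst z ((inv v \<otimes> u) \<otimes> a) - fst z a\<bar> \<le> snd (snd z))" by metis
    qed
    then obtain U where "\<forall>z\<in>Z'. openin T (U z) \<and> \<one> \<in> U z \<and>
        (\<forall>u\<in>U z. \<forall>v\<in>U z. \<forall>a\<in>carrier K. \<bar>fst z ((inv v \<otimes> u) \<otimes> a) - fst z a\<bar> \<le> snd (snd z))"
      by (rule exE)
    then have U: "\<And>z. z \<in> Z' \<Longrightarrow> openin T (U z)" "\<And>z. z \<in> Z' \<Longrightarrow> \<one> \<in> U z"
      "\<And>z u v a. \<lbrakk>z \<in> Z'; u \<in> U z; v \<in> U z; a \<in> carrier K\<rbrakk> \<Longrightarrow>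
         \<bar>fst z ((inv v \<otimes> u) \<otimes> a) - fst z a\<bar> \<le> snd (snd z)"
      by simp_all
    \<comment> \<open>Including \<open>topspace T\<close> gives an open subset of the group also
      when \<open>Z'\<close> is empty.\<close>
    define U0 where "U0 = topspace T \<inter> (\<Inter>z\<in>Z'. U z)"
    have "openin T U0"
    proof (cases "Z' = {}")
      case False
      have "openin T (\<Inter>z\<in>Z'. U z)" using Z'(1) False U(1) by (intro openin_Inter) auto
      then show ?thesis unfolding U0_def by (intro openin_Int) auto
    qed (simp add: U0_def)
    moreover have "\<one> \<in> U0" using U(2) by (auto simp: U0_def topspace)
    ultimately obtain A where A: "minimal_covering U0 A" by (rule ex_minimal_covering)
    have AK: "A \<subseteq> carrier K" "finite A" "A \<noteq> {}"
      using A by (auto simp: minimal_covering_def covering_def)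
    define m where "m f = (if f \<in> C then average A f else 0)" for f
    have "\<bar>average A f\<bar> \<le> b f" if "f \<in> C" for f
    proof -
      have "\<bar>\<Sum>a\<in>A. f a\<bar> \<le> (\<Sum>a\<in>A. b f)"
        by (rule order_trans[OF sum_abs sum_mono]) (use b[OF that] AK in auto)
      then show ?thesis using AK by (simp add: average_def divide_le_eq mult.commute card_gt_0_iff)
    qed
    then have "m \<in> \<Omega>" by (fastforce simp: \<Omega>_def m_def I_def abs_le_iff)
    moreover have "m \<in> E"
      unfolding E_def mem_Collect_eq
    proof (intro conjI ballI allI impI)
      show "m (\<lambda>k. f k + g k) = m f + m g" if "f \<in> C" "g \<in> C" for f g
        using that by (simp add: m_def C_add average_def sum.distrib add_divide_distrib)
      show "m (\<lambda>k. c * f k) = c * m f" if "f \<in> C" for c f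
        using that by (simp add: m_def C_scale average_def flip: sum_distrib_left)
      show "0 \<le> m f" if "f \<in> C" "\<forall>k\<in>topspace T. 0 \<le> f k" for f
        using that AK(1) by (auto simp: m_def average_def topspace intro!: divide_nonneg_nonneg sum_nonneg)
      show "m (\<lambda>k. 1) = 1" using AK(2,3) by (simp add: m_def C_one average_def)
    qed
    moreover have "m \<in> V z" if z: "z \<in> Z'" for z
    proof -
      obtain f h e where zz: "z = (f, h, e)" by (cases z)
      then have fh: "f \<in> C" "h \<in> carrier K" using z Z'(2) by (auto simp: Z_def)
      have "\<bar>average A (\<lambda>k. f (k \<otimes> h)) - average A f\<bar> \<le> e"
      proof (rule average_almost_invariant[OF A _ _ fh(2)])
        show "U0 \<subseteq> carrier K" by (auto simp: U0_def topspace)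
        show "\<bar>f (inv v \<otimes> u \<otimes> a) - f a\<bar> \<le> e" if "u \<in> U0" "v \<in> U0" "a \<in> carrier K" for u v a
          using U(3)[OF z _ _ that(3), of u v] that z by (auto simp: zz U0_def)
      qed
      then show ?thesis by (simp add: zz V_def m_def fh C_trans)
    qed
    ultimately show "(\<Omega> \<inter> E) \<inter> (\<Inter>z\<in>Z'. V z) \<noteq> {}" by blast
  qed
  then obtain M where M: "M \<in> E" "\<And>z. z \<in> Z \<Longrightarrow> M \<in> V z" by blast
  have "positive_mean T M" using M(1) by (simp add: positive_mean_def E_def C_def)
  moreover have "M (\<lambda>k. f (k \<otimes> h)) = M f"
    if "continuous_map T euclideanreal f" "h \<in> carrier K" for f h
  proof (rule ccontr)
    assume ne: "M (\<lambda>k. f (k \<otimes> h)) \<noteq> M f"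
    define e where "e = \<bar>M (\<lambda>k. f (k \<otimes> h)) - M f\<bar> / 2"
    have "e > 0" using ne by (simp add: e_def)
    then have "\<bar>M (\<lambda>k. f (k \<otimes> h)) - M f\<bar> \<le> e" using M(2)[of "(f, h, e)"] that by (auto simp: Z_def V_def C_def)
    then show False using ne by (simp add: e_def)
  qed
  ultimately show ?thesis using that by blast
qed

lemma positive_mean_add:
  "\<lbrakk>positive_mean T M; continuous_map T euclideanreal f; continuous_map T euclideanreal g\<rbrakk>
    \<Longrightarrow> M (\<lambda>k. f k + g k) = M f + M g"
  and positive_mean_scale:
  "\<lbrakk>positive_mean T M; continuous_map T euclideanreal f\<rbrakk> \<Longrightarrow> M (\<lambda>k. c * f k) = c * M f"
  and positive_mean_nonneg:
  "\<lbrakk>positive_mean T M; continuous_map T euclideanreal f; \<And>k. k \<in> topspace T \<Longrightarrow> 0 \<le> f k\<rbrakk> \<Longrightarrow> 0 \<le> M f"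
  and positive_mean_one: "positive_mean T M \<Longrightarrow> M (\<lambda>k. 1) = 1"
  by (auto simp: positive_mean_def)

lemma positive_mean_const: "positive_mean T M \<Longrightarrow> M (\<lambda>k. c) = c"
  using positive_mean_scale[of T M "\<lambda>k. 1" c] positive_mean_one[of T M] by simp

lemma positive_mean_diff:
  assumes "positive_mean T M" "continuous_map T euclideanreal f" "continuous_map T euclideanreal g"
  shows "M (\<lambda>k. f k - g k) = M f - M g"
proof -
  have "continuous_map T euclideanreal (\<lambda>k. -1 * g k)"
    using assms(3) by (rule continuous_map_real_mult_left)
  from positive_mean_add[OF assms(1,2) this] positive_mean_scale[OF assms(1,3), of "-1"] show ?thesis
    by simp
qed

lemma positive_mean_le:
  assumes "positive_mean T M" "continuous_map T euclideanreal f" "continuous_map T euclideanreal g"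
    and "\<And>k. k \<in> topspace T \<Longrightarrow> f k \<le> g k"
  shows "M f \<le> M g"
  using positive_mean_nonneg[OF assms(1) continuous_map_diff[OF assms(3,2)]] assms(4)
    positive_mean_diff[OF assms(1,3,2)] by simp

lemma positive_mean_cong:
  assumes "positive_mean T M" "continuous_map T euclideanreal f"
    and "\<And>k. k \<in> topspace T \<Longrightarrow> f k = g k"
  shows "M f = M g"
proof -
  have "continuous_map T euclideanreal g" using assms(2,3) continuous_map_eq by metis
  then show ?thesis using positive_mean_le[OF assms(1,2), of g] positive_mean_le[OF assms(1) _ assms(2), of g] assms(3)
    by (simp add: order_antisym)
qed

text \<open>Continuity of the mean in the supremum norm, a consequence of positivity. Limits are
  taken under the mean through this bound.\<close>

lemma positive_mean_abs_le:
  assumes "positive_mean T M" "continuous_map T euclideanreal f"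
    and "\<And>k. k \<in> topspace T \<Longrightarrow> \<bar>f k\<bar> \<le> c"
  shows "\<bar>M f\<bar> \<le> c"
proof -
  have "M f \<le> M (\<lambda>k. c)" by (rule positive_mean_le[OF assms(1,2)]) (use assms(3) in \<open>auto simp: abs_le_iff\<close>)
  moreover have "M (\<lambda>k. - c) \<le> M f"
    by (rule positive_mean_le[OF assms(1) _ assms(2)]) (use assms(3) in \<open>force simp: abs_le_iff\<close>)+
  ultimately show ?thesis by (simp add: positive_mean_const[OF assms(1)] abs_le_iff)
qed

lemma positive_mean_sum:
  assumes "positive_mean T M" "finite A" "\<And>a. a \<in> A \<Longrightarrow> continuous_map T euclideanreal (f a)"
  shows "M (\<lambda>k. \<Sum>a\<in>A. f a k) = (\<Sum>a\<in>A. M (f a))"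
  using assms(2,3)
proof (induction A rule: finite_induct)
  case empty then show ?case by (simp add: positive_mean_const[OF assms(1)])
next
  case (insert a A)
  have "continuous_map T euclideanreal (\<lambda>k. \<Sum>a\<in>A. f a k)"
    using insert by (intro continuous_map_sum) auto
  then show ?case using insert positive_mean_add[OF assms(1), of "f a" "\<lambda>k. \<Sum>a\<in>A. f a k"] by simp
qed

subsection \<open>Smooth dependence on parameters\<close>

text \<open>Derivatives are taken in the point alone, but all of them are jointly continuous in
  parameter and point. Over a compact parameter space this is what differentiation under the mean
  requires.\<close>

fun param_Ck :: "nat \<Rightarrow> 'g topology \<Rightarrow> nat \<Rightarrow> (nat \<Rightarrow> real) set \<Rightarrow> ('g \<Rightarrow> (nat \<Rightarrow> real) \<Rightarrow> real) \<Rightarrow> bool"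
  where
    "param_Ck 0 T n U F \<longleftrightarrow>
       continuous_map (prod_topology T (subtopology (Euclidean_space n) U)) euclideanreal (\<lambda>(g, x). F g x)"
  | "param_Ck (Suc k) T n U F \<longleftrightarrow>
       continuous_map (prod_topology T (subtopology (Euclidean_space n) U)) euclideanreal (\<lambda>(g, x). F g x) \<and>
       (\<forall>g\<in>topspace T. partially_diff n U (F g)) \<and> (\<forall>i<n. param_Ck k T n U (\<lambda>g. part_deriv i (F g)))"

lemma param_Ck_continuous: "param_Ck k T n U F \<Longrightarrow>
    continuous_map (prod_topology T (subtopology (Euclidean_space n) U)) euclideanreal (\<lambda>(g, x). F g x)"
  by (cases k) auto

lemma param_continuous_slice:
  assumes "continuous_map (prod_topology T (subtopology (Euclidean_space n) U)) euclideanreal (\<lambda>(g, x). F g x)"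
    and "openin (Euclidean_space n) U" "x \<in> U"
  shows "continuous_map T euclideanreal (\<lambda>g. F g x)"
proof -
  have "continuous_map T (prod_topology T (subtopology (Euclidean_space n) U)) (\<lambda>g. (g, x))"
    using assms(2,3) openin_Rn_mem by (intro continuous_map_pairedI continuous_map_const[THEN iffD2]) auto
  from continuous_map_compose[OF this assms(1)] show ?thesis by (simp add: o_def)
qed

text \<open>The tube lemma over the compact parameter space makes continuity at x uniform in
  g.\<close>

lemma param_uniform:
  assumes T: "compact_space T" and U: "openin (Euclidean_space n) U" "x \<in> U" and e: "e > 0"
    and F: "continuous_map (prod_topology T (subtopology (Euclidean_space n) U)) euclideanreal (\<lambda>(g, x). F g x)"
  obtains d where "d > 0" "cube n x d \<subseteq> U"
    "\<And>g y. g \<in> topspace T \<Longrightarrow> y \<in> cube n x d \<Longrightarrow> \<bar>F g y - F g x\<bar> < e"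
proof -
  let ?P = "prod_topology T (subtopology (Euclidean_space n) U)"
  have sub: "topspace (subtopology (Euclidean_space n) U) = U"
    using openin_Rn_subset[OF U(1)] by (simp add: Int_absorb1)
  have "continuous_map ?P euclideanreal (\<lambda>p. F (fst p) x)"
    using continuous_map_compose[OF continuous_map_fst param_continuous_slice[OF F U]] by (simp add: o_def)
  moreover have "continuous_map ?P euclideanreal (\<lambda>p. F (fst p) (snd p))"
    using F by (simp add: case_prod_beta')
  ultimately have c: "continuous_map ?P euclideanreal (\<lambda>p. \<bar>F (fst p) (snd p) - F (fst p) x\<bar>)"
    by (intro continuous_map_real_abs continuous_map_diff)
  have "openin ?P {p \<in> topspace ?P. \<bar>F (fst p) (snd p) - F (fst p) x\<bar> \<in> {..<e}}"
    by (rule openin_continuous_map_preimage[OF c]) auto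
  moreover have "topspace T \<times> {x} \<subseteq> {p \<in> topspace ?P. \<bar>F (fst p) (snd p) - F (fst p) x\<bar> \<in> {..<e}}"
    using e U openin_Rn_mem[OF U] by auto
  ultimately have "\<exists>A V. openin T A \<and> openin (subtopology (Euclidean_space n) U) V \<and> topspace T \<subseteq> A \<and> x \<in> V \<and>
    A \<times> V \<subseteq> {p \<in> topspace ?P. \<bar>F (fst p) (snd p) - F (fst p) x\<bar> \<in> {..<e}}"
    using T U(2) sub by (intro tube_lemma_left) (simp_all add: compact_space_def)
  then obtain A V where V: "openin (subtopology (Euclidean_space n) U) V" "topspace T \<subseteq> A" "x \<in> V"
    "A \<times> V \<subseteq> {p \<in> topspace ?P. \<bar>F (fst p) (snd p) - F (fst p) x\<bar> \<in> {..<e}}"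
    by (elim exE conjE) (rule that)
  have "openin (Euclidean_space n) V" using V(1) U(1) openin_trans_full by blast
  then obtain d where d: "d > 0" "cube n x d \<subseteq> V" using open_contains_cube V(3) by blast
  have "V \<subseteq> U" using openin_subset[OF V(1)] sub by simp
  moreover have "\<bar>F g y - F g x\<bar> < e" if "g \<in> topspace T" "y \<in> cube n x d" for g y
  proof -
    have "(g, y) \<in> A \<times> V" using that V(2) d(2) by auto
    with V(4) show ?thesis by auto
  qed
  ultimately show ?thesis using that[OF d(1)] d(2) by blast
qed

lemma mean_continuous:
  assumes M: "positive_mean T M" and T: "compact_space T" and U: "openin (Euclidean_space n) U"
    and F: "continuous_map (prod_topology T (subtopology (Euclidean_space n) U)) euclideanreal (\<lambda>(g, x). F g x)"
  shows "continuous_on U (\<lambda>x. M (\<lambda>g. F g x))"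
proof (rule continuous_onI_cube[OF openin_Rn_subset[OF U]])
  fix x and e :: real assume x: "x \<in> U" and e: "e > 0"
  obtain d where d: "d > 0" "cube n x d \<subseteq> U"
    "\<And>g y. g \<in> topspace T \<Longrightarrow> y \<in> cube n x d \<Longrightarrow> \<bar>F g y - F g x\<bar> < e / 2"
    using param_uniform[OF T U x _ F, of "e / 2"] e by auto
  have "\<bar>M (\<lambda>g. F g y) - M (\<lambda>g. F g x)\<bar> < e" if y: "y \<in> cube n x d" for y
  proof -
    have c: "continuous_map T euclideanreal (\<lambda>g. F g y)" "continuous_map T euclideanreal (\<lambda>g. F g x)"
      using param_continuous_slice[OF F U] x y d(2) by auto
    have "\<bar>M (\<lambda>g. F g y - F g x)\<bar> \<le> e / 2"
      by (rule positive_mean_abs_le[OF M]) (use c d(3)[OF _ y] in \<open>auto intro: continuous_map_diff less_imp_le\<close>)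
    then show ?thesis using positive_mean_diff[OF M c] e by simp
  qed
  then show "\<exists>d>0. \<forall>y\<in>U \<inter> cube n x d. \<bar>M (\<lambda>g. F g y) - M (\<lambda>g. F g x)\<bar> < e" using d(1) by blast
qed

text \<open>The mean value theorem turns the difference quotient into the derivative at an
  intermediate point. That point depends on g but stays in the cube, so by
  \<open>param_uniform\<close> the error is uniform in g, and the mean preserves uniform
  bounds.\<close>

lemma mean_DERIV:
  assumes M: "positive_mean T M" and T: "compact_space T" and U: "openin (Euclidean_space n) U"
    and F: "param_Ck (Suc k) T n U F" and i: "i < n" and x: "x \<in> U"
  shows "((\<lambda>t. M (\<lambda>g. F g (x(i := t)))) has_field_derivative M (\<lambda>g. part_deriv i (F g) x)) (at (x i))"
proof -
  have cF: "continuous_map (prod_topology T (subtopology (Euclidean_space n) U)) euclideanreal (\<lambda>(g, x). F g x)"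
    and pd: "\<And>g. g \<in> topspace T \<Longrightarrow> partially_diff n U (F g)"
    and dF: "\<And>i. i < n \<Longrightarrow> param_Ck k T n U (\<lambda>g. part_deriv i (F g))"
    using F by auto
  note cD = param_Ck_continuous[OF dF[OF i]]
  let ?D = "\<lambda>g x. part_deriv i (F g) x"
  have cDx: "continuous_map T euclideanreal (\<lambda>g. ?D g x)" by (rule param_continuous_slice[OF cD U x])
  have "((\<lambda>t. (M (\<lambda>g. F g (x(i := t))) - M (\<lambda>g. F g x)) / (t - x i)) \<longlongrightarrow> M (\<lambda>g. ?D g x)) (at (x i))"
  proof (rule tendstoI)
    fix e :: real assume e: "e > 0"
    obtain d where d: "d > 0" "cube n x d \<subseteq> U"
      "\<And>g y. g \<in> topspace T \<Longrightarrow> y \<in> cube n x d \<Longrightarrow> \<bar>?D g y - ?D g x\<bar> < e / 2"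
      using param_uniform[OF T U x _ cD, of "e / 2"] e by auto
    have xc: "x \<in> cube n x d" by (rule cube_center[OF openin_Rn_mem[OF U x] d(1)])
    have "\<forall>\<^sub>F t in at (x i). \<bar>t - x i\<bar> < d \<and> t \<noteq> x i"
      using d(1) by (auto simp: eventually_at dist_real_def intro!: exI[of _ d])
    then show "\<forall>\<^sub>F t in at (x i). dist ((M (\<lambda>g. F g (x(i := t))) - M (\<lambda>g. F g x)) / (t - x i)) (M (\<lambda>g. ?D g x)) < e"
    proof eventually_elim
      case (elim t)
      have seg: "x(i := s) \<in> cube n x d" if "s \<in> closed_segment (x i) t" for s
      proof -
        have "\<bar>s - x i\<bar> < d" using that elim by (auto simp: closed_segment_eq_real_ivl split: if_splits)
        then show ?thesis using line_in_cube[OF xc i] by simp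
      qed
      have xt: "x(i := t) \<in> U" using seg[of t] d(2) by auto
      have c: "continuous_map T euclideanreal (\<lambda>g. F g (x(i := t)))" "continuous_map T euclideanreal (\<lambda>g. F g x)"
        using param_continuous_slice[OF cF U] x xt by auto
      have cs: "continuous_map T euclideanreal (\<lambda>g. (t - x i) * ?D g x)"
        by (rule continuous_map_real_mult_left[OF cDx])
      have bd: "\<bar>F g (x(i := t)) - F g x - (t - x i) * ?D g x\<bar> \<le> e / 2 * \<bar>t - x i\<bar>"
        if g: "g \<in> topspace T" for g
      proof -
        have "((\<lambda>s. F g (x(i := s))) has_field_derivative ?D g (x(i := s))) (at s)"
          if "s \<in> closed_segment (x i) t" for s
          using partially_diffD[OF pd[OF g] i, of "x(i := s)"] seg[OF that] d(2) by auto
        then obtain s where s: "s \<in> closed_segment (x i) t"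
          "F g (x(i := t)) - F g (x(i := x i)) = ?D g (x(i := s)) * (t - x i)"
          using MVT_segment[of "x i" t "\<lambda>s. F g (x(i := s))" "\<lambda>s. ?D g (x(i := s))"] by blast
        then have "F g (x(i := t)) - F g x - (t - x i) * ?D g x = (?D g (x(i := s)) - ?D g x) * (t - x i)"
          by (simp add: algebra_simps)
        moreover have "\<bar>?D g (x(i := s)) - ?D g x\<bar> \<le> e / 2"
          using d(3)[OF g seg[OF s(1)]] by simp
        ultimately show ?thesis by (simp only: abs_mult) (rule mult_right_mono, auto)
      qed
      have "\<bar>M (\<lambda>g. F g (x(i := t)) - F g x - (t - x i) * ?D g x)\<bar> \<le> e / 2 * \<bar>t - x i\<bar>"
        by (rule positive_mean_abs_le[OF M _ bd]) (intro continuous_map_diff c cs)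
      then have "\<bar>M (\<lambda>g. F g (x(i := t))) - M (\<lambda>g. F g x) - (t - x i) * M (\<lambda>g. ?D g x)\<bar> \<le> e / 2 * \<bar>t - x i\<bar>"
        using positive_mean_diff[OF M continuous_map_diff[OF c] cs] positive_mean_diff[OF M c]
          positive_mean_scale[OF M cDx, of "t - x i"] by simp
      then have "\<bar>M (\<lambda>g. F g (x(i := t))) - M (\<lambda>g. F g x) - (t - x i) * M (\<lambda>g. ?D g x)\<bar> / \<bar>t - x i\<bar> \<le> e / 2"
        using elim by (simp add: divide_le_eq)
      then have "\<bar>(M (\<lambda>g. F g (x(i := t))) - M (\<lambda>g. F g x) - (t - x i) * M (\<lambda>g. ?D g x)) / (t - x i)\<bar> < e"
        unfolding abs_divide by (rule le_less_trans) (use e in simp)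
      moreover have "(M (\<lambda>g. F g (x(i := t))) - M (\<lambda>g. F g x) - (t - x i) * M (\<lambda>g. ?D g x)) / (t - x i)
        = (M (\<lambda>g. F g (x(i := t))) - M (\<lambda>g. F g x)) / (t - x i) - M (\<lambda>g. ?D g x)"
        using elim by (simp add: diff_divide_distrib)
      ultimately show ?case by (simp add: dist_real_def)
    qed
  qed
  then show ?thesis
    by (simp add: has_field_derivative_iff)
qed

lemma mean_Ck:
  assumes M: "positive_mean T M" and T: "compact_space T" and U: "openin (Euclidean_space n) U"
    and F: "param_Ck k T n U F"
  shows "Ck_on k n U (\<lambda>x. M (\<lambda>g. F g x))"
  using F
proof (induction k arbitrary: F)
  case 0
  then show ?case unfolding Ck_on_0[OF U] by (intro mean_continuous[OF M T U]) simp
next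
  case (Suc k)
  have cF: "continuous_map (prod_topology T (subtopology (Euclidean_space n) U)) euclideanreal (\<lambda>(g, x). F g x)"
    and dF: "\<And>i. i < n \<Longrightarrow> param_Ck k T n U (\<lambda>g. part_deriv i (F g))"
    using Suc.prems by auto
  show ?case
  proof (rule Ck_on_SucI[OF U, where f'="\<lambda>i x. M (\<lambda>g. part_deriv i (F g) x)"])
    show "Ck_on k n U (\<lambda>x. M (\<lambda>g. part_deriv i (F g) x))" if "i < n" for i
      using Suc.IH[OF dF[OF that]] .
    show "continuous_on U (\<lambda>x. M (\<lambda>g. F g x))" by (rule mean_continuous[OF M T U cF])
    show "((\<lambda>t. M (\<lambda>g. F g (x(i := t)))) has_field_derivative M (\<lambda>g. part_deriv i (F g) x)) (at (x i))"
      if "i < n" "x \<in> U" for i x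
      by (rule mean_DERIV[OF M T U Suc.prems that])
  qed
qed

lemma param_Ck_cong:
  assumes U: "openin (Euclidean_space n) U"
    and "\<And>g x. g \<in> topspace T \<Longrightarrow> x \<in> U \<Longrightarrow> F g x = F' g x" "param_Ck k T n U F"
  shows "param_Ck k T n U F'"
  using assms(2,3)
proof (induction k arbitrary: F F')
  case 0
  have "continuous_map (prod_topology T (subtopology (Euclidean_space n) U)) euclideanreal (\<lambda>(g, x). F' g x)"
    by (rule continuous_map_eq[OF param_Ck_continuous[OF 0(2)]]) (use 0(1) in auto)
  then show ?case by simp
next
  let ?P = "prod_topology T (subtopology (Euclidean_space n) U)"
  case (Suc k)
  have "continuous_map ?P euclideanreal (\<lambda>(g, x). F' g x)"
    by (rule continuous_map_eq[OF param_Ck_continuous[OF Suc.prems(2)]]) (use Suc.prems(1) in auto)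
  moreover have "partially_diff n U (F' g)" if "g \<in> topspace T" for g
    by (rule partially_diff_cong[OF U Suc.prems(1)[OF that]]) (use Suc.prems(2) that in auto)
  moreover have "param_Ck k T n U (\<lambda>g. part_deriv i (F' g))" if "i < n" for i
  proof (rule Suc.IH[of "\<lambda>g. part_deriv i (F g)"])
    show "part_deriv i (F g) x = part_deriv i (F' g) x" if "g \<in> topspace T" "x \<in> U" for g x
      by (rule part_deriv_cong[OF U Suc.prems(1)[OF that(1)] that(2) \<open>i < n\<close>])
  qed (use Suc.prems(2) that in auto)
  ultimately show ?case by simp
qed

text \<open>The weights are continuous functions of the parameter only. In the application they are
  matrix entries of \<open>rho (inv h)\<close>.\<close>

lemma param_Ck_sum:
  assumes U: "openin (Euclidean_space n) U" and A: "finite A"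
    and q: "\<And>a. a \<in> A \<Longrightarrow> continuous_map T euclideanreal (q a)"
    and F: "\<And>a. a \<in> A \<Longrightarrow> param_Ck k T n U (F a)"
  shows "param_Ck k T n U (\<lambda>g x. \<Sum>a\<in>A. q a g * F a g x)"
  using F
proof (induction k arbitrary: F)
  let ?P = "prod_topology T (subtopology (Euclidean_space n) U)"
  have "continuous_map ?P euclideanreal (\<lambda>z. q a (fst z))" if "a \<in> A" for a
    using continuous_map_compose[OF continuous_map_fst q[OF that]] by (simp add: o_def)
  then have cont: "continuous_map ?P euclideanreal (\<lambda>(g, x). \<Sum>a\<in>A. q a g * F a g x)"
    if "\<And>a. a \<in> A \<Longrightarrow> continuous_map ?P euclideanreal (\<lambda>(g, x). F a g x)"
    for F :: "'a \<Rightarrow> 'b \<Rightarrow> (nat \<Rightarrow> real) \<Rightarrow> real"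
    using that A by (auto simp: case_prod_beta' intro!: continuous_map_sum continuous_map_real_mult)
  {
    case 0
    then show ?case using cont[of F] by simp
  next
    case (Suc k)
    have pd: "((\<lambda>t. \<Sum>a\<in>A. q a g * F a g (x(i := t))) has_field_derivative
        (\<Sum>a\<in>A. q a g * part_deriv i (F a g) x)) (at (x i))" if "i < n" "g \<in> topspace T" "x \<in> U" for i g x
      using Suc.prems that by (intro DERIV_sum DERIV_cmult partially_diffD[of n U]) auto
    have "param_Ck k T n U (\<lambda>g. part_deriv i (\<lambda>x. \<Sum>a\<in>A. q a g * F a g x))" if i: "i < n" for i
    proof (rule param_Ck_cong[OF U])
      show "param_Ck k T n U (\<lambda>g x. \<Sum>a\<in>A. q a g * part_deriv i (F a g) x)"
        by (rule Suc.IH[of "\<lambda>a g. part_deriv i (F a g)"]) (use Suc.prems i in auto)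
      show "(\<Sum>a\<in>A. q a g * part_deriv i (F a g) x) = part_deriv i (\<lambda>x. \<Sum>a\<in>A. q a g * F a g x) x"
        if "g \<in> topspace T" "x \<in> U" for g x
        by (rule part_deriv_eqI[symmetric]) (rule pd[OF i that])
    qed
    moreover have "partially_diff n U (\<lambda>x. \<Sum>a\<in>A. q a g * F a g x)" if "g \<in> topspace T" for g
      unfolding partially_diff_def field_differentiable_def using pd that by blast
    ultimately show ?case using cont[of F] Suc.prems by auto
  }
qed

section \<open>Charts and smooth maps of manifolds\<close>

lemma chart_inv_right:
  assumes "a \<in> snd c ` fst c" shows "chart_inv c a \<in> fst c" "snd c (chart_inv c a) = a"
  using assms by (simp_all add: chart_inv_def inv_into_into f_inv_into_f)

lemma is_chart_subset: "is_chart n X c \<Longrightarrow> fst c \<subseteq> topspace X"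
  by (simp add: is_chart_def openin_subset)

lemma chart_inv_left:
  assumes "is_chart n X c" "y \<in> fst c" shows "chart_inv c (snd c y) = y"
proof -
  have "inj_on (snd c) (topspace X \<inter> fst c)"
    using assms(1) homeomorphic_imp_injective_map[of "subtopology X (fst c)"] by (auto simp: is_chart_def)
  then have "inj_on (snd c) (fst c)" using is_chart_subset[OF assms(1)] by (simp add: Int_absorb1)
  then show ?thesis using assms(2) by (simp add: chart_inv_def)
qed

lemma is_chart_Rn: "is_chart n X c \<Longrightarrow> y \<in> fst c \<Longrightarrow> snd c y \<in> Rn n"
  unfolding is_chart_def using openin_Rn_mem by (metis imageI)

lemma is_chart_open_image:
  assumes "is_chart n X c" "openin X W" "W \<subseteq> fst c"
  shows "openin (Euclidean_space n) (snd c ` W)"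
proof -
  have c: "openin X (fst c)" "openin (Euclidean_space n) (snd c ` fst c)"
    "homeomorphic_map (subtopology X (fst c)) (subtopology (Euclidean_space n) (snd c ` fst c)) (snd c)"
    using assms(1) by (auto simp: is_chart_def)
  have "openin (subtopology X (fst c)) W" using assms(2,3) c(1) by (simp add: openin_open_subtopology)
  moreover have "W \<subseteq> topspace (subtopology X (fst c))" using assms(3) is_chart_subset[OF assms(1)] by auto
  ultimately have "openin (subtopology (Euclidean_space n) (snd c ` fst c)) (snd c ` W)"
    using homeomorphic_map_openness[OF c(3)] by blast
  then show ?thesis using c(2) openin_trans_full by blast
qed

lemma chart_continuous:
  assumes "is_chart n X c"
  shows "continuous_map (subtopology X (fst c)) (Euclidean_space n) (snd c)"
  using assms homeomorphic_imp_continuous_map continuous_map_into_fulltopology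
  unfolding is_chart_def by blast

lemma chart_inv_continuous:
  assumes "is_chart n X c"
  shows "continuous_map (subtopology (Euclidean_space n) (snd c ` fst c)) X (chart_inv c)"
proof -
  have img: "openin (Euclidean_space n) (snd c ` fst c)" using assms by (simp add: is_chart_def)
  have top: "topspace (subtopology (Euclidean_space n) (snd c ` fst c)) = snd c ` fst c"
    using openin_Rn_subset[OF img] by (simp add: Int_absorb1)
  show ?thesis
    unfolding continuous_map_def top
  proof (intro conjI allI impI)
    show "chart_inv c \<in> snd c ` fst c \<rightarrow> topspace X"
    proof
      fix a assume "a \<in> snd c ` fst c"
      then show "chart_inv c a \<in> topspace X"
        using chart_inv_right(1)[of a c] is_chart_subset[OF assms] by (simp only: subsetD)
    qed
    fix U assume U: "openin X U"
    have "{a \<in> snd c ` fst c. chart_inv c a \<in> U} = snd c ` (fst c \<inter> U)"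
    proof (intro subset_antisym subsetI)
      fix a assume "a \<in> {a \<in> snd c ` fst c. chart_inv c a \<in> U}"
      then show "a \<in> snd c ` (fst c \<inter> U)"
        using chart_inv_right[of a c] by (intro image_eqI[of _ _ "chart_inv c a"]) simp_all
    next
      fix a assume "a \<in> snd c ` (fst c \<inter> U)"
      then obtain y where "y \<in> fst c" "y \<in> U" "a = snd c y" by (elim imageE IntE)
      then show "a \<in> {a \<in> snd c ` fst c. chart_inv c a \<in> U}"
        using chart_inv_left[OF assms, of y] by simp
    qed
    moreover have "openin (Euclidean_space n) (snd c ` (fst c \<inter> U))"
      using assms U by (intro is_chart_open_image[OF assms]) (auto simp: is_chart_def openin_Int)
    ultimately show "openin (subtopology (Euclidean_space n) (snd c ` fst c)) {a \<in> snd c ` fst c. chart_inv c a \<in> U}"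
      using img by (simp add: openin_open_subtopology image_mono)
  qed
qed

lemma openin_preimage_subtopology:
  assumes "continuous_map (subtopology X W) Y f" "openin X W" "openin Y U"
  shows "openin X {z \<in> W. f z \<in> U}"
proof -
  have "openin (subtopology X W) {z \<in> topspace (subtopology X W). f z \<in> U}"
    by (rule openin_continuous_map_preimage[OF assms(1,3)])
  moreover have "{z \<in> topspace (subtopology X W). f z \<in> U} = {z \<in> W. f z \<in> U}"
    using openin_subset[OF assms(2)] by auto
  ultimately show ?thesis using assms(2) by (simp add: openin_open_subtopology)
qed

text \<open>Hausdorffness and second countability are left out, so that products and submanifolds need not
  be shown to inherit them.\<close>

definition pre_manifold :: "'a mfd \<Rightarrow> bool"
  where "pre_manifold M \<longleftrightarrow>
    (\<forall>c\<in>atlas M. is_chart (mdim M) (mtop M) c) \<and> (\<Union>c\<in>atlas M. fst c) = points M \<and>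
    (\<forall>c\<in>atlas M. \<forall>d\<in>atlas M. charts_compatible (mdim M) c d)"

definition max_atlas :: "'a mfd \<Rightarrow> 'a chart set"
  where "max_atlas M = {c. is_chart (mdim M) (mtop M) c \<and> (\<forall>d\<in>atlas M. charts_compatible (mdim M) c d)}"

lemma smooth_manifold_pre: "smooth_manifold M \<Longrightarrow> pre_manifold M"
  by (simp add: smooth_manifold_def pre_manifold_def)

lemma atlas_max: "pre_manifold M \<Longrightarrow> c \<in> atlas M \<Longrightarrow> c \<in> max_atlas M"
  by (simp add: pre_manifold_def max_atlas_def)

lemma max_is_chart: "c \<in> max_atlas M \<Longrightarrow> is_chart (mdim M) (mtop M) c"
  by (simp add: max_atlas_def)

lemma atlas_cover:
  assumes "pre_manifold M" "y \<in> points M" obtains c where "c \<in> atlas M" "y \<in> fst c"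
  using assms unfolding pre_manifold_def by blast

lemma openin_fst_max: "c \<in> max_atlas M \<Longrightarrow> openin (mtop M) (fst c)"
  using max_is_chart[of c M] by (simp add: is_chart_def)

lemma max_open_image:
  "\<lbrakk>c \<in> max_atlas M; openin (mtop M) V; V \<subseteq> fst c\<rbrakk> \<Longrightarrow> openin (Euclidean_space (mdim M)) (snd c ` V)"
  using is_chart_open_image[OF max_is_chart] .

lemma max_inv_left: "c \<in> max_atlas M \<Longrightarrow> y \<in> fst c \<Longrightarrow> chart_inv c (snd c y) = y"
  using chart_inv_left[OF max_is_chart] .

text \<open>By definition a chart of \<open>max_atlas\<close> is compatible with the given atlas;
  two such charts are compared by inserting an atlas chart around each point.\<close>

lemma transition_smooth:
  assumes M: "pre_manifold M" and c: "c \<in> max_atlas M" and d: "d \<in> max_atlas M"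
  shows "smooth_map (mdim M) (snd c ` (fst c \<inter> fst d)) (mdim M) (\<lambda>a. snd d (chart_inv c a))"
proof (rule smooth_map_local)
  let ?n = "mdim M"
  note oc = openin_fst_max[OF c] and od = openin_fst_max[OF d]
  show "openin (Euclidean_space ?n) (snd c ` (fst c \<inter> fst d))"
    using oc od by (intro max_open_image[OF c]) auto
  fix a assume "a \<in> snd c ` (fst c \<inter> fst d)"
  then obtain y where y: "y \<in> fst c" "y \<in> fst d" "a = snd c y" by auto
  then have "y \<in> points M" using oc openin_subset by blast
  then obtain e where e: "e \<in> atlas M" "y \<in> fst e" using atlas_cover[OF M] by blast
  have em: "e \<in> max_atlas M" by (rule atlas_max[OF M e(1)])
  have oe: "openin (mtop M) (fst e)" by (rule openin_fst_max[OF em])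
  let ?V = "fst c \<inter> fst d \<inter> fst e"
  have oV: "openin (mtop M) ?V" using oc od oe by auto
  have ce: "smooth_map ?n (snd c ` (fst c \<inter> fst e)) ?n (\<lambda>a. snd e (chart_inv c a))"
    using c e(1) by (auto simp: max_atlas_def charts_compatible_def comp_def)
  have ed: "smooth_map ?n (snd e ` (fst d \<inter> fst e)) ?n (\<lambda>a. snd d (chart_inv e a))"
    using d e(1) by (auto simp: max_atlas_def charts_compatible_def comp_def)
  have o1: "openin (Euclidean_space ?n) (snd c ` ?V)" using oV by (intro max_open_image[OF c]) auto
  have o2: "openin (Euclidean_space ?n) (snd e ` (fst d \<inter> fst e))" using od oe by (intro max_open_image[OF em]) auto
  have o3: "openin (Euclidean_space ?n) (snd c ` (fst c \<inter> fst e))" using oc oe by (intro max_open_image[OF c]) auto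
  have s1: "smooth_map ?n (snd c ` ?V) ?n (\<lambda>a. snd e (chart_inv c a))"
    by (rule smooth_map_subset[OF o3 o1 _ ce]) auto
  have "smooth_map ?n (snd c ` ?V) ?n (\<lambda>a. snd d (chart_inv e (snd e (chart_inv c a))))"
    by (rule smooth_map_compose[OF o1 o2 s1 ed]) (auto simp: max_inv_left[OF c])
  then have "smooth_map ?n (snd c ` ?V) ?n (\<lambda>a. snd d (chart_inv c a))"
    by (rule smooth_map_cong[OF o1, rotated]) (auto simp: max_inv_left[OF c] max_inv_left[OF em])
  then show "\<exists>V. openin (Euclidean_space ?n) V \<and> a \<in> V \<and> smooth_map ?n V ?n (\<lambda>a. snd d (chart_inv c a))"
    using o1 y e(2) by blast
qed

text \<open>One pair of charts suffices here, and it may come from \<open>max_atlas\<close>, so that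
  adapted charts of submanifolds can be used. By \<open>smooth_at_charts\<close> any other pair does
  as well, on arbitrarily small neighbourhoods. Continuity near y is a consequence, because V is
  open and carried into a single chart.\<close>

definition smooth_at :: "'a mfd \<Rightarrow> 'b mfd \<Rightarrow> ('a \<Rightarrow> 'b) \<Rightarrow> 'a \<Rightarrow> bool"
  where "smooth_at M N f y \<longleftrightarrow> (\<exists>c\<in>max_atlas M. \<exists>d\<in>max_atlas N. \<exists>V.
    openin (mtop M) V \<and> y \<in> V \<and> V \<subseteq> fst c \<and> f ` V \<subseteq> fst d \<and>
    smooth_map (mdim M) (snd c ` V) (mdim N) (\<lambda>a. snd d (f (chart_inv c a))))"

lemma smooth_rep_continuous:
  assumes c: "c \<in> max_atlas M" and d: "d \<in> max_atlas N" and V: "openin (mtop M) V" "V \<subseteq> fst c" "f ` V \<subseteq> fst d"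
    and sm: "smooth_map (mdim M) (snd c ` V) (mdim N) (\<lambda>a. snd d (f (chart_inv c a)))"
  shows "continuous_map (subtopology (mtop M) V) (mtop N) f"
proof -
  have oV: "openin (Euclidean_space (mdim M)) (snd c ` V)" by (rule max_open_image[OF c V(1,2)])
  have "continuous_map (subtopology (mtop M) V) (subtopology (Euclidean_space (mdim M)) (snd c ` V)) (snd c)"
    using continuous_map_from_subtopology_mono[OF chart_continuous[OF max_is_chart[OF c]] V(2)]
    by (auto simp: continuous_map_in_subtopology)
  moreover have "continuous_map (subtopology (Euclidean_space (mdim M)) (snd c ` V))
      (subtopology (Euclidean_space (mdim N)) (snd d ` fst d)) (\<lambda>a. snd d (f (chart_inv c a)))"
    using smooth_map_continuous_map[OF oV sm] V(2,3)
    by (auto simp: continuous_map_in_subtopology max_inv_left[OF c] subset_iff)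
  moreover note chart_inv_continuous[OF max_is_chart[OF d]]
  ultimately have "continuous_map (subtopology (mtop M) V) (mtop N)
      (chart_inv d \<circ> ((\<lambda>a. snd d (f (chart_inv c a))) \<circ> snd c))"
    by (intro continuous_map_compose) auto
  then show ?thesis
    by (rule continuous_map_eq)
       (use V openin_subset[OF V(1)] in \<open>auto simp: max_inv_left[OF c] max_inv_left[OF d] subset_iff\<close>)
qed

lemma smooth_at_charts:
  assumes M: "pre_manifold M" and N: "pre_manifold N" and f: "smooth_at M N f y"
    and c: "c \<in> max_atlas M" "y \<in> fst c" and d: "d \<in> max_atlas N" "f y \<in> fst d"
    and W: "openin (mtop M) W" "y \<in> W"
  obtains V where "openin (mtop M) V" "y \<in> V" "V \<subseteq> W" "V \<subseteq> fst c" "f ` V \<subseteq> fst d"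
    "smooth_map (mdim M) (snd c ` V) (mdim N) (\<lambda>a. snd d (f (chart_inv c a)))"
proof -
  let ?m = "mdim M" and ?n = "mdim N"
  obtain c0 d0 V0 where c0: "c0 \<in> max_atlas M" and d0: "d0 \<in> max_atlas N"
    and V0: "openin (mtop M) V0" "y \<in> V0" "V0 \<subseteq> fst c0" "f ` V0 \<subseteq> fst d0"
    and sm: "smooth_map ?m (snd c0 ` V0) ?n (\<lambda>a. snd d0 (f (chart_inv c0 a)))"
    using f unfolding smooth_at_def by blast
  define V where "V = {z \<in> V0. f z \<in> fst d} \<inter> fst c \<inter> W"
  have "openin (mtop M) {z \<in> V0. f z \<in> fst d}"
    by (rule openin_preimage_subtopology[OF smooth_rep_continuous[OF c0 d0 V0(1,3,4) sm] V0(1) openin_fst_max[OF d(1)]])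
  then have oV: "openin (mtop M) V" using openin_fst_max[OF c(1)] W(1) by (auto simp: V_def)
  have yV: "y \<in> V" using V0(2) c(2) d(2) W(2) by (simp add: V_def)
  have oc: "openin (Euclidean_space ?m) (snd c ` V)" by (rule max_open_image[OF c(1) oV]) (auto simp: V_def)
  have oc0: "openin (Euclidean_space ?m) (snd c0 ` V0)" by (rule max_open_image[OF c0 V0(1,3)])
  have occ: "openin (Euclidean_space ?m) (snd c ` (fst c \<inter> fst c0))"
    using openin_fst_max[OF c(1)] openin_fst_max[OF c0] by (intro max_open_image[OF c(1)]) auto
  have odd: "openin (Euclidean_space ?n) (snd d0 ` (fst d0 \<inter> fst d))"
    using openin_fst_max[OF d(1)] openin_fst_max[OF d0] by (intro max_open_image[OF d0]) auto
  have VV: "z \<in> fst c" "z \<in> fst c0" "z \<in> V0" "f z \<in> fst d" "f z \<in> fst d0" if "z \<in> V" for z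
    using that V0(3,4) by (auto simp: V_def)
  have "smooth_map ?m (snd c ` V) ?m (\<lambda>a. snd c0 (chart_inv c a))"
    by (rule smooth_map_subset[OF occ oc _ transition_smooth[OF M c(1) c0]]) (use VV in auto)
  then have "smooth_map ?m (snd c ` V) ?n (\<lambda>a. snd d0 (f (chart_inv c0 (snd c0 (chart_inv c a)))))"
    by (rule smooth_map_compose[OF oc oc0 _ sm]) (use VV in \<open>auto simp: max_inv_left[OF c(1)]\<close>)
  then have "smooth_map ?m (snd c ` V) ?n (\<lambda>a. snd d0 (f (chart_inv c a)))"
    by (rule smooth_map_cong[OF oc, rotated]) (use VV in \<open>auto simp: max_inv_left[OF c(1)] max_inv_left[OF c0]\<close>)
  then have "smooth_map ?m (snd c ` V) ?n (\<lambda>a. snd d (chart_inv d0 (snd d0 (f (chart_inv c a)))))"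
    by (rule smooth_map_compose[OF oc odd _ transition_smooth[OF N d0 d(1)]])
       (use VV in \<open>auto simp: max_inv_left[OF c(1)]\<close>)
  then have sV: "smooth_map ?m (snd c ` V) ?n (\<lambda>a. snd d (f (chart_inv c a)))"
    by (rule smooth_map_cong[OF oc, rotated]) (use VV in \<open>auto simp: max_inv_left[OF c(1)] max_inv_left[OF d0]\<close>)
  have "V \<subseteq> W" "V \<subseteq> fst c" "f ` V \<subseteq> fst d" by (auto simp: V_def)
  then show ?thesis by (rule that[OF oV yV _ _ _ sV])
qed

lemma smooth_at_continuous_nbhd:
  assumes "smooth_at M N f y"
  obtains V where "openin (mtop M) V" "y \<in> V" "continuous_map (subtopology (mtop M) V) (mtop N) f"
proof -
  obtain c d V where "c \<in> max_atlas M" "d \<in> max_atlas N" "openin (mtop M) V" "y \<in> V" "V \<subseteq> fst c" "f ` V \<subseteq> fst d"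
    "smooth_map (mdim M) (snd c ` V) (mdim N) (\<lambda>a. snd d (f (chart_inv c a)))"
    using assms unfolding smooth_at_def by blast
  then show ?thesis using that[of V] smooth_rep_continuous[of c M d N V f] by simp
qed

lemma smooth_at_preimage:
  assumes "smooth_at M N f y" "openin (mtop N) O'" "f y \<in> O'"
  obtains V where "openin (mtop M) V" "y \<in> V" "f ` V \<subseteq> O'"
proof -
  obtain V where V: "openin (mtop M) V" "y \<in> V" "continuous_map (subtopology (mtop M) V) (mtop N) f"
    using smooth_at_continuous_nbhd[OF assms(1)] .
  show ?thesis
    by (rule that[OF openin_preimage_subtopology[OF V(3,1) assms(2)]]) (use V(2) assms(3) in auto)
qed

lemma smooth_at_cong:
  assumes M: "pre_manifold M" and N: "pre_manifold N" and f: "smooth_at M N f y"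
    and W: "openin (mtop M) W" "y \<in> W" "\<And>z. z \<in> W \<Longrightarrow> f z = g z"
  shows "smooth_at M N g y"
proof -
  obtain c d where c: "c \<in> max_atlas M" "y \<in> fst c" and d: "d \<in> max_atlas N" "f y \<in> fst d"
    using f unfolding smooth_at_def by blast
  obtain V where V: "openin (mtop M) V" "y \<in> V" "V \<subseteq> W" "V \<subseteq> fst c" "f ` V \<subseteq> fst d"
    "smooth_map (mdim M) (snd c ` V) (mdim N) (\<lambda>a. snd d (f (chart_inv c a)))"
    using smooth_at_charts[OF M N f c d W(1,2)] .
  have "smooth_map (mdim M) (snd c ` V) (mdim N) (\<lambda>a. snd d (g (chart_inv c a)))"
    by (rule smooth_map_cong[OF max_open_image[OF c(1) V(1,4)] _ V(6)])
       (use V W(3) in \<open>auto simp: max_inv_left[OF c(1)] subset_iff\<close>)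
  moreover have "g ` V \<subseteq> fst d" using V W(3) by force
  ultimately show ?thesis unfolding smooth_at_def using c d V by blast
qed

lemma smooth_at_compose:
  assumes M: "pre_manifold M" and N: "pre_manifold N" and P: "pre_manifold P"
    and f: "smooth_at M N f y" and g: "smooth_at N P g (f y)"
  shows "smooth_at M P (\<lambda>z. g (f z)) y"
proof -
  obtain c d where c: "c \<in> max_atlas M" "y \<in> fst c" and d: "d \<in> max_atlas N" "f y \<in> fst d"
    using f unfolding smooth_at_def by blast
  obtain e where e: "e \<in> max_atlas P" "g (f y) \<in> fst e"
    using g unfolding smooth_at_def by blast
  obtain V' where V': "openin (mtop N) V'" "f y \<in> V'" "V' \<subseteq> fst d" "V' \<subseteq> fst d" "g ` V' \<subseteq> fst e"
    "smooth_map (mdim N) (snd d ` V') (mdim P) (\<lambda>a. snd e (g (chart_inv d a)))"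
    using smooth_at_charts[OF N P g d e openin_fst_max[OF d(1)] d(2)] .
  obtain W where W: "openin (mtop M) W" "y \<in> W" "f ` W \<subseteq> V'"
    using smooth_at_preimage[OF f V'(1,2)] .
  obtain V where V: "openin (mtop M) V" "y \<in> V" "V \<subseteq> W" "V \<subseteq> fst c" "f ` V \<subseteq> fst d"
    "smooth_map (mdim M) (snd c ` V) (mdim N) (\<lambda>a. snd d (f (chart_inv c a)))"
    using smooth_at_charts[OF M N f c d W(1,2)] .
  have fV: "f z \<in> V'" if "z \<in> V" for z using that V(3) W(3) by auto
  note oV = max_open_image[OF c(1) V(1,4)] and oV' = max_open_image[OF d(1) V'(1,3)]
  have "smooth_map (mdim M) (snd c ` V) (mdim P) (\<lambda>a. snd e (g (chart_inv d (snd d (f (chart_inv c a))))))"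
    by (rule smooth_map_compose[OF oV oV' V(6) V'(6)]) (use V(4) fV in \<open>auto simp: max_inv_left[OF c(1)] subset_iff\<close>)
  then have "smooth_map (mdim M) (snd c ` V) (mdim P) (\<lambda>a. snd e (g (f (chart_inv c a))))"
    by (rule smooth_map_cong[OF oV, rotated])
       (use V(4) V'(3) fV in \<open>auto simp: max_inv_left[OF c(1)] max_inv_left[OF d(1)] subset_iff\<close>)
  moreover have "(\<lambda>z. g (f z)) ` V \<subseteq> fst e" using fV V'(5) by auto
  ultimately show ?thesis unfolding smooth_at_def using c(1) e(1) V(1,2,4) by blast
qed

lemma msmooth_on_smooth_at:
  assumes M: "pre_manifold M" and N: "pre_manifold N" and f: "msmooth_on M W N f" and y: "y \<in> W"
  shows "smooth_at M N f y"
proof -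
  have W: "openin (mtop M) W" and cf: "continuous_map (subtopology (mtop M) W) (mtop N) f"
    using f by (auto simp: msmooth_on_def)
  have top: "topspace (subtopology (mtop M) W) = W" using openin_subset[OF W] by auto
  have fy: "f y \<in> points N" "y \<in> points M"
    using continuous_map_image_subset_topspace[OF cf] y top openin_subset[OF W] by auto
  obtain c where c: "c \<in> atlas M" "y \<in> fst c" using atlas_cover[OF M fy(2)] .
  obtain d where d: "d \<in> atlas N" "f y \<in> fst d" using atlas_cover[OF N fy(1)] .
  note cm = atlas_max[OF M c(1)] and dm = atlas_max[OF N d(1)]
  let ?V = "{z \<in> fst c \<inter> W. f z \<in> fst d}"
  have "openin (mtop M) {z \<in> W. f z \<in> fst d}"
    by (rule openin_preimage_subtopology[OF cf W openin_fst_max[OF dm]])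
  then have "openin (mtop M) (fst c \<inter> {z \<in> W. f z \<in> fst d})" using openin_fst_max[OF cm] by blast
  moreover have "fst c \<inter> {z \<in> W. f z \<in> fst d} = ?V" by auto
  ultimately have "openin (mtop M) ?V" by simp
  moreover have "smooth_map (mdim M) (snd c ` ?V) (mdim N) (\<lambda>a. snd d (f (chart_inv c a)))"
    using f c(1) d(1) by (simp add: msmooth_on_def comp_def)
  ultimately show ?thesis
    unfolding smooth_at_def using cm dm c(2) d(2) y by (intro bexI[of _ c] bexI[of _ d] exI[of _ ?V]) auto
qed

lemma msmooth_onI:
  assumes M: "pre_manifold M" and N: "pre_manifold N" and W: "openin (mtop M) W"
    and f: "\<And>y. y \<in> W \<Longrightarrow> smooth_at M N f y"
  shows "msmooth_on M W N f"
  unfolding msmooth_on_def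
proof (intro conjI ballI)
  have top: "topspace (subtopology (mtop M) W) = W" using openin_subset[OF W] by auto
  show cf: "continuous_map (subtopology (mtop M) W) (mtop N) f"
    unfolding continuous_map_def top
  proof (intro conjI allI impI)
    show "f \<in> W \<rightarrow> points N"
    proof
      fix y assume "y \<in> W"
      then obtain d where "d \<in> max_atlas N" "f y \<in> fst d" using f unfolding smooth_at_def by blast
      then show "f y \<in> points N" using openin_subset[OF openin_fst_max] by blast
    qed
    fix U assume U: "openin (mtop N) U"
    have "\<exists>V. openin (mtop M) V \<and> y \<in> V \<and> V \<subseteq> {z \<in> W. f z \<in> U}" if y: "y \<in> {z \<in> W. f z \<in> U}" for y
    proof -
      obtain V where "openin (mtop M) V" "y \<in> V" "f ` V \<subseteq> U"
        using smooth_at_preimage[OF f U] y by blast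
      then show ?thesis using W y by (intro exI[of _ "V \<inter> W"]) auto
    qed
    then have "openin (mtop M) {z \<in> W. f z \<in> U}" by (subst openin_subopen) blast
    then show "openin (subtopology (mtop M) W) {z \<in> W. f z \<in> U}"
      using W by (simp add: openin_open_subtopology)
  qed
  fix c d assume c: "c \<in> atlas M" and d: "d \<in> atlas N"
  note cm = atlas_max[OF M c] and dm = atlas_max[OF N d]
  let ?V = "{z \<in> fst c \<inter> W. f z \<in> fst d}"
  have "openin (mtop M) {z \<in> W. f z \<in> fst d}"
    by (rule openin_preimage_subtopology[OF cf W openin_fst_max[OF dm]])
  then have "openin (mtop M) (fst c \<inter> {z \<in> W. f z \<in> fst d})" using openin_fst_max[OF cm] by blast
  moreover have "fst c \<inter> {z \<in> W. f z \<in> fst d} = ?V" by auto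
  ultimately have oV: "openin (mtop M) ?V" by simp
  have "smooth_map (mdim M) (snd c ` ?V) (mdim N) (\<lambda>a. snd d (f (chart_inv c a)))"
  proof (rule smooth_map_local[OF max_open_image[OF cm oV]])
    fix a assume "a \<in> snd c ` ?V"
    then obtain y where y: "y \<in> ?V" "a = snd c y" by auto
    have yc: "y \<in> fst c" "f y \<in> fst d" "y \<in> W" using y by auto
    obtain V where V: "openin (mtop M) V" "y \<in> V" "V \<subseteq> W" "V \<subseteq> fst c" "f ` V \<subseteq> fst d"
      "smooth_map (mdim M) (snd c ` V) (mdim N) (\<lambda>a. snd d (f (chart_inv c a)))"
      using smooth_at_charts[OF M N f[OF yc(3)] cm yc(1) dm yc(2) W yc(3)] .
    then show "\<exists>V. openin (Euclidean_space (mdim M)) V \<and> a \<in> V \<and>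
        smooth_map (mdim M) V (mdim N) (\<lambda>a. snd d (f (chart_inv c a)))"
      using max_open_image[OF cm V(1,4)] y(2) by blast
  qed auto
  then show "smooth_map (mdim M) (snd c ` ?V) (mdim N) (snd d \<circ> f \<circ> chart_inv c)" by (simp add: comp_def)
qed (rule W)

lemma smooth_at_points: "smooth_at M N f y \<Longrightarrow> f y \<in> points N"
  unfolding smooth_at_def using openin_fst_max openin_subset by blast

subsection \<open>Cartesian spaces, charts and products\<close>

lemma Rn_mfd_simps [simp]: "mdim (Rn_mfd n) = n" "mtop (Rn_mfd n) = Euclidean_space n"
  "atlas (Rn_mfd n) = {(Rn n, id)}"
  by (simp_all add: Rn_mfd_def)

lemma chart_inv_id: "a \<in> Rn n \<Longrightarrow> chart_inv (Rn n, id) a = a"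
  using chart_inv_right(2)[of a "(Rn n, id)"] by simp

lemma pre_manifold_Rn: "pre_manifold (Rn_mfd n)"
proof -
  have "homeomorphic_map (Euclidean_space n) (Euclidean_space n) id" by simp
  then have "is_chart n (Euclidean_space n) (Rn n, id)" by (simp add: is_chart_def)
  moreover have "smooth_map n (Rn n) n (id \<circ> chart_inv (Rn n, id))"
    by (rule smooth_map_cong[OF openin_topspace _ smooth_map_id[OF openin_topspace]]) (simp add: chart_inv_id)
  ultimately show ?thesis by (simp add: pre_manifold_def charts_compatible_def)
qed

lemma id_chart_max: "(Rn n, id) \<in> max_atlas (Rn_mfd n)"
  by (rule atlas_max[OF pre_manifold_Rn]) simp

lemma smooth_at_RnI:
  assumes "openin (Euclidean_space n) U" "a \<in> U" "smooth_map n U m F"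
  shows "smooth_at (Rn_mfd n) (Rn_mfd m) F a"
  unfolding smooth_at_def
proof (intro bexI[OF _ id_chart_max] exI[of _ U] conjI)
  show "smooth_map (mdim (Rn_mfd n)) (snd (Rn n, id) ` U) (mdim (Rn_mfd m))
     (\<lambda>a. snd (Rn m, id) (F (chart_inv (Rn n, id) a)))"
    using openin_Rn_mem[OF assms(1)] by (auto intro!: smooth_map_cong[OF assms(1) _ assms(3)] simp: chart_inv_id)
qed (use assms openin_Rn_subset[OF assms(1)] smooth_map_image[OF assms(3)] in auto)

lemma smooth_at_RnD:
  assumes "smooth_at (Rn_mfd n) (Rn_mfd m) F a"
  obtains U where "openin (Euclidean_space n) U" "a \<in> U" "smooth_map n U m F"
proof -
  have "a \<in> Rn n" using assms openin_subset unfolding smooth_at_def by (metis Rn_mfd_simps(2) subsetD)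
  moreover have "F a \<in> Rn m" using smooth_at_points[OF assms] by simp
  ultimately have aF: "a \<in> fst (Rn n, id)" "F a \<in> fst (Rn m, id)" "a \<in> Rn n" by simp_all
  have oT: "openin (mtop (Rn_mfd n)) (Rn n)" by simp
  obtain V where "openin (mtop (Rn_mfd n)) V" and aV: "a \<in> V" and "V \<subseteq> Rn n" "V \<subseteq> fst (Rn n, id)"
    "F ` V \<subseteq> fst (Rn m, id)" and sV: "smooth_map (mdim (Rn_mfd n)) (snd (Rn n, id) ` V) (mdim (Rn_mfd m))
      (\<lambda>a. snd (Rn m, id) (F (chart_inv (Rn n, id) a)))"
    by (rule smooth_at_charts[OF pre_manifold_Rn pre_manifold_Rn assms id_chart_max aF(1) id_chart_max aF(2)
        oT aF(3)]) (rule that, simp_all)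
  then have oV: "openin (Euclidean_space n) V" by simp
  have "smooth_map n V m F"
  proof (rule smooth_map_cong[OF oV, of "\<lambda>a. F (chart_inv (Rn n, id) a)"])
    show "F (chart_inv (Rn n, id) y) = F y" if "y \<in> V" for y
      using chart_inv_id[OF openin_Rn_mem[OF oV that]] by simp
    show "smooth_map n V m (\<lambda>a. F (chart_inv (Rn n, id) a))" using sV by simp
  qed
  then show ?thesis by (rule that[OF oV aV])
qed

lemma smooth_map_smooth_at:
  assumes "openin (Euclidean_space n) U" "\<And>a. a \<in> U \<Longrightarrow> smooth_at (Rn_mfd n) (Rn_mfd m) F a"
  shows "smooth_map n U m F"
  by (rule smooth_map_local[OF assms(1)]) (metis assms(2) smooth_at_RnD)

lemma smooth_at_chart:
  assumes M: "pre_manifold M" and c: "c \<in> max_atlas M" "y \<in> fst c"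
  shows "smooth_at M (Rn_mfd (mdim M)) (snd c) y"
  unfolding smooth_at_def
proof (intro bexI[OF _ c(1)] bexI[OF _ id_chart_max] exI[of _ "fst c"] conjI)
  have o: "openin (Euclidean_space (mdim M)) (snd c ` fst c)"
    using max_is_chart[OF c(1)] by (simp add: is_chart_def)
  have "smooth_map (mdim M) (snd c ` fst c) (mdim M) (\<lambda>a. snd c (chart_inv c a))"
    by (rule smooth_map_cong[OF o _ smooth_map_id[OF o]]) (simp add: chart_inv_right(2))
  then show "smooth_map (mdim M) (snd c ` fst c) (mdim (Rn_mfd (mdim M)))
     (\<lambda>a. snd (Rn (mdim M), id) (snd c (chart_inv c a)))" by simp
qed (use c openin_fst_max[OF c(1)] is_chart_Rn[OF max_is_chart[OF c(1)]] in auto)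

lemma smooth_at_chart_inv:
  assumes M: "pre_manifold M" and c: "c \<in> max_atlas M" "a \<in> snd c ` fst c"
  shows "smooth_at (Rn_mfd (mdim M)) M (chart_inv c) a"
  unfolding smooth_at_def
proof (intro bexI[OF _ c(1)] bexI[OF _ id_chart_max] exI[of _ "snd c ` fst c"] conjI)
  have o: "openin (Euclidean_space (mdim M)) (snd c ` fst c)"
    using max_is_chart[OF c(1)] by (simp add: is_chart_def)
  then show "openin (mtop (Rn_mfd (mdim M))) (snd c ` fst c)" by simp
  have "smooth_map (mdim M) (snd c ` fst c) (mdim M) (\<lambda>a. snd c (chart_inv c (chart_inv (Rn (mdim M), id) a)))"
    by (rule smooth_map_cong[OF o _ smooth_map_id[OF o]])
       (simp add: chart_inv_right(2) chart_inv_id openin_Rn_mem[OF o])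
  then show "smooth_map (mdim (Rn_mfd (mdim M))) (snd (Rn (mdim M), id) ` snd c ` fst c) (mdim M)
     (\<lambda>a. snd c (chart_inv c (chart_inv (Rn (mdim M), id) a)))" by simp
  show "snd c ` fst c \<subseteq> fst (Rn (mdim M), id)" using openin_Rn_subset[OF o] by simp
qed (use c(2) in \<open>auto simp: max_inv_left[OF c(1)]\<close>)

lemma smooth_at_const:
  assumes M: "pre_manifold M" "y \<in> points M" and N: "pre_manifold N" "z \<in> points N"
  shows "smooth_at M N (\<lambda>_. z) y"
proof -
  obtain c where c: "c \<in> atlas M" "y \<in> fst c" using atlas_cover[OF M] .
  obtain d where d: "d \<in> atlas N" "z \<in> fst d" using atlas_cover[OF N] .
  note cm = atlas_max[OF M(1) c(1)] and dm = atlas_max[OF N(1) d(1)]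
  have "smooth_map (mdim M) (snd c ` fst c) (mdim N) (\<lambda>a. snd d z)"
    by (rule smooth_map_const[OF max_open_image[OF cm openin_fst_max[OF cm] order_refl] is_chart_Rn[OF max_is_chart[OF dm] d(2)]])
  then show ?thesis unfolding smooth_at_def using cm dm c d openin_fst_max[OF cm] by blast
qed

lemma smooth_at_id:
  assumes M: "pre_manifold M" "y \<in> points M"
  shows "smooth_at M M (\<lambda>z. z) y"
proof -
  obtain c where c: "c \<in> atlas M" "y \<in> fst c" using atlas_cover[OF M] .
  note cm = atlas_max[OF M(1) c(1)]
  have "smooth_map (mdim M) (snd c ` fst c) (mdim M) (\<lambda>a. snd c (chart_inv c a))"
    using transition_smooth[OF M(1) cm cm] by simp
  then show ?thesis unfolding smooth_at_def using cm c openin_fst_max[OF cm] by blast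
qed

definition append_coords :: "nat \<Rightarrow> (nat \<Rightarrow> real) \<Rightarrow> (nat \<Rightarrow> real) \<Rightarrow> nat \<Rightarrow> real"
  where "append_coords p u v = (\<lambda>i. if i < p then u i else v (i - p))"

definition trunc :: "nat \<Rightarrow> (nat \<Rightarrow> real) \<Rightarrow> nat \<Rightarrow> real"
  where "trunc p w = (\<lambda>i. if i < p then w i else 0)"

definition shift :: "nat \<Rightarrow> (nat \<Rightarrow> real) \<Rightarrow> nat \<Rightarrow> real"
  where "shift p w = (\<lambda>i. w (p + i))"

lemma append_coords_Rn: "v \<in> Rn m \<Longrightarrow> append_coords p u v \<in> Rn (p + m)"
  by (auto simp: append_coords_def mem_Rn)

lemma trunc_Rn: "trunc p w \<in> Rn p"
  by (simp add: trunc_def mem_Rn)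

lemma shift_Rn: "w \<in> Rn (p + m) \<Longrightarrow> shift p w \<in> Rn m"
  by (simp add: shift_def mem_Rn)

lemma trunc_append_coords: "u \<in> Rn p \<Longrightarrow> trunc p (append_coords p u v) = u"
  by (auto simp: trunc_def append_coords_def mem_Rn fun_eq_iff)

lemma shift_append_coords: "shift p (append_coords p u v) = v"
  by (simp add: shift_def append_coords_def fun_eq_iff)

lemma append_coords_trunc_shift: "append_coords p (trunc p w) (shift p w) = w"
  by (simp add: append_coords_def trunc_def shift_def fun_eq_iff)

lemma linear_trunc: "linear (trunc p)"
  by (rule linearI) (auto simp: trunc_def fun_eq_iff)

lemma linear_shift: "linear (shift p)"
  by (rule linearI) (auto simp: shift_def fun_eq_iff)

lemma smooth_map_linear:
  assumes "openin (Euclidean_space n) U" "linear L" "\<And>v. v \<in> Rn n \<Longrightarrow> L v \<in> Rn m"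
  shows "smooth_map n U m L"
  using smooth_map_affine[OF assms, of 0] by simp

lemma jacobian_linear:
  assumes "linear L" "\<And>v. v \<in> Rn n \<Longrightarrow> L v \<in> Rn m" "v \<in> Rn n"
  shows "jacobian n m L x v = L v"
  using jacobian_affine[OF assms, of 0 x] by simp

lemma linear_Rn_continuous_map:
  assumes "linear L" "\<And>v. v \<in> Rn n \<Longrightarrow> L v \<in> Rn m"
  shows "continuous_map (Euclidean_space n) (Euclidean_space m) L"
  using smooth_map_continuous_map[OF openin_topspace smooth_map_linear[OF openin_topspace assms]] by simp

lemma smooth_map_append_coords:
  assumes "smooth_map n U p u" "smooth_map n U m v"
  shows "smooth_map n U (p + m) (\<lambda>a. append_coords p (u a) (v a))"
proof (rule smooth_mapI)
  show "append_coords p (u x) (v x) \<in> Rn (p + m)" if "x \<in> U" for x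
    using append_coords_Rn[OF smooth_map_mem[OF assms(2) that]] .
  show "Ck_on k n U (\<lambda>x. append_coords p (u x) (v x) j)" if "j < p + m" for j k
    using smooth_map_Ck[OF assms(1), of j k] smooth_map_Ck[OF assms(2), of "j - p" k] that
    by (cases "j < p") (simp_all add: append_coords_def del: Ck_on.simps)
qed

lemma prod_chart_eq: "snd (prod_chart p c d) (y, z) = append_coords p (snd c y) (snd d z)"
  "fst (prod_chart p c d) = fst c \<times> fst d"
  by (simp_all add: prod_chart_def append_coords_def)

text \<open>The image is a preimage of W: \<open>trunc\<close> and \<open>shift\<close> recover the
  two coordinate blocks continuously, and the inverse charts take them back to the factors.\<close>

lemma prod_chart_open_image:
  assumes c: "is_chart p X c" and d: "is_chart m Y d"
    and W: "openin (prod_topology X Y) W" "W \<subseteq> fst c \<times> fst d"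
  shows "openin (Euclidean_space (p + m)) (snd (prod_chart p c d) ` W)"
proof -
  have oc: "openin (Euclidean_space p) (snd c ` fst c)" and od: "openin (Euclidean_space m) (snd d ` fst d)"
    using c d by (auto simp: is_chart_def)
  have ct: "continuous_map (Euclidean_space (p + m)) (Euclidean_space p) (trunc p)"
    by (rule linear_Rn_continuous_map[OF linear_trunc trunc_Rn])
  have cs: "continuous_map (Euclidean_space (p + m)) (Euclidean_space m) (shift p)"
    by (rule linear_Rn_continuous_map[OF linear_shift shift_Rn])
  define A where "A = {w \<in> Rn (p + m). trunc p w \<in> snd c ` fst c} \<inter> {w \<in> Rn (p + m). shift p w \<in> snd d ` fst d}"
  have oA: "openin (Euclidean_space (p + m)) A"
    unfolding A_def by (intro openin_Int openin_continuous_map_preimage[OF ct oc] openin_continuous_map_preimage[OF cs od])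
  have c1: "continuous_map (subtopology (Euclidean_space (p + m)) A) X (chart_inv c \<circ> trunc p)"
    by (rule continuous_map_compose[OF _ chart_inv_continuous[OF c]])
       (use ct in \<open>auto simp: continuous_map_in_subtopology A_def intro: continuous_map_from_subtopology\<close>)
  have c2: "continuous_map (subtopology (Euclidean_space (p + m)) A) Y (chart_inv d \<circ> shift p)"
    by (rule continuous_map_compose[OF _ chart_inv_continuous[OF d]])
       (use cs in \<open>auto simp: continuous_map_in_subtopology A_def intro: continuous_map_from_subtopology\<close>)
  have "openin (Euclidean_space (p + m)) {w \<in> A. ((chart_inv c \<circ> trunc p) w, (chart_inv d \<circ> shift p) w) \<in> W}"
    by (rule openin_preimage_subtopology[OF continuous_map_pairedI[OF c1 c2] oA W(1)])
  also have "{w \<in> A. ((chart_inv c \<circ> trunc p) w, (chart_inv d \<circ> shift p) w) \<in> W} = snd (prod_chart p c d) ` W"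
  proof (intro subset_antisym subsetI)
    fix w assume w: "w \<in> {w \<in> A. ((chart_inv c \<circ> trunc p) w, (chart_inv d \<circ> shift p) w) \<in> W}"
    then have "trunc p w \<in> snd c ` fst c" "shift p w \<in> snd d ` fst d" by (auto simp: A_def)
    then have "snd (prod_chart p c d) ((chart_inv c \<circ> trunc p) w, (chart_inv d \<circ> shift p) w) = w"
      unfolding prod_chart_eq using chart_inv_right(2) append_coords_trunc_shift by (metis comp_apply)
    then show "w \<in> snd (prod_chart p c d) ` W" using w by (metis (mono_tags, lifting) image_eqI mem_Collect_eq)
  next
    fix w assume "w \<in> snd (prod_chart p c d) ` W"
    then obtain v where v: "v \<in> W" "w = snd (prod_chart p c d) v" by (elim imageE)
    obtain y z where "v = (y, z)" by (cases v)
    then have yz: "(y, z) \<in> W" "w = append_coords p (snd c y) (snd d z)"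
      using v by (simp_all add: prod_chart_eq)
    then have yc: "y \<in> fst c" and zd: "z \<in> fst d" using W(2) by auto
    have "trunc p w = snd c y" "shift p w = snd d z"
      using yz(2) trunc_append_coords[OF is_chart_Rn[OF c yc]] shift_append_coords by simp_all
    moreover have "w \<in> Rn (p + m)" using yz(2) append_coords_Rn[OF is_chart_Rn[OF d zd]] by simp
    ultimately show "w \<in> {w \<in> A. ((chart_inv c \<circ> trunc p) w, (chart_inv d \<circ> shift p) w) \<in> W}"
      using yz(1) yc zd by (simp add: A_def chart_inv_left[OF c] chart_inv_left[OF d])
  qed
  finally show ?thesis .
qed

lemma prod_mfd_simps [simp]: "mdim (prod_mfd M N) = mdim M + mdim N"
  "mtop (prod_mfd M N) = prod_topology (mtop M) (mtop N)"
  "atlas (prod_mfd M N) = {prod_chart (mdim M) c d |c d. c \<in> atlas M \<and> d \<in> atlas N}"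
  by (simp_all add: prod_mfd_def)

lemma prod_chart_inv:
  assumes "is_chart p X c" "is_chart m Y d" "y \<in> fst c" "z \<in> fst d"
  shows "chart_inv (prod_chart p c d) (append_coords p (snd c y) (snd d z)) = (y, z)"
proof -
  have mem: "append_coords p (snd c y) (snd d z) \<in> snd (prod_chart p c d) ` fst (prod_chart p c d)"
    by (rule image_eqI[of _ _ "(y, z)"]) (simp_all add: prod_chart_eq assms)
  obtain y' z' where yz: "chart_inv (prod_chart p c d) (append_coords p (snd c y) (snd d z)) = (y', z')"
    "y' \<in> fst c" "z' \<in> fst d"
    using chart_inv_right(1)[OF mem] by (metis mem_Sigma_iff prod_chart_eq(2) surj_pair)
  have eq: "append_coords p (snd c y') (snd d z') = append_coords p (snd c y) (snd d z)"
    using chart_inv_right(2)[OF mem] by (simp add: yz(1) prod_chart_eq)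
  have "snd c y' = snd c y"
    using arg_cong[OF eq, of "trunc p"] trunc_append_coords is_chart_Rn[OF assms(1)] yz(2) assms(3) by simp
  moreover have "snd d z' = snd d z" using arg_cong[OF eq, of "shift p"] by (simp add: shift_append_coords)
  ultimately have "chart_inv c (snd c y') = chart_inv c (snd c y)"
    "chart_inv d (snd d z') = chart_inv d (snd d z)" by simp_all
  then have "y' = y" "z' = z"
    by (simp_all only: chart_inv_left[OF assms(1)] chart_inv_left[OF assms(2)] yz(2,3) assms(3,4))
  then show ?thesis using yz(1) by simp
qed

lemma msmooth_onD:
  assumes "msmooth_on M W N f" "c \<in> atlas M" "d \<in> atlas N"
  shows "smooth_map (mdim M) (snd c ` {y \<in> fst c \<inter> W. f y \<in> fst d}) (mdim N) (\<lambda>a. snd d (f (chart_inv c a)))"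
  by (rule bspec[OF bspec[OF assms(1)[unfolded msmooth_on_def comp_def, THEN conjunct2, THEN conjunct2] assms(2)] assms(3)])

text \<open>This is the access to smoothness on a product: F is read in a product chart and composed
  with the concatenated coordinate maps of g and h. The group action is used in this form.\<close>

lemma smooth_at_pair_compose:
  assumes P: "pre_manifold P" and A: "pre_manifold A" and B: "pre_manifold B" and C: "pre_manifold C"
    and F: "msmooth (prod_mfd A B) C F" and g: "smooth_at P A g q" and h: "smooth_at P B h q"
  shows "smooth_at P C (\<lambda>q. F (g q, h q)) q"
proof -
  note gq = smooth_at_points[OF g] and hq = smooth_at_points[OF h]
  obtain c where c: "c \<in> max_atlas P" "q \<in> fst c" using g unfolding smooth_at_def by blast
  obtain a where a: "a \<in> atlas A" "g q \<in> fst a" using atlas_cover[OF A gq] .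
  obtain b where b: "b \<in> atlas B" "h q \<in> fst b" using atlas_cover[OF B hq] .
  note am = atlas_max[OF A a(1)] and bm = atlas_max[OF B b(1)]
  have cF: "continuous_map (prod_topology (mtop A) (mtop B)) (mtop C) F"
  proof -
    have "continuous_map (subtopology (mtop (prod_mfd A B)) (points (prod_mfd A B))) (mtop C) F"
      using F unfolding msmooth_on_def by (elim conjE)
    then show ?thesis by (simp only: subtopology_topspace prod_mfd_simps)
  qed
  then have "F (g q, h q) \<in> points C" using gq hq unfolding continuous_map_def by auto
  then obtain e where e: "e \<in> atlas C" "F (g q, h q) \<in> fst e" using atlas_cover[OF C] by blast
  note em = atlas_max[OF C e(1)]
  let ?ab = "prod_chart (mdim A) a b"
  define W where "W = {w \<in> fst a \<times> fst b. F w \<in> fst e}"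
  have "openin (prod_topology (mtop A) (mtop B)) {w \<in> fst a \<times> fst b. F w \<in> fst e}"
    using continuous_map_from_subtopology[OF cF] openin_fst_max[OF am] openin_fst_max[OF bm] openin_fst_max[OF em]
    by (intro openin_preimage_subtopology) (auto simp: openin_prod_Times_iff)
  then have oW: "openin (prod_topology (mtop A) (mtop B)) W" by (simp add: W_def)
  have W_eq: "{y \<in> fst ?ab \<inter> points (prod_mfd A B). F y \<in> fst e} = W"
    using openin_subset[OF oW] by (auto simp: W_def prod_chart_eq)
  have ab: "?ab \<in> atlas (prod_mfd A B)"
    unfolding prod_mfd_simps mem_Collect_eq by (intro exI[of _ a] exI[of _ b] conjI refl a(1) b(1))
  have sF: "smooth_map (mdim A + mdim B) (snd ?ab ` W) (mdim C) (\<lambda>w. snd e (F (chart_inv ?ab w)))"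
    using msmooth_onD[OF F ab e(1)] unfolding W_eq by (simp only: prod_mfd_simps)
  have oabW: "openin (Euclidean_space (mdim A + mdim B)) (snd ?ab ` W)"
    by (rule prod_chart_open_image[OF max_is_chart[OF am] max_is_chart[OF bm] oW]) (auto simp: W_def)
  have gh: "(g q, h q) \<in> W" using a b e by (simp add: W_def)
  obtain W1 W2 where W12: "openin (mtop A) W1" "openin (mtop B) W2" "g q \<in> W1" "h q \<in> W2" "W1 \<times> W2 \<subseteq> W"
    using oW[unfolded openin_prod_topology_alt, rule_format, OF gh] by (elim exE conjE) (rule that)
  obtain V1 where V1: "openin (mtop P) V1" "q \<in> V1" "g ` V1 \<subseteq> W1" using smooth_at_preimage[OF g W12(1,3)] .
  obtain V2 where V2: "openin (mtop P) V2" "q \<in> V2" "h ` V2 \<subseteq> W2" using smooth_at_preimage[OF h W12(2,4)] .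
  obtain V3 where V3: "openin (mtop P) V3" "q \<in> V3" "V3 \<subseteq> V1" "V3 \<subseteq> fst c" "g ` V3 \<subseteq> fst a"
    "smooth_map (mdim P) (snd c ` V3) (mdim A) (\<lambda>u. snd a (g (chart_inv c u)))"
    using smooth_at_charts[OF P A g c am a(2) V1(1,2)] .
  obtain V4 where V4: "openin (mtop P) V4" "q \<in> V4" "V4 \<subseteq> V2" "V4 \<subseteq> fst c" "h ` V4 \<subseteq> fst b"
    "smooth_map (mdim P) (snd c ` V4) (mdim B) (\<lambda>u. snd b (h (chart_inv c u)))"
    using smooth_at_charts[OF P B h c bm b(2) V2(1,2)] .
  let ?V = "V3 \<inter> V4"
  have oV: "openin (mtop P) ?V" using V3(1) V4(1) by blast
  have Vc: "?V \<subseteq> fst c" using V3(4) by blast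
  note ocV = max_open_image[OF c(1) oV Vc]
  have VW: "(g z, h z) \<in> W" "g z \<in> fst a" "h z \<in> fst b" "F (g z, h z) \<in> fst e" if "z \<in> ?V" for z
  proof -
    have "g z \<in> W1" "h z \<in> W2" using that V1(3) V2(3) V3(3) V4(3) by (simp_all add: image_subset_iff subset_iff)
    then show "(g z, h z) \<in> W" using W12(5) by auto
    then show "g z \<in> fst a" "h z \<in> fst b" "F (g z, h z) \<in> fst e" by (auto simp: W_def)
  qed
  have s1: "smooth_map (mdim P) (snd c ` ?V) (mdim A) (\<lambda>u. snd a (g (chart_inv c u)))"
    by (rule smooth_map_subset[OF max_open_image[OF c(1) V3(1,4)] ocV _ V3(6)]) auto
  have s2: "smooth_map (mdim P) (snd c ` ?V) (mdim B) (\<lambda>u. snd b (h (chart_inv c u)))"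
    by (rule smooth_map_subset[OF max_open_image[OF c(1) V4(1,4)] ocV _ V4(6)]) auto
  let ?G = "\<lambda>u. append_coords (mdim A) (snd a (g (chart_inv c u))) (snd b (h (chart_inv c u)))"
  have inW: "?G u \<in> snd ?ab ` W" if u: "u \<in> snd c ` ?V" for u
  proof -
    obtain z where z: "z \<in> ?V" "u = snd c z" using u by (rule imageE)
    have "chart_inv c u = z" using max_inv_left[OF c(1), of z] z Vc by (simp only: subsetD)
    then have "?G u = snd ?ab (g z, h z)" by (simp add: prod_chart_eq)
    then show ?thesis using VW(1)[OF z(1)] by (simp only: imageI)
  qed
  have "smooth_map (mdim P) (snd c ` ?V) (mdim C) (\<lambda>u. snd e (F (chart_inv ?ab (?G u))))"
    by (rule smooth_map_compose[OF ocV oabW smooth_map_append_coords[OF s1 s2] sF]) (use inW in blast)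
  then have "smooth_map (mdim P) (snd c ` ?V) (mdim C) (\<lambda>u. snd e (F (g (chart_inv c u), h (chart_inv c u))))"
  proof (rule smooth_map_cong[OF ocV, rotated])
    fix u assume u: "u \<in> snd c ` ?V"
    then obtain z where z: "z \<in> ?V" "u = snd c z" by (rule imageE)
    have "chart_inv c u = z" using max_inv_left[OF c(1), of z] z Vc by (simp only: subsetD)
    then show "snd e (F (chart_inv ?ab (?G u))) = snd e (F (g (chart_inv c u), h (chart_inv c u)))"
      using prod_chart_inv[OF max_is_chart[OF am] max_is_chart[OF bm] VW(2)[OF z(1)] VW(3)[OF z(1)]] by simp
  qed
  moreover have "(\<lambda>q. F (g q, h q)) ` ?V \<subseteq> fst e" using VW(4) by blast
  moreover have "q \<in> ?V" using V3(2) V4(2) by simp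
  ultimately show ?thesis unfolding smooth_at_def using c(1) em oV Vc
    by (intro bexI[of _ c] bexI[of _ e] exI[of _ ?V]) simp_all
qed

subsection \<open>Tangent vectors in charts\<close>

definition rep_jac :: "'a mfd \<Rightarrow> 'b mfd \<Rightarrow> 'a chart \<Rightarrow> 'b chart \<Rightarrow> ('a \<Rightarrow> 'b) \<Rightarrow> 'a
    \<Rightarrow> (nat \<Rightarrow> real) \<Rightarrow> nat \<Rightarrow> real"
  where "rep_jac M N c d f y = jacobian (mdim M) (mdim N) (\<lambda>a. snd d (f (chart_inv c a))) (snd c y)"

lemma linear_rep_jac: "linear (rep_jac M N c d f y)"
  unfolding rep_jac_def by (rule linear_jacobian)

lemma rep_jac_Rn: "rep_jac M N c d f y v \<in> Rn (mdim N)"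
  unfolding rep_jac_def by (rule jacobian_Rn)

lemma rep_jac_cong:
  assumes c: "c \<in> max_atlas M" "y \<in> fst c"
    and W: "openin (mtop M) W" "y \<in> W" "\<And>z. z \<in> W \<Longrightarrow> f z = g z"
  shows "rep_jac M N c d f y v = rep_jac M N c d g y v"
  unfolding rep_jac_def
proof (rule jacobian_cong)
  show "openin (Euclidean_space (mdim M)) (snd c ` (W \<inter> fst c))"
    using W(1) openin_fst_max[OF c(1)] by (intro max_open_image[OF c(1)]) auto
  show "snd c y \<in> snd c ` (W \<inter> fst c)" using W(2) c(2) by auto
  show "snd d (f (chart_inv c a)) = snd d (g (chart_inv c a))" if "a \<in> snd c ` (W \<inter> fst c)" for a
    using that W(3) by (auto simp: max_inv_left[OF c(1)])
qed

lemma rep_jac_id: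
  assumes c: "c \<in> max_atlas M" "y \<in> fst c" and v: "v \<in> Rn (mdim M)"
  shows "rep_jac M M c c (\<lambda>z. z) y v = v"
proof -
  have "rep_jac M M c c (\<lambda>z. z) y v = jacobian (mdim M) (mdim M) (\<lambda>a. a) (snd c y) v"
    unfolding rep_jac_def
  proof (rule jacobian_cong)
    show "openin (Euclidean_space (mdim M)) (snd c ` fst c)"
      by (rule max_open_image[OF c(1) openin_fst_max[OF c(1)] order_refl])
    show "snd c y \<in> snd c ` fst c" using c(2) by (rule imageI)
  qed (rule chart_inv_right(2))
  then show ?thesis using jacobian_id[OF v] by simp
qed

lemma rep_jac_compose:
  assumes M: "pre_manifold M" and N: "pre_manifold N" and P: "pre_manifold P"
    and f: "smooth_at M N f y" and g: "smooth_at N P g (f y)"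
    and c: "c \<in> max_atlas M" "y \<in> fst c" and d: "d \<in> max_atlas N" "f y \<in> fst d"
    and e: "e \<in> max_atlas P" "g (f y) \<in> fst e"
  shows "rep_jac M P c e (\<lambda>z. g (f z)) y v = rep_jac N P d e g (f y) (rep_jac M N c d f y v)"
proof -
  obtain V' where V': "openin (mtop N) V'" "f y \<in> V'" "V' \<subseteq> fst d" "V' \<subseteq> fst d" "g ` V' \<subseteq> fst e"
    "smooth_map (mdim N) (snd d ` V') (mdim P) (\<lambda>a. snd e (g (chart_inv d a)))"
    using smooth_at_charts[OF N P g d e openin_fst_max[OF d(1)] d(2)] .
  obtain W where W: "openin (mtop M) W" "y \<in> W" "f ` W \<subseteq> V'"
    using smooth_at_preimage[OF f V'(1,2)] .
  obtain V where V: "openin (mtop M) V" "y \<in> V" "V \<subseteq> W" "V \<subseteq> fst c" "f ` V \<subseteq> fst d"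
    "smooth_map (mdim M) (snd c ` V) (mdim N) (\<lambda>a. snd d (f (chart_inv c a)))"
    using smooth_at_charts[OF M N f c d W(1,2)] .
  note oV = max_open_image[OF c(1) V(1,4)] and oV' = max_open_image[OF d(1) V'(1,3)]
  have inv: "chart_inv c (snd c z) = z" "f z \<in> V'" "chart_inv d (snd d (f z)) = f z" if "z \<in> V" for z
  proof -
    show "f z \<in> V'" using that V(3) W(3) by auto
    then show "chart_inv d (snd d (f z)) = f z" using V'(3) max_inv_left[OF d(1)] by (simp add: subsetD)
    show "chart_inv c (snd c z) = z" using that V(4) max_inv_left[OF c(1)] by (simp add: subsetD)
  qed
  have yV: "snd c y \<in> snd c ` V" using V(2) by (rule imageI)
  have "jacobian (mdim M) (mdim P) (\<lambda>a. snd e (g (f (chart_inv c a)))) (snd c y) v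
      = jacobian (mdim M) (mdim P) (\<lambda>a. snd e (g (chart_inv d (snd d (f (chart_inv c a)))))) (snd c y) v"
    by (rule jacobian_cong[OF oV yV]) (auto simp: inv)
  also have "\<dots> = jacobian (mdim N) (mdim P) (\<lambda>a. snd e (g (chart_inv d a))) (snd d (f (chart_inv c (snd c y))))
      (jacobian (mdim M) (mdim N) (\<lambda>a. snd d (f (chart_inv c a))) (snd c y) v)"
    by (rule jacobian_compose[OF oV oV' V(6) V'(6) _ yV]) (auto simp: inv)
  finally show ?thesis by (simp add: rep_jac_def inv(1)[OF V(2)])
qed

lemma max_points: "c \<in> max_atlas M \<Longrightarrow> y \<in> fst c \<Longrightarrow> y \<in> points M"
  using openin_subset[OF openin_fst_max] by (rule subsetD)

lemma transition_compose:
  assumes M: "pre_manifold M" and c: "c \<in> max_atlas M" "y \<in> fst c" and d: "d \<in> max_atlas M" "y \<in> fst d"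
    and e: "e \<in> max_atlas M" "y \<in> fst e"
  shows "rep_jac M M d e (\<lambda>z. z) y (rep_jac M M c d (\<lambda>z. z) y v) = rep_jac M M c e (\<lambda>z. z) y v"
  using rep_jac_compose[OF M M M smooth_at_id smooth_at_id c d e] max_points[OF c] M by simp

definition some_chart :: "'a mfd \<Rightarrow> 'a \<Rightarrow> 'a chart"
  where "some_chart M x = (SOME c. c \<in> charts_at M x)"

text \<open>A tangent vector records components for charts of the given atlas. To have coordinates
  in any chart of \<open>max_atlas\<close>, such as an adapted one, the component in a chosen atlas
  chart is transported by the transition Jacobian; \<open>tvec\<close> goes back.\<close>

definition tcoord :: "'a mfd \<Rightarrow> 'a chart \<Rightarrow> 'a \<Rightarrow> ('a chart \<Rightarrow> nat \<Rightarrow> real) \<Rightarrow> nat \<Rightarrow> real"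
  where "tcoord M c x t = rep_jac M M (some_chart M x) c (\<lambda>z. z) x (t (some_chart M x))"

definition tvec :: "'a mfd \<Rightarrow> 'a chart \<Rightarrow> 'a \<Rightarrow> (nat \<Rightarrow> real) \<Rightarrow> 'a chart \<Rightarrow> nat \<Rightarrow> real"
  where "tvec M c x v = (\<lambda>d. if d \<in> charts_at M x then rep_jac M M c d (\<lambda>z. z) x v else 0)"

lemma some_chart:
  assumes "pre_manifold M" "x \<in> points M"
  shows "some_chart M x \<in> charts_at M x" "some_chart M x \<in> max_atlas M" "x \<in> fst (some_chart M x)"
proof -
  obtain c where "c \<in> atlas M" "x \<in> fst c" using atlas_cover[OF assms] .
  then have "\<exists>c. c \<in> charts_at M x" unfolding charts_at_def by (intro exI[of _ c]) simp
  then show *: "some_chart M x \<in> charts_at M x" unfolding some_chart_def by (rule someI_ex)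
  then have s: "some_chart M x \<in> atlas M" "x \<in> fst (some_chart M x)"
    unfolding charts_at_def by simp_all
  show "some_chart M x \<in> max_atlas M" by (rule atlas_max[OF assms(1) s(1)])
  show "x \<in> fst (some_chart M x)" by (rule s(2))
qed

lemma charts_at_max:
  assumes "pre_manifold M" "c \<in> charts_at M x" shows "c \<in> max_atlas M" "x \<in> fst c"
proof -
  have s: "c \<in> atlas M" "x \<in> fst c" using assms(2) unfolding charts_at_def by simp_all
  show "c \<in> max_atlas M" by (rule atlas_max[OF assms(1) s(1)])
  show "x \<in> fst c" by (rule s(2))
qed

lemma tangent_space_iff:
  "t \<in> tangent_space M x \<longleftrightarrow> (\<forall>c\<in>charts_at M x. t c \<in> Rn (mdim M)) \<and>
    (\<forall>c. c \<notin> charts_at M x \<longrightarrow> t c = 0) \<and>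
    (\<forall>c\<in>charts_at M x. \<forall>d\<in>charts_at M x. t d = rep_jac M M c d (\<lambda>z. z) x (t c))"
  by (simp add: tangent_space_def rep_jac_def comp_def)

lemma tangent_space_transform:
  assumes "t \<in> tangent_space M x" "c \<in> charts_at M x" "d \<in> charts_at M x"
  shows "t d = rep_jac M M c d (\<lambda>z. z) x (t c)"
  by (rule assms(1)[unfolded tangent_space_iff, THEN conjunct2, THEN conjunct2, THEN bspec, OF assms(2), THEN bspec, OF assms(3)])

lemma tangent_space_outside: "t \<in> tangent_space M x \<Longrightarrow> c \<notin> charts_at M x \<Longrightarrow> t c = 0"
  by (rule tangent_space_iff[THEN iffD1, THEN conjunct2, THEN conjunct1, rule_format])

lemma linear_tcoord: "linear (tcoord M c x)"
  unfolding tcoord_def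
  by (rule linearI) (simp_all add: real_vector.linear_add[OF linear_rep_jac] real_vector.linear_scale[OF linear_rep_jac] scaleR_fun_def[of _ "_ :: 'a chart \<Rightarrow> _"])

lemma linear_tvec: "linear (tvec M c x)"
  by (rule linearI) (auto simp: tvec_def fun_eq_iff real_vector.linear_add[OF linear_rep_jac] real_vector.linear_scale[OF linear_rep_jac])

lemma tcoord_Rn: "tcoord M c x t \<in> Rn (mdim M)"
  unfolding tcoord_def by (rule rep_jac_Rn)

context
  fixes M :: "'a mfd" and c :: "'a chart" and x :: 'a
  assumes M: "pre_manifold M" and c: "c \<in> max_atlas M" "x \<in> fst c"
begin

lemma tvec_tangent: "tvec M c x v \<in> tangent_space M x"
  unfolding tangent_space_iff
  using transition_compose[OF M c charts_at_max[OF M] charts_at_max[OF M]]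
  by (auto simp: tvec_def rep_jac_Rn)

lemma tcoord_tvec: "v \<in> Rn (mdim M) \<Longrightarrow> tcoord M c x (tvec M c x v) = v"
  using some_chart[OF M max_points[OF c]] transition_compose[OF M c some_chart(2,3)[OF M max_points[OF c]] c]
    rep_jac_id[OF c]
  by (simp add: tcoord_def tvec_def)

lemma tvec_tcoord: assumes t: "t \<in> tangent_space M x" shows "tvec M c x (tcoord M c x t) = t"
proof
  fix d
  show "tvec M c x (tcoord M c x t) d = t d"
  proof (cases "d \<in> charts_at M x")
    case True
    note s = some_chart[OF M max_points[OF c]]
    have "t d = rep_jac M M (some_chart M x) d (\<lambda>z. z) x (t (some_chart M x))"
      by (rule tangent_space_transform[OF t s(1) True])
    then show ?thesis
      using True transition_compose[OF M s(2,3) c charts_at_max[OF M True]] by (simp add: tvec_def tcoord_def)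
  qed (simp add: tvec_def tangent_space_outside[OF t])
qed

lemma bij_tcoord: "bij_betw (tcoord M c x) (tangent_space M x) (Rn (mdim M))"
  by (rule bij_betw_byWitness[where f'="tvec M c x"]) (auto simp: tcoord_tvec tvec_tcoord tcoord_Rn tvec_tangent)

end

text \<open>The definition uses one chosen chart at x and all atlas charts at \<open>f x\<close>.
  The chain rule with transition maps on both sides shows that any pair of charts gives the same
  vector.\<close>

lemma differential_coord:
  assumes M: "pre_manifold M" and N: "pre_manifold N" and f: "smooth_at M N f x"
    and c: "c \<in> max_atlas M" "x \<in> fst c" and d: "d \<in> max_atlas N" "f x \<in> fst d"
    and t: "t \<in> tangent_space M x"
  shows "differential M N f x t = tvec N d (f x) (rep_jac M N c d f x (tcoord M c x t))"
proof
  fix e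
  have xM: "x \<in> points M" by (rule max_points[OF c])
  note s = some_chart[OF M xM]
  show "differential M N f x t e = tvec N d (f x) (rep_jac M N c d f x (tcoord M c x t)) e"
  proof (cases "e \<in> charts_at N (f x)")
    case True
    note e = charts_at_max[OF N True]
    have "differential M N f x t e = rep_jac M N (some_chart M x) e f x (t (some_chart M x))"
      using True by (simp add: differential_def some_chart_def[symmetric] rep_jac_def comp_def Let_def)
    also have "\<dots> = rep_jac N N d e (\<lambda>z. z) (f x) (rep_jac M N (some_chart M x) d f x (t (some_chart M x)))"
      using rep_jac_compose[OF M N N f smooth_at_id[OF N smooth_at_points[OF f]] s(2,3) d e] by simp
    also have "rep_jac M N (some_chart M x) d f x (t (some_chart M x)) = rep_jac M N c d f x (tcoord M c x t)"
      using rep_jac_compose[OF M M N smooth_at_id[OF M xM] f s(2,3) c d] by (simp add: tcoord_def)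
    finally show ?thesis using True by (simp add: tvec_def)
  qed (simp add: differential_def tvec_def)
qed

lemma subspace_tangent_space:
  assumes "pre_manifold M" "x \<in> points M" shows "subspace (tangent_space M x)"
proof -
  note s = some_chart(2,3)[OF assms]
  have "tangent_space M x = tvec M (some_chart M x) x ` Rn (mdim M)"
  proof (intro subset_antisym subsetI)
    fix t assume t: "t \<in> tangent_space M x"
    show "t \<in> tvec M (some_chart M x) x ` Rn (mdim M)"
      by (rule image_eqI[where x="tcoord M (some_chart M x) x t"])
         (simp_all only: tvec_tcoord[OF assms(1) s t] tcoord_Rn)
  next
    fix t assume "t \<in> tvec M (some_chart M x) x ` Rn (mdim M)"
    then obtain v where "t = tvec M (some_chart M x) x v" by (elim imageE)
    then show "t \<in> tangent_space M x" by (simp only: tvec_tangent[OF assms(1) s])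
  qed
  then show ?thesis
    using real_vector.linear_subspace_image[OF linear_tvec subspace_Rn] by simp
qed

subsection \<open>Submanifolds\<close>

lemma openin_Rn_restrict:
  assumes "openin (Euclidean_space m) U" "k \<le> m" shows "openin (Euclidean_space k) (U \<inter> Rn k)"
proof -
  have "continuous_map (Euclidean_space k) (Euclidean_space m) (\<lambda>x. x)"
    by (rule linear_Rn_continuous_map[OF linear_ident_fun]) (use assms(2) in \<open>auto simp: mem_Rn\<close>)
  from openin_continuous_map_preimage[OF this assms(1)] show ?thesis by (simp add: Collect_conj_eq Int_commute)
qed

lemma smooth_map_inclusion:
  assumes "openin (Euclidean_space k) U" "k \<le> m" shows "smooth_map k U m (\<lambda>x. x)"
  by (rule smooth_map_linear[OF assms(1) linear_ident_fun]) (use assms(2) in \<open>auto simp: mem_Rn\<close>)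

lemma smooth_map_restrict_codomain:
  assumes "smooth_map n U m F" "k \<le> m" "F ` U \<subseteq> Rn k" shows "smooth_map n U k F"
  using assms unfolding smooth_map_def by simp

lemma sub_mfd_simps [simp]: "mdim (sub_mfd M k S) = k" "mtop (sub_mfd M k S) = subtopology (mtop M) S"
  "atlas (sub_mfd M k S) = {(fst c \<inter> S, snd c) |c. c \<in> adapted_charts M k S}"
  by (simp_all add: sub_mfd_def)

lemma adapted_max: "c \<in> adapted_charts M k S \<Longrightarrow> c \<in> max_atlas M"
  by (simp add: adapted_charts_def max_atlas_def)

lemma adapted_iff: "c \<in> adapted_charts M k S \<Longrightarrow> y \<in> fst c \<Longrightarrow> y \<in> S \<longleftrightarrow> snd c y \<in> Rn k"
  unfolding adapted_charts_def by blast

lemma adapted_image: "c \<in> adapted_charts M k S \<Longrightarrow> snd c ` (fst c \<inter> S) = snd c ` fst c \<inter> Rn k"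
  using adapted_iff by fastforce

lemma adapted_inv:
  assumes c: "c \<in> adapted_charts M k S" and a: "a \<in> snd c ` (fst c \<inter> S)"
  shows "chart_inv (fst c \<inter> S, snd c) a = chart_inv c a"
proof -
  have "a \<in> snd (fst c \<inter> S, snd c) ` fst (fst c \<inter> S, snd c)" using a by simp
  note r = chart_inv_right[OF this]
  then have "chart_inv (fst c \<inter> S, snd c) a \<in> fst c" "snd c (chart_inv (fst c \<inter> S, snd c) a) = a" by simp_all
  then show ?thesis using max_inv_left[OF adapted_max[OF c]] by metis
qed

context
  fixes M :: "'a mfd" and k :: nat and S :: "'a set"
  assumes M: "pre_manifold M" and S: "submanifold M k S"
begin

lemma submanifold_dim: "k \<le> mdim M"
  using S by (simp add: submanifold_def)

lemma submanifold_points: "S \<subseteq> points M"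
  using S by (simp add: submanifold_def)

lemma sub_chart_is_chart:
  assumes c: "c \<in> adapted_charts M k S"
  shows "is_chart k (subtopology (mtop M) S) (fst c \<inter> S, snd c)"
  unfolding is_chart_def fst_conv snd_conv
proof (intro conjI)
  note cm = adapted_max[OF c]
  have o: "openin (Euclidean_space (mdim M)) (snd c ` fst c)"
    by (rule max_open_image[OF cm openin_fst_max[OF cm] order_refl])
  show "openin (subtopology (mtop M) S) (fst c \<inter> S)"
    by (rule openin_subtopology_Int[OF openin_fst_max[OF cm]])
  show oS: "openin (Euclidean_space k) (snd c ` (fst c \<inter> S))"
    unfolding adapted_image[OF c] by (rule openin_Rn_restrict[OF o submanifold_dim])
  have h: "homeomorphic_map (subtopology (mtop M) (fst c)) (subtopology (Euclidean_space (mdim M)) (snd c ` fst c)) (snd c)"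
    using max_is_chart[OF cm] by (simp add: is_chart_def)
  have t1: "topspace (subtopology (mtop M) (fst c)) = fst c"
    using openin_subset[OF openin_fst_max[OF cm]] by auto
  have t2: "topspace (subtopology (Euclidean_space (mdim M)) (snd c ` fst c)) = snd c ` fst c"
    using openin_Rn_subset[OF o] by auto
  have "homeomorphic_map (subtopology (subtopology (mtop M) (fst c)) S)
     (subtopology (subtopology (Euclidean_space (mdim M)) (snd c ` fst c)) (Rn k)) (snd c)"
    by (rule homeomorphic_map_subtopologies[OF h]) (simp only: t1 t2 adapted_image[OF c])
  moreover have "subtopology (subtopology (mtop M) (fst c)) S = subtopology (subtopology (mtop M) S) (fst c \<inter> S)"
    by (simp add: subtopology_subtopology inf.commute inf.left_commute)
  moreover have "subtopology (subtopology (Euclidean_space (mdim M)) (snd c ` fst c)) (Rn k)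
    = subtopology (Euclidean_space k) (snd c ` (fst c \<inter> S))"
    unfolding subtopology_subtopology adapted_image[OF c, symmetric]
    using openin_Rn_subset[OF o] openin_Rn_subset[OF oS] subtopology_Rn
    by (metis adapted_image[OF c] inf.coboundedI1)
  ultimately show "homeomorphic_map (subtopology (subtopology (mtop M) S) (fst c \<inter> S))
     (subtopology (Euclidean_space k) (snd c ` (fst c \<inter> S))) (snd c)" by simp
qed

lemma sub_transition:
  assumes c: "c \<in> adapted_charts M k S" and d: "d \<in> adapted_charts M k S"
  shows "smooth_map k (snd c ` (fst c \<inter> S \<inter> (fst d \<inter> S))) k (\<lambda>a. snd d (chart_inv (fst c \<inter> S, snd c) a))"
proof -
  note cm = adapted_max[OF c] and dm = adapted_max[OF d]
  let ?U = "snd c ` (fst c \<inter> S \<inter> (fst d \<inter> S))" and ?O = "snd c ` (fst c \<inter> fst d)"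
  have oO: "openin (Euclidean_space (mdim M)) ?O"
    using openin_fst_max[OF cm] openin_fst_max[OF dm] by (intro max_open_image[OF cm]) auto
  have "?U = ?O \<inter> Rn k" using adapted_iff[OF c] by fastforce
  then have oU: "openin (Euclidean_space k) ?U" using openin_Rn_restrict[OF oO submanifold_dim] by simp
  have s: "smooth_map k ?U (mdim M) (\<lambda>a. snd d (chart_inv c a))"
    by (rule smooth_map_compose[OF oU oO smooth_map_inclusion[OF oU submanifold_dim] transition_smooth[OF M cm dm]]) auto
  have "smooth_map k ?U k (\<lambda>a. snd d (chart_inv c a))"
  proof (rule smooth_map_restrict_codomain[OF s submanifold_dim])
    show "(\<lambda>a. snd d (chart_inv c a)) ` ?U \<subseteq> Rn k"
      using adapted_iff[OF d] by (auto simp: max_inv_left[OF cm])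
  qed
  then show ?thesis
    by (rule smooth_map_cong[OF oU, rotated]) (use adapted_inv[OF c] in force)
qed

lemma pre_manifold_sub: "pre_manifold (sub_mfd M k S)"
  unfolding pre_manifold_def sub_mfd_simps
proof (intro conjI ballI)
  fix c' assume "c' \<in> {(fst c \<inter> S, snd c) |c. c \<in> adapted_charts M k S}"
  then obtain c where c: "c' = (fst c \<inter> S, snd c)" "c \<in> adapted_charts M k S" by (elim CollectE exE conjE)
  show "is_chart k (subtopology (mtop M) S) c'" unfolding c(1) by (rule sub_chart_is_chart[OF c(2)])
  fix d' assume "d' \<in> {(fst c \<inter> S, snd c) |c. c \<in> adapted_charts M k S}"
  then obtain d where d: "d' = (fst d \<inter> S, snd d)" "d \<in> adapted_charts M k S" by (elim CollectE exE conjE)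
  show "charts_compatible k c' d'"
    unfolding charts_compatible_def c(1) d(1) comp_def fst_conv snd_conv
    using sub_transition[OF c(2) d(2)] sub_transition[OF d(2) c(2)] by (simp add: Int_commute)
next
  have "S \<subseteq> \<Union>(fst ` adapted_charts M k S)" using S unfolding submanifold_def by blast
  then have "(\<Union>c\<in>adapted_charts M k S. fst c \<inter> S) = S" by blast
  moreover have "{(fst c \<inter> S, snd c) |c. c \<in> adapted_charts M k S} = (\<lambda>c. (fst c \<inter> S, snd c)) ` adapted_charts M k S"
    by blast
  ultimately show "\<Union> (fst ` {(fst c \<inter> S, snd c) |c. c \<in> adapted_charts M k S}) = topspace (subtopology (mtop M) S)"
    using submanifold_points by (simp add: image_image Int_absorb1)
qed

lemma sub_chart_max: "c \<in> adapted_charts M k S \<Longrightarrow> (fst c \<inter> S, snd c) \<in> max_atlas (sub_mfd M k S)"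
  by (rule atlas_max[OF pre_manifold_sub])
     (unfold sub_mfd_simps mem_Collect_eq, intro exI[of _ c] conjI refl)

lemma smooth_at_inclusion:
  assumes "x \<in> S" shows "smooth_at (sub_mfd M k S) M (\<lambda>y. y) x"
proof -
  obtain c where c: "c \<in> adapted_charts M k S" "x \<in> fst c" using S assms unfolding submanifold_def by blast
  have o: "openin (Euclidean_space k) (snd c ` (fst c \<inter> S))"
    using sub_chart_is_chart[OF c(1)] by (simp add: is_chart_def)
  have "smooth_map k (snd c ` (fst c \<inter> S)) (mdim M) (\<lambda>a. snd c (chart_inv (fst c \<inter> S, snd c) a))"
    by (rule smooth_map_cong[OF o _ smooth_map_inclusion[OF o submanifold_dim]])
       (use adapted_inv[OF c(1)] in \<open>force simp: max_inv_left[OF adapted_max[OF c(1)]]\<close>)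
  then show ?thesis
    unfolding smooth_at_def using sub_chart_max[OF c(1)] adapted_max[OF c(1)] assms c(2)
      openin_fst_max[OF sub_chart_max[OF c(1)]]
    by (intro bexI[of _ "(fst c \<inter> S, snd c)"] bexI[of _ c] exI[of _ "fst c \<inter> S"]) auto
qed

lemma rep_jac_inclusion:
  assumes c: "c \<in> adapted_charts M k S" "x \<in> fst c" "x \<in> S" and v: "v \<in> Rn k"
  shows "rep_jac (sub_mfd M k S) M (fst c \<inter> S, snd c) c (\<lambda>y. y) x v = v"
proof -
  have o: "openin (Euclidean_space k) (snd c ` (fst c \<inter> S))"
    using sub_chart_is_chart[OF c(1)] by (simp add: is_chart_def)
  have "rep_jac (sub_mfd M k S) M (fst c \<inter> S, snd c) c (\<lambda>y. y) x v = jacobian k (mdim M) (\<lambda>a. a) (snd c x) v"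
    unfolding rep_jac_def sub_mfd_simps snd_conv
    by (rule jacobian_cong[OF o]) (use c adapted_inv[OF c(1)] in \<open>force simp: max_inv_left[OF adapted_max[OF c(1)]]\<close>)+
  also have "\<dots> = v"
    by (rule jacobian_linear[OF linear_ident_fun _ v]) (use submanifold_dim in \<open>auto simp: mem_Rn\<close>)
  finally show ?thesis .
qed

text \<open>In an adapted chart the inclusion of S is the inclusion of \<open>Rn k\<close>, which is
  its own Jacobian.\<close>

lemma sub_tangent_space_coord:
  assumes c: "c \<in> adapted_charts M k S" "x \<in> fst c" "x \<in> S"
  shows "sub_tangent_space M k S x = {t \<in> tangent_space M x. tcoord M c x t \<in> Rn k}"
proof -
  let ?N = "sub_mfd M k S" and ?c = "(fst c \<inter> S, snd c)"
  note cm = adapted_max[OF c(1)] and cN = sub_chart_max[OF c(1)]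
  have xc: "x \<in> fst ?c" using c by simp
  have Rn_le: "v \<in> Rn (mdim M)" if "v \<in> Rn k" for v using that submanifold_dim by (auto simp: mem_Rn)
  have diff: "differential ?N M (\<lambda>y. y) x t = tvec M c x (tcoord ?N ?c x t)" if "t \<in> tangent_space ?N x" for t
    using differential_coord[OF pre_manifold_sub M smooth_at_inclusion[OF c(3)] cN xc cm c(2) that]
      rep_jac_inclusion[OF c] tcoord_Rn[of ?N ?c x t] by simp
  show ?thesis
  proof (intro subset_antisym subsetI)
    fix t assume "t \<in> sub_tangent_space M k S x"
    then obtain u where u: "u \<in> tangent_space ?N x" "t = tvec M c x (tcoord ?N ?c x u)"
      unfolding sub_tangent_space_def using diff by auto
    have "tcoord ?N ?c x u \<in> Rn k" using tcoord_Rn[of ?N ?c x u] by simp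
    then show "t \<in> {t \<in> tangent_space M x. tcoord M c x t \<in> Rn k}"
      using u(2) tvec_tangent[OF M cm c(2)] tcoord_tvec[OF M cm c(2) Rn_le] by simp
  next
    fix t assume t: "t \<in> {t \<in> tangent_space M x. tcoord M c x t \<in> Rn k}"
    let ?u = "tvec ?N ?c x (tcoord M c x t)"
    have u: "?u \<in> tangent_space ?N x" by (rule tvec_tangent[OF pre_manifold_sub cN xc])
    have "differential ?N M (\<lambda>y. y) x ?u = tvec M c x (tcoord M c x t)"
      using diff[OF u] tcoord_tvec[OF pre_manifold_sub cN xc, of "tcoord M c x t"] t by simp
    also have "\<dots> = t" using tvec_tcoord[OF M cm c(2)] t by simp
    finally show "t \<in> sub_tangent_space M k S x" unfolding sub_tangent_space_def using u by force
  qed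
qed

end

subsection \<open>Centred charts\<close>

text \<open>An inverse chart recentred so that the origin corresponds to x: pointed plots and the
  tangent representation both live at the origin.\<close>

definition cpar :: "'a chart \<Rightarrow> 'a \<Rightarrow> (nat \<Rightarrow> real) \<Rightarrow> 'a"
  where "cpar c x b = chart_inv c (snd c x + b)"

definition ccoord :: "'a chart \<Rightarrow> 'a \<Rightarrow> 'a \<Rightarrow> nat \<Rightarrow> real"
  where "ccoord c x y = snd c y - snd c x"

definition cdom :: "'a mfd \<Rightarrow> 'a chart \<Rightarrow> 'a \<Rightarrow> (nat \<Rightarrow> real) set"
  where "cdom M c x = {b \<in> Rn (mdim M). snd c x + b \<in> snd c ` fst c}"

lemma smooth_at_linear:
  assumes "linear L" "\<And>v. v \<in> Rn n \<Longrightarrow> L v \<in> Rn m" "a \<in> Rn n"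
  shows "smooth_at (Rn_mfd n) (Rn_mfd m) L a"
  by (rule smooth_at_RnI[OF openin_topspace assms(3) smooth_map_linear[OF openin_topspace assms(1,2)]])

lemma smooth_at_translate:
  assumes "u \<in> Rn n" "a \<in> Rn n"
  shows "smooth_at (Rn_mfd n) (Rn_mfd n) (\<lambda>b. u + b) a"
  by (rule smooth_at_RnI[OF openin_topspace assms(2) smooth_map_translate[OF openin_topspace assms(1)]])

lemma smooth_at_translate_minus:
  assumes "u \<in> Rn n" "a \<in> Rn n"
  shows "smooth_at (Rn_mfd n) (Rn_mfd n) (\<lambda>b. b - u) a"
  using smooth_at_translate[OF Rn_scale[OF assms(1), of "-1"] assms(2)] by (simp add: scaleR_minus_left[of 1])

context
  fixes M :: "'a mfd" and c :: "'a chart" and x :: 'a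
  assumes M: "pre_manifold M" and c: "c \<in> max_atlas M" "x \<in> fst c"
begin

lemma center_Rn: "snd c x \<in> Rn (mdim M)"
  by (rule is_chart_Rn[OF max_is_chart[OF c(1)] c(2)])

lemma openin_cdom: "openin (Euclidean_space (mdim M)) (cdom M c x)"
proof -
  have "continuous_map (Euclidean_space (mdim M)) (Euclidean_space (mdim M)) (\<lambda>b. snd c x + b)"
    using smooth_map_continuous_map[OF openin_topspace smooth_map_translate[OF openin_topspace center_Rn]]
    by (simp only: subtopology_topspace)
  moreover have "openin (Euclidean_space (mdim M)) (snd c ` fst c)"
    by (rule max_open_image[OF c(1) openin_fst_max[OF c(1)] order_refl])
  ultimately show ?thesis unfolding cdom_def by (rule openin_continuous_map_preimage)
qed

lemma cdom_0: "0 \<in> cdom M c x"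
  using c(2) by (simp add: cdom_def)

lemma cpar_0: "cpar c x 0 = x"
  by (simp add: cpar_def max_inv_left[OF c])

lemma cpar_mem: "b \<in> cdom M c x \<Longrightarrow> cpar c x b \<in> fst c"
  unfolding cdom_def cpar_def by (rule chart_inv_right(1)) simp

lemma ccoord_cpar: assumes "b \<in> cdom M c x" shows "ccoord c x (cpar c x b) = b"
proof -
  have "snd c x + b \<in> snd c ` fst c" using assms unfolding cdom_def by simp
  from chart_inv_right(2)[OF this] show ?thesis by (simp add: ccoord_def cpar_def)
qed

lemma cpar_ccoord: "y \<in> fst c \<Longrightarrow> cpar c x (ccoord c x y) = y"
  by (simp add: cpar_def ccoord_def max_inv_left[OF c(1)])

lemma ccoord_Rn: "y \<in> fst c \<Longrightarrow> ccoord c x y \<in> Rn (mdim M)"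
  unfolding ccoord_def by (intro Rn_diff center_Rn is_chart_Rn[OF max_is_chart[OF c(1)]])

lemma ccoord_cdom: assumes y: "y \<in> fst c" shows "ccoord c x y \<in> cdom M c x"
  unfolding cdom_def
proof (intro CollectI conjI ccoord_Rn[OF y])
  have "snd c x + ccoord c x y = snd c y" by (simp add: ccoord_def)
  then show "snd c x + ccoord c x y \<in> snd c ` fst c" using y by (simp only: imageI)
qed

lemma ccoord_0: "ccoord c x x = 0"
  by (simp add: ccoord_def)

lemma cpar_points: "b \<in> cdom M c x \<Longrightarrow> cpar c x b \<in> points M"
  by (rule max_points[OF c(1) cpar_mem])

lemma smooth_at_cpar:
  assumes b: "b \<in> cdom M c x" shows "smooth_at (Rn_mfd (mdim M)) M (cpar c x) b"
proof -
  have bR: "b \<in> Rn (mdim M)" "snd c x + b \<in> snd c ` fst c" using b unfolding cdom_def by simp_all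
  show ?thesis unfolding cpar_def[abs_def]
    by (rule smooth_at_compose[OF pre_manifold_Rn pre_manifold_Rn M, where f="\<lambda>b. snd c x + b" and g="chart_inv c"])
       (rule smooth_at_translate[OF center_Rn bR(1)], rule smooth_at_chart_inv[OF M c(1) bR(2)])
qed

lemma smooth_at_ccoord:
  assumes y: "y \<in> fst c" shows "smooth_at M (Rn_mfd (mdim M)) (ccoord c x) y"
  unfolding ccoord_def[abs_def]
  by (rule smooth_at_compose[OF M pre_manifold_Rn pre_manifold_Rn smooth_at_chart[OF M c(1) y]
      smooth_at_translate_minus[OF center_Rn is_chart_Rn[OF max_is_chart[OF c(1)] y]]])

text \<open>Translations in source and target do not change Jacobians. The target centre z is free,
  so that \<open>f x\<close> need not first be rewritten as the centre of the target chart.\<close>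

lemma jacobian_cpar_ccoord:
  assumes N: "pre_manifold N" and f: "smooth_at M N f x" and d: "d \<in> max_atlas N" "f x \<in> fst d"
    and v: "v \<in> Rn (mdim M)"
  shows "jacobian (mdim M) (mdim N) (\<lambda>b. ccoord d z (f (cpar c x b))) 0 v = rep_jac M N c d f x v"
proof -
  let ?m = "mdim M" and ?n = "mdim N"
  let ?R = "\<lambda>a. snd d (f (chart_inv c a))"
  obtain V where V: "openin (mtop M) V" "x \<in> V" "V \<subseteq> fst c" "V \<subseteq> fst c" "f ` V \<subseteq> fst d"
    "smooth_map ?m (snd c ` V) ?n ?R"
    using smooth_at_charts[OF M N f c d openin_fst_max[OF c(1)] c(2)] .
  have oV: "openin (Euclidean_space ?m) (snd c ` V)" by (rule max_open_image[OF c(1) V(1,3)])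
  define U where "U = {b \<in> Rn ?m. snd c x + b \<in> snd c ` V}"
  have tr: "continuous_map (Euclidean_space ?m) (Euclidean_space ?m) (\<lambda>b. snd c x + b)"
    using smooth_map_continuous_map[OF openin_topspace smooth_map_translate[OF openin_topspace center_Rn]]
    by (simp only: subtopology_topspace)
  have oU: "openin (Euclidean_space ?m) U" unfolding U_def by (rule openin_continuous_map_preimage[OF tr oV])
  have U0: "0 \<in> U" using V(2) by (simp add: U_def)
  have sU: "smooth_map ?m U ?n (\<lambda>b. ?R (snd c x + b))"
    by (rule smooth_map_compose[OF oU oV smooth_map_translate[OF oU center_Rn] V(6)]) (auto simp: U_def)
  have pd: "part_deriv i (\<lambda>b. ccoord d z (f (cpar c x b)) j) 0 = part_deriv i (\<lambda>b. ?R (snd c x + b) j) 0" for i j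
  proof -
    have "(\<lambda>t. ccoord d z (f (cpar c x (0(i := t)))) j) = (\<lambda>t. ?R (snd c x + 0(i := t)) j - snd d z j)"
      by (simp add: ccoord_def cpar_def)
    \<comment> \<open>\<open>deriv\<close> is a choice from the set of derivatives, and that set is
      the same for both functions; the equation therefore holds without differentiability.\<close>
    moreover have "deriv (\<lambda>t. g t - q) s = deriv g s" for g :: "real \<Rightarrow> real" and q s
      unfolding deriv_def by (rule arg_cong[of _ _ Eps]) (auto intro!: ext simp: has_field_derivative_iff)
    ultimately show ?thesis unfolding part_deriv_def by simp
  qed
  have "jacobian ?m ?n (\<lambda>b. ccoord d z (f (cpar c x b))) 0 v = jacobian ?m ?n (\<lambda>b. ?R (snd c x + b)) 0 v"
    unfolding jacobian_def pd ..
  also have "\<dots> = jacobian ?m ?n ?R (snd c x + 0) (jacobian ?m ?m (\<lambda>b. snd c x + b) 0 v)"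
    by (rule jacobian_compose[OF oU oV smooth_map_translate[OF oU center_Rn] V(6) _ U0]) (auto simp: U_def)
  finally show ?thesis using jacobian_translate[OF v] by (simp add: rep_jac_def)
qed

end

section \<open>The local structure of a proper action at a slice\<close>

text \<open>The charts are parameters so that coordinates are fixed once and for all: \<xi> around
  the unit of the group, and c around x, in which the slice becomes \<open>Rn k\<close>.\<close>

locale slice_setting =
  fixes G :: "('g, 'r) monoid_scheme" (structure) and GM :: "'g mfd"
    and M :: "'m mfd" and \<phi> :: "'g \<Rightarrow> 'm \<Rightarrow> 'm" and x :: 'm
    and k :: nat and S :: "'m set" and \<xi> :: "'g chart" and c :: "'m chart"
  assumes lie: "lie_group G GM" and mfd: "smooth_manifold M" and act: "smooth_action G GM M \<phi>"
    and proper: "proper_action GM M \<phi>" and x: "x \<in> points M" and slice: "slice G GM M \<phi> x k S"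
    and chi: "\<xi> \<in> atlas GM" "\<one> \<in> fst \<xi>" and ad: "c \<in> adapted_charts M k S" "x \<in> fst c"
begin

abbreviation "K \<equiv> stabilizer G \<phi> x"
abbreviation "p \<equiv> mdim GM"
abbreviation "m \<equiv> mdim M"
abbreviation "\<gamma> \<equiv> cpar \<xi> \<one>"
abbreviation "\<mu> \<equiv> cpar c x"
abbreviation "\<kappa> \<equiv> ccoord c x"

lemma pG: "pre_manifold GM" and GM_points: "points GM = carrier G" and G_group: "group G"
  using lie by (simp_all add: lie_group_def smooth_manifold_pre)

lemma pM: "pre_manifold M"
  using mfd by (rule smooth_manifold_pre)

lemma G_action: "group_action G (points M) \<phi>"
  using act by (simp add: smooth_action_def)

sublocale group G by (rule G_group)

lemma act_mult: "\<lbrakk>g \<in> carrier G; h \<in> carrier G; y \<in> points M\<rbrakk> \<Longrightarrow> \<phi> (g \<otimes> h) y = \<phi> g (\<phi> h y)"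
  using group_action.composition_rule[OF G_action] .

lemma act_one: "y \<in> points M \<Longrightarrow> \<phi> \<one> y = y"
  using group_action.id_eq_one[OF G_action] by (metis restrict_apply')

lemma act_points: "\<lbrakk>g \<in> carrier G; y \<in> points M\<rbrakk> \<Longrightarrow> \<phi> g y \<in> points M"
  using group_action.element_image[OF G_action] by blast

lemma act_inv: "\<lbrakk>g \<in> carrier G; y \<in> points M\<rbrakk> \<Longrightarrow> \<phi> (inv g) (\<phi> g y) = y"
  using act_mult[of "inv g" g y] act_one by simp

lemma smooth_at_act:
  assumes "pre_manifold P" "smooth_at P GM g q" "smooth_at P M f q"
  shows "smooth_at P M (\<lambda>q. \<phi> (g q) (f q)) q"
  using smooth_at_pair_compose[OF assms(1) pG pM pM _ assms(2,3), of "\<lambda>(g, y). \<phi> g y"] act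
  by (simp add: smooth_action_def)

lemma G_mult_smooth: "msmooth (prod_mfd GM GM) GM (\<lambda>(g, h). g \<otimes> h)"
  using lie unfolding lie_group_def by (elim conjE)

lemma G_inv_smooth: "msmooth GM GM (\<lambda>g. inv g)"
  using lie unfolding lie_group_def by (elim conjE)

lemma smooth_at_act_left:
  assumes "g \<in> carrier G" "y \<in> points M" shows "smooth_at M M (\<phi> g) y"
  using smooth_at_act[OF pM smooth_at_const[OF pM assms(2) pG] smooth_at_id[OF pM assms(2)], of g] assms(1) GM_points
  by simp

lemma K_subgroup: "subgroup K G"
  by (rule group_action.stabilizer_subgroup[OF G_action x])

lemma K_carrier: "h \<in> K \<Longrightarrow> h \<in> carrier G" and K_fix: "h \<in> K \<Longrightarrow> \<phi> h x = x"
  and K_I: "\<lbrakk>h \<in> carrier G; \<phi> h x = x\<rbrakk> \<Longrightarrow> h \<in> K"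
  by (simp_all add: stabilizer_def)

lemma K_inv: "h \<in> K \<Longrightarrow> inv h \<in> K" and K_mult: "\<lbrakk>h \<in> K; h' \<in> K\<rbrakk> \<Longrightarrow> h \<otimes> h' \<in> K" and K_one: "\<one> \<in> K"
  using K_subgroup by (simp_all add: subgroup.m_inv_closed subgroup.m_closed subgroup.one_closed)

lemma xS: "x \<in> S" and submfd: "submanifold M k S"
  and S_inv: "\<And>h y. h \<in> K \<Longrightarrow> y \<in> S \<Longrightarrow> \<phi> h y \<in> S"
  using slice by (simp_all add: slice_def)

lemma S_slice: "\<lbrakk>g \<in> carrier G; y \<in> S; \<phi> g y \<in> S\<rbrakk> \<Longrightarrow> g \<in> K"
  using slice unfolding slice_def by (elim conjE) blast

lemma km: "k \<le> m"
  by (rule submanifold_dim[OF pM submfd])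

lemma chi_max: "\<xi> \<in> max_atlas GM"
  by (rule atlas_max[OF pG chi(1)])

lemma c_max: "c \<in> max_atlas M"
  by (rule adapted_max[OF ad(1)])

lemmas \<gamma>_smooth = smooth_at_cpar[OF pG chi_max chi(2)]
lemmas \<mu>_smooth = smooth_at_cpar[OF pM c_max ad(2)]
lemmas \<kappa>_smooth = smooth_at_ccoord[OF pM c_max ad(2)]
lemmas \<gamma>_0 = cpar_0[OF pG chi_max chi(2)]
lemmas \<mu>_0 = cpar_0[OF pM c_max ad(2)]
lemmas \<kappa>_\<mu> = ccoord_cpar[OF pM c_max ad(2)]
lemmas \<mu>_\<kappa> = cpar_ccoord[OF pM c_max ad(2)]

lemma \<gamma>_carrier: "a \<in> cdom GM \<xi> \<one> \<Longrightarrow> \<gamma> a \<in> carrier G"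
  using cpar_points[OF pG chi_max chi(2)] GM_points by simp

lemma \<mu>_points: "b \<in> cdom M c x \<Longrightarrow> \<mu> b \<in> points M"
  by (rule cpar_points[OF pM c_max ad(2)])

lemma Rk_Rm: "v \<in> Rn k \<Longrightarrow> v \<in> Rn m"
  using km by (auto simp: mem_Rn)

lemma center_Rk: "snd c x \<in> Rn k"
  using adapted_iff[OF ad] xS by simp

lemma \<kappa>_S: assumes "y \<in> fst c" shows "y \<in> S \<longleftrightarrow> \<kappa> y \<in> Rn k"
proof -
  have "\<kappa> y \<in> Rn k \<longleftrightarrow> snd c y \<in> Rn k"
    using center_Rk by (auto simp: ccoord_def mem_Rn)
  then show ?thesis using adapted_iff[OF ad(1) assms] by simp
qed

lemma \<mu>_S: "b \<in> cdom M c x \<Longrightarrow> \<mu> b \<in> S \<longleftrightarrow> b \<in> Rn k"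
  using \<kappa>_S[OF cpar_mem[OF pM c_max ad(2)]] \<kappa>_\<mu> by simp

text \<open>K is the projection to the group of the preimage of \<open>(x, x)\<close> under the
  proper map of the action.\<close>

lemma K_compact: "compactin (mtop GM) K"
proof -
  let ?T = "prod_topology (mtop GM) (mtop M)"
  have "compactin ?T {q \<in> topspace ?T. (case q of (g, y) \<Rightarrow> (\<phi> g y, y)) = (x, x)}"
    using proper x unfolding proper_action_def proper_map_def by simp
  then have "compactin (mtop GM) (fst ` {q \<in> topspace ?T. (case q of (g, y) \<Rightarrow> (\<phi> g y, y)) = (x, x)})"
    by (rule image_compactin) (rule continuous_map_fst)
  also have "fst ` {q \<in> topspace ?T. (case q of (g, y) \<Rightarrow> (\<phi> g y, y)) = (x, x)} = K"
    using x by (force simp: stabilizer_def GM_points)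
  finally show ?thesis .
qed

abbreviation "TK \<equiv> subtopology (mtop GM) K"
abbreviation "KG \<equiv> G\<lparr>carrier := K\<rparr>"

lemma TK_topspace: "topspace TK = K"
  using K_carrier GM_points by auto

lemma TK_compact: "compact_space TK"
  using K_compact compact_space_subtopology by blast

lemma continuous_mult: "continuous_map (prod_topology (mtop GM) (mtop GM)) (mtop GM) (\<lambda>(a, b). a \<otimes> b)"
proof -
  have "continuous_map (subtopology (mtop (prod_mfd GM GM)) (points (prod_mfd GM GM))) (mtop GM) (\<lambda>(g, h). g \<otimes> h)"
    using G_mult_smooth unfolding msmooth_on_def by (elim conjE)
  then show ?thesis by (simp only: subtopology_topspace prod_mfd_simps)
qed

lemma continuous_act: "continuous_map (prod_topology (mtop GM) (mtop M)) (mtop M) (\<lambda>(a, b). \<phi> a b)"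
proof -
  have "msmooth (prod_mfd GM M) M (\<lambda>(g, h). \<phi> g h)" using act by (simp add: smooth_action_def)
  then have "continuous_map (subtopology (mtop (prod_mfd GM M)) (points (prod_mfd GM M))) (mtop M) (\<lambda>(g, h). \<phi> g h)"
    unfolding msmooth_on_def by (elim conjE)
  then show ?thesis by (simp only: subtopology_topspace prod_mfd_simps)
qed

lemma continuous_inv: "continuous_map (mtop GM) (mtop GM) (\<lambda>a. inv a)"
proof -
  have "continuous_map (subtopology (mtop GM) (points GM)) (mtop GM) (\<lambda>a. inv a)"
    using G_inv_smooth unfolding msmooth_on_def by (elim conjE)
  then show ?thesis by (simp only: subtopology_topspace)
qed

sublocale KC: compact_group KG TK
proof -
  have "group KG" by (rule subgroup.subgroup_is_group[OF K_subgroup G_group])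
  moreover have "continuous_map (prod_topology TK TK) TK (\<lambda>(a, b). a \<otimes>\<^bsub>KG\<^esub> b)"
    using continuous_mult K_mult
    by (auto simp: continuous_map_in_subtopology subtopology_Times[symmetric] intro: continuous_map_from_subtopology)
  moreover have "continuous_map TK TK (\<lambda>a. inv\<^bsub>KG\<^esub> a)"
  proof -
    have "continuous_map TK TK (\<lambda>a. inv a)"
      using continuous_inv K_inv by (auto simp: continuous_map_in_subtopology intro: continuous_map_from_subtopology)
    then show ?thesis
      by (rule continuous_map_eq) (simp add: TK_topspace m_inv_consistent[OF K_subgroup])
  qed
  ultimately show "compact_group KG TK"
    unfolding compact_group_def compact_group_axioms_def using TK_topspace TK_compact by simp
qed

subsection \<open>The tangent representation of the stabilizer\<close>

definition rho :: "'g \<Rightarrow> (nat \<Rightarrow> real) \<Rightarrow> nat \<Rightarrow> real"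
  where "rho h = jacobian m m (\<lambda>b. \<kappa> (\<phi> h (\<mu> b))) 0"

lemma rho_rep_jac: "h \<in> K \<Longrightarrow> v \<in> Rn m \<Longrightarrow> rho h v = rep_jac M M c c (\<phi> h) x v"
  unfolding rho_def
  using jacobian_cpar_ccoord[OF pM c_max ad(2) pM smooth_at_act_left[OF K_carrier x] c_max, of h v x] K_fix ad(2)
  by simp

lemma linear_rho: "linear (rho h)"
  unfolding rho_def by (rule linear_jacobian)

lemma rho_Rm: "rho h v \<in> Rn m"
  unfolding rho_def by (rule jacobian_Rn)

lemma rho_mult:
  assumes "g \<in> K" "h \<in> K" "v \<in> Rn m" shows "rho (g \<otimes> h) v = rho g (rho h v)"
proof -
  note gh = K_carrier[OF assms(1)] K_carrier[OF assms(2)]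
  have "rep_jac M M c c (\<phi> (g \<otimes> h)) x v = rep_jac M M c c (\<lambda>y. \<phi> g (\<phi> h y)) x v"
    by (rule rep_jac_cong[OF c_max ad(2) openin_topspace x]) (simp add: act_mult gh)
  also have "\<dots> = rep_jac M M c c (\<phi> g) (\<phi> h x) (rep_jac M M c c (\<phi> h) x v)"
    using gh x K_fix assms ad(2) by (intro rep_jac_compose[OF pM pM pM _ _ c_max ad(2) c_max _ c_max] smooth_at_act_left) simp_all
  finally show ?thesis
    unfolding rho_rep_jac[OF K_mult[OF assms(1,2)] assms(3)] rho_rep_jac[OF assms(2,3)]
      rho_rep_jac[OF assms(1) rep_jac_Rn] K_fix[OF assms(2)] .
qed

lemma rho_one: assumes "v \<in> Rn m" shows "rho \<one> v = v"
proof -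
  have "rep_jac M M c c (\<phi> \<one>) x v = rep_jac M M c c (\<lambda>y. y) x v"
    by (rule rep_jac_cong[OF c_max ad(2) openin_topspace x]) (simp add: act_one)
  then show ?thesis using rho_rep_jac[OF K_one assms] rep_jac_id[OF c_max ad(2) assms] by simp
qed

text \<open>The components of F from k on vanish identically along \<open>Rn k\<close>, and so do
  their partial derivatives in the first k directions.\<close>

lemma jacobian_Rn_subspace:
  assumes U: "openin (Euclidean_space n) U" "a \<in> U" "a \<in> Rn k" and v: "v \<in> Rn k" and kn: "k \<le> n"
    and F: "\<And>b. b \<in> U \<Longrightarrow> b \<in> Rn k \<Longrightarrow> F b \<in> Rn k"
  shows "jacobian n n F a v \<in> Rn k" "jacobian n n F a v = jacobian k k F a v"
proof -
  have pd: "part_deriv i (\<lambda>b. F b j) a = 0" if "i < k" "k \<le> j" for i j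
  proof -
    have o: "openin (Euclidean_space k) (U \<inter> Rn k)" by (rule openin_Rn_restrict[OF U(1) kn])
    have "part_deriv i (\<lambda>b. F b j) a = part_deriv i (\<lambda>b. 0) a"
      by (rule part_deriv_cong[OF o _ _ that(1)]) (use U F that(2) in \<open>auto simp: mem_Rn\<close>)
    also have "\<dots> = 0" by (rule part_deriv_eqI) simp
    finally show ?thesis .
  qed
  have sum: "(\<Sum>i<n. part_deriv i (\<lambda>b. F b j) a * v i) = (\<Sum>i<k. part_deriv i (\<lambda>b. F b j) a * v i)" for j
    by (rule sum.mono_neutral_right) (use kn v in \<open>auto simp: mem_Rn\<close>)
  show 1: "jacobian n n F a v \<in> Rn k"
    unfolding jacobian_def sum by (auto simp: mem_Rn pd)
  then show "jacobian n n F a v = jacobian k k F a v"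
    unfolding jacobian_def sum using kn by (auto simp: fun_eq_iff mem_Rn)
qed

lemma rho_Rk: assumes "h \<in> K" "v \<in> Rn k"
  shows "rho h v \<in> Rn k" "rho h v = jacobian k k (\<lambda>b. \<kappa> (\<phi> h (\<mu> b))) 0 v"
proof -
  have s: "smooth_at (Rn_mfd m) M (\<lambda>b. \<phi> h (\<mu> b)) 0"
    using smooth_at_compose[OF pre_manifold_Rn pM pM \<mu>_smooth smooth_at_act_left] cdom_0[OF pM c_max ad(2)]
      K_carrier[OF assms(1)] \<mu>_points by blast
  obtain V where V: "openin (mtop (Rn_mfd m)) V" "0 \<in> V" "(\<lambda>b. \<phi> h (\<mu> b)) ` V \<subseteq> fst c"
    using smooth_at_preimage[OF s openin_fst_max[OF c_max]] \<mu>_0 K_fix[OF assms(1)] ad(2) by auto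
  let ?U = "V \<inter> cdom M c x"
  have U: "openin (Euclidean_space m) ?U" "0 \<in> ?U"
    using V openin_cdom[OF pM c_max ad(2)] cdom_0[OF pM c_max ad(2)] by auto
  have F: "\<kappa> (\<phi> h (\<mu> b)) \<in> Rn k" if "b \<in> ?U" "b \<in> Rn k" for b
  proof -
    have "\<phi> h (\<mu> b) \<in> S" using that S_inv[OF assms(1)] \<mu>_S by simp
    moreover have "\<phi> h (\<mu> b) \<in> fst c" using that V(3) by (simp add: image_subset_iff)
    ultimately show ?thesis using \<kappa>_S by simp
  qed
  show "rho h v \<in> Rn k" "rho h v = jacobian k k (\<lambda>b. \<kappa> (\<phi> h (\<mu> b))) 0 v"
    unfolding rho_def using jacobian_Rn_subspace[OF U Rn_0 assms(2) km F] by simp_all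
qed

end

lemma smooth_at_open_preimage:
  assumes "\<And>y. y \<in> W \<Longrightarrow> smooth_at M N f y" "openin (mtop M) W" "openin (mtop N) O'"
  shows "openin (mtop M) {z \<in> W. f z \<in> O'}"
proof (subst openin_subopen, rule ballI)
  fix y assume "y \<in> {z \<in> W. f z \<in> O'}"
  then have y: "y \<in> W" "f y \<in> O'" by simp_all
  obtain V where V: "openin (mtop M) V" "y \<in> V" "f ` V \<subseteq> O'"
    using smooth_at_preimage[OF assms(1)[OF y(1)] assms(3) y(2)] .
  have "openin (mtop M) (V \<inter> W)" by (rule openin_Int[OF V(1) assms(2)])
  then show "\<exists>T. openin (mtop M) T \<and> y \<in> T \<and> T \<subseteq> {z \<in> W. f z \<in> O'}"
    using V(2,3) y(1) by (intro exI[of _ "V \<inter> W"]) (auto simp: image_subset_iff)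
qed

lemma jacobian_compose_at:
  assumes g: "smooth_at (Rn_mfd n) (Rn_mfd m) g a" and f: "smooth_at (Rn_mfd m) (Rn_mfd l) f (g a)"
  shows "jacobian n l (\<lambda>x. f (g x)) a v = jacobian m l f (g a) (jacobian n m g a v)"
proof -
  obtain V where V: "openin (Euclidean_space m) V" "g a \<in> V" "smooth_map m V l f" using smooth_at_RnD[OF f] .
  obtain U where U: "openin (Euclidean_space n) U" "a \<in> U" "smooth_map n U m g" using smooth_at_RnD[OF g] .
  have oV: "openin (mtop (Rn_mfd m)) V" using V(1) by simp
  obtain W where W: "openin (mtop (Rn_mfd n)) W" "a \<in> W" "g ` W \<subseteq> V"
    by (rule smooth_at_preimage[OF g, of V]) (rule oV, rule V(2), rule that)
  have oU: "openin (Euclidean_space n) (U \<inter> W)" using U(1) W(1) by (simp add: openin_Int)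
  show ?thesis
    by (rule jacobian_compose[OF oU V(1) smooth_map_subset[OF U(1) oU _ U(3)] V(3)]) (use U(2) W(2,3) in auto)
qed

section \<open>Splitting a neighbourhood of x into group and slice directions\<close>

context slice_setting
begin

definition D1 :: "(nat \<Rightarrow> real) \<Rightarrow> nat \<Rightarrow> real"
  where "D1 = jacobian p m (\<lambda>a. \<kappa> (\<phi> (\<gamma> a) x)) 0"

lemma linear_D1: "linear D1"
  unfolding D1_def by (rule linear_jacobian)

lemma D1_Rm: "D1 a \<in> Rn m"
  unfolding D1_def by (rule jacobian_Rn)

lemma smooth_at_orbit_map: "g \<in> carrier G \<Longrightarrow> y \<in> points M \<Longrightarrow> smooth_at GM M (\<lambda>g. \<phi> g y) g"
  using smooth_at_act[OF pG smooth_at_id[OF pG] smooth_at_const[OF pG _ pM]] GM_points by simp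

lemma orbit_map_one: "\<phi> \<one> x \<in> fst c"
  using act_one[OF x] ad(2) by simp

lemma D1_rep_jac: "a \<in> Rn p \<Longrightarrow> D1 a = rep_jac GM M \<xi> c (\<lambda>g. \<phi> g x) \<one> a"
  unfolding D1_def
  by (rule jacobian_cpar_ccoord[OF pG chi_max chi(2) pM smooth_at_orbit_map[OF one_closed x] c_max orbit_map_one])

text \<open>Transversality of the slice at x, read in coordinates: the orbit directions are given by
  \<open>D1\<close>, and the tangent space of S is \<open>Rn k\<close>.\<close>

lemma complement_Rk:
  assumes w: "w \<in> Rn m" obtains a s where "a \<in> Rn p" "s \<in> Rn k" "w = D1 a + s"
proof -
  let ?t = "tvec M c x w"
  have "?t \<in> tangent_space M x" by (rule tvec_tangent[OF pM c_max ad(2)])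
  also have "tangent_space M x = {a + b |a b. a \<in> orbit_directions G GM M \<phi> x \<and> b \<in> sub_tangent_space M k S x}"
    using slice xS unfolding slice_def by (elim conjE) (rule bspec)
  finally obtain t1 t2 where t: "?t = t1 + t2" "t1 \<in> orbit_directions G GM M \<phi> x" "t2 \<in> sub_tangent_space M k S x"
    by (elim CollectE exE conjE)
  obtain u where u: "u \<in> tangent_space GM \<one>" "t1 = differential GM M (\<lambda>g. \<phi> g x) \<one> u"
    using t(2) unfolding orbit_directions_def by (elim imageE)
  have "t1 = tvec M c (\<phi> \<one> x) (rep_jac GM M \<xi> c (\<lambda>g. \<phi> g x) \<one> (tcoord GM \<xi> \<one> u))"
    unfolding u(2)
    by (rule differential_coord[OF pG pM smooth_at_orbit_map[OF one_closed x] chi_max chi(2) c_max orbit_map_one u(1)])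
  then have "t1 = tvec M c x (D1 (tcoord GM \<xi> \<one> u))"
    by (simp only: act_one[OF x] D1_rep_jac[OF tcoord_Rn])
  then have t1: "tcoord M c x t1 = D1 (tcoord GM \<xi> \<one> u)"
    by (simp only: tcoord_tvec[OF pM c_max ad(2) D1_Rm])
  have t2: "tcoord M c x t2 \<in> Rn k"
    using t(3) sub_tangent_space_coord[OF pM submfd ad xS] by simp
  have "w = tcoord M c x (t1 + t2)"
    using tcoord_tvec[OF pM c_max ad(2) w] t(1) by simp
  also have "\<dots> = D1 (tcoord GM \<xi> \<one> u) + tcoord M c x t2"
    by (simp only: real_vector.linear_add[OF linear_tcoord] t1)
  finally show ?thesis by (rule that[OF tcoord_Rn t2])
qed

lemma ex_complement_map:
  obtains l where "linear l" "\<And>v. l v \<in> Rn p" "\<And>v. v \<in> Rn k \<Longrightarrow> l v = 0"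
    "\<And>v. v \<in> Rn m \<Longrightarrow> D1 (l v) - v \<in> Rn k"
proof -
  have "\<forall>i\<in>{..<m}. \<exists>a. a \<in> Rn p \<and> D1 a - uvec i \<in> Rn k"
  proof
    fix i assume "i \<in> {..<m}"
    then have "uvec i \<in> Rn m" by (simp add: uvec_Rn)
    then obtain a s where as: "a \<in> Rn p" "s \<in> Rn k" "uvec i = D1 a + s" by (rule complement_Rk)
    have "D1 a - uvec i = (-1) *\<^sub>R s" using as(3) by simp
    then have "D1 a - uvec i \<in> Rn k" by (simp only: Rn_scale[OF as(2)])
    then show "\<exists>a. a \<in> Rn p \<and> D1 a - uvec i \<in> Rn k" using as(1) by (intro exI[of _ a]) simp
  qed
  then obtain A where A: "\<forall>i\<in>{..<m}. A i \<in> Rn p \<and> D1 (A i) - uvec i \<in> Rn k"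
    by (rule bchoice[THEN exE])
  \<comment> \<open>Only the coordinates from k on enter, so l vanishes on
    \<open>Rn k\<close>.\<close>
  define l where "l v = (\<Sum>i\<in>{k..<m}. v i *\<^sub>R A i)" for v :: "nat \<Rightarrow> real"
  have l: "linear l"
    by (rule linearI) (simp_all add: l_def scaleR_left_distrib sum.distrib scaleR_right.sum)
  have lp: "l v \<in> Rn p" for v
    unfolding l_def by (rule real_vector.subspace_sum[OF subspace_Rn]) (use A in \<open>auto intro: Rn_scale\<close>)
  have lk: "l v = 0" if "v \<in> Rn k" for v
    unfolding l_def using that by (intro sum.neutral) (simp add: Rn_nth)
  have D: "D1 (l v) - v \<in> Rn k" if v: "v \<in> Rn m" for v
  proof -
    have "D1 (l v) = (\<Sum>i\<in>{k..<m}. v i *\<^sub>R D1 (A i))"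
      unfolding l_def by (rule linear_sum_apply[OF linear_D1])
    moreover have "v = (\<Sum>i\<in>{k..<m}. v i *\<^sub>R uvec i) + (\<Sum>i<k. v i *\<^sub>R uvec i)"
    proof -
      have eq: "{..<m} = {k..<m} \<union> {..<k}" using km by auto
      have "(\<Sum>i<m. v i *\<^sub>R uvec i) = (\<Sum>i\<in>{k..<m}. v i *\<^sub>R uvec i) + (\<Sum>i<k. v i *\<^sub>R uvec i)"
        unfolding eq by (rule sum.union_disjoint) auto
      then show ?thesis using Rn_expansion[OF v] by metis
    qed
    ultimately have "D1 (l v) - v = (\<Sum>i\<in>{k..<m}. v i *\<^sub>R D1 (A i)) - ((\<Sum>i\<in>{k..<m}. v i *\<^sub>R uvec i) + (\<Sum>i<k. v i *\<^sub>R uvec i))"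
      by simp
    also have "\<dots> = (\<Sum>i\<in>{k..<m}. v i *\<^sub>R (D1 (A i) - uvec i)) - (\<Sum>i<k. v i *\<^sub>R uvec i)"
      by (simp add: sum_subtractf scaleR_right_diff_distrib)
    also have "\<dots> \<in> Rn k"
    proof (rule Rn_diff)
      show "(\<Sum>i\<in>{k..<m}. v i *\<^sub>R (D1 (A i) - uvec i)) \<in> Rn k"
        by (rule real_vector.subspace_sum[OF subspace_Rn], rule Rn_scale) (use A in simp)
      show "(\<Sum>i<k. v i *\<^sub>R uvec i) \<in> Rn k"
        by (rule real_vector.subspace_sum[OF subspace_Rn], rule Rn_scale, rule uvec_Rn) simp
    qed
    finally show ?thesis .
  qed
  show ?thesis by (rule that[OF l lp lk D])
qed

text \<open>Here \<open>l\<close> inverts \<open>D1\<close> modulo the tangent space of the slice, which makes the derivative of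
  \<open>Fmap l\<close> at \<open>0\<close> injective. The local inverse splits a point near \<open>x\<close> as a group element \<open>g0\<close>
  acting on a slice point with coordinates \<open>r\<close>.\<close>

definition Fpre :: "((nat \<Rightarrow> real) \<Rightarrow> nat \<Rightarrow> real) \<Rightarrow> (nat \<Rightarrow> real) \<Rightarrow> 'm"
  where "Fpre l w = \<phi> (\<gamma> (l w)) (\<mu> (trunc k w))"

definition Fmap :: "((nat \<Rightarrow> real) \<Rightarrow> nat \<Rightarrow> real) \<Rightarrow> (nat \<Rightarrow> real) \<Rightarrow> nat \<Rightarrow> real"
  where "Fmap l w = \<kappa> (Fpre l w)"

definition Fdom :: "((nat \<Rightarrow> real) \<Rightarrow> nat \<Rightarrow> real) \<Rightarrow> (nat \<Rightarrow> real) set"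
  where "Fdom l = {w \<in> Rn m. l w \<in> cdom GM \<xi> \<one> \<and> trunc k w \<in> cdom M c x \<and> Fpre l w \<in> fst c}"

lemma trunc_k_Rm: "trunc k w \<in> Rn m"
  by (rule Rk_Rm[OF trunc_Rn])

lemma trunc_k_id: "w \<in> Rn k \<Longrightarrow> trunc k w = w"
  by (auto simp: trunc_def mem_Rn fun_eq_iff)

context
  fixes l :: "(nat \<Rightarrow> real) \<Rightarrow> nat \<Rightarrow> real"
  assumes l: "linear l" "\<And>v. l v \<in> Rn p" "\<And>v. v \<in> Rn k \<Longrightarrow> l v = 0"
    and D1l: "\<And>v. v \<in> Rn m \<Longrightarrow> D1 (l v) - v \<in> Rn k"
begin

lemma smooth_at_Fpre:
  assumes w: "w \<in> Rn m" "l w \<in> cdom GM \<xi> \<one>" "trunc k w \<in> cdom M c x"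
  shows "smooth_at (Rn_mfd m) M (Fpre l) w"
  unfolding Fpre_def
proof (rule smooth_at_act[OF pre_manifold_Rn])
  show "smooth_at (Rn_mfd m) GM (\<lambda>w. \<gamma> (l w)) w"
    by (rule smooth_at_compose[OF pre_manifold_Rn pre_manifold_Rn pG, where f=l and g=\<gamma>])
       (rule smooth_at_linear[OF l(1,2) w(1)], rule \<gamma>_smooth[OF w(2)])
  show "smooth_at (Rn_mfd m) M (\<lambda>w. \<mu> (trunc k w)) w"
    by (rule smooth_at_compose[OF pre_manifold_Rn pre_manifold_Rn pM, where f="trunc k" and g=\<mu>])
       (rule smooth_at_linear[OF linear_trunc trunc_k_Rm w(1)], rule \<mu>_smooth[OF w(3)])
qed

lemma openin_Fdom: "openin (Euclidean_space m) (Fdom l)"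
proof -
  have "continuous_map (Euclidean_space m) (Euclidean_space p) l"
    by (rule linear_Rn_continuous_map[OF l(1,2)])
  then have o1: "openin (Euclidean_space m) {w \<in> Rn m. l w \<in> cdom GM \<xi> \<one>}"
    by (rule openin_continuous_map_preimage) (rule openin_cdom[OF pG chi_max chi(2)])
  have "continuous_map (Euclidean_space m) (Euclidean_space m) (trunc k)"
    by (rule linear_Rn_continuous_map[OF linear_trunc trunc_k_Rm])
  then have o2: "openin (Euclidean_space m) {w \<in> Rn m. trunc k w \<in> cdom M c x}"
    by (rule openin_continuous_map_preimage) (rule openin_cdom[OF pM c_max ad(2)])
  let ?U = "{w \<in> Rn m. l w \<in> cdom GM \<xi> \<one>} \<inter> {w \<in> Rn m. trunc k w \<in> cdom M c x}"
  have "openin (mtop (Rn_mfd m)) {w \<in> ?U. Fpre l w \<in> fst c}"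
    by (rule smooth_at_open_preimage[OF smooth_at_Fpre _ openin_fst_max[OF c_max]])
       (use o1 o2 in \<open>auto simp: openin_Int\<close>)
  moreover have "{w \<in> ?U. Fpre l w \<in> fst c} = Fdom l" by (auto simp: Fdom_def)
  ultimately show ?thesis by simp
qed

lemma smooth_at_Fmap: assumes w: "w \<in> Fdom l" shows "smooth_at (Rn_mfd m) (Rn_mfd m) (Fmap l) w"
proof -
  have w': "w \<in> Rn m" "l w \<in> cdom GM \<xi> \<one>" "trunc k w \<in> cdom M c x" "Fpre l w \<in> fst c"
    using w by (simp_all add: Fdom_def)
  show ?thesis unfolding Fmap_def
    by (rule smooth_at_compose[OF pre_manifold_Rn pM pre_manifold_Rn, where f="Fpre l" and g=\<kappa>])
       (rule smooth_at_Fpre[OF w'(1-3)], rule \<kappa>_smooth[OF w'(4)])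
qed

lemma Fdom_Rk: assumes b: "b \<in> cdom M c x" "b \<in> Rn k"
  shows "b \<in> Fdom l" "Fpre l b = \<mu> b" "Fmap l b = b"
proof -
  show *: "Fpre l b = \<mu> b"
    using b by (simp add: Fpre_def l(3) \<gamma>_0 trunc_k_id act_one \<mu>_points)
  show "b \<in> Fdom l"
    using b Rk_Rm[OF b(2)] cpar_mem[OF pM c_max ad(2)] cdom_0[OF pG chi_max chi(2)]
    by (simp add: Fdom_def l(3) trunc_k_id *)
  show "Fmap l b = b" using b by (simp add: Fmap_def * \<kappa>_\<mu>)
qed

lemma Fdom_0: "0 \<in> Fdom l" "Fmap l 0 = 0"
  using Fdom_Rk[OF cdom_0[OF pM c_max ad(2)] Rn_0] by simp_all

text \<open>The vector is split along and across the slice. Along \<open>Rn k\<close> the map is the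
  identity, because l vanishes there. On vectors with zero truncation it is the orbit map after l,
  whose derivative is \<open>D1\<close> after l.\<close>

lemma jacobian_Fmap: assumes v: "v \<in> Rn m" shows "jacobian m m (Fmap l) 0 v = D1 (l v) + trunc k v"
proof -
  have lin: "linear (jacobian m m (Fmap l) 0)" by (rule linear_jacobian)
  let ?q = "\<lambda>w. w - trunc k w"
  have linq: "linear ?q"
    by (rule linearI) (simp_all add: real_vector.linear_add[OF linear_trunc] real_vector.linear_scale[OF linear_trunc] algebra_simps)
  have qR: "?q w \<in> Rn m" if "w \<in> Rn m" for w by (rule Rn_diff[OF that trunc_k_Rm])
  have sF: "smooth_at (Rn_mfd m) (Rn_mfd m) (Fmap l) 0" by (rule smooth_at_Fmap[OF Fdom_0(1)])
  have t0: "trunc k 0 = 0" by (rule real_vector.linear_0[OF linear_trunc])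
  have "jacobian m m (\<lambda>w. Fmap l (trunc k w)) 0 v = jacobian m m (Fmap l) (trunc k 0) (jacobian m m (trunc k) 0 v)"
    by (rule jacobian_compose_at)
       (rule smooth_at_linear[OF linear_trunc trunc_k_Rm Rn_0], unfold t0, rule sF)
  then have "jacobian m m (Fmap l) 0 (trunc k v) = jacobian m m (\<lambda>w. Fmap l (trunc k w)) 0 v"
    by (simp add: t0 jacobian_linear[OF linear_trunc trunc_k_Rm v])
  also have "\<dots> = jacobian m m (trunc k) 0 v"
  proof (rule jacobian_cong)
    have "continuous_map (Euclidean_space m) (Euclidean_space m) (trunc k)"
      by (rule linear_Rn_continuous_map[OF linear_trunc trunc_k_Rm])
    then show "openin (Euclidean_space m) {w \<in> Rn m. trunc k w \<in> cdom M c x}"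
      by (rule openin_continuous_map_preimage) (rule openin_cdom[OF pM c_max ad(2)])
    show "0 \<in> {w \<in> Rn m. trunc k w \<in> cdom M c x}" using t0 cdom_0[OF pM c_max ad(2)] by simp
  qed (simp add: Fdom_Rk(3)[OF _ trunc_Rn])
  also have "\<dots> = trunc k v" by (rule jacobian_linear[OF linear_trunc trunc_k_Rm v])
  finally have 1: "jacobian m m (Fmap l) 0 (trunc k v) = trunc k v" .
  have tq: "trunc k (?q w) = 0" and lq: "l (?q w) = l w" for w
    by (simp add: trunc_def fun_eq_iff) (simp add: real_vector.linear_diff[OF l(1)] l(3)[OF trunc_Rn])
  have sq: "smooth_at (Rn_mfd m) (Rn_mfd m) ?q 0" by (rule smooth_at_linear[OF linq qR]) simp_all
  have sF': "smooth_at (Rn_mfd m) (Rn_mfd m) (Fmap l) (?q 0)" unfolding t0 diff_self by (rule sF)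
  have "jacobian m m (\<lambda>w. Fmap l (?q w)) 0 v = jacobian m m (Fmap l) (?q 0) (jacobian m m ?q 0 v)"
    by (rule jacobian_compose_at[OF sq sF'])
  then have "jacobian m m (Fmap l) 0 (?q v) = jacobian m m (\<lambda>w. Fmap l (?q w)) 0 v"
    by (simp only: t0 diff_self jacobian_linear[OF linq qR v])
  also have "(\<lambda>w. Fmap l (?q w)) = (\<lambda>w. (\<lambda>a. \<kappa> (\<phi> (\<gamma> a) x)) (l w))"
    by (simp only: Fmap_def Fpre_def tq lq \<mu>_0)
  also have "jacobian m m (\<lambda>w. (\<lambda>a. \<kappa> (\<phi> (\<gamma> a) x)) (l w)) 0 v
      = jacobian p m (\<lambda>a. \<kappa> (\<phi> (\<gamma> a) x)) (l 0) (jacobian m p l 0 v)"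
  proof (rule jacobian_compose_at[OF smooth_at_linear[OF l(1,2) Rn_0]])
    have A0: "0 \<in> cdom GM \<xi> \<one>" by (rule cdom_0[OF pG chi_max chi(2)])
    have "smooth_at (Rn_mfd p) M (\<lambda>a. \<phi> (\<gamma> a) x) 0"
      by (rule smooth_at_act[OF pre_manifold_Rn \<gamma>_smooth[OF A0] smooth_at_const[OF pre_manifold_Rn _ pM x]]) simp
    then have "smooth_at (Rn_mfd p) (Rn_mfd m) (\<lambda>a. \<kappa> (\<phi> (\<gamma> a) x)) 0"
      by (rule smooth_at_compose[OF pre_manifold_Rn pM pre_manifold_Rn, where g=\<kappa>])
         (simp add: \<gamma>_0 \<kappa>_smooth[OF orbit_map_one])
    then show "smooth_at (Rn_mfd p) (Rn_mfd m) (\<lambda>a. \<kappa> (\<phi> (\<gamma> a) x)) (l 0)"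
      by (simp only: real_vector.linear_0[OF l(1)])
  qed
  also have "\<dots> = D1 (l v)"
    by (simp only: real_vector.linear_0[OF l(1)] jacobian_linear[OF l(1,2) v] D1_def)
  finally have 2: "jacobian m m (Fmap l) 0 (?q v) = D1 (l v)" .
  have "jacobian m m (Fmap l) 0 (?q v + trunc k v) = D1 (l v) + trunc k v"
    by (simp only: real_vector.linear_add[OF lin] 1 2)
  then show ?thesis by simp
qed

text \<open>If the derivative vanishes, \<open>D1 (l v)\<close> lies in \<open>Rn k\<close>. It
  agrees with v modulo \<open>Rn k\<close>, so v lies there too; then \<open>l v\<close> is 0 and v
  equals its truncation, which is 0.\<close>

lemma jacobian_Fmap_inj: assumes v: "v \<in> Rn m" and 0: "jacobian m m (Fmap l) 0 v = 0" shows "v = 0"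
proof -
  have eq: "D1 (l v) + trunc k v = 0" using 0 jacobian_Fmap[OF v] by simp
  then have "D1 (l v) = (-1) *\<^sub>R trunc k v" by (simp add: eq_neg_iff_add_eq_0)
  then have "D1 (l v) \<in> Rn k" by (simp only: Rn_scale[OF trunc_Rn])
  then have "D1 (l v) - (D1 (l v) - v) \<in> Rn k" using D1l[OF v] by (rule Rn_diff)
  then have vk: "v \<in> Rn k" by simp
  then have "D1 (l v) = 0" by (simp add: l(3) real_vector.linear_0[OF linear_D1])
  then show ?thesis using eq trunc_k_id[OF vk] by simp
qed

lemma ex_tube_inverse:
  obtains W0 H where "openin (Euclidean_space m) W0" "0 \<in> W0" "W0 \<subseteq> Fdom l"
    "openin (Euclidean_space m) (Fmap l ` W0)" "smooth_map m (Fmap l ` W0) m H" "\<And>w. w \<in> W0 \<Longrightarrow> H (Fmap l w) = w"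
  by (rule smooth_inverse_function[OF openin_Fdom Fdom_0(1) smooth_map_smooth_at[OF openin_Fdom smooth_at_Fmap] jacobian_Fmap_inj])
     (assumption | rule that)+

end

end

text \<open>The new parameters are the witnesses provided by \<open>ex_complement_map\<close>,
  \<open>ex_tube_inverse\<close> and the invariant mean on K. Fixing them in a locale lets all
  further maps be defined from the same choices.\<close>

locale slice_tube = slice_setting +
  fixes l W0 H Mn
  assumes l: "linear l" "\<And>v. l v \<in> Rn p" "\<And>v. v \<in> Rn k \<Longrightarrow> l v = 0"
    and D1l: "\<And>v. v \<in> Rn m \<Longrightarrow> D1 (l v) - v \<in> Rn k"
    and W0: "openin (Euclidean_space m) W0" "0 \<in> W0" "W0 \<subseteq> Fdom l" "openin (Euclidean_space m) (Fmap l ` W0)"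
    and H: "smooth_map m (Fmap l ` W0) m H" "\<And>w. w \<in> W0 \<Longrightarrow> H (Fmap l w) = w"
    and mean: "positive_mean TK Mn"
    and mean_inv: "\<And>f h. continuous_map TK euclideanreal f \<Longrightarrow> h \<in> K \<Longrightarrow> Mn (\<lambda>k. f (k \<otimes> h)) = Mn f"
begin

definition Wx where "Wx = {y \<in> fst c. \<kappa> y \<in> Fmap l ` W0}"

definition \<theta> where "\<theta> y = H (\<kappa> y)"

definition r where "r y = trunc k (\<theta> y)"

definition g0 where "g0 y = \<gamma> (l (\<theta> y))"

lemma openin_Wx: "openin (mtop M) Wx"
  unfolding Wx_def
  by (rule smooth_at_open_preimage[OF \<kappa>_smooth openin_fst_max[OF c_max]]) (use W0(4) in auto)

lemma Wx_facts:
  assumes y: "y \<in> Wx"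
  shows "\<theta> y \<in> W0" "Fpre l (\<theta> y) = y" "g0 y \<in> carrier G" "r y \<in> cdom M c x" "\<mu> (r y) \<in> S"
    "\<phi> (g0 y) (\<mu> (r y)) = y" "y \<in> points M" "y \<in> fst c"
proof -
  have yc: "y \<in> fst c" "\<kappa> y \<in> Fmap l ` W0" using y by (simp_all add: Wx_def)
  then obtain w where w: "w \<in> W0" "\<kappa> y = Fmap l w" by (elim imageE)
  have th: "\<theta> y = w" by (simp add: \<theta>_def w(2) H(2)[OF w(1)])
  have wd: "l w \<in> cdom GM \<xi> \<one>" "trunc k w \<in> cdom M c x" "Fpre l w \<in> fst c"
    using w(1) W0(3) by (auto simp: Fdom_def)
  have "\<mu> (\<kappa> y) = \<mu> (\<kappa> (Fpre l w))" using w(2) by (simp add: Fmap_def)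
  then have Fw: "Fpre l w = y" using \<mu>_\<kappa> yc(1) wd(3) by simp
  show "\<theta> y \<in> W0" "Fpre l (\<theta> y) = y" "g0 y \<in> carrier G" "r y \<in> cdom M c x" "\<mu> (r y) \<in> S"
    "\<phi> (g0 y) (\<mu> (r y)) = y" "y \<in> points M" "y \<in> fst c"
    using w(1) th Fw wd yc(1) \<gamma>_carrier \<mu>_S[OF wd(2)] trunc_Rn[of k w] max_points[OF c_max]
    by (simp_all add: g0_def r_def Fpre_def)
qed

lemma smooth_at_\<theta>: assumes y: "y \<in> Wx" shows "smooth_at M (Rn_mfd m) \<theta> y"
proof -
  have "\<kappa> y \<in> Fmap l ` W0" using y by (simp add: Wx_def)
  then have "smooth_at (Rn_mfd m) (Rn_mfd m) H (\<kappa> y)" by (rule smooth_at_RnI[OF W0(4) _ H(1)])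
  then show ?thesis unfolding \<theta>_def[abs_def]
    by (rule smooth_at_compose[OF pM pre_manifold_Rn pre_manifold_Rn \<kappa>_smooth[OF Wx_facts(8)[OF y]]])
qed

lemma smooth_at_r: assumes y: "y \<in> Wx" shows "smooth_at M (Rn_mfd k) r y"
  unfolding r_def[abs_def]
  by (rule smooth_at_compose[OF pM pre_manifold_Rn pre_manifold_Rn, where f=\<theta> and g="trunc k"])
     (rule smooth_at_\<theta>[OF y], rule smooth_at_linear[OF linear_trunc trunc_Rn],
      use smooth_at_points[OF smooth_at_\<theta>[OF y]] in simp)

lemma smooth_at_g0: assumes y: "y \<in> Wx" shows "smooth_at M GM g0 y"
proof -
  have th: "\<theta> y \<in> Rn m" using smooth_at_points[OF smooth_at_\<theta>[OF y]] by simp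
  have ld: "l (\<theta> y) \<in> cdom GM \<xi> \<one>" using Wx_facts(1)[OF y] W0(3) by (auto simp: Fdom_def)
  have "smooth_at M (Rn_mfd p) (\<lambda>y. l (\<theta> y)) y"
    by (rule smooth_at_compose[OF pM pre_manifold_Rn pre_manifold_Rn, where f=\<theta> and g=l])
       (rule smooth_at_\<theta>[OF y], rule smooth_at_linear[OF l(1,2) th])
  then show ?thesis unfolding g0_def[abs_def]
    by (rule smooth_at_compose[OF pM pre_manifold_Rn pG, where g=\<gamma>]) (rule \<gamma>_smooth[OF ld])
qed

lemma W0_Rk:
  assumes b: "b \<in> W0" "b \<in> Rn k"
  shows "b \<in> cdom M c x" "\<mu> b \<in> Wx" "\<theta> (\<mu> b) = b" "r (\<mu> b) = b" "\<mu> b \<in> S"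
proof -
  have "b \<in> Fdom l" using b(1) W0(3) by auto
  then show bd: "b \<in> cdom M c x" using trunc_k_id[OF b(2)] by (simp add: Fdom_def)
  have F: "Fmap l b = b" by (rule Fdom_Rk(3)[OF l D1l bd b(2)])
  have m: "\<mu> b \<in> fst c" "\<kappa> (\<mu> b) = b" using cpar_mem[OF pM c_max ad(2) bd] \<kappa>_\<mu>[OF bd] by simp_all
  show "\<mu> b \<in> Wx" unfolding Wx_def using m b(1) F by (simp add: image_iff) (metis F)
  show "\<theta> (\<mu> b) = b" using H(2)[OF b(1)] by (simp add: \<theta>_def m(2) F)
  then show "r (\<mu> b) = b" by (simp add: r_def trunc_k_id[OF b(2)])
  show "\<mu> b \<in> S" using \<mu>_S[OF bd] b(2) by simp
qed

lemma x_Wx: "x \<in> Wx" "r x = 0"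
  using W0_Rk[OF W0(2) Rn_0] by (simp_all add: \<mu>_0)

text \<open>The element \<open>inv (g0 y') \<otimes> (g \<otimes> g0 y)\<close> carries one slice
  point to the other, so the slice property puts it in K. Slice coordinates of nearby points on one
  orbit thus agree up to K.\<close>

lemma slice_transporter:
  assumes y: "y \<in> Wx" "y' \<in> Wx" and g: "g \<in> carrier G" "y' = \<phi> g y"
  obtains h where "h \<in> K" "\<mu> (r y') = \<phi> h (\<mu> (r y))"
proof -
  note f = Wx_facts[OF y(1)] and f' = Wx_facts[OF y(2)]
  have mu: "\<mu> (r y) \<in> points M" "\<mu> (r y') \<in> points M" using \<mu>_points f(4) f'(4) by simp_all
  define h where "h = inv (g0 y') \<otimes> (g \<otimes> g0 y)"
  have hG: "h \<in> carrier G" using f(3) f'(3) g(1) by (simp add: h_def)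
  have "\<phi> h (\<mu> (r y)) = \<phi> (inv (g0 y')) (\<phi> g (\<phi> (g0 y) (\<mu> (r y))))"
    using f(3) f'(3) g(1) mu by (simp add: h_def act_mult act_points)
  also have "\<dots> = \<phi> (inv (g0 y')) (\<phi> (g0 y') (\<mu> (r y')))" using f(6) f'(6) g(2) by simp
  also have "\<dots> = \<mu> (r y')" by (rule act_inv[OF f'(3) mu(2)])
  finally have eq: "\<phi> h (\<mu> (r y)) = \<mu> (r y')" .
  then have "h \<in> K" using S_slice[OF hG f(5)] f'(5) by simp
  then show ?thesis using that eq by simp
qed

end

subsection \<open>Averaging the slice coordinates\<close>

lemma continuous_map_Rn_coords:
  "continuous_map X (Euclidean_space n) f \<longleftrightarrow>
    f ` topspace X \<subseteq> Rn n \<and> (\<forall>i<n. continuous_map X euclideanreal (\<lambda>x. f x i))"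
proof
  assume L: "continuous_map X (Euclidean_space n) f"
  have im: "f ` topspace X \<subseteq> Rn n" by (rule continuous_map_image_subset_topspace[OF L])
  have "continuous_map X (powertop_real UNIV) f"
    using L unfolding Euclidean_space_def by (rule continuous_map_into_fulltopology)
  then show "f ` topspace X \<subseteq> Rn n \<and> (\<forall>i<n. continuous_map X euclideanreal (\<lambda>x. f x i))"
    using im by (simp add: continuous_map_componentwise_UNIV)
next
  assume R: "f ` topspace X \<subseteq> Rn n \<and> (\<forall>i<n. continuous_map X euclideanreal (\<lambda>x. f x i))"
  then have "continuous_map X (Euclidean_space n) (\<lambda>x i. if i < n then f x i else 0)"
    unfolding continuous_map_componentwise_Euclidean_space by simp
  then show "continuous_map X (Euclidean_space n) f"
    by (rule continuous_map_eq) (use R in \<open>auto simp: fun_eq_iff mem_Rn image_subset_iff\<close>)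
qed

context slice_setting
begin

definition U0 where "U0 = cdom M c x \<inter> Rn k"

lemma openin_U0: "openin (Euclidean_space k) U0"
  unfolding U0_def by (rule openin_Rn_restrict[OF openin_cdom[OF pM c_max ad(2)] km])

lemma U0_0: "0 \<in> U0"
  by (simp add: U0_def cdom_0[OF pM c_max ad(2)])

lemma \<mu>_continuous: "continuous_map (subtopology (Euclidean_space k) U0) (mtop M) \<mu>"
proof -
  have "msmooth_on (Rn_mfd m) (cdom M c x) M \<mu>"
    by (rule msmooth_onI[OF pre_manifold_Rn pM _ \<mu>_smooth]) (use openin_cdom[OF pM c_max ad(2)] in simp)
  then have "continuous_map (subtopology (mtop (Rn_mfd m)) (cdom M c x)) (mtop M) \<mu>"
    unfolding msmooth_on_def by (elim conjE)
  then have "continuous_map (top_of_set (cdom M c x)) (mtop M) \<mu>"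
    using subtopology_Rn[OF openin_Rn_subset[OF openin_cdom[OF pM c_max ad(2)]]] by simp
  then have "continuous_map (top_of_set U0) (mtop M) \<mu>"
    by (rule continuous_map_from_subtopology_mono) (auto simp: U0_def)
  then show ?thesis using subtopology_Rn[OF openin_Rn_subset[OF openin_U0]] by simp
qed

lemma act_\<mu>_continuous:
  "continuous_map (prod_topology (mtop GM) (subtopology (Euclidean_space k) U0)) (mtop M) (\<lambda>(h, b). \<phi> h (\<mu> b))"
proof -
  have "continuous_map (prod_topology (mtop GM) (subtopology (Euclidean_space k) U0)) (prod_topology (mtop GM) (mtop M))
      (\<lambda>q. (fst q, \<mu> (snd q)))"
    using continuous_map_compose[OF continuous_map_snd \<mu>_continuous]
    by (intro continuous_map_pairedI continuous_map_fst) (simp add: o_def)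
  from continuous_map_compose[OF this continuous_act] show ?thesis by (simp add: o_def case_prod_beta')
qed

text \<open>The whole K-orbit is required to stay in the chart. This makes the set K-invariant and,
  by compactness of K, still open, so that K acts on it through \<open>act_S\<close>.\<close>

definition B1 where "B1 = {b \<in> U0. \<forall>h\<in>K. \<phi> h (\<mu> b) \<in> fst c}"

definition act_S :: "_ \<Rightarrow> (nat \<Rightarrow> real) \<Rightarrow> nat \<Rightarrow> real" where "act_S h b = \<kappa> (\<phi> h (\<mu> b))"

text \<open>For each b the compact set \<open>K \<times> {b}\<close> has a product neighbourhood
  that the action carries into V.\<close>

lemma openin_K_tube:
  assumes V: "openin (mtop M) V"
  shows "openin (Euclidean_space k) {b \<in> U0. \<forall>h\<in>K. \<phi> h (\<mu> b) \<in> V}"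
proof (subst openin_subopen, rule ballI)
  let ?E = "subtopology (Euclidean_space k) U0"
  let ?P = "prod_topology (mtop GM) ?E"
  have tE: "topspace ?E = U0" using openin_subset[OF openin_U0] by auto
  fix b assume "b \<in> {b \<in> U0. \<forall>h\<in>K. \<phi> h (\<mu> b) \<in> V}"
  then have b: "b \<in> U0" "\<forall>h\<in>K. \<phi> h (\<mu> b) \<in> V" by simp_all
  have o: "openin ?P {q \<in> topspace ?P. (case q of (h, b) \<Rightarrow> \<phi> h (\<mu> b)) \<in> V}"
    by (rule openin_continuous_map_preimage[OF act_\<mu>_continuous V])
  have sub: "K \<times> {b} \<subseteq> {q \<in> topspace ?P. (case q of (h, b) \<Rightarrow> \<phi> h (\<mu> b)) \<in> V}"
    using b tE K_carrier GM_points by auto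
  have "\<exists>N W. openin (mtop GM) N \<and> openin ?E W \<and> K \<subseteq> N \<and> b \<in> W \<and>
      N \<times> W \<subseteq> {q \<in> topspace ?P. (case q of (h, b) \<Rightarrow> \<phi> h (\<mu> b)) \<in> V}"
    by (rule tube_lemma_left[OF o K_compact _ sub]) (use b(1) tE in simp)
  then obtain N W where W: "openin ?E W" "K \<subseteq> N" "b \<in> W"
    "N \<times> W \<subseteq> {q \<in> topspace ?P. (case q of (h, b) \<Rightarrow> \<phi> h (\<mu> b)) \<in> V}"
    by (elim exE conjE) (rule that)
  have "openin (Euclidean_space k) W" using W(1) openin_U0 openin_trans_full by blast
  moreover have "W \<subseteq> {b \<in> U0. \<forall>h\<in>K. \<phi> h (\<mu> b) \<in> V}"
  proof
    fix b' assume b': "b' \<in> W"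
    then have "b' \<in> U0" using openin_subset[OF W(1)] tE by auto
    moreover have "\<phi> h (\<mu> b') \<in> V" if "h \<in> K" for h
    proof -
      have "(h, b') \<in> N \<times> W" using that b' W(2) by auto
      then have "(h, b') \<in> {q \<in> topspace ?P. (case q of (h, b) \<Rightarrow> \<phi> h (\<mu> b)) \<in> V}" using W(4) by (rule rev_subsetD)
      then show ?thesis by simp
    qed
    ultimately show "b' \<in> {b \<in> U0. \<forall>h\<in>K. \<phi> h (\<mu> b) \<in> V}" by simp
  qed
  ultimately show "\<exists>T. openin (Euclidean_space k) T \<and> b \<in> T \<and> T \<subseteq> {b \<in> U0. \<forall>h\<in>K. \<phi> h (\<mu> b) \<in> V}"
    using W(3) by (intro exI[of _ W]) simp
qed

lemma openin_B1: "openin (Euclidean_space k) B1"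
  unfolding B1_def by (rule openin_K_tube[OF openin_fst_max[OF c_max]])

lemma B1_0: "0 \<in> B1"
  by (simp add: B1_def U0_0 \<mu>_0 K_fix ad(2))

lemma B1_D:
  assumes "b \<in> B1" shows "b \<in> U0" "b \<in> cdom M c x" "b \<in> Rn k" "\<mu> b \<in> points M" "\<mu> b \<in> S"
    "h \<in> K \<Longrightarrow> \<phi> h (\<mu> b) \<in> fst c" "h \<in> K \<Longrightarrow> \<phi> h (\<mu> b) \<in> S"
  using assms \<mu>_points \<mu>_S S_inv by (simp_all add: B1_def U0_def)

lemma act_S_facts:
  assumes b: "b \<in> B1" and h: "h \<in> K"
  shows "\<mu> (act_S h b) = \<phi> h (\<mu> b)" "act_S h b \<in> B1" "act_S h b \<in> Rn k"
proof -
  note f = B1_D[OF b]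
  have fc: "\<phi> h (\<mu> b) \<in> fst c" "\<phi> h (\<mu> b) \<in> S" using f(6,7) h by simp_all
  show 1: "\<mu> (act_S h b) = \<phi> h (\<mu> b)" unfolding act_S_def by (rule \<mu>_\<kappa>[OF fc(1)])
  show 2: "act_S h b \<in> Rn k" using \<kappa>_S[OF fc(1)] fc(2) by (simp add: act_S_def)
  have "act_S h b \<in> cdom M c x" unfolding act_S_def by (rule ccoord_cdom[OF pM c_max ad(2) fc(1)])
  then have "act_S h b \<in> U0" using 2 by (simp add: U0_def)
  moreover have "\<phi> h' (\<mu> (act_S h b)) \<in> fst c" if h': "h' \<in> K" for h'
    using f(6)[OF K_mult[OF h' h]] 1 f(4) K_carrier[OF h] K_carrier[OF h'] by (simp add: act_mult)
  ultimately show "act_S h b \<in> B1" by (simp add: B1_def)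
qed

lemma act_S_mult: "\<lbrakk>b \<in> B1; h \<in> K; h' \<in> K\<rbrakk> \<Longrightarrow> act_S h (act_S h' b) = act_S (h \<otimes> h') b"
  using act_S_facts(1)[of b h'] B1_D(4)[of b] by (simp add: act_S_def[of h] act_S_def[of "h \<otimes> h'"] act_mult K_carrier)

lemma act_S_one: "b \<in> B1 \<Longrightarrow> act_S \<one> b = b"
  using B1_D(2,4)[of b] by (simp add: act_S_def act_one \<kappa>_\<mu>)

lemma rho_part_deriv:
  assumes "i < k" "j < m" shows "part_deriv i (\<lambda>b. act_S h b j) 0 = rho h (uvec i) j"
  using assms km by (simp add: rho_def act_S_def jacobian_uvec)

subsubsection \<open>Joint smoothness in the group element and the point\<close>

text \<open>K carries only a topology here, so smoothness in h is borrowed from the group: locally F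
  agrees on K with a smooth function \<open>Hf\<close> of group chart coordinates and b. Unlike mere
  joint continuity, this property is inherited by partial derivatives in b.\<close>

definition joint_smooth :: "(nat \<Rightarrow> real) set \<Rightarrow> (_ \<Rightarrow> (nat \<Rightarrow> real) \<Rightarrow> real) \<Rightarrow> bool"
  where "joint_smooth U F \<longleftrightarrow> (\<forall>h0\<in>K. \<forall>b0\<in>U. \<exists>e N Ub V Hf. e \<in> max_atlas GM \<and> h0 \<in> N \<and> openin (mtop GM) N \<and> N \<subseteq> fst e \<and>
    openin (Euclidean_space k) Ub \<and> b0 \<in> Ub \<and> Ub \<subseteq> U \<and> openin (Euclidean_space (p + k)) V \<and>
    (\<forall>n. Ck_on n (p + k) V Hf) \<and> (\<forall>h\<in>N. \<forall>b\<in>Ub. append_coords p (snd e h) b \<in> V) \<and>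
    (\<forall>h\<in>N \<inter> K. \<forall>b\<in>Ub. F h b = Hf (append_coords p (snd e h) b)))"

lemma joint_smoothD:
  assumes "joint_smooth U F" "h0 \<in> K" "b0 \<in> U"
  obtains e N Ub V Hf where "e \<in> max_atlas GM" "h0 \<in> N" "openin (mtop GM) N" "N \<subseteq> fst e"
    "openin (Euclidean_space k) Ub" "b0 \<in> Ub" "Ub \<subseteq> U" "openin (Euclidean_space (p + k)) V"
    "\<forall>n. Ck_on n (p + k) V Hf" "\<forall>h\<in>N. \<forall>b\<in>Ub. append_coords p (snd e h) b \<in> V"
    "\<forall>h\<in>N \<inter> K. \<forall>b\<in>Ub. F h b = Hf (append_coords p (snd e h) b)"
  using assms(1)[unfolded joint_smooth_def, THEN bspec, OF assms(2), THEN bspec, OF assms(3)]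
  by (elim exE conjE) (rule that)

lemma append_coords_upd: "append_coords p u (b(i := t)) = (append_coords p u b)(p + i := t)"
  by (auto simp: append_coords_def fun_eq_iff)

lemma append_coords_nth: "append_coords p u b (p + i) = b i"
  by (simp add: append_coords_def)

lemma joint_smooth_DERIV:
  assumes Ub: "openin (Euclidean_space k) Ub" "b \<in> Ub" and V: "openin (Euclidean_space (p + k)) V"
    and Hf: "Ck_on (Suc 0) (p + k) V Hf" and cV: "\<And>b. b \<in> Ub \<Longrightarrow> append_coords p u b \<in> V"
    and F: "\<And>b. b \<in> Ub \<Longrightarrow> F b = Hf (append_coords p u b)" and i: "i < k"
  shows "((\<lambda>t. F (b(i := t))) has_field_derivative part_deriv (p + i) Hf (append_coords p u b)) (at (b i))"
proof -
  have "((\<lambda>t. Hf ((append_coords p u b)(p + i := t))) has_field_derivative part_deriv (p + i) Hf (append_coords p u b))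
      (at (append_coords p u b (p + i)))"
    by (rule partially_diffD[OF Ck_on_SucD(2)[OF V Hf] _ cV[OF Ub(2)]]) (use i in simp)
  then have "((\<lambda>t. Hf (append_coords p u (b(i := t)))) has_field_derivative part_deriv (p + i) Hf (append_coords p u b)) (at (b i))"
    by (simp only: append_coords_upd append_coords_nth)
  then show ?thesis
    using DERIV_line_cong[of k Ub F "\<lambda>b. Hf (append_coords p u b)" b i, OF Ub(1) F Ub(2) i] by simp
qed

text \<open>The i-th partial derivative in b is the one of \<open>Hf\<close> with index
  \<open>p + i\<close>, so the same chart and neighbourhoods serve.\<close>

lemma joint_smooth_part_deriv:
  assumes F: "joint_smooth U F" and i: "i < k"
  shows "joint_smooth U (\<lambda>h. part_deriv i (F h))"
  unfolding joint_smooth_def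
proof (intro ballI)
  fix h0 b0 assume h0: "h0 \<in> K" and b0: "b0 \<in> U"
  obtain e N Ub V Hf where e: "e \<in> max_atlas GM" "h0 \<in> N" "openin (mtop GM) N" "N \<subseteq> fst e"
    and Ub: "openin (Euclidean_space k) Ub" "b0 \<in> Ub" "Ub \<subseteq> U" and V: "openin (Euclidean_space (p + k)) V"
    and Hf: "\<forall>n. Ck_on n (p + k) V Hf" and cV: "\<forall>h\<in>N. \<forall>b\<in>Ub. append_coords p (snd e h) b \<in> V"
    and FH: "\<forall>h\<in>N \<inter> K. \<forall>b\<in>Ub. F h b = Hf (append_coords p (snd e h) b)"
    by (rule joint_smoothD[OF F h0 b0])
  have "\<forall>n. Ck_on n (p + k) V (part_deriv (p + i) Hf)"
    using Ck_on_SucD(3)[OF V Hf[THEN spec], of "p + i"] i by simp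
  moreover have "part_deriv i (F h) b = part_deriv (p + i) Hf (append_coords p (snd e h) b)" if "h \<in> N \<inter> K" "b \<in> Ub" for h b
    by (rule part_deriv_eqI, rule joint_smooth_DERIV[OF Ub(1) that(2) V Hf[THEN spec] _ _ i])
       (use cV FH that in simp_all)
  ultimately show "\<exists>e N Ub V Hf. e \<in> max_atlas GM \<and> h0 \<in> N \<and> openin (mtop GM) N \<and> N \<subseteq> fst e \<and>
    openin (Euclidean_space k) Ub \<and> b0 \<in> Ub \<and> Ub \<subseteq> U \<and> openin (Euclidean_space (p + k)) V \<and>
    (\<forall>n. Ck_on n (p + k) V Hf) \<and> (\<forall>h\<in>N. \<forall>b\<in>Ub. append_coords p (snd e h) b \<in> V) \<and>
    (\<forall>h\<in>N \<inter> K. \<forall>b\<in>Ub. part_deriv i (F h) b = Hf (append_coords p (snd e h) b))"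
    using e Ub V cV by (intro exI[of _ e] exI[of _ N] exI[of _ Ub] exI[of _ V] exI[of _ "part_deriv (p + i) Hf"] conjI) simp_all
qed

lemma joint_smooth_partially_diff:
  assumes F: "joint_smooth U F" and h: "h \<in> K"
  shows "partially_diff k U (F h)"
  unfolding partially_diff_def
proof (intro allI impI ballI)
  fix i b0 assume i: "i < k" and b0: "b0 \<in> U"
  obtain e N Ub V Hf where e: "e \<in> max_atlas GM" "h \<in> N" "openin (mtop GM) N" "N \<subseteq> fst e"
    and Ub: "openin (Euclidean_space k) Ub" "b0 \<in> Ub" "Ub \<subseteq> U" and V: "openin (Euclidean_space (p + k)) V"
    and Hf: "\<forall>n. Ck_on n (p + k) V Hf" and cV: "\<forall>h\<in>N. \<forall>b\<in>Ub. append_coords p (snd e h) b \<in> V"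
    and FH: "\<forall>h\<in>N \<inter> K. \<forall>b\<in>Ub. F h b = Hf (append_coords p (snd e h) b)"
    by (rule joint_smoothD[OF F h b0])
  have "((\<lambda>t. F h (b0(i := t))) has_field_derivative part_deriv (p + i) Hf (append_coords p (snd e h) b0)) (at (b0 i))"
    by (rule joint_smooth_DERIV[OF Ub(1,2) V Hf[THEN spec] _ _ i]) (use cV FH e(2) h in simp_all)
  then show "(\<lambda>t. F h (b0(i := t))) field_differentiable at (b0 i)"
    unfolding field_differentiable_def by (rule exI)
qed

lemma joint_smooth_continuous:
  assumes U: "openin (Euclidean_space k) U" and F: "joint_smooth U F"
  shows "continuous_map (prod_topology TK (subtopology (Euclidean_space k) U)) euclideanreal (\<lambda>(h, b). F h b)"
  unfolding continuous_map_def
proof (intro conjI allI impI)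
  let ?P = "prod_topology TK (subtopology (Euclidean_space k) U)"
  have tU: "topspace (subtopology (Euclidean_space k) U) = U" using openin_subset[OF U] by auto
  fix Y :: "real set" assume Y: "openin euclideanreal Y"
  show "openin ?P {q \<in> topspace ?P. (case q of (h, b) \<Rightarrow> F h b) \<in> Y}"
  proof (subst openin_subopen, rule ballI)
    fix q assume "q \<in> {q \<in> topspace ?P. (case q of (h, b) \<Rightarrow> F h b) \<in> Y}"
    moreover obtain h0 b0 where q: "q = (h0, b0)" by (cases q)
    ultimately have h0: "h0 \<in> K" and b0: "b0 \<in> U" and FY: "F h0 b0 \<in> Y" using tU TK_topspace by auto
    obtain e N Ub V Hf where e: "e \<in> max_atlas GM" "h0 \<in> N" "openin (mtop GM) N" "N \<subseteq> fst e"
    and Ub: "openin (Euclidean_space k) Ub" "b0 \<in> Ub" "Ub \<subseteq> U" and V: "openin (Euclidean_space (p + k)) V"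
    and Hf: "\<forall>n. Ck_on n (p + k) V Hf" and cV: "\<forall>h\<in>N. \<forall>b\<in>Ub. append_coords p (snd e h) b \<in> V"
    and FH: "\<forall>h\<in>N \<inter> K. \<forall>b\<in>Ub. F h b = Hf (append_coords p (snd e h) b)"
    by (rule joint_smoothD[OF F h0 b0])
    let ?Q = "prod_topology (subtopology (mtop GM) N) (subtopology (Euclidean_space k) Ub)"
    have tN: "topspace (subtopology (mtop GM) N) = N" using openin_subset[OF e(3)] by auto
    have tUb: "topspace (subtopology (Euclidean_space k) Ub) = Ub" using openin_subset[OF Ub(1)] by auto
    have "continuous_map (subtopology (mtop GM) N) (Euclidean_space p) (snd e)"
      by (rule continuous_map_from_subtopology_mono[OF chart_continuous[OF max_is_chart[OF e(1)]] e(4)])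
    note ce = this[unfolded continuous_map_Rn_coords, THEN conjunct2, rule_format]
    have c1: "continuous_map ?Q euclideanreal (\<lambda>q. snd e (fst q) i)" if "i < p" for i
      using continuous_map_compose[OF continuous_map_fst ce[OF that]] by (simp add: o_def)
    have "continuous_map (subtopology (Euclidean_space k) Ub) (Euclidean_space k) (\<lambda>b. b)"
      using continuous_map_from_subtopology[OF continuous_map_id] by (simp add: id_def)
    note ci = this[unfolded continuous_map_Rn_coords, THEN conjunct2, rule_format]
    have c2: "continuous_map ?Q euclideanreal (\<lambda>q. snd q i)" if "i < k" for i
      using continuous_map_compose[OF continuous_map_snd ci[OF that]] by (simp add: o_def)
    have cc: "continuous_map ?Q (Euclidean_space (p + k)) (\<lambda>q. append_coords p (snd e (fst q)) (snd q))"
      unfolding continuous_map_Rn_coords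
    proof (intro conjI allI impI)
      show "(\<lambda>q. append_coords p (snd e (fst q)) (snd q)) ` topspace ?Q \<subseteq> Rn (p + k)"
        unfolding image_subset_iff
      proof (intro ballI)
        fix q assume "q \<in> topspace ?Q"
        then have "snd q \<in> Ub" using tUb by (simp only: topspace_prod_topology mem_Times_iff)
        then show "append_coords p (snd e (fst q)) (snd q) \<in> Rn (p + k)" by (intro append_coords_Rn openin_Rn_mem[OF Ub(1)])
      qed
      show "continuous_map ?Q euclideanreal (\<lambda>q. append_coords p (snd e (fst q)) (snd q) i)" if "i < p + k" for i
        using c1[of i] c2[of "i - p"] that by (cases "i < p") (simp_all add: append_coords_def)
    qed
    have "openin (subtopology (Euclidean_space (p + k)) V) {w \<in> topspace (subtopology (Euclidean_space (p + k)) V). Hf w \<in> Y}"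
      using openin_continuous_map_preimage[OF Hf[THEN spec, of 0, unfolded Ck_on.simps(1)] Y] .
    moreover have tV: "topspace (subtopology (Euclidean_space (p + k)) V) = V"
      by (simp only: topspace_subtopology inf.absorb2[OF openin_subset[OF V]])
    ultimately have "openin (subtopology (Euclidean_space (p + k)) V) {w \<in> V. Hf w \<in> Y}"
      by (simp only: tV)
    then have "openin (Euclidean_space (p + k)) {w \<in> V. Hf w \<in> Y}"
      by (rule openin_trans_full[OF _ V])
    from openin_continuous_map_preimage[OF cc this]
    have "openin ?Q {q \<in> topspace ?Q. append_coords p (snd e (fst q)) (snd q) \<in> {w \<in> V. Hf w \<in> Y}}" .
    moreover have "(h0, b0) \<in> {q \<in> topspace ?Q. append_coords p (snd e (fst q)) (snd q) \<in> {w \<in> V. Hf w \<in> Y}}"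
      using e(2) Ub(2) cV FH h0 FY tN tUb by simp
    ultimately obtain N' U' where NU: "openin (subtopology (mtop GM) N) N'" "openin (subtopology (Euclidean_space k) Ub) U'"
      "h0 \<in> N'" "b0 \<in> U'" "N' \<times> U' \<subseteq> {q \<in> topspace ?Q. append_coords p (snd e (fst q)) (snd q) \<in> {w \<in> V. Hf w \<in> Y}}"
      unfolding openin_prod_topology_alt by (elim allE impE exE conjE) (assumption, rule that)
    have N': "openin (mtop GM) N'" "N' \<subseteq> N" using NU(1) e(3) openin_trans_full openin_subset tN by blast+
    have U': "openin (Euclidean_space k) U'" "U' \<subseteq> Ub" using NU(2) Ub(1) openin_trans_full openin_subset tUb by blast+
    have "openin ?P ((N' \<inter> K) \<times> U')"
      unfolding openin_prod_Times_iff using N'(1) U' U Ub(3)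
      by (auto intro: openin_subtopology_Int simp: openin_open_subtopology)
    moreover have "(N' \<inter> K) \<times> U' \<subseteq> {q \<in> topspace ?P. (case q of (h, b) \<Rightarrow> F h b) \<in> Y}"
    proof
      fix z assume "z \<in> (N' \<inter> K) \<times> U'"
      then obtain h b where z: "z = (h, b)" "h \<in> N'" "h \<in> K" "b \<in> U'" by auto
      then have "(h, b) \<in> N' \<times> U'" by simp
      with NU(5) have "(h, b) \<in> {q \<in> topspace ?Q. append_coords p (snd e (fst q)) (snd q) \<in> {w \<in> V. Hf w \<in> Y}}" by (rule subsetD)
      then have "Hf (append_coords p (snd e h) b) \<in> Y" "h \<in> N" "b \<in> Ub" using tN tUb by simp_all
      then show "z \<in> {q \<in> topspace ?P. (case q of (h, b) \<Rightarrow> F h b) \<in> Y}"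
        using z FH Ub(3) tU TK_topspace by auto
    qed
    ultimately show "\<exists>T. openin ?P T \<and> q \<in> T \<and> T \<subseteq> {q \<in> topspace ?P. (case q of (h, b) \<Rightarrow> F h b) \<in> Y}"
      using q NU(3,4) h0 by (intro exI[of _ "(N' \<inter> K) \<times> U'"]) simp
  qed
qed simp

text \<open>This links the action to differentiation under the mean: every iterated partial
  derivative is again jointly smooth, hence jointly continuous.\<close>

lemma joint_smooth_param_Ck:
  assumes U: "openin (Euclidean_space k) U" and F: "joint_smooth U F"
  shows "param_Ck n TK k U F"
  using F
proof (induction n arbitrary: F)
  case 0 then show ?case using joint_smooth_continuous[OF U] by simp
next
  case (Suc n)
  then show ?case
    using joint_smooth_continuous[OF U] joint_smooth_partially_diff joint_smooth_part_deriv TK_topspace by simp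
qed

text \<open>The witness is the action written in a group chart, \<mu> and \<kappa>. The box
  \<open>N' \<times> U'\<close> keeps its values inside the chart c for all group elements near
  \<open>h0\<close>, not only for those in K.\<close>

lemma joint_smooth_act_S:
  assumes j: "j < m" shows "joint_smooth B1 (\<lambda>h b. act_S h b j)"
  unfolding joint_smooth_def
proof (intro ballI)
  fix h0 b0 assume h0: "h0 \<in> K" and b0: "b0 \<in> B1"
  obtain e where e: "e \<in> atlas GM" "h0 \<in> fst e"
    by (rule atlas_cover[OF pG, of h0]) (use K_carrier[OF h0] GM_points in auto)
  note em = atlas_max[OF pG e(1)]
  let ?E = "Euclidean_space (p + k)"
  define \<Phi> where "\<Phi> w = \<phi> (chart_inv e (trunc p w)) (\<mu> (shift p w))" for w
  have oe: "openin (Euclidean_space p) (snd e ` fst e)"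
    by (rule max_open_image[OF em openin_fst_max[OF em] order_refl])
  have "openin ?E {w \<in> Rn (p + k). trunc p w \<in> snd e ` fst e}"
    by (rule openin_continuous_map_preimage[OF linear_Rn_continuous_map[OF linear_trunc trunc_Rn] oe])
  moreover have "openin ?E {w \<in> Rn (p + k). shift p w \<in> B1}"
    by (rule openin_continuous_map_preimage[OF linear_Rn_continuous_map[OF linear_shift shift_Rn] openin_B1])
  ultimately have "openin ?E ({w \<in> Rn (p + k). trunc p w \<in> snd e ` fst e} \<inter> {w \<in> Rn (p + k). shift p w \<in> B1})"
    by (rule openin_Int)
  moreover have "{w \<in> Rn (p + k). trunc p w \<in> snd e ` fst e} \<inter> {w \<in> Rn (p + k). shift p w \<in> B1}
      = {w \<in> Rn (p + k). trunc p w \<in> snd e ` fst e \<and> shift p w \<in> B1}" by auto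
  ultimately have oV0: "openin (mtop (Rn_mfd (p + k))) {w \<in> Rn (p + k). trunc p w \<in> snd e ` fst e \<and> shift p w \<in> B1}"
    by simp
  let ?V0 = "{w \<in> Rn (p + k). trunc p w \<in> snd e ` fst e \<and> shift p w \<in> B1}"
  have s\<Phi>: "smooth_at (Rn_mfd (p + k)) M \<Phi> w" if w: "w \<in> ?V0" for w
    unfolding \<Phi>_def
  proof (rule smooth_at_act[OF pre_manifold_Rn])
    have w': "w \<in> Rn (p + k)" "trunc p w \<in> snd e ` fst e" "shift p w \<in> B1" using w by simp_all
    show "smooth_at (Rn_mfd (p + k)) GM (\<lambda>w. chart_inv e (trunc p w)) w"
      by (rule smooth_at_compose[OF pre_manifold_Rn pre_manifold_Rn pG, where f="trunc p" and g="chart_inv e"])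
         (rule smooth_at_linear[OF linear_trunc trunc_Rn w'(1)], rule smooth_at_chart_inv[OF pG em w'(2)])
    show "smooth_at (Rn_mfd (p + k)) M (\<lambda>w. \<mu> (shift p w)) w"
      by (rule smooth_at_compose[OF pre_manifold_Rn pre_manifold_Rn pM, where f="shift p" and g=\<mu>])
         (rule smooth_at_linear[OF linear_shift Rk_Rm[OF shift_Rn] w'(1)], assumption, rule \<mu>_smooth[OF B1_D(2)[OF w'(3)]])
  qed
  define V where "V = {w \<in> ?V0. \<Phi> w \<in> fst c}"
  have "openin (mtop (Rn_mfd (p + k))) V"
    unfolding V_def by (rule smooth_at_open_preimage[OF s\<Phi> oV0 openin_fst_max[OF c_max]])
  then have oV: "openin ?E V" by simp
  have "smooth_at (Rn_mfd (p + k)) (Rn_mfd m) (\<lambda>w. \<kappa> (\<Phi> w)) w" if "w \<in> V" for w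
    by (rule smooth_at_compose[OF pre_manifold_Rn pM pre_manifold_Rn s\<Phi> \<kappa>_smooth]) (use that in \<open>simp_all add: V_def\<close>)
  then have sV: "smooth_map (p + k) V m (\<lambda>w. \<kappa> (\<Phi> w))" by (rule smooth_map_smooth_at[OF oV])
  let ?P = "prod_topology (mtop GM) (subtopology (Euclidean_space k) U0)"
  have tU0: "topspace (subtopology (Euclidean_space k) U0) = U0" using openin_subset[OF openin_U0] by auto
  have o1: "openin ?P {q \<in> topspace ?P. (case q of (h, b) \<Rightarrow> \<phi> h (\<mu> b)) \<in> fst c}"
    by (rule openin_continuous_map_preimage[OF act_\<mu>_continuous openin_fst_max[OF c_max]])
  have mem: "(h0, b0) \<in> {q \<in> topspace ?P. (case q of (h, b) \<Rightarrow> \<phi> h (\<mu> b)) \<in> fst c}"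
    using B1_D(1,6)[OF b0] h0 K_carrier[OF h0] GM_points tU0 by simp
  obtain N' U' where NU: "openin (mtop GM) N'" "openin (subtopology (Euclidean_space k) U0) U'"
    "h0 \<in> N'" "b0 \<in> U'" "N' \<times> U' \<subseteq> {q \<in> topspace ?P. (case q of (h, b) \<Rightarrow> \<phi> h (\<mu> b)) \<in> fst c}"
    using o1[unfolded openin_prod_topology_alt, rule_format, OF mem] by (elim exE conjE) (rule that)
  have oU': "openin (Euclidean_space k) U'" using NU(2) openin_U0 openin_trans_full by blast
  define N where "N = N' \<inter> fst e"
  define Ub where "Ub = U' \<inter> B1"
  have oN: "openin (mtop GM) N" unfolding N_def by (rule openin_Int[OF NU(1) openin_fst_max[OF em]])
  have oUb: "openin (Euclidean_space k) Ub" unfolding Ub_def by (rule openin_Int[OF oU' openin_B1])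
  have key: "append_coords p (snd e h) b \<in> V \<and> \<Phi> (append_coords p (snd e h) b) = \<phi> h (\<mu> b)" if h: "h \<in> N" and b: "b \<in> Ub" for h b
  proof -
    have he: "h \<in> fst e" "h \<in> N'" and bB: "b \<in> B1" "b \<in> U'" using h b by (simp_all add: N_def Ub_def)
    have t: "trunc p (append_coords p (snd e h) b) = snd e h" by (rule trunc_append_coords[OF is_chart_Rn[OF max_is_chart[OF em] he(1)]])
    have \<Phi>: "\<Phi> (append_coords p (snd e h) b) = \<phi> h (\<mu> b)"
      by (simp add: \<Phi>_def t shift_append_coords max_inv_left[OF em he(1)])
    have "(h, b) \<in> N' \<times> U'" using he bB by simp
    with NU(5) have "(h, b) \<in> {q \<in> topspace ?P. (case q of (h, b) \<Rightarrow> \<phi> h (\<mu> b)) \<in> fst c}" by (rule subsetD)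
    then have "\<phi> h (\<mu> b) \<in> fst c" by simp
    then show ?thesis
      using \<Phi> t he(1) bB(1) append_coords_Rn[OF B1_D(3)[OF bB(1)], of p "snd e h"] by (simp add: V_def shift_append_coords)
  qed
  show "\<exists>e N Ub V Hf. e \<in> max_atlas GM \<and> h0 \<in> N \<and> openin (mtop GM) N \<and> N \<subseteq> fst e \<and>
    openin (Euclidean_space k) Ub \<and> b0 \<in> Ub \<and> Ub \<subseteq> B1 \<and> openin (Euclidean_space (p + k)) V \<and>
    (\<forall>n. Ck_on n (p + k) V Hf) \<and> (\<forall>h\<in>N. \<forall>b\<in>Ub. append_coords p (snd e h) b \<in> V) \<and>
    (\<forall>h\<in>N \<inter> K. \<forall>b\<in>Ub. act_S h b j = Hf (append_coords p (snd e h) b))"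
  proof (rule exI[of _ e], rule exI[of _ N], rule exI[of _ Ub], rule exI[of _ V], rule exI[of _ "\<lambda>w. \<kappa> (\<Phi> w) j"], intro conjI)
    show "\<forall>n. Ck_on n (p + k) V (\<lambda>w. \<kappa> (\<Phi> w) j)" using smooth_map_Ck[OF sV j] by blast
    show "\<forall>h\<in>N. \<forall>b\<in>Ub. append_coords p (snd e h) b \<in> V" using key by blast
    show "\<forall>h\<in>N \<inter> K. \<forall>b\<in>Ub. act_S h b j = \<kappa> (\<Phi> (append_coords p (snd e h) b)) j"
    proof (intro ballI)
      fix h b assume "h \<in> N \<inter> K" "b \<in> Ub"
      then show "act_S h b j = \<kappa> (\<Phi> (append_coords p (snd e h) b)) j" using key[of h b] by (simp add: act_S_def)
    qed
  qed (use em oN oUb oV NU(3,4) e(2) b0 in \<open>auto simp: N_def Ub_def\<close>)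
qed

text \<open>The entries of \<open>rho h\<close> are partial derivatives of \<open>act_S h\<close> at
  0, and these are jointly continuous in h and the point.\<close>

lemma rho_continuous:
  assumes "i < k" "j < m"
  shows "continuous_map TK euclideanreal (\<lambda>h. rho h (uvec i) j)"
    "continuous_map TK euclideanreal (\<lambda>h. rho (inv h) (uvec i) j)"
proof -
  have "param_Ck 0 TK k B1 (\<lambda>h. part_deriv i (\<lambda>b. act_S h b j))"
    by (rule joint_smooth_param_Ck[OF openin_B1 joint_smooth_part_deriv[OF joint_smooth_act_S[OF assms(2)] assms(1)]])
  then have "continuous_map TK euclideanreal (\<lambda>h. part_deriv i (\<lambda>b. act_S h b j) 0)"
    using param_continuous_slice[OF _ openin_B1 B1_0] by (simp only: param_Ck.simps(1))
  then show *: "continuous_map TK euclideanreal (\<lambda>h. rho h (uvec i) j)"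
    by (simp only: rho_part_deriv[OF assms])
  have "continuous_map TK TK (\<lambda>a. inv a)"
    using continuous_inv K_inv by (auto simp: continuous_map_in_subtopology intro: continuous_map_from_subtopology)
  from continuous_map_compose[OF this *] show "continuous_map TK euclideanreal (\<lambda>h. rho (inv h) (uvec i) j)"
    by (simp add: o_def)
qed

end

section \<open>Vector-valued means and averaging operators\<close>

context slice_tube
begin

text \<open>Components from k on are set to 0, so the mean of a family of slice vectors is again a
  slice vector.\<close>

definition vmean :: "(_ \<Rightarrow> nat \<Rightarrow> real) \<Rightarrow> nat \<Rightarrow> real"
  where "vmean F = (\<lambda>j. if j < k then Mn (\<lambda>h. F h j) else 0)"

definition K_family :: "(_ \<Rightarrow> nat \<Rightarrow> real) \<Rightarrow> bool"
  where "K_family F \<longleftrightarrow> (\<forall>h\<in>K. F h \<in> Rn k) \<and> (\<forall>j<k. continuous_map TK euclideanreal (\<lambda>h. F h j))"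

lemma vmean_Rk: "vmean F \<in> Rn k"
  by (simp add: vmean_def mem_Rn)

lemma vmean_cong: assumes "K_family F" "\<And>h. h \<in> K \<Longrightarrow> F h = F' h" shows "vmean F = vmean F'"
proof -
  have "Mn (\<lambda>h. F h j) = Mn (\<lambda>h. F' h j)" if "j < k" for j
    by (rule positive_mean_cong[OF mean]) (use assms that TK_topspace in \<open>simp_all add: K_family_def\<close>)
  then show ?thesis by (simp add: vmean_def fun_eq_iff)
qed

lemma vmean_translate: assumes "K_family F" "h \<in> K" shows "vmean (\<lambda>h'. F (h' \<otimes> h)) = vmean F"
  using mean_inv[of "\<lambda>h. F h _"] assms by (simp add: vmean_def K_family_def fun_eq_iff)

lemma vmean_const: assumes "v \<in> Rn k" shows "vmean (\<lambda>h. v) = v"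
  using positive_mean_const[OF mean] Rn_nth[OF assms] by (auto simp: vmean_def fun_eq_iff not_less)

lemma linear_apply_coord: assumes "linear L" "v \<in> Rn n" shows "L v j = (\<Sum>i<n. L (uvec i) j * v i)"
  using linear_Rn_expansion[OF assms] by (simp add: sum_fun_apply mult.commute)

text \<open>On \<open>Rn k\<close> each coordinate of L is a finite combination of coordinates, so L
  commutes with the mean by linearity of the latter.\<close>

lemma linear_vmean:
  assumes L: "linear L" "\<And>v. v \<in> Rn k \<Longrightarrow> L v \<in> Rn k" and F: "K_family F"
  shows "K_family (\<lambda>h. L (F h))" "vmean (\<lambda>h. L (F h)) = L (vmean F)"
proof -
  have cF: "continuous_map TK euclideanreal (\<lambda>h. F h i)" if "i < k" for i using F that by (simp add: K_family_def)
  have c: "continuous_map TK euclideanreal (\<lambda>h. \<Sum>i<k. L (uvec i) j * F h i)" for j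
    using cF by (intro continuous_map_sum continuous_map_real_mult_left) simp_all
  have *: "L (F h) j = (\<Sum>i<k. L (uvec i) j * F h i)" if "h \<in> K" for h j
    by (rule linear_apply_coord[OF L(1)]) (use F that in \<open>simp add: K_family_def\<close>)
  show "K_family (\<lambda>h. L (F h))"
    unfolding K_family_def
  proof (intro conjI ballI allI impI)
    show "continuous_map TK euclideanreal (\<lambda>h. L (F h) j)" for j
      by (rule continuous_map_eq[OF c[of j]]) (use * TK_topspace in simp)
  qed (use F L(2) in \<open>simp add: K_family_def\<close>)
  show "vmean (\<lambda>h. L (F h)) = L (vmean F)"
  proof
    fix j
    show "vmean (\<lambda>h. L (F h)) j = L (vmean F) j"
    proof (cases "j < k")
      case True
      have "vmean (\<lambda>h. L (F h)) j = Mn (\<lambda>h. L (F h) j)" using True by (simp add: vmean_def)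
      also have "\<dots> = Mn (\<lambda>h. \<Sum>i<k. L (uvec i) j * F h i)"
        by (rule positive_mean_cong[OF mean, symmetric]) (use c * TK_topspace in simp_all)
      also have "\<dots> = (\<Sum>i<k. Mn (\<lambda>h. L (uvec i) j * F h i))"
        by (rule positive_mean_sum[OF mean]) (use cF in \<open>auto intro: continuous_map_real_mult_left\<close>)
      also have "\<dots> = (\<Sum>i<k. L (uvec i) j * vmean F i)"
        by (rule sum.cong[OF refl]) (simp add: positive_mean_scale[OF mean cF] vmean_def)
      finally show ?thesis using linear_apply_coord[OF L(1) vmean_Rk] by simp
    next
      case False
      then show ?thesis using Rn_nth[OF L(2)[OF vmean_Rk], of j] by (simp add: vmean_def)
    qed
  qed
qed

lemma K_family_add: "\<lbrakk>K_family F; K_family F'\<rbrakk> \<Longrightarrow> K_family (\<lambda>h. F h + F' h) \<and> vmean (\<lambda>h. F h + F' h) = vmean F + vmean F'"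
  by (auto simp: K_family_def vmean_def fun_eq_iff positive_mean_add[OF mean] Rn_add simp del: topspace_Euclidean_space
      intro!: continuous_map_add)

lemma K_family_rho: assumes v: "v \<in> Rn k" shows "K_family (\<lambda>h. rho h v)" "K_family (\<lambda>h. rho (inv h) v)"
proof -
  have c: "continuous_map TK euclideanreal (\<lambda>h. \<Sum>i<k. rho h (uvec i) j * v i)"
    "continuous_map TK euclideanreal (\<lambda>h. \<Sum>i<k. rho (inv h) (uvec i) j * v i)" if "j < k" for j
    by (intro continuous_map_sum continuous_map_real_mult_right rho_continuous, use that km in simp_all)+
  show "K_family (\<lambda>h. rho h v)" "K_family (\<lambda>h. rho (inv h) v)"
    unfolding K_family_def using c rho_Rk(1)[OF _ v] K_inv linear_apply_coord[OF linear_rho v] by simp_all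
qed

definition fixed :: "(nat \<Rightarrow> real) set" where "fixed = {v \<in> Rn k. \<forall>h\<in>K. rho h v = v}"

definition e where "e v = vmean (\<lambda>h. rho h v)"

definition e' where "e' v = vmean (\<lambda>h. rho (inv h) v)"

lemma fixed_Rk: "v \<in> fixed \<Longrightarrow> v \<in> Rn k"
  by (simp add: fixed_def)

lemma fixed_rho: "v \<in> fixed \<Longrightarrow> h \<in> K \<Longrightarrow> rho h v = v"
  by (simp add: fixed_def)

lemma subspace_fixed: "subspace fixed"
  using linear_rho by (auto simp: fixed_def subspace_def Rn_add Rn_scale linear_add linear_scale linear_0
      simp del: topspace_Euclidean_space)

lemma e_fixed: "v \<in> fixed \<Longrightarrow> e v = v" "v \<in> fixed \<Longrightarrow> e' v = v"
  using vmean_cong[OF K_family_rho(1), of v "\<lambda>h. v"] vmean_cong[OF K_family_rho(2), of v "\<lambda>h. v"]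
  by (simp_all add: e_def e'_def fixed_def K_inv vmean_const)

lemma e_rho: assumes v: "v \<in> Rn k" and h: "h \<in> K" shows "e (rho h v) = e v"
proof -
  have "e (rho h v) = vmean (\<lambda>h'. rho (h' \<otimes> h) v)"
    unfolding e_def by (rule vmean_cong[OF K_family_rho(1)[OF rho_Rk(1)[OF h v]]]) (simp add: rho_mult h Rk_Rm[OF v])
  also have "\<dots> = e v" unfolding e_def by (rule vmean_translate[OF K_family_rho(1)[OF v] h])
  finally show ?thesis .
qed

lemma e_Rk: "e v \<in> Rn k" "e' v \<in> Rn k"
  by (simp_all only: e_def e'_def vmean_Rk)

text \<open>Applying \<open>rho h\<close> to \<open>rho (inv h') v\<close> gives
  \<open>rho (inv (h' \<otimes> inv h)) v\<close>, a right translate of the averaged family.\<close>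

lemma e'_mem: assumes v: "v \<in> Rn k" shows "e' v \<in> fixed"
  unfolding fixed_def
proof (intro CollectI conjI ballI e_Rk)
  fix h assume h: "h \<in> K"
  note hc = K_carrier[OF h] and hi = K_inv[OF h]
  have "rho h (e' v) = vmean (\<lambda>h'. rho h (rho (inv h') v))"
    unfolding e'_def by (rule linear_vmean(2)[OF linear_rho rho_Rk(1)[OF h] K_family_rho(2)[OF v], symmetric])
  also have "\<dots> = vmean (\<lambda>h'. rho (inv (h' \<otimes> inv h)) v)"
  proof (rule vmean_cong[OF linear_vmean(1)[OF linear_rho rho_Rk(1)[OF h] K_family_rho(2)[OF v]]])
    fix h' assume h': "h' \<in> K"
    then show "rho h (rho (inv h') v) = rho (inv (h' \<otimes> inv h)) v"
      using rho_mult[OF h K_inv[OF h'] Rk_Rm[OF v]] hc K_carrier[OF h'] by (simp add: inv_mult_group)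
  qed
  also have "\<dots> = e' v" unfolding e'_def by (rule vmean_translate[OF K_family_rho(2)[OF v] hi])
  finally show "rho h (e' v) = e' v" .
qed

subsection \<open>Linearizing coordinates on the slice\<close>

text \<open>Bochner's linearization: the action of h in slice coordinates, followed by the inverse
  of its derivative at 0, averaged over K.\<close>

definition \<psi> where "\<psi> b = vmean (\<lambda>h. rho (inv h) (act_S h b))"

lemma param_Ck_lin:
  assumes "j < k"
  shows "param_Ck n TK k B1 (\<lambda>h b. \<Sum>i<k. rho (inv h) (uvec i) j * act_S h b i)"
  by (rule param_Ck_sum[OF openin_B1 finite_lessThan])
     (use assms km in \<open>auto intro!: rho_continuous(2) joint_smooth_param_Ck[OF openin_B1 joint_smooth_act_S]\<close>)

lemma lin_eq:
  assumes "b \<in> B1" "h \<in> K" shows "rho (inv h) (act_S h b) j = (\<Sum>i<k. rho (inv h) (uvec i) j * act_S h b i)"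
  by (rule linear_apply_coord[OF linear_rho act_S_facts(3)[OF assms]])

lemma param_Ck_lin': assumes "j < k" shows "param_Ck n TK k B1 (\<lambda>h b. rho (inv h) (act_S h b) j)"
  by (rule param_Ck_cong[OF openin_B1 _ param_Ck_lin[OF assms]]) (use lin_eq TK_topspace in simp)

lemma K_family_lin: assumes b: "b \<in> B1" shows "K_family (\<lambda>h. rho (inv h) (act_S h b))"
  unfolding K_family_def
proof (intro conjI ballI allI impI)
  show "rho (inv h) (act_S h b) \<in> Rn k" if "h \<in> K" for h
    by (rule rho_Rk(1)[OF K_inv[OF that] act_S_facts(3)[OF b that]])
  show "continuous_map TK euclideanreal (\<lambda>h. rho (inv h) (act_S h b) j)" if "j < k" for j
    by (rule param_continuous_slice[OF _ openin_B1 b])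
       (rule param_Ck_continuous[OF param_Ck_lin'[OF that]])
qed

lemma \<psi>_Rk: "\<psi> b \<in> Rn k"
  by (simp only: \<psi>_def vmean_Rk)

lemma smooth_\<psi>: "smooth_map k B1 k \<psi>"
proof (rule smooth_mapI[OF \<psi>_Rk])
  fix j n assume j: "j < k"
  have "Ck_on n k B1 (\<lambda>b. Mn (\<lambda>h. rho (inv h) (act_S h b) j))"
    by (rule mean_Ck[OF mean TK_compact openin_B1 param_Ck_lin'[OF j]])
  then show "Ck_on n k B1 (\<lambda>b. \<psi> b j)" using j by (simp add: \<psi>_def vmean_def)
qed

text \<open>Substituting \<open>h' \<otimes> h\<close> for \<open>h'\<close> in the mean pulls the
  factor \<open>rho h\<close> out.\<close>

lemma \<psi>_act: assumes b: "b \<in> B1" and h: "h \<in> K" shows "\<psi> (act_S h b) = rho h (\<psi> b)"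
proof -
  note b' = act_S_facts(2)[OF b h]
  let ?F = "\<lambda>h'. rho (inv h') (act_S h' b)"
  note F = K_family_lin[OF b]
  have F': "K_family (\<lambda>h'. rho h (?F h'))" and m: "vmean (\<lambda>h'. rho h (?F h')) = rho h (\<psi> b)"
    using linear_vmean[OF linear_rho rho_Rk(1)[OF h] F] by (simp_all add: \<psi>_def)
  have "\<psi> (act_S h b) = vmean (\<lambda>h'. rho h (?F (h' \<otimes> h)))"
    unfolding \<psi>_def
  proof (rule vmean_cong[OF K_family_lin[OF b']])
    fix h' assume h': "h' \<in> K"
    have hh: "h' \<otimes> h \<in> K" by (rule K_mult[OF h' h])
    have "rho h (?F (h' \<otimes> h)) = rho (h \<otimes> inv (h' \<otimes> h)) (act_S (h' \<otimes> h) b)"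
      by (rule rho_mult[OF h K_inv[OF hh] Rk_Rm[OF act_S_facts(3)[OF b hh]], symmetric])
    also have "h \<otimes> inv (h' \<otimes> h) = inv h'"
      using K_carrier[OF h] K_carrier[OF h'] by (simp add: inv_mult_group m_assoc[symmetric])
    also have "act_S (h' \<otimes> h) b = act_S h' (act_S h b)" by (rule act_S_mult[OF b h' h, symmetric])
    finally show "rho (inv h') (act_S h' (act_S h b)) = rho h (?F (h' \<otimes> h))" by (simp add: act_S_mult[OF b h' h])
  qed
  also have "\<dots> = vmean (\<lambda>h'. rho h (?F h'))" by (rule vmean_translate[OF F' h])
  finally show ?thesis using m by simp
qed

lemma act_S_0: "h \<in> K \<Longrightarrow> act_S h 0 = 0"
  by (simp add: act_S_def \<mu>_0 K_fix ccoord_0[OF pM c_max ad(2)])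

lemma \<psi>_0: "\<psi> 0 = 0"
proof -
  have "\<psi> 0 = vmean (\<lambda>h. 0)"
    unfolding \<psi>_def by (rule vmean_cong[OF K_family_lin[OF B1_0]]) (simp add: act_S_0 linear_0[OF linear_rho])
  then show ?thesis using vmean_const[OF Rn_0] by simp
qed

text \<open>Each averaged map has derivative \<open>rho (inv h)\<close> after \<open>rho h\<close>,
  the identity, and differentiation passes under the mean.\<close>

lemma jacobian_\<psi>: assumes v: "v \<in> Rn k" shows "jacobian k k \<psi> 0 v = v"
proof -
  have pd: "part_deriv i (\<lambda>b. \<psi> b j) 0 = uvec i j" if i: "i < k" and j: "j < k" for i j
  proof -
    have d: "part_deriv i (\<lambda>b. rho (inv h) (act_S h b) j) 0 = uvec i j" if h: "h \<in> K" for h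
    proof -
      have "((\<lambda>t. act_S h ((0::nat \<Rightarrow> real)(i := t)) i') has_field_derivative rho h (uvec i) i') (at (0::real))" if i': "i' < k" for i'
      proof -
        have "(\<lambda>t. act_S h ((0::nat \<Rightarrow> real)(i := t)) i') field_differentiable at ((0::nat \<Rightarrow> real) i)"
          using joint_smooth_partially_diff[OF joint_smooth_act_S h, of i'] i' km
          unfolding partially_diff_def using i B1_0 by (metis order_less_le_trans)
        then have "((\<lambda>t. act_S h ((0::nat \<Rightarrow> real)(i := t)) i') has_field_derivative part_deriv i (\<lambda>b. act_S h b i') 0) (at ((0::nat \<Rightarrow> real) i))"
          unfolding part_deriv_def by (rule DERIV_deriv_iff_field_differentiable[THEN iffD2])
        then show ?thesis using rho_part_deriv[OF i, of i' h] i' km by simp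
      qed
      then have "((\<lambda>t. \<Sum>i'<k. rho (inv h) (uvec i') j * act_S h ((0::nat \<Rightarrow> real)(i := t)) i') has_field_derivative
          (\<Sum>i'<k. rho (inv h) (uvec i') j * rho h (uvec i) i')) (at ((0::nat \<Rightarrow> real) i))"
        by (intro DERIV_sum) (auto intro: DERIV_cmult)
      also have "(\<Sum>i'<k. rho (inv h) (uvec i') j * rho h (uvec i) i') = rho (inv h) (rho h (uvec i)) j"
        by (rule linear_apply_coord[OF linear_rho rho_Rk(1)[OF h uvec_Rn[OF i]], symmetric])
      also have "rho (inv h) (rho h (uvec i)) = uvec i"
        using rho_mult[OF K_inv[OF h] h Rk_Rm[OF uvec_Rn[OF i]]] rho_one[OF Rk_Rm[OF uvec_Rn[OF i]]] K_carrier[OF h] by simp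
      finally have "part_deriv i (\<lambda>b. \<Sum>i'<k. rho (inv h) (uvec i') j * act_S h b i') 0 = uvec i j"
        by (rule part_deriv_eqI)
      moreover have "part_deriv i (\<lambda>b. rho (inv h) (act_S h b) j) 0 = part_deriv i (\<lambda>b. \<Sum>i'<k. rho (inv h) (uvec i') j * act_S h b i') 0"
        by (rule part_deriv_cong[OF openin_B1 lin_eq[OF _ h] B1_0 i])
      ultimately show ?thesis by simp
    qed
    have "((\<lambda>t. Mn (\<lambda>h. rho (inv h) (act_S h ((0::nat \<Rightarrow> real)(i := t))) j)) has_field_derivative
        Mn (\<lambda>h. part_deriv i (\<lambda>b. rho (inv h) (act_S h b) j) 0)) (at ((0::nat \<Rightarrow> real) i))"
      by (rule mean_DERIV[OF mean TK_compact openin_B1 param_Ck_lin'[OF j] i B1_0])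
    moreover have "Mn (\<lambda>h. part_deriv i (\<lambda>b. rho (inv h) (act_S h b) j) 0) = Mn (\<lambda>h. uvec i j)"
      by (rule positive_mean_cong[OF mean, symmetric]) (use d TK_topspace in simp_all)
    ultimately have "((\<lambda>t. \<psi> ((0::nat \<Rightarrow> real)(i := t)) j) has_field_derivative uvec i j) (at ((0::nat \<Rightarrow> real) i))"
      using j positive_mean_const[OF mean] by (simp add: \<psi>_def vmean_def)
    then show ?thesis by (rule part_deriv_eqI)
  qed
  have "jacobian k k \<psi> 0 v j = v j" for j
  proof (cases "j < k")
    case True
    have "jacobian k k \<psi> 0 v j = (\<Sum>i<k. uvec i j * v i)" using True pd by (simp add: jacobian_def)
    also have "\<dots> = v j" using linear_apply_coord[OF linear_ident_fun v, of j] by simp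
    finally show ?thesis .
  qed (use Rn_nth[OF v] in \<open>simp add: jacobian_def\<close>)
  then show ?thesis by (simp add: fun_eq_iff)
qed

lemma ex_linearization:
  obtains W1 Gi where "openin (Euclidean_space k) W1" "0 \<in> W1" "W1 \<subseteq> B1" "openin (Euclidean_space k) (\<psi> ` W1)"
    "smooth_map k (\<psi> ` W1) k Gi" "\<And>b. b \<in> W1 \<Longrightarrow> Gi (\<psi> b) = b"
  by (rule smooth_inverse_function[OF openin_B1 B1_0 smooth_\<psi>]) (simp add: jacobian_\<psi>, rule that)

definition Wp where "Wp = {y \<in> Wx. r y \<in> B1}"

text \<open>Along an orbit \<open>r\<close> is determined up to K, \<psi> turns the action of K into
  \<open>rho\<close>, and \<open>e\<close> does not see \<open>rho\<close>. The composite is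
  therefore invariant near x, while its derivative still restricts to the identity on fixed
  vectors.\<close>

definition \<Psi> where "\<Psi> y = e (\<psi> (r y))"

lemma openin_Wp: "openin (mtop M) Wp"
proof -
  have "openin (mtop (Rn_mfd k)) B1" using openin_B1 by simp
  from smooth_at_open_preimage[OF smooth_at_r openin_Wx this] show ?thesis by (simp add: Wp_def)
qed

lemma x_Wp: "x \<in> Wp"
  using x_Wx B1_0 by (simp add: Wp_def)

lemma r_transport:
  assumes y: "y \<in> Wp" "y' \<in> Wp" and g: "g \<in> carrier G" "y' = \<phi> g y"
  obtains h where "h \<in> K" "r y' = act_S h (r y)"
proof -
  have w: "y \<in> Wx" "y' \<in> Wx" using y by (simp_all add: Wp_def)
  obtain h where h: "h \<in> K" "\<mu> (r y') = \<phi> h (\<mu> (r y))" using slice_transporter[OF w g] .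
  have "r y' = \<kappa> (\<mu> (r y'))" by (rule \<kappa>_\<mu>[OF Wx_facts(4)[OF w(2)], symmetric])
  then have "r y' = act_S h (r y)" by (simp add: act_S_def h(2))
  then show ?thesis using that h(1) by blast
qed

lemma \<Psi>_invariant:
  assumes y: "y \<in> Wp" "y' \<in> Wp" and g: "g \<in> carrier G" "y' = \<phi> g y"
  shows "\<Psi> y' = \<Psi> y"
proof -
  have "r y \<in> B1" using y by (simp add: Wp_def)
  moreover obtain h where "h \<in> K" "r y' = act_S h (r y)" using r_transport[OF y g] .
  ultimately show ?thesis by (simp add: \<Psi>_def \<psi>_act e_rho[OF \<psi>_Rk])
qed

text \<open>Additivity of \<open>e\<close> is available on \<open>Rn k\<close>, where the averaged
  families are known to be continuous. Precomposition with \<open>trunc k\<close> gives a linear map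
  on the whole type that agrees with it there.\<close>

lemma linear_ext_Rk:
  assumes "\<And>u v. u \<in> Rn k \<Longrightarrow> v \<in> Rn k \<Longrightarrow> f (u + v) = f u + f v" "\<And>a v. v \<in> Rn k \<Longrightarrow> f (a *\<^sub>R v) = a *\<^sub>R f v"
  shows "linear (\<lambda>v. f (trunc k v))"
proof (rule linearI)
  fix a :: real and u v :: "nat \<Rightarrow> real"
  show "f (trunc k (u + v)) = f (trunc k u) + f (trunc k v)"
    by (simp only: linear_add[OF linear_trunc] assms(1)[OF trunc_Rn trunc_Rn])
  show "f (trunc k (a *\<^sub>R v)) = a *\<^sub>R f (trunc k v)"
    by (simp only: linear_scale[OF linear_trunc] assms(2)[OF trunc_Rn])
qed

lemma linear_e: "linear (\<lambda>v. e (trunc k v))"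
proof (rule linear_ext_Rk)
  fix u v assume u: "u \<in> Rn k" and v: "v \<in> Rn k"
  show "e (u + v) = e u + e v"
    unfolding e_def using K_family_add[OF K_family_rho(1)[OF u] K_family_rho(1)[OF v]]
    by (simp add: linear_add[OF linear_rho])
next
  fix a v assume v: "v \<in> Rn k"
  have "vmean (\<lambda>h. a *\<^sub>R rho h v) = a *\<^sub>R vmean (\<lambda>h. rho h v)"
    by (rule linear_vmean(2)[OF _ Rn_scale K_family_rho(1)[OF v]]) (auto intro: linearI simp: scaleR_add_right)
  then show "e (a *\<^sub>R v) = a *\<^sub>R e v" unfolding e_def by (simp add: linear_scale[OF linear_rho])
qed

lemma smooth_at_e: assumes "v \<in> Rn k" shows "smooth_at (Rn_mfd k) (Rn_mfd k) e v"
proof -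
  have "smooth_map k (Rn k) k (\<lambda>v. e (trunc k v))" by (rule smooth_map_linear[OF openin_topspace linear_e e_Rk(1)])
  then have "smooth_map k (Rn k) k e"
    by (rule smooth_map_cong[OF openin_topspace, rotated]) (simp only: trunc_k_id)
  then show ?thesis by (rule smooth_at_RnI[OF openin_topspace assms])
qed

lemma jacobian_e: assumes "v \<in> Rn k" "a \<in> Rn k" shows "jacobian k k e a v = e v"
proof -
  have "jacobian k k e a v = jacobian k k (\<lambda>v. e (trunc k v)) a v"
    by (rule jacobian_cong[OF openin_topspace assms(2)]) (simp only: trunc_k_id)
  also have "\<dots> = e (trunc k v)" by (rule jacobian_linear[OF linear_e e_Rk(1) assms(1)])
  finally show ?thesis by (simp only: trunc_k_id[OF assms(1)])
qed

lemma smooth_at_\<Psi>: assumes y: "y \<in> Wp" shows "smooth_at M (Rn_mfd k) \<Psi> y"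
  unfolding \<Psi>_def[abs_def]
proof (rule smooth_at_compose[OF pM pre_manifold_Rn pre_manifold_Rn, where f="\<lambda>y. \<psi> (r y)" and g=e])
  show "smooth_at M (Rn_mfd k) (\<lambda>y. \<psi> (r y)) y"
  proof (rule smooth_at_compose[OF pM pre_manifold_Rn pre_manifold_Rn, where f=r and g=\<psi>])
    show "smooth_at M (Rn_mfd k) r y" using y by (intro smooth_at_r) (simp add: Wp_def)
    show "smooth_at (Rn_mfd k) (Rn_mfd k) \<psi> (r y)"
      using y by (intro smooth_at_RnI[OF openin_B1 _ smooth_\<psi>]) (simp add: Wp_def)
  qed
  show "smooth_at (Rn_mfd k) (Rn_mfd k) e (\<psi> (r y))" by (rule smooth_at_e[OF \<psi>_Rk])
qed

end

section \<open>A stabilizer-invariant neighbourhood in linearized coordinates\<close>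

locale slice_linearization = slice_tube +
  fixes W1 Gi
  assumes W1: "openin (Euclidean_space k) W1" "0 \<in> W1" "W1 \<subseteq> B1" "openin (Euclidean_space k) (\<psi> ` W1)"
    and Gi: "smooth_map k (\<psi> ` W1) k Gi" "\<And>b. b \<in> W1 \<Longrightarrow> Gi (\<psi> b) = b"
begin

text \<open>The K-orbit has to stay in \<open>W0\<close> and \<open>W1\<close>, so that both the
  tube inverse and \<open>Gi\<close> apply along it. The condition is phrased with points of M to be
  an instance of \<open>openin_K_tube\<close>; \<open>trunc k\<close> appears because
  \<open>W1\<close> is open in \<open>Rn k\<close> rather than in \<open>Rn m\<close>.
  \<open>C0_iff\<close> gives the coordinate form.\<close>

definition C0 where "C0 = {b \<in> U0. \<forall>h\<in>K. \<phi> h (\<mu> b) \<in> {y \<in> fst c. \<kappa> y \<in> W0 \<inter> {w \<in> Rn m. trunc k w \<in> W1}}}"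

definition A0 where "A0 = \<psi> ` C0"

lemma openin_C0: "openin (Euclidean_space k) C0"
proof -
  have "openin (Euclidean_space m) {w \<in> Rn m. trunc k w \<in> W1}"
    by (rule openin_continuous_map_preimage[OF linear_Rn_continuous_map[OF linear_trunc trunc_Rn] W1(1)])
  then have o: "openin (mtop (Rn_mfd m)) (W0 \<inter> {w \<in> Rn m. trunc k w \<in> W1})"
    using openin_Int[OF W0(1)] by simp
  show ?thesis unfolding C0_def
    by (rule openin_K_tube[OF smooth_at_open_preimage[OF \<kappa>_smooth openin_fst_max[OF c_max] o]])
qed

lemma C0_iff: "b \<in> C0 \<longleftrightarrow> b \<in> B1 \<and> (\<forall>h\<in>K. act_S h b \<in> W0 \<inter> W1)"
proof
  assume b: "b \<in> C0"
  then have B: "b \<in> B1" by (simp add: C0_def B1_def)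
  have "act_S h b \<in> W0 \<inter> W1" if h: "h \<in> K" for h
  proof -
    have "act_S h b \<in> W0" "trunc k (act_S h b) \<in> W1" using b h by (simp_all add: C0_def act_S_def)
    then show ?thesis by (simp only: trunc_k_id[OF act_S_facts(3)[OF B h]] Int_iff simp_thms)
  qed
  with B show "b \<in> B1 \<and> (\<forall>h\<in>K. act_S h b \<in> W0 \<inter> W1)" by blast
next
  assume R: "b \<in> B1 \<and> (\<forall>h\<in>K. act_S h b \<in> W0 \<inter> W1)"
  then have B: "b \<in> B1" ..
  have "\<phi> h (\<mu> b) \<in> {y \<in> fst c. \<kappa> y \<in> W0 \<inter> {w \<in> Rn m. trunc k w \<in> W1}}" if h: "h \<in> K" for h
    using R h trunc_k_id[OF act_S_facts(3)[OF B h]] Rk_Rm[OF act_S_facts(3)[OF B h]] B1_D(6)[OF B h]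
    by (simp add: act_S_def)
  with B1_D(1)[OF B] show "b \<in> C0" by (simp add: C0_def)
qed

lemma C0_D:
  assumes "b \<in> C0" shows "b \<in> B1" "b \<in> W0" "b \<in> W1" "h \<in> K \<Longrightarrow> act_S h b \<in> C0" "b \<in> Rn k"
proof -
  show B: "b \<in> B1" using assms C0_iff by blast
  have "act_S \<one> b \<in> W0 \<inter> W1" using assms C0_iff K_one by blast
  then show "b \<in> W0" "b \<in> W1" using act_S_one[OF B] by simp_all
  show "b \<in> Rn k" by (rule B1_D(3)[OF B])
  show "act_S h b \<in> C0" if h: "h \<in> K"
    using assms act_S_facts(2)[OF B h] act_S_mult[OF B _ h] K_mult[OF _ h] by (simp add: C0_iff)
qed

lemma C0_0: "0 \<in> C0"
  using B1_0 W0(2) W1(2) by (simp add: C0_iff act_S_0)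

lemma A0_D:
  assumes "u \<in> A0" shows "Gi u \<in> C0" "\<psi> (Gi u) = u" "u \<in> Rn k"
  using assms Gi(2) C0_D(3) \<psi>_Rk by (auto simp: A0_def simp del: topspace_Euclidean_space)

lemma A0_\<psi>: "b \<in> C0 \<Longrightarrow> \<psi> b \<in> A0"
  by (simp add: A0_def)

lemma Gi_\<psi>: "b \<in> C0 \<Longrightarrow> Gi (\<psi> b) = b"
  by (rule Gi(2)[OF C0_D(3)])

lemma A0_0: "0 \<in> A0" "Gi 0 = 0"
  using A0_\<psi>[OF C0_0] Gi_\<psi>[OF C0_0] by (simp_all add: \<psi>_0)

lemma openin_A0: "openin (Euclidean_space k) A0"
proof -
  have "A0 = {u \<in> \<psi> ` W1. Gi u \<in> C0}" using C0_D(3) Gi(2) by (auto simp: A0_def)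
  moreover have "openin (mtop (Rn_mfd k)) {u \<in> \<psi> ` W1. Gi u \<in> C0}"
    by (rule smooth_at_open_preimage[OF smooth_at_RnI[OF W1(4) _ Gi(1)]]) (use W1(4) openin_C0 in simp_all)
  ultimately show ?thesis by simp
qed

lemma smooth_at_Gi: assumes "u \<in> A0" shows "smooth_at (Rn_mfd k) (Rn_mfd k) Gi u"
  by (rule smooth_at_RnI[OF W1(4) _ Gi(1)]) (use assms C0_D(3) in \<open>auto simp: A0_def\<close>)

lemma A0_rho: assumes u: "u \<in> A0" and h: "h \<in> K" shows "rho h u \<in> A0" "Gi (rho h u) = act_S h (Gi u)"
proof -
  note a = A0_D[OF u]
  have "\<psi> (act_S h (Gi u)) = rho h u" using \<psi>_act[OF C0_D(1)[OF a(1)] h] a(2) by simp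
  then show "rho h u \<in> A0" "Gi (rho h u) = act_S h (Gi u)"
    using A0_\<psi>[OF C0_D(4)[OF a(1) h]] Gi_\<psi>[OF C0_D(4)[OF a(1) h]] by simp_all
qed

end

subsection \<open>Isomorphisms with the internal tangent space\<close>

text \<open>A map into a space of cosets is easier to define than a map out of it, so isomorphisms
  are built in the opposite direction and inverted.\<close>

lemma bij_betw_vs_isomorphic_sym:
  assumes f: "bij_betw f (vcarrier V) (vcarrier W)"
    and add: "\<And>a b. a \<in> vcarrier V \<Longrightarrow> b \<in> vcarrier V \<Longrightarrow> vadd V a b \<in> vcarrier V \<and> f (vadd V a b) = vadd W (f a) (f b)"
    and scale: "\<And>r a. a \<in> vcarrier V \<Longrightarrow> vscale V r a \<in> vcarrier V \<and> f (vscale V r a) = vscale W r (f a)"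
  shows "vs_isomorphic W V"
  unfolding vs_isomorphic_def
proof (intro exI[of _ "inv_into (vcarrier V) f"] conjI ballI allI)
  let ?g = "inv_into (vcarrier V) f"
  show "bij_betw ?g (vcarrier W) (vcarrier V)" by (rule bij_betw_inv_into[OF f])
  have gf: "?g (f a) = a" if "a \<in> vcarrier V" for a by (rule bij_betw_inv_into_left[OF f that])
  have fg: "f (?g b) = b" "?g b \<in> vcarrier V" if "b \<in> vcarrier W" for b
    using bij_betw_inv_into_right[OF f that] bij_betw_apply[OF bij_betw_inv_into[OF f] that] by simp_all
  show "?g (vadd W a b) = vadd V (?g a) (?g b)" if "a \<in> vcarrier W" "b \<in> vcarrier W" for a b
  proof -
    have "vadd W a b = f (vadd V (?g a) (?g b))" using add[OF fg(2)[OF that(1)] fg(2)[OF that(2)]] fg(1) that by simp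
    then show ?thesis using gf[OF conjunct1[OF add[OF fg(2)[OF that(1)] fg(2)[OF that(2)]]]] by (simp only:)
  qed
  show "?g (vscale W r a) = vscale V r (?g a)" if "a \<in> vcarrier W" for r a
  proof -
    have "vscale W r a = f (vscale V r (?g a))" using scale[OF fg(2)[OF that]] fg(1)[OF that] by simp
    then show ?thesis using gf[OF conjunct1[OF scale[OF fg(2)[OF that], of r]]] by (simp only:)
  qed
qed

text \<open>This leaves two tasks for an internal tangent space: bring every vector into the range
  of f modulo R, and show that f sends only 0 into R.\<close>

lemma quot_vspace_vs_isomorphic:
  assumes F: "subspace F" and R: "subspace R" "R \<subseteq> F" and W: "subspace W" and f: "linear f" "f ` W \<subseteq> F"
    and inj: "\<And>w. w \<in> W \<Longrightarrow> f w \<in> R \<Longrightarrow> w = 0" and surj: "\<And>a. a \<in> F \<Longrightarrow> \<exists>w\<in>W. a - f w \<in> R"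
  shows "vs_isomorphic (quot_vspace F R) (sub_vspace W)"
proof (rule bij_betw_vs_isomorphic_sym[where f="\<lambda>w. {f w + h |h. h \<in> R}"])
  let ?C = "\<lambda>a. {a + h |h. h \<in> R}"
  have mem: "b \<in> ?C a \<longleftrightarrow> b - a \<in> R" for a b
  proof
    assume "b - a \<in> R" then show "b \<in> ?C a" by (intro CollectI exI[of _ "b - a"]) simp
  qed auto
  have eq: "?C a = ?C b \<longleftrightarrow> a - b \<in> R" for a b
  proof
    assume "?C a = ?C b" then have "a \<in> ?C b" using mem[of a a] subspace_0[OF R(1)] by simp
    then show "a - b \<in> R" using mem by simp
  next
    assume ab: "a - b \<in> R"
    then have "z - a \<in> R \<longleftrightarrow> z - b \<in> R" for z
      using subspace_add[OF R(1), of "z - a" "a - b"] subspace_diff[OF R(1), of "z - b" "a - b"] by auto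
    then show "?C a = ?C b" using mem by blast
  qed
  have car: "vcarrier (quot_vspace F R) = ?C ` F" "vcarrier (sub_vspace W) = W" by (simp_all add: quot_vspace_def sub_vspace_def)
  show "bij_betw (\<lambda>w. ?C (f w)) (vcarrier (sub_vspace W)) (vcarrier (quot_vspace F R))"
    unfolding car
  proof (rule bij_betw_imageI)
    show "inj_on (\<lambda>w. ?C (f w)) W"
    proof (rule inj_onI)
      fix u w assume uw: "u \<in> W" "w \<in> W" "?C (f u) = ?C (f w)"
      then have "f (u - w) \<in> R" unfolding eq by (simp add: linear_diff[OF f(1)])
      from inj[OF subspace_diff[OF W uw(1,2)] this] show "u = w" by simp
    qed
    show "(\<lambda>w. ?C (f w)) ` W = ?C ` F"
    proof
      show "(\<lambda>w. ?C (f w)) ` W \<subseteq> ?C ` F" using f(2) by auto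
      show "?C ` F \<subseteq> (\<lambda>w. ?C (f w)) ` W"
      proof (rule image_subsetI)
        fix a assume "a \<in> F"
        then obtain w where "w \<in> W" "a - f w \<in> R" using surj by blast
        then show "?C a \<in> (\<lambda>w. ?C (f w)) ` W" using eq by blast
      qed
    qed
  qed
  show "vadd (sub_vspace W) a b \<in> vcarrier (sub_vspace W) \<and>
      ?C (f (vadd (sub_vspace W) a b)) = vadd (quot_vspace F R) (?C (f a)) (?C (f b))"
    if "a \<in> vcarrier (sub_vspace W)" "b \<in> vcarrier (sub_vspace W)" for a b
  proof -
    have "{u + v |u v. u \<in> ?C (f a) \<and> v \<in> ?C (f b)} = ?C (f a + f b)"
    proof (intro equalityI subsetI)
      fix z assume "z \<in> {u + v |u v. u \<in> ?C (f a) \<and> v \<in> ?C (f b)}"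
      then obtain u v where "z = u + v" "u - f a \<in> R" "v - f b \<in> R" using mem by auto
      then show "z \<in> ?C (f a + f b)" unfolding mem using subspace_add[OF R(1), of "u - f a" "v - f b"] by (simp add: algebra_simps)
    next
      fix z assume "z \<in> ?C (f a + f b)"
      then have "z - f b \<in> ?C (f a)" "f b \<in> ?C (f b)" unfolding mem using subspace_0[OF R(1)] by (simp_all add: algebra_simps)
      then show "z \<in> {u + v |u v. u \<in> ?C (f a) \<and> v \<in> ?C (f b)}"
        by (intro CollectI exI[of _ "z - f b"] exI[of _ "f b"]) simp
    qed
    then show ?thesis using that subspace_add[OF W] by (simp add: quot_vspace_def sub_vspace_def linear_add[OF f(1)])
  qed
  show "vscale (sub_vspace W) r a \<in> vcarrier (sub_vspace W) \<and>
      ?C (f (vscale (sub_vspace W) r a)) = vscale (quot_vspace F R) r (?C (f a))"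
    if "a \<in> vcarrier (sub_vspace W)" for r a
  proof -
    have "{r *\<^sub>R u + h |u h. u \<in> ?C (f a) \<and> h \<in> R} = ?C (r *\<^sub>R f a)"
    proof (intro equalityI subsetI)
      fix z assume "z \<in> {r *\<^sub>R u + h |u h. u \<in> ?C (f a) \<and> h \<in> R}"
      then obtain u h where "z = r *\<^sub>R u + h" "u - f a \<in> R" "h \<in> R" using mem by auto
      then show "z \<in> ?C (r *\<^sub>R f a)" unfolding mem
        using subspace_add[OF R(1) subspace_scale[OF R(1), of "u - f a" r], of h] by (simp add: algebra_simps)
    next
      fix z assume "z \<in> ?C (r *\<^sub>R f a)"
      then have "z - r *\<^sub>R f a \<in> R" "f a \<in> ?C (f a)" unfolding mem using subspace_0[OF R(1)] by simp_all
      then show "z \<in> {r *\<^sub>R u + h |u h. u \<in> ?C (f a) \<and> h \<in> R}"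
        by (intro CollectI exI[of _ "f a"] exI[of _ "z - r *\<^sub>R f a"]) simp
    qed
    then show ?thesis using that subspace_scale[OF W] by (simp add: quot_vspace_def sub_vspace_def linear_scale[OF f(1)])
  qed
qed

text \<open>Pointed plots need connected domains; those constructed below are star-shaped about
  0.\<close>

lemma connectedin_starlike_Rn:
  assumes A: "A \<subseteq> Rn n" "0 \<in> A" and star: "\<And>w t. w \<in> A \<Longrightarrow> 0 \<le> t \<Longrightarrow> t \<le> 1 \<Longrightarrow> t *\<^sub>R w \<in> A"
  shows "connectedin (Euclidean_space n) A"
proof -
  have "connectedin (Euclidean_space n) ((\<lambda>t. t *\<^sub>R w) ` {0..1::real})" if w: "w \<in> A" for w
  proof (rule connectedin_continuous_map_image)
    show "continuous_map euclideanreal (Euclidean_space n) (\<lambda>t. t *\<^sub>R w)"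
      unfolding continuous_map_Rn_coords
      using w A(1) by (auto simp: subset_iff mem_Rn intro!: continuous_intros)
    show "connectedin euclideanreal {0..1::real}" by simp
  qed
  then have "connectedin (Euclidean_space n) (\<Union>w\<in>A. (\<lambda>t. t *\<^sub>R w) ` {0..1::real})"
  proof (intro connectedin_Union)
    have "0 \<in> \<Inter> ((\<lambda>w. (\<lambda>t. t *\<^sub>R w) ` {0..1::real}) ` A)" by (auto intro!: image_eqI[of _ _ "0::real"])
    then show "\<Inter> ((\<lambda>w. (\<lambda>t. t *\<^sub>R w) ` {0..1::real}) ` A) \<noteq> {}" by blast
  qed auto
  also have "(\<Union>w\<in>A. (\<lambda>t. t *\<^sub>R w) ` {0..1::real}) = A"
    using star by (force intro: image_eqI[of _ _ "1::real"])
  finally show ?thesis .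
qed

lemma connectedin_cube: "d > 0 \<Longrightarrow> connectedin (Euclidean_space n) (cube n 0 d)"
proof (rule connectedin_starlike_Rn[OF cube_subset_Rn])
  show "t *\<^sub>R w \<in> cube n 0 d" if "w \<in> cube n 0 d" "0 \<le> t" "t \<le> 1" for w t
  proof -
    have "\<bar>t * w i\<bar> < d" if "i < n" for i
    proof -
      have "\<bar>t * w i\<bar> \<le> \<bar>w i\<bar>" using \<open>0 \<le> t\<close> \<open>t \<le> 1\<close> by (simp add: abs_mult mult_left_le_one_le)
      then show ?thesis using \<open>w \<in> cube n 0 d\<close> \<open>i < n\<close> by (auto simp: cube_def)
    qed
    then show ?thesis using that(1) Rn_scale by (auto simp: cube_def mem_Rn)
  qed
qed (simp_all add: cube_center[OF Rn_0])

section \<open>The direct sum over plots and its relations\<close>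

lemma linear_summand: "linear (summand P)"
  by (rule linearI) (auto simp: summand_def fun_eq_iff)

lemma summand_plot_sum:
  assumes "P \<in> pointed_plots D y" "v \<in> Rn (fst P)" shows "summand P v \<in> plot_sum D y"
proof -
  have "{Q. summand P v Q \<noteq> 0} \<subseteq> {P}" by (auto simp: summand_def)
  then have "finite {Q. summand P v Q \<noteq> 0}" by (rule finite_subset) simp
  then show ?thesis unfolding plot_sum_def mem_Collect_eq
    using assms by (auto simp: summand_def split: if_splits)
qed

lemma plot_sumD:
  assumes "f \<in> plot_sum D y" shows "finite {P. f P \<noteq> 0}" "f P \<noteq> 0 \<Longrightarrow> P \<in> pointed_plots D y" "f P \<in> Rn (fst P)"
proof -
  note a = assms[unfolded plot_sum_def mem_Collect_eq]
  show "finite {P. f P \<noteq> 0}" by (rule conjunct1[OF a])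
  show "P \<in> pointed_plots D y" if "f P \<noteq> 0" using conjunct2[OF a] that by blast
  show "f P \<in> Rn (fst P)"
  proof (cases "f P = 0")
    case True then show ?thesis by (simp only: Rn_0)
  next
    case False then show ?thesis using conjunct2[OF a] by blast
  qed
qed

lemma subspace_plot_sum: "subspace (plot_sum D y)"
  unfolding subspace_def
proof (intro conjI ballI allI)
  show "0 \<in> plot_sum D y" by (simp add: plot_sum_def)
next
  fix f g assume fg: "f \<in> plot_sum D y" "g \<in> plot_sum D y"
  have sub: "{P. (f + g) P \<noteq> 0} \<subseteq> {P. f P \<noteq> 0} \<union> {P. g P \<noteq> 0}" by auto
  have "finite {P. (f + g) P \<noteq> 0}" by (rule finite_subset[OF sub]) (use fg in \<open>simp add: plot_sum_def\<close>)
  moreover have "P \<in> pointed_plots D y \<and> (f + g) P \<in> Rn (fst P)" if "(f + g) P \<noteq> 0" for P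
  proof -
    have "f P \<in> Rn (fst P)" "g P \<in> Rn (fst P)" by (rule plot_sumD(3)[OF fg(1)], rule plot_sumD(3)[OF fg(2)])
    moreover have "f P \<noteq> 0 \<or> g P \<noteq> 0" using that by auto
    then have "P \<in> pointed_plots D y" using plot_sumD(2)[OF fg(1)] plot_sumD(2)[OF fg(2)] by blast
    ultimately show ?thesis by (simp only: plus_fun_def Rn_add[unfolded plus_fun_def] simp_thms)
  qed
  ultimately show "f + g \<in> plot_sum D y" unfolding plot_sum_def by blast
next
  fix r f assume f: "f \<in> plot_sum D y"
  have sub: "{P. (r *\<^sub>R f) P \<noteq> 0} \<subseteq> {P. f P \<noteq> 0}" by auto
  have "finite {P. (r *\<^sub>R f) P \<noteq> 0}" by (rule finite_subset[OF sub]) (use f in \<open>simp add: plot_sum_def\<close>)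
  moreover have "P \<in> pointed_plots D y \<and> (r *\<^sub>R f) P \<in> Rn (fst P)" if "(r *\<^sub>R f) P \<noteq> 0" for P
  proof -
    have "f P \<noteq> 0" using that sub by blast
    then show ?thesis using plot_sumD(2,3)[OF f] Rn_scale by (simp only: scaleR_fun_apply simp_thms)
  qed
  ultimately show "r *\<^sub>R f \<in> plot_sum D y" unfolding plot_sum_def by blast
qed

lemma plot_sum_decompose:
  assumes "f \<in> plot_sum D y" shows "f = (\<Sum>P | f P \<noteq> 0. summand P (f P))"
proof
  fix Q
  have "finite {P. f P \<noteq> 0}" using assms by (simp add: plot_sum_def)
  then show "f Q = (\<Sum>P | f P \<noteq> 0. summand P (f P)) Q"
    by (simp only: sum_fun_apply) (simp add: summand_def)
qed

lemma plot_relationsI: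
  assumes P: "(n, U, p) \<in> pointed_plots D y" "openin (Euclidean_space n) U"
    and Q: "(m, V, q) \<in> pointed_plots D y" "openin (Euclidean_space m) V" and v: "v \<in> Rn n"
    and W: "openin (Euclidean_space n) W" "0 \<in> W" and g: "smooth_map n W m g" "g 0 = 0"
    and pq: "\<And>u. \<lbrakk>u \<in> W; u \<in> U; g u \<in> V\<rbrakk> \<Longrightarrow> p u = q (g u)"
  shows "summand (n, U, p) v - summand (m, V, q) (jacobian n m g 0 v) \<in> plot_relations D y"
proof -
  have 0: "0 \<in> U" "0 \<in> V" using P(1) Q(1) by (simp_all add: pointed_plots_def)
  define W' where "W' = {u \<in> W. g u \<in> V} \<inter> U"
  have "openin (mtop (Rn_mfd n)) {u \<in> W. g u \<in> V}"
    by (rule smooth_at_open_preimage[OF smooth_at_RnI[OF W(1) _ g(1)]]) (use W(1) Q(2) in simp_all)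
  then have oW': "openin (Euclidean_space n) W'" unfolding W'_def using P(2) by (intro openin_Int) simp_all
  have sub: "W' \<subseteq> U" "W' \<subseteq> W" "g ` W' \<subseteq> V" by (auto simp: W'_def)
  have W'0: "0 \<in> W'" using 0 W(2) g(2) by (simp add: W'_def)
  show ?thesis
    unfolding plot_relations_def
  proof (rule span_base, intro CollectI, rule exI[of _ n], rule exI[of _ U], rule exI[of _ p], rule exI[of _ m],
      rule exI[of _ V], rule exI[of _ q], rule exI[of _ g], rule exI[of _ W'], rule exI[of _ v], intro conjI refl)
    show "smooth_map n W' m g" by (rule smooth_map_subset[OF W(1) oW' sub(2) g(1)])
    show "\<forall>u\<in>W'. p u = q (g u)"
    proof
      fix u assume "u \<in> W'"
      then show "p u = q (g u)" by (intro pq) (simp_all add: W'_def)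
    qed
  qed (fact P(1) Q(1) v oW' W'0 sub g(2))+
qed

lemma subspace_plot_relations: "subspace (plot_relations D y)"
  by (simp add: plot_relations_def)

lemma plot_relations_sub: "plot_relations D y \<subseteq> plot_sum D y"
  unfolding plot_relations_def
proof (rule span_minimal[OF _ subspace_plot_sum], rule subsetI)
  fix z assume "z \<in> {summand (n, U, p) v - summand (m, V, q) (jacobian n m g 0 v) | n U p m V q g W v.
       (n, U, p) \<in> pointed_plots D y \<and> (m, V, q) \<in> pointed_plots D y \<and> v \<in> Rn n \<and>
       openin (Euclidean_space n) W \<and> 0 \<in> W \<and> W \<subseteq> U \<and>
       smooth_map n W m g \<and> g ` W \<subseteq> V \<and> g 0 = 0 \<and> (\<forall>u\<in>W. p u = q (g u))}"
  then obtain n U p m V q g v where "z = summand (n, U, p) v - summand (m, V, q) (jacobian n m g 0 v)"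
    "(n, U, p) \<in> pointed_plots D y" "(m, V, q) \<in> pointed_plots D y" "v \<in> Rn n"
    by (elim CollectE exE conjE) (rule that)
  then show "z \<in> plot_sum D y"
    by (simp only:) (intro subspace_diff[OF subspace_plot_sum] summand_plot_sum, simp_all only: fst_conv jacobian_Rn)
qed

section \<open>Plots of the orbit space compared with one reference plot\<close>

context slice_setting
begin

abbreviation "orb \<equiv> orbit G \<phi>"
abbreviation "DO \<equiv> orbit_diffeology G M \<phi>"

lemma orb_iff: "z \<in> orb y \<longleftrightarrow> (\<exists>g\<in>carrier G. z = \<phi> g y)"
  by (auto simp: orbit_def)

lemma orb_self: "y \<in> points M \<Longrightarrow> y \<in> orb y"
  unfolding orb_iff using act_one one_closed by metis

lemma orb_act: assumes "g \<in> carrier G" "y \<in> points M" shows "orb (\<phi> g y) = orb y"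
proof (intro equalityI subsetI)
  fix z assume "z \<in> orb (\<phi> g y)"
  then obtain h where "h \<in> carrier G" "z = \<phi> h (\<phi> g y)" unfolding orb_iff by blast
  then show "z \<in> orb y" unfolding orb_iff using assms by (intro bexI[of _ "h \<otimes> g"]) (simp_all add: act_mult)
next
  fix z assume "z \<in> orb y"
  then obtain h where h: "h \<in> carrier G" "z = \<phi> h y" unfolding orb_iff by blast
  have "\<phi> (h \<otimes> inv g) (\<phi> g y) = \<phi> h y" using assms h(1) by (simp add: act_mult act_points act_inv)
  then show "z \<in> orb (\<phi> g y)" unfolding orb_iff using assms h by (intro bexI[of _ "h \<otimes> inv g"]) simp_all
qed

lemma orb_eqD: assumes "z \<in> points M" "orb y = orb z" obtains g where "g \<in> carrier G" "z = \<phi> g y"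
  using orb_self[OF assms(1), folded assms(2), unfolded orb_iff] that by blast

lemma orbit_plotI:
  assumes U: "openin (Euclidean_space n) U" and f: "\<And>u. u \<in> U \<Longrightarrow> smooth_at (Rn_mfd n) M f u"
  shows "(n, U, restrict (\<lambda>u. orb (f u)) U) \<in> DO"
proof -
  have fp: "f u \<in> points M" if "u \<in> U" for u by (rule smooth_at_points[OF f[OF that]])
  have "smooth_at (Rn_mfd n) M (restrict f U) u" if "u \<in> U" for u
    by (rule smooth_at_cong[OF pre_manifold_Rn pM f[OF that] _ that]) (use U in simp_all)
  then have "msmooth_on (Rn_mfd n) U M (restrict f U)"
    using U by (intro msmooth_onI[OF pre_manifold_Rn pM]) simp_all
  moreover have "restrict f U \<in> U \<rightarrow>\<^sub>E points M" using fp by auto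
  ultimately have std: "(n, U, restrict f U) \<in> standard_diffeology M"
    using U by (simp add: standard_diffeology_def params_def)
  have im: "restrict (\<lambda>u. orb (f u)) U \<in> U \<rightarrow>\<^sub>E orb ` points M" using fp by auto
  have "\<forall>u\<in>U. \<exists>V q. openin (Euclidean_space n) V \<and> u \<in> V \<and> V \<subseteq> U \<and> (n, V, q) \<in> standard_diffeology M \<and>
      (\<forall>v\<in>V. restrict (\<lambda>u. orb (f u)) U v = orb (q v))"
    using U std by (intro ballI exI[of _ U] exI[of _ "restrict f U"]) simp
  then show ?thesis using U im by (simp add: orbit_diffeology_def quotient_diffeology_def params_def)
qed

lemma pointed_orbit_plotI:
  assumes "openin (Euclidean_space n) U" "\<And>u. u \<in> U \<Longrightarrow> smooth_at (Rn_mfd n) M f u"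
    and "connectedin (Euclidean_space n) U" "0 \<in> U" "f 0 = x"
  shows "(n, U, restrict (\<lambda>u. orb (f u)) U) \<in> pointed_plots DO (orb x)"
  using orbit_plotI[OF assms(1,2)] assms(3-5) by (simp add: pointed_plots_def)

lemma pointed_plot_open: "(n, U, P) \<in> pointed_plots DO y \<Longrightarrow> openin (Euclidean_space n) U"
  by (simp add: pointed_plots_def orbit_diffeology_def quotient_diffeology_def params_def)

text \<open>The quotient diffeology gives a lift near 0 whose base point lies on the orbit of x. A
  group element moves this base point to x without changing the projected plot.\<close>

lemma pointed_plot_lift:
  assumes P: "(n, U, P) \<in> pointed_plots DO (orb x)"
  obtains V q where "openin (Euclidean_space n) V" "0 \<in> V" "V \<subseteq> U" "\<forall>u\<in>V. smooth_at (Rn_mfd n) M q u"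
    "\<forall>u\<in>V. P u = orb (q u)" "q 0 = x"
proof -
  have 0: "0 \<in> U" "P 0 = orb x" and D: "\<forall>u\<in>U. \<exists>V q. openin (Euclidean_space n) V \<and> u \<in> V \<and> V \<subseteq> U \<and>
      (n, V, q) \<in> standard_diffeology M \<and> (\<forall>v\<in>V. P v = orb (q v))"
    using P by (simp_all add: pointed_plots_def orbit_diffeology_def quotient_diffeology_def)
  obtain V q where V: "openin (Euclidean_space n) V" "0 \<in> V" "V \<subseteq> U" and q: "(n, V, q) \<in> standard_diffeology M"
    "\<forall>v\<in>V. P v = orb (q v)"
    using bspec[OF D 0(1)] by (elim exE conjE) (rule that)
  have sq: "smooth_at (Rn_mfd n) M q u" if "u \<in> V" for u
    using q(1) that by (intro msmooth_on_smooth_at[OF pre_manifold_Rn pM, of n V]) (simp_all add: standard_diffeology_def)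
  have qp: "q u \<in> points M" if "u \<in> V" for u by (rule smooth_at_points[OF sq[OF that]])
  obtain g where g: "g \<in> carrier G" "x = \<phi> g (q 0)"
    by (rule orb_eqD[OF x, of "q 0"]) (use 0 q(2) V(2) in simp_all)
  show ?thesis
  proof (rule that[OF V, of "\<lambda>u. \<phi> g (q u)"])
    show "\<forall>u\<in>V. smooth_at (Rn_mfd n) M (\<lambda>u. \<phi> g (q u)) u"
    proof
      fix u assume u: "u \<in> V"
      show "smooth_at (Rn_mfd n) M (\<lambda>u. \<phi> g (q u)) u"
        by (rule smooth_at_compose[OF pre_manifold_Rn pM pM, where f=q and g="\<phi> g"])
           (rule sq[OF u], rule smooth_at_act_left[OF g(1) qp[OF u]])
    qed
    show "\<forall>u\<in>V. P u = orb (\<phi> g (q u))" using q(2) orb_act[OF g(1) qp] by simp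
  qed (simp add: g(2))
qed

text \<open>A cube inside the chart domain, since a pointed plot needs a connected domain and a
  chart domain may be disconnected.\<close>

definition UQ where "UQ = cube m 0 (SOME d. d > 0 \<and> cube m 0 d \<subseteq> cdom M c x)"

text \<open>The reference plot. Every pointed plot is related to it, so its summand alone represents
  the whole internal tangent space.\<close>

definition Qp where "Qp = (m, UQ, restrict (\<lambda>w. orb (\<mu> w)) UQ)"

lemma UQ: "openin (Euclidean_space m) UQ" "0 \<in> UQ" "UQ \<subseteq> cdom M c x" "connectedin (Euclidean_space m) UQ"
proof -
  have "\<exists>d>0. cube m 0 d \<subseteq> cdom M c x"
    using open_contains_cube[OF openin_cdom[OF pM c_max ad(2)] cdom_0[OF pM c_max ad(2)]] by metis
  then have d: "(SOME d. d > 0 \<and> cube m 0 d \<subseteq> cdom M c x) > 0 \<and> UQ \<subseteq> cdom M c x"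
    unfolding UQ_def by (rule someI_ex)
  then show "openin (Euclidean_space m) UQ" "0 \<in> UQ" "UQ \<subseteq> cdom M c x" "connectedin (Euclidean_space m) UQ"
    unfolding UQ_def by (simp_all add: openin_cube cube_center[OF Rn_0] connectedin_cube)
qed

lemma Qp_pointed: "Qp \<in> pointed_plots DO (orb x)"
  unfolding Qp_def by (rule pointed_orbit_plotI[OF UQ(1) \<mu>_smooth UQ(4,2) \<mu>_0]) (rule subsetD[OF UQ(3)])

abbreviation "RO \<equiv> plot_relations DO (orb x)"

text \<open>Near 0 the plot is \<open>Qp\<close> composed with the coordinates of the lift f. Two
  lifts of one plot therefore identify two vectors in the summand of \<open>Qp\<close>.\<close>

lemma Qp_relation:
  assumes P: "(n, U, P) \<in> pointed_plots DO (orb x)" and W: "openin (Euclidean_space n) W" "0 \<in> W"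
    and f: "\<And>u. u \<in> W \<Longrightarrow> smooth_at (Rn_mfd n) M f u" "f 0 = x"
    and Pf: "\<And>u. u \<in> W \<Longrightarrow> u \<in> U \<Longrightarrow> P u = orb (f u)" and v: "v \<in> Rn n"
  shows "summand (n, U, P) v - summand Qp (jacobian n m (\<lambda>u. \<kappa> (f u)) 0 v) \<in> RO"
proof -
  define W' where "W' = {u \<in> W. f u \<in> fst c}"
  have oW: "openin (mtop (Rn_mfd n)) W" using W(1) by simp
  have "openin (mtop (Rn_mfd n)) W'"
    unfolding W'_def by (rule smooth_at_open_preimage[OF f(1) oW openin_fst_max[OF c_max]])
  then have oW': "openin (Euclidean_space n) W'" by simp
  have "smooth_at (Rn_mfd n) (Rn_mfd m) (\<lambda>u. \<kappa> (f u)) u" if "u \<in> W'" for u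
    by (rule smooth_at_compose[OF pre_manifold_Rn pM pre_manifold_Rn f(1) \<kappa>_smooth]) (use that in \<open>simp_all add: W'_def\<close>)
  then have s: "smooth_map n W' m (\<lambda>u. \<kappa> (f u))" by (rule smooth_map_smooth_at[OF oW'])
  show ?thesis
    unfolding Qp_def
  proof (rule plot_relationsI[OF P pointed_plot_open[OF P] Qp_pointed[unfolded Qp_def] UQ(1) v oW' _ s])
    show "0 \<in> W'" using W(2) f(2) ad(2) by (simp add: W'_def)
    show "\<kappa> (f 0) = 0" by (simp add: f(2) ccoord_0[OF pM c_max ad(2)])
    show "P u = restrict (\<lambda>w. orb (\<mu> w)) UQ (\<kappa> (f u))" if "u \<in> W'" "u \<in> U" "\<kappa> (f u) \<in> UQ" for u
      using that Pf[of u] \<mu>_\<kappa>[of "f u"] by (simp add: W'_def)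
  qed
qed

definition Zs where "Zs = {v \<in> Rn m. summand Qp v \<in> RO}"

lemma subspace_Zs: "subspace Zs"
  unfolding subspace_def Zs_def
  by (auto simp: linear_0[OF linear_summand] linear_add[OF linear_summand] linear_scale[OF linear_summand]
      subspace_0[OF subspace_plot_relations] subspace_add[OF subspace_plot_relations] subspace_scale[OF subspace_plot_relations]
      Rn_add Rn_scale simp del: topspace_Euclidean_space)

text \<open>The constant plot on \<open>Rn p\<close> has two lifts: the constant map x, with
  derivative 0, and the orbit map in group coordinates, with derivative \<open>D1\<close>.\<close>

lemma D1_Zs: assumes a: "a \<in> Rn p" shows "D1 a \<in> Zs"
proof -
  let ?P = "(p, Rn p, restrict (\<lambda>u. orb x) (Rn p))"
  have sx: "smooth_at (Rn_mfd p) M (\<lambda>u. x) u" if "u \<in> Rn p" for u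
    using smooth_at_const[OF pre_manifold_Rn _ pM x] that by simp
  have P: "?P \<in> pointed_plots DO (orb x)"
    by (rule pointed_orbit_plotI[OF openin_topspace sx connectedin_starlike_Rn[OF order_refl Rn_0 Rn_scale] Rn_0 refl])
  have "summand ?P a - summand Qp (D1 a) \<in> RO"
    unfolding D1_def
  proof (rule Qp_relation[OF P openin_cdom[OF pG chi_max chi(2)] cdom_0[OF pG chi_max chi(2)] _ _ _ a])
    show "smooth_at (Rn_mfd p) M (\<lambda>u. \<phi> (\<gamma> u) x) u" if "u \<in> cdom GM \<xi> \<one>" for u
      by (rule smooth_at_act[OF pre_manifold_Rn \<gamma>_smooth[OF that] sx]) (use that in \<open>simp add: cdom_def\<close>)
    show "\<phi> (\<gamma> 0) x = x" by (simp add: \<gamma>_0 act_one x)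
    show "restrict (\<lambda>u. orb x) (Rn p) u = orb (\<phi> (\<gamma> u) x)" if "u \<in> cdom GM \<xi> \<one>" "u \<in> Rn p" for u
      using orb_act[OF \<gamma>_carrier[OF that(1)] x] that(2) by simp
  qed
  moreover have "summand ?P a - summand Qp (jacobian p m (\<lambda>u. \<kappa> x) 0 a) \<in> RO"
    by (rule Qp_relation[OF P openin_topspace Rn_0 sx refl _ a]) (assumption, rule restrict_apply')
  then have "summand ?P a \<in> RO" by (simp add: jacobian_const linear_0[OF linear_summand])
  ultimately have "summand Qp (D1 a) \<in> RO"
    using subspace_diff[OF subspace_plot_relations] by fastforce
  then show ?thesis by (simp add: Zs_def D1_Rm del: topspace_Euclidean_space)
qed

text \<open>Acting by h in K on \<mu> gives a second lift of \<open>Qp\<close> based at x, and its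
  derivative in coordinates is \<open>rho h\<close>.\<close>

lemma rho_Zs: assumes h: "h \<in> K" and v: "v \<in> Rn m" shows "v - rho h v \<in> Zs"
proof -
  have "summand Qp v - summand Qp (rho h v) \<in> RO"
    unfolding rho_def
    apply (subst (1) Qp_def)
  proof (rule Qp_relation[OF Qp_pointed[unfolded Qp_def] UQ(1,2) _ _ _ v])
    show "smooth_at (Rn_mfd m) M (\<lambda>b. \<phi> h (\<mu> b)) u" if "u \<in> UQ" for u
      by (rule smooth_at_compose[OF pre_manifold_Rn pM pM, where f=\<mu> and g="\<phi> h"])
         (rule \<mu>_smooth[OF subsetD[OF UQ(3) that]], rule smooth_at_act_left[OF K_carrier[OF h] \<mu>_points[OF subsetD[OF UQ(3) that]]])
    show "\<phi> h (\<mu> 0) = x" by (simp add: \<mu>_0 K_fix h)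
    show "restrict (\<lambda>w. orb (\<mu> w)) UQ u = orb (\<phi> h (\<mu> u))" if "u \<in> UQ" for u
      using orb_act[OF K_carrier[OF h] \<mu>_points[OF subsetD[OF UQ(3) that]]] that by simp
  qed
  then show ?thesis using v by (simp add: Zs_def linear_diff[OF linear_summand] Rn_diff rho_Rm del: topspace_Euclidean_space)
qed

end

section \<open>Reduction to fixed vectors and their separation\<close>

context slice_linearization
begin

text \<open>A linear projection onto the part of Z in \<open>Rn k\<close> fixes every member of the
  family and commutes with the mean.\<close>

lemma vmean_subspace:
  assumes Z: "subspace Z" and F: "K_family F" "\<And>h. h \<in> K \<Longrightarrow> F h \<in> Z"
  shows "vmean F \<in> Z"
proof -
  have sI: "subspace (Z \<inter> Rn k)" by (rule subspace_inter[OF Z subspace_Rn])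
  obtain P where P: "range P \<subseteq> Z \<inter> Rn k" "linear P" "\<forall>v\<in>Z \<inter> Rn k. P v = v"
    using linear_exists_left_inverse_on[OF linear_ident_fun sI] by auto
  have "vmean F = vmean (\<lambda>h. P (F h))"
    by (rule vmean_cong[OF F(1)]) (use P(3) F in \<open>simp add: K_family_def\<close>)
  also have "\<dots> = P (vmean F)" by (rule linear_vmean(2)[OF P(2) _ F(1)]) (use P(1) in auto)
  finally show ?thesis using P(1) by auto
qed

text \<open>The difference is written with \<open>(-1) *\<^sub>R\<close> because the closure
  properties of families are stated for sums and linear images.\<close>

lemma mean_defect:
  assumes s: "s \<in> Rn k"
  shows "K_family (\<lambda>h. s + (-1) *\<^sub>R rho (inv h) s)" "vmean (\<lambda>h. s + (-1) *\<^sub>R rho (inv h) s) = s + (-1) *\<^sub>R e' s"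
proof -
  have c: "K_family (\<lambda>h. s)" using s by (simp add: K_family_def)
  have l: "linear (\<lambda>v :: nat \<Rightarrow> real. (-1) *\<^sub>R v)" by (rule linearI) (simp_all add: scaleR_add_right)
  note m = linear_vmean[OF l Rn_scale K_family_rho(2)[OF s]]
  show "K_family (\<lambda>h. s + (-1) *\<^sub>R rho (inv h) s)" "vmean (\<lambda>h. s + (-1) *\<^sub>R rho (inv h) s) = s + (-1) *\<^sub>R e' s"
    using K_family_add[OF c m(1)] m(2) vmean_const[OF s] by (simp_all only: e'_def simp_thms)
qed

text \<open>The difference is the mean of the vectors \<open>s - rho (inv h) s\<close>, each of
  which represents zero.\<close>

lemma Zs_fixed: assumes s: "s \<in> Rn k" shows "s - e' s \<in> Zs"
proof -
  have "vmean (\<lambda>h. s + (-1) *\<^sub>R rho (inv h) s) \<in> Zs"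
    by (rule vmean_subspace[OF subspace_Zs mean_defect(1)[OF s]]) (use rho_Zs[OF K_inv Rk_Rm[OF s]] in simp)
  then show ?thesis unfolding mean_defect(2)[OF s] by simp
qed

lemma pointed_plot_reduce:
  assumes P: "P \<in> pointed_plots DO (orb x)" and v: "v \<in> Rn (fst P)"
  obtains u where "u \<in> fixed" "summand P v - summand Qp u \<in> RO"
proof -
  obtain n U q where Pq: "P = (n, U, q)" by (cases P)
  note P' = P[unfolded Pq] and v' = v[unfolded Pq fst_conv]
  obtain V f where V: "openin (Euclidean_space n) V" "0 \<in> V" "V \<subseteq> U"
    and f: "\<forall>u\<in>V. smooth_at (Rn_mfd n) M f u" "\<forall>u\<in>V. q u = orb (f u)" "f 0 = x"
    by (rule pointed_plot_lift[OF P'])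
  define w where "w = jacobian n m (\<lambda>u. \<kappa> (f u)) 0 v"
  have w: "w \<in> Rn m" unfolding w_def by (rule jacobian_Rn)
  have 1: "summand P v - summand Qp w \<in> RO"
    unfolding w_def Pq by (rule Qp_relation[OF P' V(1,2) f(1)[rule_format] f(3) _ v']) (assumption, rule f(2)[rule_format])
  obtain a s where as: "a \<in> Rn p" "s \<in> Rn k" "w = D1 a + s" using complement_Rk[OF w] .
  \<comment> \<open>Modulo relations the orbit part of w disappears and its slice part may be
    replaced by the average.\<close>
  have "D1 a + (s - e' s) \<in> Zs" by (rule subspace_add[OF subspace_Zs D1_Zs[OF as(1)] Zs_fixed[OF as(2)]])
  then have "summand Qp (w - e' s) \<in> RO" by (simp add: Zs_def as(3) add_diff_eq)
  then have "summand P v - summand Qp w + (summand Qp w - summand Qp (e' s)) \<in> RO"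
    using subspace_add[OF subspace_plot_relations 1] by (simp only: linear_diff[OF linear_summand])
  then show ?thesis using that[OF e'_mem[OF as(2)]] by simp
qed

lemma plot_sum_reduce:
  assumes f: "f \<in> plot_sum DO (orb x)"
  shows "\<exists>u\<in>fixed. f - summand Qp u \<in> RO"
proof -
  have "\<exists>u\<in>fixed. (\<Sum>P\<in>A. summand P (f P)) - summand Qp u \<in> RO" if "finite A" "A \<subseteq> {P. f P \<noteq> 0}" for A
    using that
  proof (induction A rule: finite_induct)
    case empty
    have "(\<Sum>P\<in>{}. summand P (f P)) - summand Qp 0 \<in> RO"
      by (simp only: sum.empty linear_0[OF linear_summand] diff_self subspace_0[OF subspace_plot_relations])
    then show ?case using subspace_0[OF subspace_fixed] by (rule bexI)
  next
    case (insert P A)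
    obtain u where u: "u \<in> fixed" "(\<Sum>P\<in>A. summand P (f P)) - summand Qp u \<in> RO" using insert by blast
    have "f P \<noteq> 0" using insert by blast
    obtain u' where u': "u' \<in> fixed" "summand P (f P) - summand Qp u' \<in> RO"
      using pointed_plot_reduce[OF plot_sumD(2)[OF f \<open>f P \<noteq> 0\<close>] plot_sumD(3)[OF f]] .
    have "(summand P (f P) - summand Qp u') + ((\<Sum>P\<in>A. summand P (f P)) - summand Qp u) \<in> RO"
      by (rule subspace_add[OF subspace_plot_relations u'(2) u(2)])
    then have "(\<Sum>P\<in>insert P A. summand P (f P)) - summand Qp (u' + u) \<in> RO"
      by (simp only: add_diff_add[symmetric] linear_add[OF linear_summand] sum.insert[OF insert.hyps])
    then show ?case using subspace_add[OF subspace_fixed u'(1) u(1)] by (rule bexI)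
  qed
  from this[OF plot_sumD(1)[OF f] order_refl] show ?thesis using plot_sum_decompose[OF f] by simp
qed

text \<open>On orbits meeting \<open>Wp\<close> invariance makes the choice harmless. Other orbits
  get an arbitrary value, which no germ at the base point sees.\<close>

definition \<Psi>o where "\<Psi>o O' = \<Psi> (SOME y. y \<in> Wp \<and> orb y = O')"

lemma Wp_points: "y \<in> Wp \<Longrightarrow> y \<in> points M"
  using openin_subset[OF openin_Wp] by blast

lemma \<Psi>o_orb: assumes y: "y \<in> Wp" shows "\<Psi>o (orb y) = \<Psi> y"
proof -
  have z: "(SOME z. z \<in> Wp \<and> orb z = orb y) \<in> Wp \<and> orb (SOME z. z \<in> Wp \<and> orb z = orb y) = orb y"
    by (rule someI[of _ y]) (simp add: y)
  obtain g where "g \<in> carrier G" "y = \<phi> g (SOME z. z \<in> Wp \<and> orb z = orb y)"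
    using orb_eqD[OF Wp_points[OF y] conjunct2[OF z]] .
  from \<Psi>_invariant[OF conjunct1[OF z] y this] show ?thesis by (simp add: \<Psi>o_def)
qed

text \<open>Near 0 the plot lifts to M, and along the lift \<open>\<Psi>o\<close> becomes the smooth
  map \<Psi>.\<close>

lemma smooth_at_\<Psi>o:
  assumes P: "(n, U, P) \<in> pointed_plots DO (orb x)" shows "smooth_at (Rn_mfd n) (Rn_mfd k) (\<lambda>u. \<Psi>o (P u)) 0"
proof -
  obtain V f where V: "openin (Euclidean_space n) V" "0 \<in> V" "V \<subseteq> U"
    and f: "\<forall>u\<in>V. smooth_at (Rn_mfd n) M f u" "\<forall>u\<in>V. P u = orb (f u)" "f 0 = x"
    by (rule pointed_plot_lift[OF P])
  have oV: "openin (mtop (Rn_mfd n)) V" using V(1) by simp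
  show ?thesis
  proof (rule smooth_at_cong[OF pre_manifold_Rn pre_manifold_Rn])
    show "smooth_at (Rn_mfd n) (Rn_mfd k) (\<lambda>u. \<Psi> (f u)) 0"
    proof (rule smooth_at_compose[OF pre_manifold_Rn pM pre_manifold_Rn, where f=f and g=\<Psi>])
      show "smooth_at M (Rn_mfd k) \<Psi> (f 0)" unfolding f(3) by (rule smooth_at_\<Psi>[OF x_Wp])
    qed (rule bspec[OF f(1) V(2)])
    show "openin (mtop (Rn_mfd n)) {u \<in> V. f u \<in> Wp}" by (rule smooth_at_open_preimage[OF f(1)[rule_format] oV openin_Wp])
    show "0 \<in> {u \<in> V. f u \<in> Wp}" using V(2) f(3) x_Wp by simp
    show "\<Psi> (f u) = \<Psi>o (P u)" if "u \<in> {u \<in> V. f u \<in> Wp}" for u using that f(2) \<Psi>o_orb by simp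
  qed
qed

definition Jp where "Jp P = jacobian (fst P) k (\<lambda>u. \<Psi>o (snd (snd P) u)) 0"

lemma linear_Jp: "linear (Jp P)"
  unfolding Jp_def by (rule linear_jacobian)

text \<open>The derivative of \<open>\<Psi>o\<close> as a map on the whole sum: on each summand it
  is the Jacobian of \<open>\<Psi>o\<close> along the plot.\<close>

definition J where "J f = (\<Sum>P | f P \<noteq> 0. Jp P (f P))"

lemma J_superset: "\<lbrakk>finite A; {P. f P \<noteq> 0} \<subseteq> A\<rbrakk> \<Longrightarrow> J f = (\<Sum>P\<in>A. Jp P (f P))"
  unfolding J_def by (rule sum.mono_neutral_left) (auto simp: linear_0[OF linear_Jp])

lemma J_summand: "J (summand P v) = Jp P v"
proof -
  have "J (summand P v) = (\<Sum>Q\<in>{P}. Jp Q (summand P v Q))" by (rule J_superset) (auto simp: summand_def)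
  then show ?thesis by (simp add: summand_def)
qed

text \<open>On a generator this is the chain rule: the plots p and q with p = q \<circ> g near 0
  give \<open>\<Psi>o\<close> along p as \<open>\<Psi>o\<close> along q, composed with g. Additivity
  of \<open>J\<close> needs finite supports, so the span is formed inside the direct sum.\<close>

lemma J_relations: assumes "f \<in> RO" shows "J f = 0"
proof -
  have add: "J (f + g) = J f + J g" if "finite {P. f P \<noteq> 0}" "finite {P. g P \<noteq> 0}" for f g
  proof -
    let ?A = "{P. f P \<noteq> 0} \<union> {P. g P \<noteq> 0}"
    have fA: "finite ?A" using that by simp
    have "J (f + g) = (\<Sum>P\<in>?A. Jp P ((f + g) P))" by (rule J_superset[OF fA]) auto
    also have "\<dots> = (\<Sum>P\<in>?A. Jp P (f P)) + (\<Sum>P\<in>?A. Jp P (g P))"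
      by (simp only: plus_fun_def[of f g] linear_add[OF linear_Jp] sum.distrib)
    also have "(\<Sum>P\<in>?A. Jp P (f P)) = J f" by (rule J_superset[OF fA, symmetric]) auto
    also have "(\<Sum>P\<in>?A. Jp P (g P)) = J g" by (rule J_superset[OF fA, symmetric]) auto
    finally show ?thesis .
  qed
  have scale: "J (r *\<^sub>R f) = r *\<^sub>R J f" if "finite {P. f P \<noteq> 0}" for r f
  proof -
    have "J (r *\<^sub>R f) = (\<Sum>P | f P \<noteq> 0. Jp P ((r *\<^sub>R f) P))" by (rule J_superset[OF that]) auto
    then show ?thesis by (simp only: scaleR_fun_apply linear_scale[OF linear_Jp] J_def scaleR_sum_right)
  qed
  have fin: "finite {P. f P \<noteq> 0}" if "f \<in> plot_sum DO (orb x)" for f by (rule plot_sumD(1)[OF that])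
  note ps = subspace_plot_sum[of DO "orb x"]
  have "RO \<subseteq> {f \<in> plot_sum DO (orb x). J f = 0}"
    unfolding plot_relations_def
  proof (rule span_minimal)
    show "subspace {f \<in> plot_sum DO (orb x). J f = 0}"
      unfolding subspace_def
    proof (intro conjI ballI allI)
      show "0 \<in> {f \<in> plot_sum DO (orb x). J f = 0}" using subspace_0[OF ps] by (simp add: J_def)
      show "f + g \<in> {f \<in> plot_sum DO (orb x). J f = 0}"
        if "f \<in> {f \<in> plot_sum DO (orb x). J f = 0}" "g \<in> {f \<in> plot_sum DO (orb x). J f = 0}" for f g
        using that subspace_add[OF ps] add[OF fin fin] by simp
      show "r *\<^sub>R f \<in> {f \<in> plot_sum DO (orb x). J f = 0}" if "f \<in> {f \<in> plot_sum DO (orb x). J f = 0}" for r f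
        using that subspace_scale[OF ps] scale[OF fin] by simp
    qed
    show "{summand (n, U, p) v - summand (m, V, q) (jacobian n m g 0 v) | n U p m V q g W v.
       (n, U, p) \<in> pointed_plots DO (orb x) \<and> (m, V, q) \<in> pointed_plots DO (orb x) \<and> v \<in> Rn n \<and>
       openin (Euclidean_space n) W \<and> 0 \<in> W \<and> W \<subseteq> U \<and>
       smooth_map n W m g \<and> g ` W \<subseteq> V \<and> g 0 = 0 \<and> (\<forall>u\<in>W. p u = q (g u))} \<subseteq> {f \<in> plot_sum DO (orb x). J f = 0}"
    proof (rule subsetI, elim CollectE exE conjE)
      fix z n U P m' V q g W v
      assume z: "z = summand (n, U, P) v - summand (m', V, q) (jacobian n m' g 0 v)"
        and P: "(n, U, P) \<in> pointed_plots DO (orb x)" and Q: "(m', V, q) \<in> pointed_plots DO (orb x)" and v: "v \<in> Rn n"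
        and W: "openin (Euclidean_space n) W" "0 \<in> W" and g: "smooth_map n W m' g" "g 0 = 0"
        and pq: "\<forall>u\<in>W. P u = q (g u)"
      have s1: "summand (n, U, P) v \<in> plot_sum DO (orb x)" by (rule summand_plot_sum[OF P]) (simp only: fst_conv v)
      have s2: "summand (m', V, q) (jacobian n m' g 0 v) \<in> plot_sum DO (orb x)"
        by (rule summand_plot_sum[OF Q]) (simp only: fst_conv jacobian_Rn)
      have "jacobian n k (\<lambda>u. \<Psi>o (P u)) 0 v = jacobian n k (\<lambda>u. \<Psi>o (q (g u))) 0 v"
        by (rule jacobian_cong[OF W]) (simp add: pq)
      also have "\<dots> = jacobian m' k (\<lambda>u. \<Psi>o (q u)) (g 0) (jacobian n m' g 0 v)"
        by (rule jacobian_compose_at[OF smooth_at_RnI[OF W g(1)], where f="\<lambda>u. \<Psi>o (q u)"])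
           (unfold g(2), rule smooth_at_\<Psi>o[OF Q])
      finally have "Jp (n, U, P) v = Jp (m', V, q) (jacobian n m' g 0 v)" by (simp add: Jp_def g(2))
      moreover have "J z = J (summand (n, U, P) v + (-1) *\<^sub>R summand (m', V, q) (jacobian n m' g 0 v))" by (simp add: z)
      then have "J z = Jp (n, U, P) v + (-1) *\<^sub>R Jp (m', V, q) (jacobian n m' g 0 v)"
        using add[OF fin[OF s1] fin[OF subspace_scale[OF ps s2, of "-1"]]] scale[OF fin[OF s2], of "-1"] by (simp only: J_summand)
      ultimately show "z \<in> {f \<in> plot_sum DO (orb x). J f = 0}"
        using subspace_diff[OF ps s1 s2] z by simp
    qed
  qed
  then show ?thesis using assms by blast
qed

text \<open>The derivative is taken along slice vectors only. At slice points \<Psi> reduces to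
  \<open>e\<close> after \<psi>, where \<psi> has identity derivative at 0 and \<open>e\<close>
  leaves u unchanged.\<close>

lemma Jp_Qp: assumes u: "u \<in> fixed" shows "Jp Qp u = u"
proof -
  note uk = fixed_Rk[OF u]
  have sQ: "smooth_at (Rn_mfd m) (Rn_mfd k) (\<lambda>w. \<Psi>o (restrict (\<lambda>w. orb (\<mu> w)) UQ w)) 0"
    by (rule smooth_at_\<Psi>o[OF Qp_pointed[unfolded Qp_def]])
  have i: "smooth_at (Rn_mfd k) (Rn_mfd m) (\<lambda>w. w) 0" by (rule smooth_at_linear[OF linear_ident_fun Rk_Rm Rn_0])
  have "jacobian k k (\<lambda>w. \<Psi>o (restrict (\<lambda>w. orb (\<mu> w)) UQ w)) 0 u
      = jacobian m k (\<lambda>w. \<Psi>o (restrict (\<lambda>w. orb (\<mu> w)) UQ w)) 0 (jacobian k m (\<lambda>w. w) 0 u)"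
    by (rule jacobian_compose_at[OF i sQ])
  also have "jacobian k m (\<lambda>w. w) 0 u = u" by (rule jacobian_linear[OF linear_ident_fun Rk_Rm uk])
  finally have 1: "Jp Qp u = jacobian k k (\<lambda>w. \<Psi>o (restrict (\<lambda>w. orb (\<mu> w)) UQ w)) 0 u"
    by (simp only: Jp_def Qp_def fst_conv snd_conv)
  have oU: "openin (Euclidean_space k) (C0 \<inter> (UQ \<inter> Rn k))"
    by (intro openin_Int openin_C0 openin_Rn_restrict[OF UQ(1) km])
  have "jacobian k k (\<lambda>w. \<Psi>o (restrict (\<lambda>w. orb (\<mu> w)) UQ w)) 0 u = jacobian k k (\<lambda>b. e (\<psi> b)) 0 u"
  proof (rule jacobian_cong[OF oU])
    show "0 \<in> C0 \<inter> (UQ \<inter> Rn k)" using C0_0 UQ(2) by simp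
    show "\<Psi>o (restrict (\<lambda>w. orb (\<mu> w)) UQ b) = e (\<psi> b)" if "b \<in> C0 \<inter> (UQ \<inter> Rn k)" for b
    proof -
      have b: "b \<in> C0" "b \<in> UQ" using that by simp_all
      note f = W0_Rk[OF C0_D(2)[OF b(1)] C0_D(5)[OF b(1)]]
      have "\<mu> b \<in> Wp" using f C0_D(1)[OF b(1)] by (simp add: Wp_def)
      then show ?thesis using b(2) f(4) by (simp add: \<Psi>o_orb \<Psi>_def)
    qed
  qed
  also have "\<dots> = jacobian k k e (\<psi> 0) (jacobian k k \<psi> 0 u)"
    by (rule jacobian_compose_at[OF smooth_at_RnI[OF openin_B1 B1_0 smooth_\<psi>] smooth_at_e[OF \<psi>_Rk]])
  also have "\<dots> = u" by (simp add: jacobian_\<psi>[OF uk] jacobian_e[OF uk \<psi>_Rk] e_fixed(1)[OF u])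
  finally show ?thesis using 1 by simp
qed

text \<open>W is kept arbitrary so that the fixed tangent vectors and the tangent space of the
  stratum are both instances; each needs only a linear bijection onto \<open>fixed\<close>.\<close>

theorem internal_tangent_space_vs_isomorphic:
  assumes W: "subspace W" and L: "linear L" "bij_betw L W fixed"
  shows "vs_isomorphic (internal_tangent_space DO (orb x)) (sub_vspace W)"
  unfolding internal_tangent_space_def
proof (rule quot_vspace_vs_isomorphic[OF subspace_plot_sum subspace_plot_relations plot_relations_sub W,
      where f="\<lambda>w. summand Qp (L w)"])
  have LW: "L w \<in> fixed" if "w \<in> W" for w by (rule bij_betw_apply[OF L(2) that])
  show "linear (\<lambda>w. summand Qp (L w))" using linear_compose[OF L(1) linear_summand] by (simp add: o_def)
  show "(\<lambda>w. summand Qp (L w)) ` W \<subseteq> plot_sum DO (orb x)"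
  proof (rule image_subsetI, rule summand_plot_sum[OF Qp_pointed])
    show "L w \<in> Rn (fst Qp)" if "w \<in> W" for w
      using Rk_Rm[OF fixed_Rk[OF LW[OF that]]] by (simp only: Qp_def fst_conv)
  qed
  show "w = 0" if w: "w \<in> W" "summand Qp (L w) \<in> RO" for w
  proof -
    have "L w = L 0" using J_relations[OF w(2)] by (simp add: J_summand Jp_Qp[OF LW[OF w(1)]] linear_0[OF L(1)])
    then show ?thesis using L(2) w(1) subspace_0[OF W] unfolding bij_betw_def inj_on_def by blast
  qed
  show "\<exists>w\<in>W. a - summand Qp (L w) \<in> RO" if a: "a \<in> plot_sum DO (orb x)" for a
  proof -
    obtain u where u: "u \<in> fixed" "a - summand Qp u \<in> RO" using plot_sum_reduce[OF a] by (elim bexE) (rule that)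
    obtain w where "w \<in> W" "u = L w" using u(1) L(2) unfolding bij_betw_def by blast
    then show ?thesis using u(2) by (intro bexI[of _ w]) simp_all
  qed
qed

lemma fixed_tangents_eq: "fixed_tangents G M \<phi> x k S = {t \<in> tangent_space M x. tcoord M c x t \<in> fixed}"
proof -
  have "differential M M (\<phi> h) x t = t \<longleftrightarrow> rho h (tcoord M c x t) = tcoord M c x t"
    if h: "h \<in> K" and t: "t \<in> tangent_space M x" for h t
  proof -
    note fx = K_fix[OF h]
    have "differential M M (\<phi> h) x t = tvec M c (\<phi> h x) (rep_jac M M c c (\<phi> h) x (tcoord M c x t))"
      by (rule differential_coord[OF pM pM smooth_at_act_left[OF K_carrier[OF h] x] c_max ad(2) c_max _ t])
         (simp add: fx ad(2))
    then have d: "differential M M (\<phi> h) x t = tvec M c x (rho h (tcoord M c x t))"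
      by (simp add: fx rho_rep_jac[OF h tcoord_Rn])
    show ?thesis
      using tcoord_tvec[OF pM c_max ad(2) rho_Rm, of h "tcoord M c x t"] tvec_tcoord[OF pM c_max ad(2) t] d by metis
  qed
  then show ?thesis
    unfolding fixed_tangents_def sub_tangent_space_coord[OF pM submfd ad(1,2) xS] fixed_def by blast
qed

theorem internal_tangent_space_fixed_tangents:
  "vs_isomorphic (internal_tangent_space DO (orb x)) (sub_vspace (fixed_tangents G M \<phi> x k S))"
proof (rule internal_tangent_space_vs_isomorphic)
  show "linear (tcoord M c x)" by (rule linear_tcoord)
  have b: "bij_betw (tcoord M c x) (tangent_space M x) (Rn m)" by (rule bij_tcoord[OF pM c_max ad(2)])
  show "subspace (fixed_tangents G M \<phi> x k S)"
    unfolding fixed_tangents_eq subspace_def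
    using subspace_tangent_space[OF pM x] subspace_fixed linear_tcoord[of M c x]
    by (simp add: subspace_0 subspace_add subspace_scale linear_0 linear_add linear_scale)
  show "bij_betw (tcoord M c x) (fixed_tangents G M \<phi> x k S) fixed"
    unfolding bij_betw_def
  proof
    show "inj_on (tcoord M c x) (fixed_tangents G M \<phi> x k S)"
      by (rule inj_on_subset[OF bij_betw_imp_inj_on[OF b]]) (auto simp: fixed_tangents_eq)
    show "tcoord M c x ` fixed_tangents G M \<phi> x k S = fixed"
    proof (intro equalityI subsetI)
      fix u assume u: "u \<in> fixed"
      then obtain t where "t \<in> tangent_space M x" "u = tcoord M c x t"
        using b Rk_Rm[OF fixed_Rk[OF u]] unfolding bij_betw_def by blast
      then show "u \<in> tcoord M c x ` fixed_tangents G M \<phi> x k S" using u by (auto simp: fixed_tangents_eq)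
    qed (auto simp: fixed_tangents_eq)
  qed
qed

end

subsection \<open>Points with the same local type\<close>

text \<open>In an adapted chart the values already lie in \<open>Rn l\<close>, so the coordinate map
  stays smooth when its codomain is restricted.\<close>

lemma smooth_at_sub_mfd:
  assumes P: "pre_manifold P" and M': "pre_manifold M'" and L: "submanifold M' l L" and f: "smooth_at P M' f y"
    and W: "openin (mtop P) W" "y \<in> W" "f ` W \<subseteq> L"
  shows "smooth_at P (sub_mfd M' l L) f y"
proof -
  have fy: "f y \<in> L" using W by auto
  obtain d where d: "d \<in> adapted_charts M' l L" "f y \<in> fst d" using L fy unfolding submanifold_def by blast
  note dm = adapted_max[OF d(1)]
  obtain e where e: "e \<in> atlas P" "y \<in> fst e" by (rule atlas_cover[OF P]) (use openin_subset[OF W(1)] W(2) in auto)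
  note em = atlas_max[OF P e(1)]
  obtain V where V: "openin (mtop P) V" "y \<in> V" "V \<subseteq> W" "V \<subseteq> fst e" "f ` V \<subseteq> fst d"
    "smooth_map (mdim P) (snd e ` V) (mdim M') (\<lambda>a. snd d (f (chart_inv e a)))"
    using smooth_at_charts[OF P M' f em e(2) dm d(2) W(1,2)] .
  have fV: "f z \<in> fst d \<inter> L" if "z \<in> V" for z using that V(3,5) W(3) by (auto simp: image_subset_iff)
  have "smooth_map (mdim P) (snd e ` V) l (\<lambda>a. snd d (f (chart_inv e a)))"
  proof (rule smooth_map_restrict_codomain[OF V(6) submanifold_dim[OF M' L]])
    show "(\<lambda>a. snd d (f (chart_inv e a))) ` snd e ` V \<subseteq> Rn l"
      unfolding image_image image_subset_iff
    proof
      fix z assume z: "z \<in> V"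
      then have "chart_inv e (snd e z) = z" using max_inv_left[OF em] V(4) by blast
      moreover have "snd d (f z) \<in> Rn l" using fV[OF z] adapted_iff[OF d(1)] by blast
      ultimately show "snd d (f (chart_inv e (snd e z))) \<in> Rn l" by (simp only:)
    qed
  qed
  then show ?thesis
    unfolding smooth_at_def
    by (intro bexI[OF _ em] bexI[OF _ sub_chart_max[OF M' L d(1)]] exI[of _ V])
       (use V fV in \<open>auto simp: image_subset_iff\<close>)
qed

section \<open>Extending stabilizer-equivariant maps of the slice to tubes\<close>

context slice_linearization
begin

definition tube :: "(nat \<Rightarrow> real) set \<Rightarrow> _ set" where "tube C = {y. \<exists>g\<in>carrier G. \<exists>s\<in>C. y = \<phi> g (\<mu> s)}"

text \<open>The G-equivariant extension of a map \<tau> of slice coordinates. A point of the tube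
  determines its representation up to K, so the choice does not matter once \<tau> commutes with
  K.\<close>

definition tube_map :: "(nat \<Rightarrow> real) set \<Rightarrow> ((nat \<Rightarrow> real) \<Rightarrow> nat \<Rightarrow> real) \<Rightarrow> _ \<Rightarrow> _"
  where "tube_map C \<tau> y = (SOME z. \<exists>g\<in>carrier G. \<exists>s\<in>C. y = \<phi> g (\<mu> s) \<and> z = \<phi> g (\<mu> (\<tau> s)))"

lemma \<mu>_C0: assumes "s \<in> C0" shows "\<mu> s \<in> points M" "\<mu> s \<in> S" "\<mu> s \<in> Wp" "r (\<mu> s) = s" "s \<in> cdom M c x"
proof -
  note f = W0_Rk[OF C0_D(2)[OF assms] C0_D(5)[OF assms]]
  show "\<mu> s \<in> points M" "\<mu> s \<in> S" "s \<in> cdom M c x" by (rule B1_D[OF C0_D(1)[OF assms]])+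
  show "\<mu> s \<in> Wp" "r (\<mu> s) = s" using f C0_D(1)[OF assms] by (simp_all add: Wp_def)
qed

text \<open>The element \<open>inv g \<otimes> g'\<close> moves one slice point to the other and
  hence lies in K.\<close>

lemma C0_transport:
  assumes s: "s \<in> C0" "s' \<in> C0" and g: "g \<in> carrier G" "g' \<in> carrier G" "\<phi> g (\<mu> s) = \<phi> g' (\<mu> s')"
  obtains h where "h \<in> K" "g' = g \<otimes> h" "s = act_S h s'"
proof -
  note f = \<mu>_C0[OF s(1)] and f' = \<mu>_C0[OF s(2)]
  define h where "h = inv g \<otimes> g'"
  have hG: "h \<in> carrier G" using g by (simp add: h_def)
  have "\<phi> h (\<mu> s') = \<phi> (inv g) (\<phi> g' (\<mu> s'))" using g f' by (simp add: h_def act_mult)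
  also have "\<dots> = \<mu> s" using g(3)[symmetric] act_inv[OF g(1) f(1)] by simp
  finally have eq: "\<phi> h (\<mu> s') = \<mu> s" .
  then have h: "h \<in> K" using S_slice[OF hG f'(2)] f(2) by simp
  have "g' = g \<otimes> h" using g by (simp add: h_def m_assoc[symmetric])
  moreover have "s = act_S h s'" using eq \<kappa>_\<mu>[OF f(5)] by (simp add: act_S_def)
  ultimately show ?thesis using that h by blast
qed

lemma tube_I: "g \<in> carrier G \<Longrightarrow> s \<in> C \<Longrightarrow> \<phi> g (\<mu> s) \<in> tube C"
  unfolding tube_def by blast

lemma tube_E: assumes "y \<in> tube C" obtains g s where "g \<in> carrier G" "s \<in> C" "y = \<phi> g (\<mu> s)"
  using assms unfolding tube_def by blast

context
  fixes C assumes C: "openin (Euclidean_space k) C" "C \<subseteq> C0"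
begin

lemma tube_invariant: assumes "g \<in> carrier G" "y \<in> tube C" shows "\<phi> g y \<in> tube C"
proof -
  obtain a s where as: "a \<in> carrier G" "s \<in> C" "y = \<phi> a (\<mu> s)" using tube_E[OF assms(2)] .
  have "\<phi> g y = \<phi> (g \<otimes> a) (\<mu> s)" using as assms(1) \<mu>_C0(1)[OF subsetD[OF C(2) as(2)]] by (simp add: act_mult)
  then show ?thesis using tube_I[of "g \<otimes> a" s C] as assms(1) by simp
qed

lemma openin_slice_nbhd: "openin (mtop M) {z \<in> Wx. r z \<in> C}"
proof -
  have "openin (mtop (Rn_mfd k)) C" using C(1) by simp
  from smooth_at_open_preimage[OF smooth_at_r openin_Wx this] show ?thesis .
qed

lemma openin_translated: assumes "a \<in> carrier G" shows "openin (mtop M) {y \<in> points M. \<phi> a y \<in> {z \<in> Wx. r z \<in> C}}"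
  by (rule smooth_at_open_preimage[OF smooth_at_act_left[OF assms] openin_topspace openin_slice_nbhd])

text \<open>As a union of preimages of one open set under group elements the tube is visibly open,
  and near each of its points \<open>g0\<close> and \<open>r\<close> become available after one
  translation.\<close>

lemma tube_eq: "tube C = (\<Union>a\<in>carrier G. {y \<in> points M. \<phi> a y \<in> {z \<in> Wx. r z \<in> C}})"
proof (intro equalityI subsetI)
  fix y assume "y \<in> tube C"
  then obtain g s where gs: "g \<in> carrier G" "s \<in> C" "y = \<phi> g (\<mu> s)" by (rule tube_E)
  note f = \<mu>_C0[OF subsetD[OF C(2) gs(2)]]
  have "\<phi> (inv g) y = \<mu> s" by (simp add: gs(3) act_inv[OF gs(1) f(1)])
  then have "y \<in> {y \<in> points M. \<phi> (inv g) y \<in> {z \<in> Wx. r z \<in> C}}"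
    using f gs act_points[OF gs(1) f(1)] by (simp add: Wp_def)
  moreover have "inv g \<in> carrier G" using gs(1) by simp
  ultimately show "y \<in> (\<Union>a\<in>carrier G. {y \<in> points M. \<phi> a y \<in> {z \<in> Wx. r z \<in> C}})" by (rule UN_I[rotated])
next
  fix y assume "y \<in> (\<Union>a\<in>carrier G. {y \<in> points M. \<phi> a y \<in> {z \<in> Wx. r z \<in> C}})"
  then obtain a where a: "a \<in> carrier G" "y \<in> points M" "\<phi> a y \<in> Wx" "r (\<phi> a y) \<in> C" by blast
  note f = Wx_facts[OF a(3)]
  have "\<phi> (inv a \<otimes> g0 (\<phi> a y)) (\<mu> (r (\<phi> a y))) = \<phi> (inv a) (\<phi> a y)"
    using f a(1) \<mu>_points[OF f(4)] by (simp add: act_mult)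
  then have "y = \<phi> (inv a \<otimes> g0 (\<phi> a y)) (\<mu> (r (\<phi> a y)))" using act_inv[OF a(1,2)] by simp
  then show "y \<in> tube C" using tube_I[of "inv a \<otimes> g0 (\<phi> a y)" "r (\<phi> a y)" C] a f(3) by simp
qed

lemma openin_tube: "openin (mtop M) (tube C)"
  unfolding tube_eq by (rule openin_Union) (use openin_translated in blast)

context
  fixes \<tau> assumes \<tau>: "\<And>s. s \<in> C \<Longrightarrow> \<tau> s \<in> C0"
    and \<tau>_act: "\<And>s h. \<lbrakk>s \<in> C; h \<in> K\<rbrakk> \<Longrightarrow> \<tau> (act_S h s) = act_S h (\<tau> s)"
    and \<tau>_smooth: "\<And>s. s \<in> C \<Longrightarrow> smooth_at (Rn_mfd k) (Rn_mfd k) \<tau> s"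
begin

lemma tube_map: assumes g: "g \<in> carrier G" "s \<in> C" shows "tube_map C \<tau> (\<phi> g (\<mu> s)) = \<phi> g (\<mu> (\<tau> s))"
proof -
  have "\<exists>z. \<exists>g'\<in>carrier G. \<exists>s'\<in>C. \<phi> g (\<mu> s) = \<phi> g' (\<mu> s') \<and> z = \<phi> g' (\<mu> (\<tau> s'))" using g by blast
  from someI_ex[OF this] obtain g' s' where g': "g' \<in> carrier G" "s' \<in> C" "\<phi> g (\<mu> s) = \<phi> g' (\<mu> s')"
    "tube_map C \<tau> (\<phi> g (\<mu> s)) = \<phi> g' (\<mu> (\<tau> s'))"
    unfolding tube_map_def[symmetric] by (elim bexE conjE) (rule that)
  obtain h where h: "h \<in> K" "g' = g \<otimes> h" "s = act_S h s'"
    using C0_transport[OF subsetD[OF C(2) g(2)] subsetD[OF C(2) g'(2)] g(1) g'(1,3)] .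
  note ts = \<tau>[OF g'(2)]
  have "\<phi> g' (\<mu> (\<tau> s')) = \<phi> g (\<phi> h (\<mu> (\<tau> s')))"
    using h(2) g(1) K_carrier[OF h(1)] \<mu>_C0(1)[OF ts] by (simp add: act_mult)
  also have "\<phi> h (\<mu> (\<tau> s')) = \<mu> (\<tau> s)"
    using act_S_facts(1)[OF C0_D(1)[OF ts] h(1)] \<tau>_act[OF g'(2) h(1)] h(3) by simp
  finally show ?thesis using g'(4) by simp
qed

lemma tube_map_act: assumes g: "g \<in> carrier G" and y: "y \<in> tube C" shows "tube_map C \<tau> (\<phi> g y) = \<phi> g (tube_map C \<tau> y)"
proof -
  obtain a s where as: "a \<in> carrier G" "s \<in> C" "y = \<phi> a (\<mu> s)" using tube_E[OF y] .
  have "\<phi> g y = \<phi> (g \<otimes> a) (\<mu> s)" using as g \<mu>_C0(1)[OF subsetD[OF C(2) as(2)]] by (simp add: act_mult)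
  then have "tube_map C \<tau> (\<phi> g y) = \<phi> (g \<otimes> a) (\<mu> (\<tau> s))" using tube_map[of "g \<otimes> a" s] as g by simp
  also have "\<dots> = \<phi> g (tube_map C \<tau> y)"
    using as g tube_map[OF as(1,2)] \<mu>_C0(1)[OF \<tau>[OF as(2)]] by (simp add: act_mult)
  finally show ?thesis .
qed

text \<open>A group element a moves a neighbourhood of y into \<open>Wx\<close>, where
  \<open>g0\<close> and \<open>r\<close> are smooth. There the map is the action of
  \<open>inv a\<close> on \<open>\<phi> (g0 (\<phi> a y)) (\<mu> (\<tau> (r (\<phi> a y))))\<close>,
  which no longer involves a choice.\<close>

lemma smooth_at_tube_map: assumes y: "y \<in> tube C" shows "smooth_at M M (tube_map C \<tau>) y"
proof -
  obtain a where a: "a \<in> carrier G" "y \<in> {y \<in> points M. \<phi> a y \<in> {z \<in> Wx. r z \<in> C}}" using y unfolding tube_eq by blast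
  then have y': "y \<in> points M" "\<phi> a y \<in> Wx" "r (\<phi> a y) \<in> C" by simp_all
  have ia: "inv a \<in> carrier G" using a(1) by simp
  have sa: "smooth_at M M (\<lambda>y. \<phi> a y) y" by (rule smooth_at_act_left[OF a(1) y'(1)])
  have s1: "smooth_at M GM (\<lambda>y. g0 (\<phi> a y)) y"
    by (rule smooth_at_compose[OF pM pM pG, where f="\<phi> a" and g=g0]) (rule sa, rule smooth_at_g0[OF y'(2)])
  have s2: "smooth_at M (Rn_mfd k) (\<lambda>y. r (\<phi> a y)) y"
    by (rule smooth_at_compose[OF pM pM pre_manifold_Rn, where f="\<phi> a" and g=r]) (rule sa, rule smooth_at_r[OF y'(2)])
  have s3: "smooth_at M (Rn_mfd k) (\<lambda>y. \<tau> (r (\<phi> a y))) y"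
    by (rule smooth_at_compose[OF pM pre_manifold_Rn pre_manifold_Rn, where f="\<lambda>y. r (\<phi> a y)" and g=\<tau>])
       (rule s2, rule \<tau>_smooth[OF y'(3)])
  have tk: "\<tau> (r (\<phi> a y)) \<in> C0" by (rule \<tau>[OF y'(3)])
  have i: "smooth_at (Rn_mfd k) (Rn_mfd m) (\<lambda>b. b) (\<tau> (r (\<phi> a y)))"
    by (rule smooth_at_linear[OF linear_ident_fun Rk_Rm C0_D(5)[OF tk]])
  have s4: "smooth_at M (Rn_mfd m) (\<lambda>y. \<tau> (r (\<phi> a y))) y"
    by (rule smooth_at_compose[OF pM pre_manifold_Rn pre_manifold_Rn, where f="\<lambda>y. \<tau> (r (\<phi> a y))" and g="\<lambda>b. b"])
       (rule s3, rule i)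
  have s5: "smooth_at M M (\<lambda>y. \<mu> (\<tau> (r (\<phi> a y)))) y"
    by (rule smooth_at_compose[OF pM pre_manifold_Rn pM, where f="\<lambda>y. \<tau> (r (\<phi> a y))" and g=\<mu>])
       (rule s4, rule \<mu>_smooth[OF \<mu>_C0(5)[OF tk]])
  have s6: "smooth_at M M (\<lambda>y. \<phi> (g0 (\<phi> a y)) (\<mu> (\<tau> (r (\<phi> a y))))) y" by (rule smooth_at_act[OF pM s1 s5])
  have s7: "smooth_at M M (\<lambda>y. \<phi> (inv a) (\<phi> (g0 (\<phi> a y)) (\<mu> (\<tau> (r (\<phi> a y)))))) y"
    by (rule smooth_at_compose[OF pM pM pM, where f="\<lambda>y. \<phi> (g0 (\<phi> a y)) (\<mu> (\<tau> (r (\<phi> a y))))" and g="\<phi> (inv a)"])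
       (rule s6, rule smooth_at_act_left[OF ia smooth_at_points[OF s6]])
  show ?thesis
  proof (rule smooth_at_cong[OF pM pM s7 openin_translated[OF a(1)] a(2)])
    fix z assume "z \<in> {y \<in> points M. \<phi> a y \<in> {z \<in> Wx. r z \<in> C}}"
    then have z: "z \<in> points M" "\<phi> a z \<in> Wx" "r (\<phi> a z) \<in> C" by simp_all
    note f = Wx_facts[OF z(2)]
    have az: "\<phi> a z \<in> tube C" using tube_I[OF f(3) z(3)] f(6) by simp
    have "tube_map C \<tau> z = tube_map C \<tau> (\<phi> (inv a) (\<phi> a z))" by (simp add: act_inv[OF a(1) z(1)])
    also have "\<dots> = \<phi> (inv a) (tube_map C \<tau> (\<phi> a z))" by (rule tube_map_act[OF ia az])
    also have "tube_map C \<tau> (\<phi> a z) = \<phi> (g0 (\<phi> a z)) (\<mu> (\<tau> (r (\<phi> a z))))" using tube_map[OF f(3) z(3)] f(6) by simp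
    finally show "\<phi> (inv a) (\<phi> (g0 (\<phi> a z)) (\<mu> (\<tau> (r (\<phi> a z))))) = tube_map C \<tau> z" ..
  qed
qed

end

end

section \<open>Translation by a fixed vector in linearized coordinates\<close>

lemma smooth_at_shift:
  assumes u: "u \<in> Rn k" and s: "s \<in> C0" "\<psi> s + u \<in> A0" shows "smooth_at (Rn_mfd k) (Rn_mfd k) (\<lambda>s. Gi (\<psi> s + u)) s"
proof -
  have sp: "smooth_at (Rn_mfd k) (Rn_mfd k) \<psi> s" by (rule smooth_at_RnI[OF openin_B1 C0_D(1)[OF s(1)] smooth_\<psi>])
  have 1: "smooth_at (Rn_mfd k) (Rn_mfd k) (\<lambda>s. u + \<psi> s) s"
    by (rule smooth_at_compose[OF pre_manifold_Rn pre_manifold_Rn pre_manifold_Rn, where f=\<psi> and g="\<lambda>b. u + b"])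
       (rule sp, rule smooth_at_translate[OF u \<psi>_Rk])
  have 2: "smooth_at (Rn_mfd k) (Rn_mfd k) Gi (u + \<psi> s)" using smooth_at_Gi[OF s(2)] by (simp add: add.commute)
  have "smooth_at (Rn_mfd k) (Rn_mfd k) (\<lambda>s. Gi (u + \<psi> s)) s"
    by (rule smooth_at_compose[OF pre_manifold_Rn pre_manifold_Rn pre_manifold_Rn, where f="\<lambda>s. u + \<psi> s" and g=Gi])
       (rule 1, rule 2)
  then show ?thesis by (simp add: add.commute)
qed

text \<open>The conditions on start and end point are symmetric: translation by u exchanges this
  domain with the one for \<open>- u\<close> with U and V swapped.\<close>

definition shift_dom where "shift_dom u U V = {s \<in> C0. \<mu> s \<in> U \<and> \<psi> s + u \<in> A0 \<and> \<mu> (Gi (\<psi> s + u)) \<in> V}"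

lemma openin_shift_dom:
  assumes u: "u \<in> Rn k" and U: "openin (mtop M) U" and V: "openin (mtop M) V"
  shows "openin (Euclidean_space k) (shift_dom u U V)"
proof -
  have \<mu>s: "smooth_at (Rn_mfd k) M \<mu> s" if s: "s \<in> C0" for s
  proof -
    have i: "smooth_at (Rn_mfd k) (Rn_mfd m) (\<lambda>b. b) s" by (rule smooth_at_linear[OF linear_ident_fun Rk_Rm C0_D(5)[OF s]])
    show ?thesis
      by (rule smooth_at_compose[OF pre_manifold_Rn pre_manifold_Rn[of m] pM, where f="\<lambda>b. b" and g=\<mu>])
         (rule i, rule \<mu>_smooth[OF \<mu>_C0(5)[OF s]])
  qed
  have o0: "openin (mtop (Rn_mfd k)) C0" using openin_C0 by simp
  have 1: "openin (mtop (Rn_mfd k)) {s \<in> C0. \<mu> s \<in> U}" by (rule smooth_at_open_preimage[OF \<mu>s o0 U])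
  have sp: "smooth_at (Rn_mfd k) (Rn_mfd k) (\<lambda>s. u + \<psi> s) s" if "s \<in> C0" for s
    by (rule smooth_at_compose[OF pre_manifold_Rn pre_manifold_Rn pre_manifold_Rn, where f=\<psi> and g="\<lambda>b. u + b"])
       (rule smooth_at_RnI[OF openin_B1 C0_D(1)[OF that] smooth_\<psi>], rule smooth_at_translate[OF u \<psi>_Rk])
  have oA: "openin (mtop (Rn_mfd k)) A0" using openin_A0 by simp
  have 2: "openin (mtop (Rn_mfd k)) {s \<in> C0. u + \<psi> s \<in> A0}" by (rule smooth_at_open_preimage[OF sp o0 oA])
  have s3: "smooth_at (Rn_mfd k) M (\<lambda>s. \<mu> (Gi (\<psi> s + u))) s" if "s \<in> {s \<in> C0. u + \<psi> s \<in> A0}" for s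
  proof (rule smooth_at_compose[OF pre_manifold_Rn pre_manifold_Rn pM, where f="\<lambda>s. Gi (\<psi> s + u)" and g=\<mu>])
    have s: "s \<in> C0" "\<psi> s + u \<in> A0" using that by (simp_all add: add.commute)
    show "smooth_at (Rn_mfd k) (Rn_mfd k) (\<lambda>s. Gi (\<psi> s + u)) s" by (rule smooth_at_shift[OF u s])
    show "smooth_at (Rn_mfd k) M \<mu> (Gi (\<psi> s + u))" by (rule \<mu>s[OF A0_D(1)[OF s(2)]])
  qed
  have 3: "openin (mtop (Rn_mfd k)) {s \<in> {s \<in> C0. u + \<psi> s \<in> A0}. \<mu> (Gi (\<psi> s + u)) \<in> V}"
    by (rule smooth_at_open_preimage[OF s3 2 V])
  have "shift_dom u U V = {s \<in> C0. \<mu> s \<in> U} \<inter> {s \<in> {s \<in> C0. u + \<psi> s \<in> A0}. \<mu> (Gi (\<psi> s + u)) \<in> V}"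
    by (auto simp: shift_dom_def add.commute)
  then show ?thesis using openin_Int[OF 1 3] by simp
qed

lemma shift_dom_sub: "shift_dom u U V \<subseteq> C0"
  by (auto simp: shift_dom_def)

text \<open>Translation by u commutes with the linear maps \<open>rho h\<close> because they fix u;
  \<open>Gi\<close> carries this back to the action on the slice.\<close>

lemma shift_act:
  assumes u: "u \<in> fixed" and s: "s \<in> C0" "\<psi> s + u \<in> A0" and h: "h \<in> K"
  shows "Gi (\<psi> (act_S h s) + u) = act_S h (Gi (\<psi> s + u))"
proof -
  have "\<psi> (act_S h s) + u = rho h (\<psi> s + u)"
    using \<psi>_act[OF C0_D(1)[OF s(1)] h] fixed_rho[OF u h] by (simp add: linear_add[OF linear_rho])
  then show ?thesis using A0_rho(2)[OF s(2) h] by simp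
qed

lemma shift_inverse:
  assumes s: "s \<in> shift_dom u U V"
  shows "Gi (\<psi> s + u) \<in> shift_dom (- u) V U" "Gi (\<psi> (Gi (\<psi> s + u)) + - u) = s"
proof -
  have s': "s \<in> C0" "\<psi> s + u \<in> A0" "\<mu> s \<in> U" "\<mu> (Gi (\<psi> s + u)) \<in> V" using s by (simp_all add: shift_dom_def)
  note a = A0_D[OF s'(2)]
  have e: "\<psi> (Gi (\<psi> s + u)) + - u = \<psi> s" using a(2) by simp
  show 1: "Gi (\<psi> (Gi (\<psi> s + u)) + - u) = s" unfolding e by (rule Gi_\<psi>[OF s'(1)])
  show "Gi (\<psi> s + u) \<in> shift_dom (- u) V U"
    unfolding shift_dom_def mem_Collect_eq 1 using a(1) s'(3,4) e A0_\<psi>[OF s'(1)] by simp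
qed

text \<open>Collects what the translation provides on tubes. It is applied to u and to
  \<open>- u\<close>, whose tube maps are inverse to each other.\<close>

lemma shift_invariant_nbhd:
  assumes u: "u \<in> fixed" and U: "invariant_nbhd G M \<phi> y U" and V: "invariant_nbhd G M \<phi> z V"
  shows "tube (shift_dom u U V) \<subseteq> U"
    and "\<And>t. t \<in> tube (shift_dom u U V) \<Longrightarrow>
      tube_map (shift_dom u U V) (\<lambda>s. Gi (\<psi> s + u)) t \<in> tube (shift_dom (- u) V U) \<and>
      tube_map (shift_dom (- u) V U) (\<lambda>s. Gi (\<psi> s + - u)) (tube_map (shift_dom u U V) (\<lambda>s. Gi (\<psi> s + u)) t) = t"
    and "\<And>t. t \<in> tube (shift_dom u U V) \<Longrightarrow> smooth_at M M (tube_map (shift_dom u U V) (\<lambda>s. Gi (\<psi> s + u))) t"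
    and "\<And>t g. t \<in> tube (shift_dom u U V) \<Longrightarrow> g \<in> carrier G \<Longrightarrow>
       tube_map (shift_dom u U V) (\<lambda>s. Gi (\<psi> s + u)) (\<phi> g t) = \<phi> g (tube_map (shift_dom u U V) (\<lambda>s. Gi (\<psi> s + u)) t)"
    and "openin (mtop M) (tube (shift_dom u U V))"
    and "\<And>s g. s \<in> shift_dom u U V \<Longrightarrow> g \<in> carrier G \<Longrightarrow>
       tube_map (shift_dom u U V) (\<lambda>s. Gi (\<psi> s + u)) (\<phi> g (\<mu> s)) = \<phi> g (\<mu> (Gi (\<psi> s + u)))"
proof -
  note uk = fixed_Rk[OF u]
  have u': "- u \<in> fixed" by (rule subspace_neg[OF subspace_fixed u])
  have U': "openin (mtop M) U" "\<And>g t. g \<in> carrier G \<Longrightarrow> t \<in> U \<Longrightarrow> \<phi> g t \<in> U" using U by (simp_all add: invariant_nbhd_def)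
  have V': "openin (mtop M) V" using V by (simp add: invariant_nbhd_def)
  note C = openin_shift_dom[OF uk U'(1) V'] shift_dom_sub[of u U V]
  note C' = openin_shift_dom[OF fixed_Rk[OF u'] V' U'(1)] shift_dom_sub[of "- u" V U]
  have t1: "Gi (\<psi> s + u) \<in> C0" if "s \<in> shift_dom u U V" for s using that A0_D(1) by (simp add: shift_dom_def)
  have t1': "Gi (\<psi> s + - u) \<in> C0" if "s \<in> shift_dom (- u) V U" for s using that A0_D(1) by (simp add: shift_dom_def)
  have t2: "Gi (\<psi> (act_S h s) + u) = act_S h (Gi (\<psi> s + u))" if "s \<in> shift_dom u U V" "h \<in> K" for s h
    using that shift_act[OF u] by (simp add: shift_dom_def)
  have t2': "Gi (\<psi> (act_S h s) + - u) = act_S h (Gi (\<psi> s + - u))" if "s \<in> shift_dom (- u) V U" "h \<in> K" for s h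
    using that shift_act[OF u'] by (simp add: shift_dom_def)
  have t3: "smooth_at (Rn_mfd k) (Rn_mfd k) (\<lambda>s. Gi (\<psi> s + u)) s" if "s \<in> shift_dom u U V" for s
    using that smooth_at_shift[OF uk] by (simp add: shift_dom_def)
  have t3': "smooth_at (Rn_mfd k) (Rn_mfd k) (\<lambda>s. Gi (\<psi> s + - u)) s" if "s \<in> shift_dom (- u) V U" for s
    using that smooth_at_shift[OF fixed_Rk[OF u']] by (simp add: shift_dom_def)
  have tm: "tube_map (shift_dom u U V) (\<lambda>s. Gi (\<psi> s + u)) (\<phi> g (\<mu> s)) = \<phi> g (\<mu> (Gi (\<psi> s + u)))"
    if "g \<in> carrier G" "s \<in> shift_dom u U V" for g s by (rule tube_map[OF C t1 t2 t3 that])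
  have tm': "tube_map (shift_dom (- u) V U) (\<lambda>s. Gi (\<psi> s + - u)) (\<phi> g (\<mu> s)) = \<phi> g (\<mu> (Gi (\<psi> s + - u)))"
    if "g \<in> carrier G" "s \<in> shift_dom (- u) V U" for g s by (rule tube_map[OF C' t1' t2' t3' that])
  show "openin (mtop M) (tube (shift_dom u U V))" by (rule openin_tube[OF C])
  show "tube (shift_dom u U V) \<subseteq> U"
  proof
    fix t assume "t \<in> tube (shift_dom u U V)"
    then show "t \<in> U" by (rule tube_E) (use U'(2) in \<open>auto simp: shift_dom_def\<close>)
  qed
  show "tube_map (shift_dom u U V) (\<lambda>s. Gi (\<psi> s + u)) (\<phi> g (\<mu> s)) = \<phi> g (\<mu> (Gi (\<psi> s + u)))"
    if "s \<in> shift_dom u U V" "g \<in> carrier G" for s g by (rule tm[OF that(2,1)])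
  show "smooth_at M M (tube_map (shift_dom u U V) (\<lambda>s. Gi (\<psi> s + u))) t" if "t \<in> tube (shift_dom u U V)" for t
    by (rule smooth_at_tube_map[OF C t1 t2 t3 that])
  show "tube_map (shift_dom u U V) (\<lambda>s. Gi (\<psi> s + u)) (\<phi> g t) = \<phi> g (tube_map (shift_dom u U V) (\<lambda>s. Gi (\<psi> s + u)) t)"
    if "t \<in> tube (shift_dom u U V)" "g \<in> carrier G" for t g
    by (rule tube_map_act[OF C t1 t2 t3 that(2,1)])
  show "tube_map (shift_dom u U V) (\<lambda>s. Gi (\<psi> s + u)) t \<in> tube (shift_dom (- u) V U) \<and>
      tube_map (shift_dom (- u) V U) (\<lambda>s. Gi (\<psi> s + - u)) (tube_map (shift_dom u U V) (\<lambda>s. Gi (\<psi> s + u)) t) = t"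
    if t: "t \<in> tube (shift_dom u U V)" for t
  proof -
    obtain g s where gs: "g \<in> carrier G" "s \<in> shift_dom u U V" "t = \<phi> g (\<mu> s)" using tube_E[OF t] .
    note i = shift_inverse[OF gs(2)]
    have e: "tube_map (shift_dom u U V) (\<lambda>s. Gi (\<psi> s + u)) t = \<phi> g (\<mu> (Gi (\<psi> s + u)))"
      unfolding gs(3) by (rule tm[OF gs(1,2)])
    have "tube_map (shift_dom (- u) V U) (\<lambda>s. Gi (\<psi> s + - u)) (\<phi> g (\<mu> (Gi (\<psi> s + u)))) = t"
      unfolding gs(3) using tm'[OF gs(1) i(1)] i(2) by simp
    then show ?thesis using e tube_I[OF gs(1) i(1)] by simp
  qed
qed

text \<open>Translation by \<open>- u\<close> extends to an equivariant diffeomorphism of tubes that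
  sends \<open>\<mu> (Gi u)\<close> to x. Shrinking into the prescribed invariant neighbourhoods is
  built into \<open>shift_dom\<close>.\<close>

lemma same_local_type_fixed:
  assumes u: "u \<in> fixed" "u \<in> A0"
  shows "same_local_type G M \<phi> (\<mu> (Gi u)) x"
  unfolding same_local_type_def
proof (intro allI impI, elim conjE)
  fix U V assume U: "invariant_nbhd G M \<phi> (\<mu> (Gi u)) U" and V: "invariant_nbhd G M \<phi> x V"
  have u': "- u \<in> fixed" by (rule subspace_neg[OF subspace_fixed u(1)])
  define C where "C = shift_dom (- u) U V"
  define C' where "C' = shift_dom u V U"
  define f where "f = tube_map C (\<lambda>s. Gi (\<psi> s + - u))"
  define f' where "f' = tube_map C' (\<lambda>s. Gi (\<psi> s + u))"
  note F = shift_invariant_nbhd[OF u' U V, folded C_def, folded f_def, unfolded minus_minus, folded C'_def, folded f'_def]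
  note F' = shift_invariant_nbhd[OF u(1) V U, folded C'_def, folded f'_def, folded C_def, folded f_def]
  note a = A0_D[OF u(2)]
  have b0: "Gi u \<in> C" using a U V A0_0 \<mu>_0 by (simp add: C_def shift_dom_def invariant_nbhd_def)
  have b1: "0 \<in> C'" using u(2) U V C0_0 \<psi>_0 \<mu>_0 by (simp add: C'_def shift_dom_def invariant_nbhd_def)
  have CC: "C \<subseteq> C0" "C' \<subseteq> C0" by (simp_all add: C_def C'_def shift_dom_sub)
  have oC: "openin (Euclidean_space k) C" "openin (Euclidean_space k) C'"
    unfolding C_def C'_def using U V fixed_Rk[OF u(1)] fixed_Rk[OF u'] by (auto simp: invariant_nbhd_def intro!: openin_shift_dom)
  have y0: "\<mu> (Gi u) \<in> points M" by (rule \<mu>_C0(1)[OF a(1)])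
  have yT: "\<mu> (Gi u) \<in> tube C" using tube_I[OF one_closed b0] act_one[OF y0] by simp
  have xT: "x \<in> tube C'" using tube_I[OF one_closed b1] act_one[OF x] \<mu>_0 by simp
  have bij: "bij_betw f (tube C) (tube C')"
    by (rule bij_betw_byWitness[where f'=f']) (use F(2) F'(2) in auto)
  have inv: "inv_into (tube C) f z = f' z" if "z \<in> tube C'" for z
    by (rule inv_into_f_eq[OF bij_betw_imp_inj_on[OF bij]]) (use F'(2)[OF that] in auto)
  have eq: "equivariant_diffeo G M \<phi> (tube C) (tube C') f"
    unfolding equivariant_diffeo_def
  proof (intro conjI ballI)
    show "msmooth_on M (tube C) M f" by (rule msmooth_onI[OF pM pM F(5,3)])
    show "msmooth_on M (tube C') M (inv_into (tube C) f)"
    proof (rule msmooth_onI[OF pM pM F'(5)])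
      fix z assume z: "z \<in> tube C'"
      show "smooth_at M M (inv_into (tube C) f) z"
        by (rule smooth_at_cong[OF pM pM F'(3)[OF z] F'(5) z]) (rule inv[symmetric])
    qed
  qed (use bij F(4) in auto)
  have nU: "invariant_nbhd G M \<phi> (\<mu> (Gi u)) (tube C)"
    unfolding invariant_nbhd_def using F(5) yT tube_invariant[OF oC(1) CC(1)] by blast
  have nV: "invariant_nbhd G M \<phi> x (tube C')"
    unfolding invariant_nbhd_def using F'(5) xT tube_invariant[OF oC(2) CC(2)] by blast
  have fy: "f (\<phi> g (\<mu> (Gi u))) = \<phi> g x" if "g \<in> carrier G" for g
    using F(6)[OF b0 that] a(2) by (simp add: A0_0 \<mu>_0)
  have img: "f ` orb (\<mu> (Gi u)) = orb x"
  proof (intro equalityI subsetI)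
    fix z assume "z \<in> f ` orb (\<mu> (Gi u))"
    then obtain g where "g \<in> carrier G" "z = f (\<phi> g (\<mu> (Gi u)))" unfolding orbit_def by blast
    then show "z \<in> orb x" using fy unfolding orb_iff by blast
  next
    fix z assume "z \<in> orb x"
    then obtain g where g: "g \<in> carrier G" "z = \<phi> g x" unfolding orb_iff by blast
    then show "z \<in> f ` orb (\<mu> (Gi u))" using fy[OF g(1)] orb_iff by (intro image_eqI[of _ _ "\<phi> g (\<mu> (Gi u))"]) auto
  qed
  show "\<exists>U' V' f. invariant_nbhd G M \<phi> (\<mu> (Gi u)) U' \<and> U' \<subseteq> U \<and> invariant_nbhd G M \<phi> x V' \<and> V' \<subseteq> V \<and>
      equivariant_diffeo G M \<phi> U' V' f \<and> f ` orb (\<mu> (Gi u)) = orb x"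
    using nU F(1) nV F'(1) eq img by blast
qed

abbreviation "Lx \<equiv> local_type G M \<phi> x"

lemma fixed_local_type: "\<lbrakk>u \<in> fixed; u \<in> A0\<rbrakk> \<Longrightarrow> \<mu> (Gi u) \<in> Lx"
  using same_local_type_fixed \<mu>_C0(1)[OF A0_D(1)] by (simp add: local_type_def)

lemma x_Lx: "x \<in> Lx"
  using fixed_local_type[OF subspace_0[OF subspace_fixed] A0_0(1)] by (simp add: A0_0 \<mu>_0)

text \<open>An invariant set contains y exactly when it contains \<open>\<phi> g y\<close>, so both
  points have the same invariant neighbourhoods, and they have the same orbit.\<close>

lemma Lx_act: assumes g: "g \<in> carrier G" and y: "y \<in> Lx" shows "\<phi> g y \<in> Lx"
proof -
  have yp: "y \<in> points M" using y by (simp add: local_type_def)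
  have "invariant_nbhd G M \<phi> (\<phi> g y) U \<longleftrightarrow> invariant_nbhd G M \<phi> y U" for U
    unfolding invariant_nbhd_def using g yp act_inv[OF g yp] inv_closed[OF g] by metis
  then show ?thesis using y act_points[OF g yp] orb_act[OF g yp] by (simp add: local_type_def same_local_type_def)
qed

subsection \<open>The dimension of the stratum\<close>

lemma openin_orbit_topology:
  "openin (orbit_topology G M \<phi>) W \<longleftrightarrow> W \<subseteq> orbits G (points M) \<phi> \<and> openin (mtop M) {y \<in> points M. orb y \<in> W}"
proof -
  have "istopology (\<lambda>W. W \<subseteq> orbits G (points M) \<phi> \<and> openin (mtop M) {y \<in> points M. orb y \<in> W})"
    unfolding istopology_def
  proof (intro conjI allI impI)
    fix A B assume AB: "A \<subseteq> orbits G (points M) \<phi> \<and> openin (mtop M) {y \<in> points M. orb y \<in> A}"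
      "B \<subseteq> orbits G (points M) \<phi> \<and> openin (mtop M) {y \<in> points M. orb y \<in> B}"
    have "{y \<in> points M. orb y \<in> A \<inter> B} = {y \<in> points M. orb y \<in> A} \<inter> {y \<in> points M. orb y \<in> B}" by auto
    then show "openin (mtop M) {y \<in> points M. orb y \<in> A \<inter> B}" using AB by auto
    show "A \<inter> B \<subseteq> orbits G (points M) \<phi>" using AB by auto
  next
    fix \<W> assume W: "\<forall>A\<in>\<W>. A \<subseteq> orbits G (points M) \<phi> \<and> openin (mtop M) {y \<in> points M. orb y \<in> A}"
    have "{y \<in> points M. orb y \<in> \<Union>\<W>} = (\<Union>A\<in>\<W>. {y \<in> points M. orb y \<in> A})" by auto
    then show "openin (mtop M) {y \<in> points M. orb y \<in> \<Union>\<W>}" using W by auto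
    show "\<Union>\<W> \<subseteq> orbits G (points M) \<phi>" using W by auto
  qed
  then show ?thesis unfolding orbit_topology_def by (simp add: topology_inverse')
qed

lemma continuous_map_orbit: "continuous_map (mtop M) (orbit_topology G M \<phi>) orb"
  unfolding continuous_map_def
proof (intro conjI allI impI)
  have "openin (orbit_topology G M \<phi>) (orbits G (points M) \<phi>)"
    unfolding openin_orbit_topology by (auto simp: orbits_def intro: openin_subopen[THEN iffD2])
  then have "orbits G (points M) \<phi> \<subseteq> topspace (orbit_topology G M \<phi>)" by (rule openin_subset)
  then show "orb \<in> points M \<rightarrow> topspace (orbit_topology G M \<phi>)" by (auto simp: orbits_def)
qed (simp add: openin_orbit_topology)

context
  fixes N :: "_ set mfd" and kL
  assumes N: "smooth_manifold N" and topN: "mtop N = subtopology (orbit_topology G M \<phi>) (orb ` Lx)"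
    and Lsub: "submanifold M kL Lx" and subm: "submersion (sub_mfd M kL Lx) N orb"
begin

abbreviation "PL \<equiv> sub_mfd M kL Lx"

lemma pN: "pre_manifold N"
  by (rule smooth_manifold_pre[OF N])

lemma pPL: "pre_manifold PL"
  by (rule pre_manifold_sub[OF pM Lsub])

lemma Lx_points: "Lx \<subseteq> points M"
  by (auto simp: local_type_def)

lemma points_PL: "points PL = Lx"
  using Lx_points by auto

lemma smooth_at_orb: "y \<in> Lx \<Longrightarrow> smooth_at PL N orb y"
  using subm points_PL by (intro msmooth_on_smooth_at[OF pPL pN, of "points PL"]) (simp_all add: submersion_def)

lemma orb_points_N: "orb x \<in> points N"
  by (rule smooth_at_points[OF smooth_at_orb[OF x_Lx]])

text \<open>The derivative B of the projection is defined on coordinates of the local type, whereas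
  the average lives in slice coordinates; the derivative I of the inclusion connects the two. The
  mean of the differences lies in \<open>Y\<close>, the image under I of the kernel of B, so it can
  be pulled back and subtracted without changing B.\<close>

lemma fixed_dim_ge:
  assumes d: "d \<in> max_atlas N" "orb x \<in> fst d"
  shows "mdim N \<le> dim fixed"
proof -
  let ?n = "mdim N"
  obtain cL where cL: "cL \<in> adapted_charts M kL Lx" "x \<in> fst cL" using Lsub x_Lx unfolding submanifold_def by blast
  define cl where "cl = (fst cL \<inter> Lx, snd cL)"
  note cLm = adapted_max[OF cL(1)]
  have cl: "cl \<in> max_atlas PL" "x \<in> fst cl"
    unfolding cl_def using sub_chart_max[OF pM Lsub cL(1)] cL(2) x_Lx by simp_all
  define I where "I = rep_jac PL M cl c (\<lambda>y. y) x"
  define B where "B = rep_jac PL N cl d orb x"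
  have lin: "linear I" "linear B" by (simp_all add: I_def B_def linear_rep_jac)
  have I_Rm: "I v \<in> Rn m" for v unfolding I_def by (rule rep_jac_Rn)
  note sI = smooth_at_inclusion[OF pM Lsub]
  have I_inj: "v = 0" if v: "v \<in> Rn kL" "I v = 0" for v
  proof -
    have "rep_jac PL M cl cL (\<lambda>y. y) x v = rep_jac M M c cL (\<lambda>y. y) x (I v)"
      unfolding I_def
      by (rule rep_jac_compose[where f="\<lambda>y. y" and g="\<lambda>y. y" and y=x, OF pPL pM pM sI[OF x_Lx] smooth_at_id[OF pM x] cl c_max ad(2) cLm cL(2)])
    moreover have "rep_jac PL M cl cL (\<lambda>y. y) x v = v"
      unfolding cl_def by (rule rep_jac_inclusion[OF pM Lsub cL x_Lx v(1)])
    ultimately show ?thesis by (simp add: v(2) linear_0[OF linear_rep_jac])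
  qed
  have B_surj: "\<exists>v\<in>Rn kL. B v = w" if w: "w \<in> Rn ?n" for w
  proof -
    have xp: "x \<in> points PL" using x_Lx points_PL by simp
    have "tvec N d (orb x) w \<in> differential PL N orb x ` tangent_space PL x"
      using subm xp tvec_tangent[OF pN d] unfolding submersion_def by simp
    then obtain t where t: "t \<in> tangent_space PL x" "tvec N d (orb x) w = differential PL N orb x t" by blast
    have "tvec N d (orb x) w = tvec N d (orb x) (B (tcoord PL cl x t))"
      using t(2) differential_coord[OF pPL pN smooth_at_orb[OF x_Lx] cl d t(1)] by (simp add: B_def)
    then have "tcoord N d (orb x) (tvec N d (orb x) w) = tcoord N d (orb x) (tvec N d (orb x) (B (tcoord PL cl x t)))" by simp
    then have "w = B (tcoord PL cl x t)"
      using tcoord_tvec[OF pN d w] tcoord_tvec[OF pN d, of "B (tcoord PL cl x t)"] by (simp add: B_def rep_jac_Rn del: topspace_Euclidean_space)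
    moreover have "tcoord PL cl x t \<in> Rn kL" using tcoord_Rn[of PL cl x t] by (simp only: sub_mfd_simps)
    ultimately show ?thesis by blast
  qed
  \<comment> \<open>The orbit map of x takes values in the local type, which gives a preimage of
    \<open>D1 a\<close> under I. After projection to N the orbit map is constant.\<close>
  have orbit_dir: "\<exists>a'\<in>Rn kL. I a' = D1 a \<and> B a' = 0" if a: "a \<in> Rn p" for a
  proof -
    let ?j = "\<lambda>g. \<phi> g x"
    have jL: "?j ` points GM \<subseteq> Lx" using GM_points Lx_act[OF _ x_Lx] by auto
    have one: "\<one> \<in> points GM" using GM_points by simp
    have j1: "?j \<one> = x" by (rule act_one[OF x])
    have sj: "smooth_at GM PL ?j \<one>"
      by (rule smooth_at_sub_mfd[OF pG pM Lsub smooth_at_orbit_map[OF one_closed x] openin_topspace one jL])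
    define a' where "a' = rep_jac GM PL \<xi> cl ?j \<one> a"
    have cl': "?j \<one> \<in> fst cl" by (simp add: j1 cl(2))
    have c': "?j \<one> \<in> fst c" by (simp add: j1 ad(2))
    have "rep_jac GM M \<xi> c (\<lambda>g. \<phi> g x) \<one> a = rep_jac PL M cl c (\<lambda>y. y) (\<phi> \<one> x) a'"
      unfolding a'_def by (rule rep_jac_compose[where f="\<lambda>g. \<phi> g x" and g="\<lambda>y. y" and y=\<one>, OF pG pPL pM sj _ chi_max chi(2) cl(1) cl' c_max c']) (simp only: j1 sI[OF x_Lx])
    then have "I a' = D1 a" by (simp only: I_def j1 D1_rep_jac[OF a])
    have d': "orb (?j \<one>) \<in> fst d" by (simp add: j1 d(2))
    have "rep_jac GM N \<xi> d (\<lambda>g. orb (\<phi> g x)) \<one> a = rep_jac PL N cl d orb (\<phi> \<one> x) a'"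
      unfolding a'_def by (rule rep_jac_compose[where f="\<lambda>g. \<phi> g x" and g=orb and y=\<one>, OF pG pPL pN sj _ chi_max chi(2) cl(1) cl' d(1) d']) (simp only: j1 smooth_at_orb[OF x_Lx])
    moreover have "rep_jac GM N \<xi> d (\<lambda>g. orb (\<phi> g x)) \<one> a = rep_jac GM N \<xi> d (\<lambda>g. orb x) \<one> a"
      by (rule rep_jac_cong[OF chi_max chi(2) openin_topspace one]) (simp add: GM_points orb_act x)
    moreover have "rep_jac GM N \<xi> d (\<lambda>g. orb x) \<one> a = 0" by (simp only: rep_jac_def jacobian_const)
    ultimately have "B a' = 0" by (simp only: B_def j1)
    have "a' \<in> Rn kL" using rep_jac_Rn[of GM PL \<xi> cl ?j \<one> a] by (simp only: a'_def sub_mfd_simps)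
    with \<open>I a' = D1 a\<close> \<open>B a' = 0\<close> show ?thesis by blast
  qed
  \<comment> \<open>Acting by h preserves the local type and fixes x. Its derivative corresponds to
    \<open>rho h\<close> under I and is invisible after the projection.\<close>
  have K_dir: "\<exists>v'\<in>Rn kL. I v' = rho h (I v) \<and> B v' = B v" if h: "h \<in> K" and v: "v \<in> Rn kL" for h v
  proof -
    note hG = K_carrier[OF h] and hx = K_fix[OF h]
    have s0: "smooth_at PL M (\<lambda>y. \<phi> h y) x"
      by (rule smooth_at_compose[OF pPL pM pM, where f="\<lambda>y. y" and g="\<phi> h"])
         (rule sI[OF x_Lx], rule smooth_at_act_left[OF hG x])
    have sh: "smooth_at PL PL (\<phi> h) x"
      by (rule smooth_at_sub_mfd[OF pPL pM Lsub s0 openin_topspace]) (use points_PL x_Lx Lx_act[OF hG] in auto)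
    define v' where "v' = rep_jac PL PL cl cl (\<phi> h) x v"
    have hcl: "\<phi> h x \<in> fst cl" "\<phi> h x \<in> fst c" "orb (\<phi> h x) \<in> fst d" using cl(2) ad(2) d(2) hx by simp_all
    have "rep_jac PL M cl c (\<lambda>y. \<phi> h y) x v = rep_jac PL M cl c (\<lambda>y. y) (\<phi> h x) v'"
      unfolding v'_def by (rule rep_jac_compose[where f="\<phi> h" and g="\<lambda>y. y" and y=x, OF pPL pPL pM sh _ cl cl(1) hcl(1) c_max hcl(2)]) (simp only: hx sI[OF x_Lx])
    moreover have "rep_jac PL M cl c (\<lambda>y. \<phi> h y) x v = rep_jac M M c c (\<phi> h) x (rep_jac PL M cl c (\<lambda>y. y) x v)"
      by (rule rep_jac_compose[where f="\<lambda>y. y" and g="\<phi> h" and y=x, OF pPL pM pM sI[OF x_Lx] smooth_at_act_left[OF hG x] cl c_max ad(2) c_max hcl(2)])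
    ultimately have 1: "I v' = rho h (I v)" by (simp only: I_def hx rho_rep_jac[OF h rep_jac_Rn])
    have "rep_jac PL N cl d (\<lambda>y. orb (\<phi> h y)) x v = rep_jac PL N cl d orb (\<phi> h x) v'"
      unfolding v'_def by (rule rep_jac_compose[where f="\<phi> h" and g=orb and y=x, OF pPL pPL pN sh _ cl cl(1) hcl(1) d(1) hcl(3)]) (simp only: hx smooth_at_orb[OF x_Lx])
    moreover have "rep_jac PL N cl d (\<lambda>y. orb (\<phi> h y)) x v = rep_jac PL N cl d orb x v"
      by (rule rep_jac_cong[OF cl openin_topspace]) (use points_PL x_Lx Lx_points orb_act[OF hG] in auto)
    ultimately have 2: "B v' = B v" by (simp only: B_def hx)
    have "v' \<in> Rn kL" using rep_jac_Rn[of PL PL cl cl "\<phi> h" x v] by (simp only: v'_def sub_mfd_simps)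
    with 1 2 show ?thesis by blast
  qed
  define Y where "Y = I ` {v \<in> Rn kL. B v = 0}"
  have "subspace {v \<in> Rn kL. B v = 0}"
    unfolding subspace_def using lin(2)
    by (auto simp: Rn_add Rn_scale linear_0 linear_add linear_scale simp del: topspace_Euclidean_space)
  then have sY: "subspace Y" unfolding Y_def by (rule linear_subspace_image[OF lin(1)])
  have reduce: "\<exists>v'\<in>Rn kL. I v' \<in> fixed \<and> B v' = B v" if v: "v \<in> Rn kL" for v
  proof -
    obtain a s where as: "a \<in> Rn p" "s \<in> Rn k" "I v = D1 a + s" using complement_Rk[OF I_Rm] .
    obtain a' where a': "a' \<in> Rn kL" "I a' = D1 a" "B a' = 0" using orbit_dir[OF as(1)] by blast
    define v1 where "v1 = v - a'"
    have v1: "v1 \<in> Rn kL" "I v1 = s" "B v1 = B v"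
      unfolding v1_def by (rule Rn_diff[OF v a'(1)]) (simp_all add: linear_diff lin as(3) a')
    have F: "K_family (\<lambda>h. s + (-1) *\<^sub>R rho (inv h) s)" "vmean (\<lambda>h. s + (-1) *\<^sub>R rho (inv h) s) = s + (-1) *\<^sub>R e' s"
      by (rule mean_defect[OF as(2)])+
    have "vmean (\<lambda>h. s + (-1) *\<^sub>R rho (inv h) s) \<in> Y"
    proof (rule vmean_subspace[OF sY F(1)])
      fix h assume h: "h \<in> K"
      obtain v' where v': "v' \<in> Rn kL" "I v' = rho (inv h) (I v1)" "B v' = B v1"
        using K_dir[OF K_inv[OF h] v1(1)] by (elim bexE conjE) (rule that)
      have "B (v1 - v') = 0" by (simp only: linear_diff[OF lin(2)] v'(3) diff_self)
      then have n1: "v1 - v' \<in> {v \<in> Rn kL. B v = 0}" using Rn_diff[OF v1(1) v'(1)] by (intro CollectI conjI)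
      have n2: "s + (-1) *\<^sub>R rho (inv h) s = I (v1 - v')" by (simp add: linear_diff[OF lin(1)] v'(2) v1(2))
      show "s + (-1) *\<^sub>R rho (inv h) s \<in> Y" unfolding n2 Y_def by (rule imageI[OF n1])
    qed
    then obtain z where z: "z \<in> Rn kL" "B z = 0" "s - e' s = I z" unfolding F(2) Y_def by auto
    have "I (v1 - z) = e' s" by (simp add: linear_diff[OF lin(1)] v1(2) z(3)[symmetric])
    moreover have "B (v1 - z) = B v" by (simp add: linear_diff[OF lin(2)] v1(3) z(2))
    ultimately show ?thesis using e'_mem[OF as(2)] Rn_diff[OF v1(1) z(1)] by (intro bexI[of _ "v1 - z"]) simp_all
  qed
  define E where "E = {v \<in> Rn kL. I v \<in> fixed}"
  have sE: "subspace E"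
    unfolding subspace_def E_def using lin(1) subspace_fixed
    by (auto simp: Rn_add Rn_scale linear_0 linear_add linear_scale subspace_0 subspace_add subspace_scale
        simp del: topspace_Euclidean_space)
  have E_Rl: "E \<subseteq> Rn kL" by (auto simp: E_def)
  have BE: "B ` E = Rn ?n"
  proof
    show "B ` E \<subseteq> Rn ?n" unfolding B_def by (rule image_subsetI) (rule rep_jac_Rn)
    show "Rn ?n \<subseteq> B ` E"
    proof
      fix w assume "w \<in> Rn ?n"
      then obtain v where v: "v \<in> Rn kL" "B v = w" by (rule B_surj[THEN bexE])
      obtain v' where v': "v' \<in> Rn kL" "I v' \<in> fixed" "B v' = B v" using reduce[OF v(1)] by (elim bexE conjE) (rule that)
      have "w = B v'" by (simp only: v(2) v'(3))
      moreover have "v' \<in> E" unfolding E_def by (intro CollectI conjI v'(1,2))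
      ultimately show "w \<in> B ` E" by (rule image_eqI)
    qed
  qed
  obtain b where b: "b \<subseteq> E" "independent b" "span b = E" "finite b" "card b = dim E" using subspace_Rn_basis[OF sE E_Rl] .
  have "span (B ` b) = Rn ?n" using linear_span_image[OF lin(2), of b] b(3) BE by simp
  then have "dim (Rn ?n) \<le> card (B ` b)" by (intro dim_le_card) (use b(4) in auto)
  also have "\<dots> \<le> dim E" using card_image_le[OF b(4), of B] b(5) by simp
  also have "dim E \<le> dim fixed"
  proof (rule linear_inj_dim_le(1)[OF lin(1) sE E_Rl _ _ subspace_fixed])
    show "inj_on I E"
    proof (rule inj_onI)
      fix u v assume uv: "u \<in> E" "v \<in> E" "I u = I v"
      then have "u - v \<in> Rn kL" "I (u - v) = 0" using E_Rl Rn_diff by (auto simp: linear_diff[OF lin(1)] subset_iff simp del: topspace_Euclidean_space)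
      then show "u = v" using I_inj by force
    qed
    show "I ` E \<subseteq> fixed" by (auto simp: E_def)
    show "fixed \<subseteq> Rn k" using fixed_Rk by blast
  qed
  finally show ?thesis by (simp only: dim_Rn)
qed

lemma linear_iso_fixed: obtains L where "linear L" "bij_betw L (Rn (dim fixed)) fixed"
proof -
  let ?d = "dim fixed"
  have fk: "fixed \<subseteq> Rn k" using fixed_Rk by blast
  obtain b where b: "b \<subseteq> fixed" "independent b" "span b = fixed" "finite b" "card b = ?d" using subspace_Rn_basis[OF subspace_fixed fk] .
  obtain q where q: "bij_betw q {..<?d} b" using b(4,5) by (metis bij_betw_iff_card finite_lessThan card_lessThan)
  obtain L where L: "linear L" "\<forall>v\<in>uvec ` {..<?d}. L v = q (inv_into UNIV uvec v)"
    using linear_independent_extend[OF independent_uvec, of ?d "\<lambda>v. q (inv_into UNIV uvec v)"] by blast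
  have Lu: "L (uvec i) = q i" if "i < ?d" for i using L(2) that inj_uvec by simp
  have img: "L ` (uvec ` {..<?d}) = b" using Lu q by (auto simp: bij_betw_def image_image)
  have im: "L ` Rn ?d = fixed" using linear_span_image[OF L(1), of "uvec ` {..<?d}"] by (simp add: img b(3) span_uvec del: topspace_Euclidean_space)
  have "inj_on L (uvec ` {..<?d})"
  proof (rule inj_onI)
    fix u v assume uv: "u \<in> uvec ` {..<?d}" "v \<in> uvec ` {..<?d}" "L u = L v"
    then obtain i j where ij: "i < ?d" "j < ?d" "u = uvec i" "v = uvec j" by blast
    then have "q i = q j" using uv(3) Lu by simp
    then have "i = j" using ij(1,2) bij_betw_imp_inj_on[OF q] by (simp add: inj_on_def)
    then show "u = v" by (simp add: ij)
  qed
  then have "inj_on L (span (uvec ` {..<?d}))"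
    using linear_inj_on_span_iff_independent_image[OF L(1)] img b(2) by simp
  then have "inj_on L (Rn ?d)" by (simp only: span_uvec)
  then show ?thesis using that[OF L(1)] im unfolding bij_betw_def by blast
qed

text \<open>Injectivity holds because \<open>\<Psi>o\<close> recovers the fixed vector from the
  orbit. If \<open>dim fixed\<close> were larger than \<open>mdim N\<close>, the coordinate image
  would be open in \<open>Rn (dim fixed)\<close> and yet contained in the smaller
  \<open>Rn (mdim N)\<close>.\<close>

lemma fixed_dim_le:
  assumes d: "d \<in> max_atlas N" "orb x \<in> fst d"
  shows "dim fixed \<le> mdim N"
proof (rule ccontr)
  let ?d = "dim fixed" and ?n = "mdim N"
  assume "\<not> ?d \<le> ?n"
  then have nd: "?n < ?d" by simp
  obtain L where L: "linear L" "bij_betw L (Rn ?d) fixed" by (rule linear_iso_fixed)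
  have Lf: "L w \<in> fixed" if "w \<in> Rn ?d" for w by (rule bij_betw_apply[OF L(2) that])
  have Lk: "L w \<in> Rn k" if "w \<in> Rn ?d" for w by (rule fixed_Rk[OF Lf[OF that]])
  have sL: "smooth_at (Rn_mfd ?d) (Rn_mfd k) L w" if "w \<in> Rn ?d" for w by (rule smooth_at_linear[OF L(1) Lk that])
  define U1 where "U1 = {w \<in> Rn ?d. L w \<in> A0}"
  define q where "q w = \<mu> (Gi (L w))" for w
  have oA: "openin (mtop (Rn_mfd k)) A0" using openin_A0 by simp
  have "openin (mtop (Rn_mfd ?d)) U1"
    unfolding U1_def by (rule smooth_at_open_preimage[OF sL _ oA]) simp_all
  then have oU1: "openin (Euclidean_space ?d) U1" by simp
  have U1: "w \<in> Rn ?d" "L w \<in> A0" if "w \<in> U1" for w using that by (simp_all add: U1_def)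
  have sq: "smooth_at (Rn_mfd ?d) M q w" if w: "w \<in> U1" for w
  proof -
    have g: "Gi (L w) \<in> C0" by (rule A0_D(1)[OF U1(2)[OF w]])
    have s1: "smooth_at (Rn_mfd ?d) (Rn_mfd k) (\<lambda>w. Gi (L w)) w"
      by (rule smooth_at_compose[OF pre_manifold_Rn pre_manifold_Rn pre_manifold_Rn, where f=L and g=Gi])
         (rule sL[OF U1(1)[OF w]], rule smooth_at_Gi[OF U1(2)[OF w]])
    have i: "smooth_at (Rn_mfd k) (Rn_mfd m) (\<lambda>b. b) (Gi (L w))"
      by (rule smooth_at_linear[OF linear_ident_fun Rk_Rm C0_D(5)[OF g]])
    have s2: "smooth_at (Rn_mfd ?d) (Rn_mfd m) (\<lambda>w. Gi (L w)) w"
      by (rule smooth_at_compose[OF pre_manifold_Rn pre_manifold_Rn pre_manifold_Rn, where f="\<lambda>w. Gi (L w)" and g="\<lambda>b. b"])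
         (rule s1, rule i)
    show ?thesis
      unfolding q_def[abs_def]
      by (rule smooth_at_compose[OF pre_manifold_Rn pre_manifold_Rn pM, where f="\<lambda>w. Gi (L w)" and g=\<mu>])
         (rule s2, rule \<mu>_smooth[OF \<mu>_C0(5)[OF g]])
  qed
  have qL: "q w \<in> Lx" if "w \<in> U1" for w
    unfolding q_def by (rule fixed_local_type[OF Lf[OF U1(1)[OF that]] U1(2)[OF that]])
  have \<Psi>q: "\<Psi>o (orb (q w)) = L w" if w: "w \<in> U1" for w
  proof -
    note g = A0_D[OF U1(2)[OF w]]
    show ?thesis
      using \<Psi>o_orb[OF \<mu>_C0(3)[OF g(1)]] \<mu>_C0(4)[OF g(1)] g(2) e_fixed(1)[OF Lf[OF U1(1)[OF w]]]
      by (simp add: q_def \<Psi>_def)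
  qed
  have tU1: "topspace (subtopology (Euclidean_space ?d) U1) = U1"
    by (simp only: topspace_subtopology inf.absorb2[OF openin_subset[OF oU1]])
  have "msmooth_on (Rn_mfd ?d) U1 M q" by (rule msmooth_onI[OF pre_manifold_Rn pM _ sq]) (simp add: oU1)
  then have "continuous_map (subtopology (Euclidean_space ?d) U1) (mtop M) q"
    unfolding msmooth_on_def by simp
  from continuous_map_compose[OF this continuous_map_orbit]
  have "continuous_map (subtopology (Euclidean_space ?d) U1) (orbit_topology G M \<phi>) (\<lambda>w. orb (q w))" by (simp add: o_def)
  then have cN: "continuous_map (subtopology (Euclidean_space ?d) U1) (mtop N) (\<lambda>w. orb (q w))"
    unfolding topN continuous_map_in_subtopology using qL tU1 by auto
  define U where "U = {w \<in> U1. orb (q w) \<in> fst d}"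
  have "openin (subtopology (Euclidean_space ?d) U1) {w \<in> topspace (subtopology (Euclidean_space ?d) U1). orb (q w) \<in> fst d}"
    by (rule openin_continuous_map_preimage[OF cN openin_fst_max[OF d(1)]])
  then have oU: "openin (Euclidean_space ?d) U" unfolding tU1 U_def by (rule openin_trans_full[OF _ oU1])
  have U: "w \<in> U1" "orb (q w) \<in> fst d" if "w \<in> U" for w using that by (simp_all add: U_def)
  have tU: "topspace (subtopology (Euclidean_space ?d) U) = U"
    by (simp only: topspace_subtopology inf.absorb2[OF openin_subset[OF oU]])
  have "continuous_map (subtopology (Euclidean_space ?d) U) (mtop N) (\<lambda>w. orb (q w))"
    by (rule continuous_map_from_subtopology_mono[OF cN]) (auto simp: U_def)
  then have "continuous_map (subtopology (Euclidean_space ?d) U) (subtopology (mtop N) (fst d)) (\<lambda>w. orb (q w))"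
    unfolding continuous_map_in_subtopology tU using U(2) by auto
  from continuous_map_compose[OF this chart_continuous[OF max_is_chart[OF d(1)]]]
  have c: "continuous_map (subtopology (Euclidean_space ?d) U) (Euclidean_space ?n) (\<lambda>w. snd d (orb (q w)))" by (simp add: o_def)
  define f where "f w = snd d (orb (q w))" for w
  have fR: "f ` U \<subseteq> Rn ?n" using continuous_map_image_subset_topspace[OF c] tU by (simp add: f_def image_subset_iff)
  have cf: "continuous_map (subtopology (Euclidean_space ?d) U) (Euclidean_space ?d) f"
    unfolding continuous_map_Rn_coords tU
  proof (intro conjI allI impI)
    show "f ` U \<subseteq> Rn ?d" using fR nd by (auto simp: image_subset_iff mem_Rn)
    show "continuous_map (subtopology (Euclidean_space ?d) U) euclideanreal (\<lambda>w. f w i)" for i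
    proof (cases "i < ?n")
      case True
      then show ?thesis using c unfolding continuous_map_Rn_coords f_def by blast
    next
      case False
      have "continuous_map (subtopology (Euclidean_space ?d) U) euclideanreal (\<lambda>w. 0)" by simp
      then show ?thesis
        by (rule continuous_map_eq) (use fR tU False in \<open>simp add: image_subset_iff mem_Rn\<close>)
    qed
  qed
  have "inj_on f U"
  proof (rule inj_onI)
    fix w w' assume w: "w \<in> U" "w' \<in> U" "f w = f w'"
    have "orb (q w) = chart_inv d (f w)" "orb (q w') = chart_inv d (f w')"
      unfolding f_def by (rule max_inv_left[OF d(1) U(2)[OF w(1)], symmetric], rule max_inv_left[OF d(1) U(2)[OF w(2)], symmetric])
    then have "orb (q w) = orb (q w')" using w(3) by simp
    then have "L w = L w'" using \<Psi>q[OF U(1)[OF w(1)]] \<Psi>q[OF U(1)[OF w(2)]] by simp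
    then show "w = w'" using bij_betw_imp_inj_on[OF L(2)] U1(1)[OF U(1)[OF w(1)]] U1(1)[OF U(1)[OF w(2)]]
      by (meson inj_onD)
  qed
  then have of: "openin (Euclidean_space ?d) (f ` U)" by (rule invariance_of_domain_Euclidean_space[OF oU cf])
  have "q 0 = x" by (simp add: q_def linear_0[OF L(1)] A0_0 \<mu>_0)
  then have 0: "0 \<in> U" using d(2) A0_0(1) by (simp add: U_def U1_def linear_0[OF L(1)])
  obtain \<delta> where \<delta>: "\<delta> > 0" "cube ?d (f 0) \<delta> \<subseteq> f ` U" using open_contains_cube[OF of imageI[OF 0]] by metis
  have f0: "f 0 \<in> Rn ?n" using fR 0 by blast
  \<comment> \<open>A point of the cube whose coordinate with index \<open>mdim N\<close> is not 0,
    although this coordinate vanishes on \<open>Rn (mdim N)\<close>.\<close>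
  let ?y = "f 0 + (\<delta> / 2) *\<^sub>R uvec ?n"
  have "?y \<in> cube ?d (f 0) \<delta>"
    using \<delta>(1) f0 nd by (auto simp: cube_def mem_Rn uvec_def)
  then have "?y \<in> Rn ?n" using \<delta>(2) fR by blast
  then have "?y ?n = 0" by (rule Rn_nth) simp
  then show False using Rn_nth[OF f0, of ?n] \<delta>(1) by (simp add: uvec_def)
qed

text \<open>Once the dimensions agree, chart coordinates on \<open>N\<close> followed by some linear
  bijection onto \<open>fixed\<close> give the required isomorphism.\<close>

theorem internal_tangent_space_stratum:
  "vs_isomorphic (internal_tangent_space DO (orb x)) (sub_vspace (tangent_space N (orb x)))"
proof -
  obtain d where d0: "d \<in> atlas N" "orb x \<in> fst d" by (rule atlas_cover[OF pN orb_points_N])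
  note d = atlas_max[OF pN d0(1)] d0(2)
  have dim: "dim fixed = mdim N" using fixed_dim_le[OF d] fixed_dim_ge[OF d] by simp
  obtain L where L: "linear L" "bij_betw L (Rn (mdim N)) fixed" using linear_iso_fixed unfolding dim by metis
  show ?thesis
  proof (rule internal_tangent_space_vs_isomorphic[OF subspace_tangent_space[OF pN orb_points_N]])
    show "linear (L \<circ> tcoord N d (orb x))" by (rule linear_compose[OF linear_tcoord L(1)])
    show "bij_betw (L \<circ> tcoord N d (orb x)) (tangent_space N (orb x)) fixed"
      by (rule bij_betw_trans[OF bij_tcoord[OF pN d] L(2)])
  qed
qed

end

end

theorem theorem5p6:
  fixes G :: "('g, 'r) monoid_scheme" and GM :: "'g mfd"
    and M :: "'m mfd" and \<phi> :: "'g \<Rightarrow> 'm \<Rightarrow> 'm" and x :: 'm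
    and k :: nat and S :: "'m set"
  assumes "lie_group G GM"
    and "smooth_manifold M"
    and "smooth_action G GM M \<phi>"
    and "proper_action GM M \<phi>"
    and "x \<in> points M"
    and "slice G GM M \<phi> x k S"
  shows "vs_isomorphic (internal_tangent_space (orbit_diffeology G M \<phi>) (orbit G \<phi> x))
           (sub_vspace (fixed_tangents G M \<phi> x k S)) \<and>
         (\<forall>N. orbit_stratum G M \<phi> x N \<longrightarrow>
           vs_isomorphic (internal_tangent_space (orbit_diffeology G M \<phi>) (orbit G \<phi> x))
             (sub_vspace (tangent_space N (orbit G \<phi> x))))"
proof -
  have pG: "pre_manifold GM" and G: "group G" "points GM = carrier G"
    using assms(1) smooth_manifold_pre by (auto simp: lie_group_def)
  obtain \<xi> where \<xi>: "\<xi> \<in> atlas GM" "\<one>\<^bsub>G\<^esub> \<in> fst \<xi>"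
    by (rule atlas_cover[OF pG, of "\<one>\<^bsub>G\<^esub>"]) (simp add: G group.is_monoid monoid.one_closed)
  obtain c where c: "c \<in> adapted_charts M k S" "x \<in> fst c"
  proof -
    have "submanifold M k S \<and> x \<in> S" using assms(6) unfolding slice_def by (elim conjE) (rule conjI)
    then show ?thesis unfolding submanifold_def using that by blast
  qed
  interpret slice_setting G GM M \<phi> x k S \<xi> c
    by unfold_locales (fact assms \<xi> c)+
  obtain l where l: "linear l" "\<And>v. l v \<in> Rn p" "\<And>v. v \<in> Rn k \<Longrightarrow> l v = 0" "\<And>v. v \<in> Rn m \<Longrightarrow> D1 (l v) - v \<in> Rn k"
    by (rule ex_complement_map, rule that)
  obtain W0 H where W0: "openin (Euclidean_space m) W0" "0 \<in> W0" "W0 \<subseteq> Fdom l"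
    "openin (Euclidean_space m) (Fmap l ` W0)" "smooth_map m (Fmap l ` W0) m H" "\<And>w. w \<in> W0 \<Longrightarrow> H (Fmap l w) = w"
    by (rule ex_tube_inverse[OF l]) (assumption | rule that)+
  obtain Mn where Mn: "positive_mean TK Mn"
    "\<And>f h. continuous_map TK euclideanreal f \<Longrightarrow> h \<in> carrier KG \<Longrightarrow> Mn (\<lambda>k. f (k \<otimes>\<^bsub>KG\<^esub> h)) = Mn f"
    by (rule KC.invariant_mean, rule that)
  \<comment> \<open>\<open>KG\<close> differs from G only in its carrier, so its multiplication is
    that of G.\<close>
  have mean_inv: "Mn (\<lambda>k. f (k \<otimes>\<^bsub>G\<^esub> h)) = Mn f" if "continuous_map TK euclideanreal f" "h \<in> K" for f h
    using Mn(2)[of f h] that by simp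
  interpret slice_tube G GM M \<phi> x k S \<xi> c l W0 H Mn
    by unfold_locales (fact linear_add[OF l(1)] linear_scale[OF l(1)] l W0 Mn(1) mean_inv)+
  obtain W1 Gi where W1: "openin (Euclidean_space k) W1" "0 \<in> W1" "W1 \<subseteq> B1" "openin (Euclidean_space k) (\<psi> ` W1)"
    "smooth_map k (\<psi> ` W1) k Gi" "\<And>b. b \<in> W1 \<Longrightarrow> Gi (\<psi> b) = b"
    by (rule ex_linearization, rule that)
  interpret slice_linearization G GM M \<phi> x k S \<xi> c l W0 H Mn W1 Gi
    by unfold_locales (fact W1)+
  show ?thesis
  proof (intro conjI allI impI)
    show "vs_isomorphic (internal_tangent_space DO (orb x)) (sub_vspace (fixed_tangents G M \<phi> x k S))"
      by (rule internal_tangent_space_fixed_tangents)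
    fix N assume "orbit_stratum G M \<phi> x N"
    then obtain l' where "smooth_manifold N" "mtop N = subtopology (orbit_topology G M \<phi>) (orb ` local_type G M \<phi> x)"
      "submanifold M l' (local_type G M \<phi> x)" "submersion (sub_mfd M l' (local_type G M \<phi> x)) N orb"
      unfolding orbit_stratum_def by blast
    then show "vs_isomorphic (internal_tangent_space DO (orb x)) (sub_vspace (tangent_space N (orb x)))"
      by (rule internal_tangent_space_stratum)
  qed
qed

end
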